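(* Let $M$ be a conformally flat manifold of dimension $n=p+q\ge 2$, let $\lambda,\mu\in\mathbb{R}$ and $\delta=\mu-\lambda$. If $\delta\notin\Sigma$, then there exists an isomorphism of $\mathfrak{so}(p+1,q+1)$-modules $$\widetilde{\mathcal{Q}}_{\lambda,\mu}:\mathcal{S}_\delta\to\mathcal{D}_{\lambda,\mu}$$ which is unique provided the principal symbol is preserved at each order.
   Context: Resonances. $\Sigma=\{\delta_{k,\ell;s,t}\mid k,\ell,s,t\in\mathbb{N},\ k>\ell,\ 2s\le k,\ 2t\le\ell\}$ (with $0\in\mathbb{N}$), where $$\delta_{k,\ell;s,t}=\frac{1}{n(k-\ell)}\Big((k-\ell+t-s)(k+\ell-2(s+t)+n-1)+(s-t)(k+\ell+1)+2(kt-\ell s)\Big).$$ Conformal algebra. Let $g=(g_{ij})$ be the constant flat metric of signature $(p,q)$ on $\mathbb{R}^n$, used to raise and lower indices ($x_i=g_{ij}x^j$); repeated indices are summed. $\mathfrak{so}(p+1,q+1)$ is realized as the Lie algebra of vector fields on $\mathbb{R}^n$ spanned by $X_i=\partial_i$, $X_{ij}=x_i\partial_j-x_j\partial_i$, $X_0=x^i\partial_i$, $\bar X_i=x_jx^j\partial_i-2x_ix^j\partial_j$. Manifold. $(M,\mathrm{g})$ is a smooth orientable conformally flat pseudo-Riemannian manifold of signature $(p,q)$ (locally $F\,\mathrm{g}$ is flat for some positive function $F$). It carries an atlas of adapted charts in which $\mathrm{g}$ is conformal to the constant metric $g$ and whose coordinate changes are restrictions of conformal transformations given by elements of $SO(p+1,q+1)$;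 in each adapted chart, with coordinates $(x^1,\dots,x^n)$, $\mathfrak{so}(p+1,q+1)$ acts by the vector fields $X_i=\partial_i$, $X_{ij}=x_i\partial_j-x_j\partial_i$, $X_0=x^i\partial_i$, $\bar X_i=x_jx^j\partial_i-2x_ix^j\partial_j$. Modules. $\mathcal{F}_\lambda$ is the space of complex-valued smooth $\lambda$-densities (sections of $|\Lambda^nT^*M|^{\otimes\lambda}\otimes\mathbb{C}$), and $L^\lambda_X(f)=X(f)+\lambda\,\mathrm{Div}(X)f$. $\mathcal{D}_{\lambda,\mu}$ is the space of linear differential operators $\mathcal{F}_\lambda\to\mathcal{F}_\mu$, with action $\mathcal{L}^{\lambda,\mu}_X(A)=L^\mu_X A-AL^\lambda_X$. $\mathcal{S}_\delta=\Gamma(S(TM)\otimes|\Lambda^nT^*M|^{\otimes\delta})$ (complex coefficients allowed) is the space of symmetric contravariant tensor fields with values in $\delta$-densities, i.e. polynomials in the fibre coordinates $\xi_i$, with action $L^\delta_X(P)=L_X(P)+\delta\,\mathrm{Div}(X)P$; for $X=X^i\xi_i$ this reads $L^\delta_X=\partial_{\xi_i}X\,\partial_i-\partial_iX\,\partial_{\xi_i}+\delta\,\partial_iX^i$. $\mathcal{S}^k_\delta$ denotes symbols of degree $\le k$. Since the action of $\mathfrak{so}(p+1,q+1)$ on $M$ is only local, an isomorphism of $\mathfrak{so}(p+1,q+1)$-modules is a globally defined linear isomorphism, compatible with restriction to adapted chart domains, which in every adapted chart intertwines the actions of $X_i,X_{ij},X_0,\bar X_i$. "The principal symbol is preserved at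 each order" means: under the normal-ordering identification $A^{i_1\dots i_k}\partial_{i_1}\cdots\partial_{i_k}\leftrightarrow A^{i_1\dots i_k}\xi_{i_1}\cdots\xi_{i_k}$ in adapted coordinates, $\widetilde{\mathcal{Q}}_{\lambda,\mu}=\mathrm{Id}+\mathcal{N}$ with $\mathcal{N}:\mathcal{S}^k_\delta\to\mathcal{S}^{k-1}_\delta$ for all $k$. *)

theory Defs
  imports "HOL-Analysis.Analysis"
begin

section \<open>Calculus on open subsets of \<open>real ^ 'n\<close>\<close>

definition pd :: "'n::finite \<Rightarrow> (real ^ 'n \<Rightarrow> 'b::real_normed_vector) \<Rightarrow> real ^ 'n \<Rightarrow> 'b" where
  "pd i f x = frechet_derivative f (at x) (axis i 1)"

primrec Ck_on :: "nat \<Rightarrow> (real ^ 'n::finite) set \<Rightarrow> (real ^ 'n \<Rightarrow> 'b::real_normed_vector) \<Rightarrow> bool" where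
  "Ck_on 0 V f \<longleftrightarrow> continuous_on V f"
| "Ck_on (Suc k) V f \<longleftrightarrow> (\<forall>x\<in>V. f differentiable (at x)) \<and> (\<forall>i. Ck_on k V (pd i f))"

text \<open>Only used for open \<open>V\<close>.\<close>

definition smooth_on :: "(real ^ 'n::finite) set \<Rightarrow> (real ^ 'n \<Rightarrow> 'b::real_normed_vector) \<Rightarrow> bool" where
  "smooth_on V f \<longleftrightarrow> (\<forall>k. Ck_on k V f)"

primrec iter_pd :: "'n::finite list \<Rightarrow> (real ^ 'n \<Rightarrow> complex) \<Rightarrow> real ^ 'n \<Rightarrow> complex" where
  "iter_pd [] f = f"
| "iter_pd (i # is) f = pd i (iter_pd is f)"


section \<open>Smooth manifolds\<close>

text \<open>
  The manifold is the whole type \<open>'m\<close>. A chart is a pair of its domain and its coordinate map;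
  values of the coordinate map outside the domain are irrelevant.
\<close>

type_synonym ('m, 'n) chart = "'m set \<times> ('m \<Rightarrow> real ^ 'n)"

abbreviation cdom :: "('m, 'n::finite) chart \<Rightarrow> 'm set" where
  "cdom c \<equiv> fst c"

abbreviation coord :: "('m, 'n::finite) chart \<Rightarrow> 'm \<Rightarrow> real ^ 'n" where
  "coord c \<equiv> snd c"

abbreviation cimg :: "('m, 'n::finite) chart \<Rightarrow> (real ^ 'n) set" where
  "cimg c \<equiv> coord c ` cdom c"

abbreviation cinv :: "('m, 'n::finite) chart \<Rightarrow> real ^ 'n \<Rightarrow> 'm" where
  "cinv c \<equiv> inv_into (cdom c) (coord c)"

definition is_chart :: "('m::topological_space, 'n::finite) chart \<Rightarrow> bool" where
  "is_chart c \<longleftrightarrow> open (cdom c) \<and> open (cimg c) \<and> homeomorphism (cdom c) (cimg c) (coord c) (cinv c)"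

definition transition :: "('m, 'n::finite) chart \<Rightarrow> ('m, 'n) chart \<Rightarrow> real ^ 'n \<Rightarrow> real ^ 'n" where
  "transition c c' = coord c' \<circ> cinv c"

definition smoothly_compatible :: "('m, 'n::finite) chart \<Rightarrow> ('m, 'n) chart \<Rightarrow> bool" where
  "smoothly_compatible c c' \<longleftrightarrow>
     smooth_on (coord c ` (cdom c \<inter> cdom c')) (transition c c') \<and>
     smooth_on (coord c' ` (cdom c \<inter> cdom c')) (transition c' c)"

text \<open>
  \<open>S\<close> is a smooth structure (a maximal smooth atlas). The Hausdorff property and second countability
  are carried by the type class constraint on \<open>'m\<close>.
\<close>

definition smooth_structure ::
    "('m::{t2_space,second_countable_topology}, 'n::finite) chart set \<Rightarrow> bool" where
  "smooth_structure S \<longleftrightarrow>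
     (\<forall>c\<in>S. is_chart c) \<and>
     (\<Union>c\<in>S. cdom c) = UNIV \<and>
     (\<forall>c\<in>S. \<forall>c'\<in>S. smoothly_compatible c c') \<and>
     (\<forall>c. is_chart c \<and> (\<forall>c'\<in>S. smoothly_compatible c c') \<longrightarrow> c \<in> S)"

definition jac :: "('m, 'n::finite) chart \<Rightarrow> ('m, 'n) chart \<Rightarrow> 'm \<Rightarrow> real ^ 'n ^ 'n" where
  "jac c c' p = matrix (frechet_derivative (transition c c') (at (coord c p)))"

definition orientable :: "('m, 'n::finite) chart set \<Rightarrow> bool" where
  "orientable S \<longleftrightarrow> (\<exists>A\<subseteq>S. (\<Union>c\<in>A. cdom c) = UNIV \<and>
     (\<forall>c\<in>A. \<forall>c'\<in>A. \<forall>p\<in>cdom c \<inter> cdom c'. det (jac c c' p) > 0))"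


section \<open>Conformally flat pseudo-Riemannian manifolds\<close>

definition has_signature :: "real ^ 'n ^ 'n::finite \<Rightarrow> nat \<Rightarrow> nat \<Rightarrow> bool" where
  "has_signature g p q \<longleftrightarrow> (\<exists>(B :: real ^ 'n ^ 'n) (I :: 'n set). invertible B \<and> card I = p \<and> card (- I) = q \<and>
     transpose B ** g ** B = (\<chi> i j. if i = j then (if i \<in> I then 1 else - 1) else 0))"

text \<open>
  A metric, like every section of a natural bundle below, is the family of its coefficients
  in all charts of the smooth structure, subject to the transformation law of the bundle.
\<close>

definition pseudo_riemannian_metric ::
    "('m, 'n::finite) chart set \<Rightarrow> nat \<Rightarrow> nat \<Rightarrow> (('m, 'n) chart \<Rightarrow> 'm \<Rightarrow> real ^ 'n ^ 'n) \<Rightarrow> bool" where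
  "pseudo_riemannian_metric S p q G \<longleftrightarrow>
     (\<forall>c\<in>S. smooth_on (cimg c) (\<lambda>x. G c (cinv c x)) \<and> (\<forall>x\<in>cdom c. has_signature (G c x) p q)) \<and>
     (\<forall>c\<in>S. \<forall>c'\<in>S. \<forall>x\<in>cdom c \<inter> cdom c'. G c x = transpose (jac c c' x) ** G c' x ** jac c c' x)"

definition flat_metric_on ::
    "('m, 'n::finite) chart set \<Rightarrow> 'm set \<Rightarrow> (('m, 'n) chart \<Rightarrow> 'm \<Rightarrow> real ^ 'n ^ 'n) \<Rightarrow> bool" where
  "flat_metric_on S W G \<longleftrightarrow>
     (\<forall>x\<in>W. \<exists>c\<in>S. x \<in> cdom c \<and> cdom c \<subseteq> W \<and> (\<exists>g. \<forall>y\<in>cdom c. G c y = g))"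

text \<open>The factor \<open>F\<close> is automatically smooth, since \<open>G\<close> is smooth and \<open>F G\<close> is locally constant in a chart.\<close>

definition conformally_flat ::
    "('m::topological_space, 'n::finite) chart set \<Rightarrow> (('m, 'n) chart \<Rightarrow> 'm \<Rightarrow> real ^ 'n ^ 'n) \<Rightarrow> bool" where
  "conformally_flat S G \<longleftrightarrow>
     (\<forall>x. \<exists>W F. open W \<and> x \<in> W \<and> (\<forall>y\<in>W. F y > 0) \<and> flat_metric_on S W (\<lambda>c y. F y *\<^sub>R G c y))"

text \<open>
  The form \<open>g + u\<^sup>2 - v\<^sup>2\<close> of signature \<open>(p + 1, q + 1)\<close> on \<open>real ^ 'n\<close> times the plane, its special
  orthogonal group, and the embedding of \<open>real ^ 'n\<close> into the null cone through which this group acts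
  by (locally defined) conformal transformations.
\<close>

definition ambient_form :: "real ^ 'n ^ 'n \<Rightarrow> real ^ ('n::finite + bool) ^ ('n + bool)" where
  "ambient_form g = (\<chi> a b.
     case (a, b) of
       (Inl i, Inl j) \<Rightarrow> g $ i $ j
     | (Inr u, Inr v) \<Rightarrow> if u = v then (if u then 1 else - 1) else 0
     | _ \<Rightarrow> 0)"

definition SO_ambient :: "real ^ 'n ^ 'n \<Rightarrow> (real ^ ('n::finite + bool) ^ ('n + bool)) set" where
  "SO_ambient g = {A. transpose A ** ambient_form g ** A = ambient_form g \<and> det A = 1}"

definition null_lift :: "real ^ 'n ^ 'n \<Rightarrow> real ^ 'n \<Rightarrow> real ^ ('n::finite + bool)" where
  "null_lift g x = (\<chi> a. case a of
       Inl i \<Rightarrow> x $ i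
     | Inr u \<Rightarrow> if u then (1 - x \<bullet> (g *v x)) / 2 else (1 + x \<bullet> (g *v x)) / 2)"

definition conformal_transformation_on ::
    "real ^ 'n ^ 'n \<Rightarrow> (real ^ 'n::finite) set \<Rightarrow> (real ^ 'n \<Rightarrow> real ^ 'n) \<Rightarrow> bool" where
  "conformal_transformation_on g W \<phi> \<longleftrightarrow>
     (\<exists>A\<in>SO_ambient g. \<forall>x\<in>W. \<exists>r. r \<noteq> 0 \<and> A *v null_lift g x = r *\<^sub>R null_lift g (\<phi> x))"

text \<open>
  Coordinate changes are only required to be given by an element of the group locally, so that
  different elements may occur on different components of an overlap.
\<close>

definition adapted_atlas ::
    "('m::topological_space, 'n::finite) chart set \<Rightarrow> (('m, 'n) chart \<Rightarrow> 'm \<Rightarrow> real ^ 'n ^ 'n) \<Rightarrow>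
     real ^ 'n ^ 'n \<Rightarrow> ('m, 'n) chart set \<Rightarrow> bool" where
  "adapted_atlas S G g A \<longleftrightarrow>
     A \<subseteq> S \<and> (\<Union>c\<in>A. cdom c) = UNIV \<and>
     (\<forall>c\<in>A. \<forall>x\<in>cdom c. \<exists>F>0. G c x = F *\<^sub>R g) \<and>
     (\<forall>c\<in>A. \<forall>c'\<in>A. \<forall>x\<in>cdom c \<inter> cdom c'. \<exists>W. open W \<and> coord c x \<in> W \<and>
        W \<subseteq> coord c ` (cdom c \<inter> cdom c') \<and> conformal_transformation_on g W (transition c c'))"

definition adapted_charts :: "('m::topological_space, 'n::finite) chart set \<Rightarrow> ('m, 'n) chart set" where
  "adapted_charts A = {(W, \<phi>). open W \<and> (\<exists>U. (U, \<phi>) \<in> A \<and> W \<subseteq> U)}"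


section \<open>The conformal Lie algebra\<close>

definition lower_index :: "real ^ 'n ^ 'n \<Rightarrow> real ^ 'n::finite \<Rightarrow> 'n \<Rightarrow> real" where
  "lower_index g x i = (\<Sum>j\<in>UNIV. g $ i $ j * x $ j)"

definition vf_transl :: "'n::finite \<Rightarrow> real ^ 'n \<Rightarrow> real ^ 'n" where
  "vf_transl i x = axis i 1"

definition vf_rot :: "real ^ 'n ^ 'n \<Rightarrow> 'n::finite \<Rightarrow> 'n \<Rightarrow> real ^ 'n \<Rightarrow> real ^ 'n" where
  "vf_rot g i j x = lower_index g x i *\<^sub>R axis j 1 - lower_index g x j *\<^sub>R axis i 1"

definition vf_euler :: "real ^ 'n::finite \<Rightarrow> real ^ 'n" where
  "vf_euler x = x"

definition vf_inv :: "real ^ 'n ^ 'n \<Rightarrow> 'n::finite \<Rightarrow> real ^ 'n \<Rightarrow> real ^ 'n" where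
  "vf_inv g i x = (\<Sum>j\<in>UNIV. lower_index g x j * x $ j) *\<^sub>R axis i 1 - (2 * lower_index g x i) *\<^sub>R x"

definition conformal_generators :: "real ^ 'n ^ 'n \<Rightarrow> (real ^ 'n::finite \<Rightarrow> real ^ 'n) set" where
  "conformal_generators g =
     range vf_transl \<union> {vf_rot g i j | i j. True} \<union> {vf_euler} \<union> range (vf_inv g)"


section \<open>Densities, symbols and differential operators on an open subset of \<open>real ^ 'n\<close>\<close>

text \<open>
  Elements of these spaces vanish outside \<open>V\<close> (operators: outside the space of functions on \<open>V\<close>),
  so that equality of elements is equality of HOL functions. A symbol is a function of the point and
  of the fibre coordinates \<open>\<xi>\<close>. Orders are integers so that the space of order \<open>-1\<close> is zero.
\<close>

definition multi_indices :: "int \<Rightarrow> 'n::finite list set" where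
  "multi_indices k = {is. int (length is) \<le> k}"

definition loc_fun :: "(real ^ 'n::finite) set \<Rightarrow> (real ^ 'n \<Rightarrow> complex) set" where
  "loc_fun V = {f. smooth_on V f \<and> (\<forall>x. x \<notin> V \<longrightarrow> f x = 0)}"

definition poly_symbol ::
    "(real ^ 'n::finite) set \<Rightarrow> int \<Rightarrow> ('n list \<Rightarrow> real ^ 'n \<Rightarrow> complex) \<Rightarrow> real ^ 'n \<Rightarrow> real ^ 'n \<Rightarrow> complex" where
  "poly_symbol V k a = (\<lambda>x \<xi>. if x \<in> V
     then (\<Sum>is\<in>multi_indices k. a is x * (\<Prod>i\<leftarrow>is. complex_of_real (\<xi> $ i))) else 0)"

definition diff_op ::
    "(real ^ 'n::finite) set \<Rightarrow> int \<Rightarrow> ('n list \<Rightarrow> real ^ 'n \<Rightarrow> complex) \<Rightarrow>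
     (real ^ 'n \<Rightarrow> complex) \<Rightarrow> real ^ 'n \<Rightarrow> complex" where
  "diff_op V k a = (\<lambda>f x. if f \<in> loc_fun V \<and> x \<in> V
     then (\<Sum>is\<in>multi_indices k. a is x * iter_pd is f x) else 0)"

definition loc_symbol_upto ::
    "(real ^ 'n::finite) set \<Rightarrow> int \<Rightarrow> (real ^ 'n \<Rightarrow> real ^ 'n \<Rightarrow> complex) set" where
  "loc_symbol_upto V k = {poly_symbol V k a | a. \<forall>is. smooth_on V (a is)}"

definition loc_symbol :: "(real ^ 'n::finite) set \<Rightarrow> (real ^ 'n \<Rightarrow> real ^ 'n \<Rightarrow> complex) set" where
  "loc_symbol V = (\<Union>k. loc_symbol_upto V k)"

definition loc_op_upto ::
    "(real ^ 'n::finite) set \<Rightarrow> int \<Rightarrow> ((real ^ 'n \<Rightarrow> complex) \<Rightarrow> real ^ 'n \<Rightarrow> complex) set" where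
  "loc_op_upto V k = {diff_op V k a | a. \<forall>is. smooth_on V (a is)}"

definition loc_op ::
    "(real ^ 'n::finite) set \<Rightarrow> ((real ^ 'n \<Rightarrow> complex) \<Rightarrow> real ^ 'n \<Rightarrow> complex) set" where
  "loc_op V = (\<Union>k. loc_op_upto V k)"

text \<open>
  Normal ordering as a relation: the coefficients \<open>a\<close> are not assumed symmetric in their indices and
  hence not unique, but the operator and the symbol determine each other.
\<close>

definition normal_ordered ::
    "(real ^ 'n::finite) set \<Rightarrow> ((real ^ 'n \<Rightarrow> complex) \<Rightarrow> real ^ 'n \<Rightarrow> complex) \<Rightarrow>
     (real ^ 'n \<Rightarrow> real ^ 'n \<Rightarrow> complex) \<Rightarrow> bool" where
  "normal_ordered V B P \<longleftrightarrow>
     (\<exists>k a. (\<forall>is. smooth_on V (a is)) \<and> B = diff_op V k a \<and> P = poly_symbol V k a)"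

definition divergence :: "(real ^ 'n::finite \<Rightarrow> real ^ 'n) \<Rightarrow> real ^ 'n \<Rightarrow> real" where
  "divergence X x = (\<Sum>i\<in>UNIV. pd i X x $ i)"

definition lie_density ::
    "(real ^ 'n::finite) set \<Rightarrow> real \<Rightarrow> (real ^ 'n \<Rightarrow> real ^ 'n) \<Rightarrow>
     (real ^ 'n \<Rightarrow> complex) \<Rightarrow> real ^ 'n \<Rightarrow> complex" where
  "lie_density V l X f = (\<lambda>x. if x \<in> V
     then (\<Sum>i\<in>UNIV. complex_of_real (X x $ i) * pd i f x) + complex_of_real (l * divergence X x) * f x
     else 0)"

definition lie_op ::
    "(real ^ 'n::finite) set \<Rightarrow> real \<Rightarrow> real \<Rightarrow> (real ^ 'n \<Rightarrow> real ^ 'n) \<Rightarrow>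
     ((real ^ 'n \<Rightarrow> complex) \<Rightarrow> real ^ 'n \<Rightarrow> complex) \<Rightarrow> (real ^ 'n \<Rightarrow> complex) \<Rightarrow> real ^ 'n \<Rightarrow> complex" where
  "lie_op V l m X B = (\<lambda>f x. if f \<in> loc_fun V
     then lie_density V m X (B f) x - B (lie_density V l X f) x else 0)"

definition lie_symbol ::
    "(real ^ 'n::finite) set \<Rightarrow> real \<Rightarrow> (real ^ 'n \<Rightarrow> real ^ 'n) \<Rightarrow>
     (real ^ 'n \<Rightarrow> real ^ 'n \<Rightarrow> complex) \<Rightarrow> real ^ 'n \<Rightarrow> real ^ 'n \<Rightarrow> complex" where
  "lie_symbol V d X P = (\<lambda>x \<xi>. if x \<in> V
     then (\<Sum>i\<in>UNIV. complex_of_real (X x $ i) * pd i (\<lambda>y. P y \<xi>) x)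
        - (\<Sum>i\<in>UNIV. complex_of_real (\<Sum>j\<in>UNIV. pd i X x $ j * \<xi> $ j) * pd i (P x) \<xi>)
        + complex_of_real (d * divergence X x) * P x \<xi>
     else 0)"


section \<open>Densities, symbols and differential operators on the manifold\<close>

type_synonym ('m, 'n) density = "('m, 'n) chart \<Rightarrow> 'm \<Rightarrow> complex"

type_synonym ('m, 'n) symbol = "('m, 'n) chart \<Rightarrow> 'm \<Rightarrow> real ^ 'n \<Rightarrow> complex"

type_synonym ('m, 'n) operator = "('m, 'n) density \<Rightarrow> ('m, 'n) density"

definition dens_in :: "('m, 'n::finite) chart \<Rightarrow> ('m, 'n) density \<Rightarrow> real ^ 'n \<Rightarrow> complex" where
  "dens_in c f = (\<lambda>x. if x \<in> cimg c then f c (cinv c x) else 0)"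

definition symb_in :: "('m, 'n::finite) chart \<Rightarrow> ('m, 'n) symbol \<Rightarrow> real ^ 'n \<Rightarrow> real ^ 'n \<Rightarrow> complex" where
  "symb_in c P = (\<lambda>x \<xi>. if x \<in> cimg c then P c (cinv c x) \<xi> else 0)"

text \<open>\<open>f c\<close> is the coefficient of the density with respect to \<open>|dx\<^sup>1 \<dots> dx\<^sup>n|\<close> to the power \<open>l\<close>.\<close>

definition densities :: "('m, 'n::finite) chart set \<Rightarrow> real \<Rightarrow> ('m, 'n) density set" where
  "densities S l = {f.
     (\<forall>c\<in>S. dens_in c f \<in> loc_fun (cimg c)) \<and>
     (\<forall>c\<in>S. \<forall>c'\<in>S. \<forall>x\<in>cdom c \<inter> cdom c'.
        f c x = complex_of_real (\<bar>det (jac c c' x)\<bar> powr l) * f c' x) \<and>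
     (\<forall>c x. c \<notin> S \<or> x \<notin> cdom c \<longrightarrow> f c x = 0)}"

text \<open>A covector with coordinates \<open>\<xi>\<close> in \<open>c'\<close> has coordinates \<open>transpose (jac c c' x) *v \<xi>\<close> in \<open>c\<close>.\<close>

definition symbols_upto :: "('m, 'n::finite) chart set \<Rightarrow> real \<Rightarrow> int \<Rightarrow> ('m, 'n) symbol set" where
  "symbols_upto S d k = {P.
     (\<forall>c\<in>S. symb_in c P \<in> loc_symbol_upto (cimg c) k) \<and>
     (\<forall>c\<in>S. \<forall>c'\<in>S. \<forall>x\<in>cdom c \<inter> cdom c'. \<forall>\<xi>.
        P c x (transpose (jac c c' x) *v \<xi>) = complex_of_real (\<bar>det (jac c c' x)\<bar> powr d) * P c' x \<xi>) \<and>
     (\<forall>c x \<xi>. c \<notin> S \<or> x \<notin> cdom c \<longrightarrow> P c x \<xi> = 0)}"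

definition symbols :: "('m, 'n::finite) chart set \<Rightarrow> real \<Rightarrow> ('m, 'n) symbol set" where
  "symbols S d = (\<Union>k. symbols_upto S d k)"

definition operators_upto ::
    "('m, 'n::finite) chart set \<Rightarrow> real \<Rightarrow> real \<Rightarrow> int \<Rightarrow> ('m, 'n) operator set" where
  "operators_upto S l m k = {A.
     (\<forall>f\<in>densities S l. A f \<in> densities S m) \<and>
     (\<forall>f. f \<notin> densities S l \<longrightarrow> A f = (\<lambda>c x. 0)) \<and>
     (\<forall>c\<in>S. \<exists>B\<in>loc_op_upto (cimg c) k. \<forall>f\<in>densities S l. dens_in c (A f) = B (dens_in c f))}"

definition operators :: "('m, 'n::finite) chart set \<Rightarrow> real \<Rightarrow> real \<Rightarrow> ('m, 'n) operator set" where
  "operators S l m = (\<Union>k. operators_upto S l m k)"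

definition op_restricts_to ::
    "('m, 'n::finite) chart set \<Rightarrow> real \<Rightarrow> ('m, 'n) chart \<Rightarrow> ('m, 'n) operator \<Rightarrow>
     ((real ^ 'n \<Rightarrow> complex) \<Rightarrow> real ^ 'n \<Rightarrow> complex) \<Rightarrow> bool" where
  "op_restricts_to S l c A B \<longleftrightarrow>
     B \<in> loc_op (cimg c) \<and> (\<forall>f\<in>densities S l. dens_in c (A f) = B (dens_in c f))"


section \<open>Equivariant quantization maps\<close>

definition linear_iso ::
    "('m, 'n::finite) symbol set \<Rightarrow> ('m, 'n) operator set \<Rightarrow> (('m, 'n) symbol \<Rightarrow> ('m, 'n) operator) \<Rightarrow> bool" where
  "linear_iso U D Q \<longleftrightarrow> bij_betw Q U D \<and>
     (\<forall>P\<in>U. \<forall>P'\<in>U. \<forall>a b. Q (\<lambda>c x \<xi>. a * P c x \<xi> + b * P' c x \<xi>) = (\<lambda>f c x. a * Q P f c x + b * Q P' f c x))"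

definition loc_linear_iso ::
    "(real ^ 'n::finite) set \<Rightarrow> ((real ^ 'n \<Rightarrow> real ^ 'n \<Rightarrow> complex) \<Rightarrow>
       (real ^ 'n \<Rightarrow> complex) \<Rightarrow> real ^ 'n \<Rightarrow> complex) \<Rightarrow> bool" where
  "loc_linear_iso V Q \<longleftrightarrow> bij_betw Q (loc_symbol V) (loc_op V) \<and>
     (\<forall>P\<in>loc_symbol V. \<forall>P'\<in>loc_symbol V. \<forall>a b.
        Q (\<lambda>x \<xi>. a * P x \<xi> + b * P' x \<xi>) = (\<lambda>f x. a * Q P f x + b * Q P' f x))"

text \<open>
  The conformal algebra acts only on chart domains. \<open>Qc\<close> is the map induced by \<open>Q\<close> on an adapted
  chart domain; since such domains form a base of the topology, \<open>Q\<close> is in particular local.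
\<close>

definition conformal_module_iso ::
    "('m::topological_space, 'n::finite) chart set \<Rightarrow> ('m, 'n) chart set \<Rightarrow> real ^ 'n ^ 'n \<Rightarrow> real \<Rightarrow> real \<Rightarrow>
     (('m, 'n) symbol \<Rightarrow> ('m, 'n) operator) \<Rightarrow> bool" where
  "conformal_module_iso S A g l m Q \<longleftrightarrow>
     linear_iso (symbols S (m - l)) (operators S l m) Q \<and>
     (\<forall>c\<in>adapted_charts A. \<exists>Qc. loc_linear_iso (cimg c) Qc \<and>
        (\<forall>P\<in>symbols S (m - l). op_restricts_to S l c (Q P) (Qc (symb_in c P))) \<and>
        (\<forall>X\<in>conformal_generators g. \<forall>P\<in>loc_symbol (cimg c).
           Qc (lie_symbol (cimg c) (m - l) X P) = lie_op (cimg c) l m X (Qc P)))"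

definition preserves_principal_symbol ::
    "('m::topological_space, 'n::finite) chart set \<Rightarrow> ('m, 'n) chart set \<Rightarrow> real \<Rightarrow> real \<Rightarrow>
     (('m, 'n) symbol \<Rightarrow> ('m, 'n) operator) \<Rightarrow> bool" where
  "preserves_principal_symbol S A l m Q \<longleftrightarrow>
     (\<forall>c\<in>adapted_charts A. \<forall>k. \<forall>P\<in>symbols_upto S (m - l) k.
        \<exists>B. \<exists>N\<in>loc_symbol_upto (cimg c) (k - 1).
          op_restricts_to S l c (Q P) B \<and>
          normal_ordered (cimg c) B (\<lambda>x \<xi>. symb_in c P x \<xi> + N x \<xi>))"


section \<open>Resonances\<close>

definition resonance :: "nat \<Rightarrow> nat \<Rightarrow> nat \<Rightarrow> nat \<Rightarrow> nat \<Rightarrow> real" where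
  "resonance n k l s t =
     ((real k - real l + real t - real s) * (real k + real l - 2 * (real s + real t) + real n - 1)
      + (real s - real t) * (real k + real l + 1) + 2 * (real k * real t - real l * real s))
     / (real n * (real k - real l))"

definition resonances :: "nat \<Rightarrow> real set" where
  "resonances n = {resonance n k l s t | k l s t. k > l \<and> 2 * s \<le> k \<and> 2 * t \<le> l}"

end

theory Submission
  imports Defs "HOL-Computational_Algebra.Polynomial"
begin

text \<open>
 In an adapted chart both modules are acted on by a Weyl algebra, and normal ordering turns the action on operators
 into a perturbation of the action on symbols: only the inversions change, by a term lowering the degree.
 The Casimir element acts on symbols by \<open>C0\<close> and on operators by \<open>C0 + C1\<close>, with \<open>C1\<close> of degree \<open>-1\<close>. On symbols
 of degree \<open>k\<close> the element \<open>C0\<close> is annihilated by a polynomial with roots \<open>gam k s\<close>, and \<open>gam k s = gam l t\<close> with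
 \<open>k > l\<close> says exactly that \<open>\<delta>\<close> is the resonance \<open>(k, l; s, t)\<close>. Outside the resonances Bezout's identity
 therefore yields polynomials \<open>uk k\<close> in the Casimir operator that lift a homogeneous symbol of degree \<open>k\<close> to the
 generalized eigenspaces of its degree; this is the quantization map, and an equivariant map preserving principal
 symbols must agree with it because it commutes with the Casimir operators.

 The uniqueness applies in particular to the conjugate of the local map by a conformal transformation \<open>A\<close>, since
 \<open>A\<close> acts on the null cone and so maps the generators to vector fields spanned by the generators. Hence the local maps are compatible with the coordinate changes and glue to \<open>M\<close>. Since every
 local density extends, near a point, to a global one, an operator on \<open>M\<close> determines its local expressions.
\<close>

section \<open>Calculus of smooth maps on open sets\<close>

text \<open>Only symbols of different degrees have to be separated by the Casimir operator, never
  those of one degree. The roots are therefore gathered degree by degree into \<open>pk k\<close>,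
  and no decomposition into eigenvectors is made; this is why resonances involve k > l only. In a
  difference of two roots the terms quadratic in \<delta> cancel, which leaves one critical weight
  for each (k, l; s, t). Since every correction is a polynomial in the Casimir operator, it is again
  a differential operator: smooth coefficients, locality and compatibility with restriction come
  along with it. Two obstacles shape the formal development. Coefficients of symbols are indexed by
  lists and are not unique, so canonical ones are taken from the Taylor expansion at \<xi> = 0.
  Preservation of principal symbols is given for global symbols only, while uniqueness is proved in
  a chart and degree by degree. The local uniqueness statement therefore treats one symbol at a
  time, with a hypothesis on its homogeneous components alone, and these components are shown to be
  global symbols.\<close>

abbreviation cr :: "real \<Rightarrow> complex" where "cr \<equiv> of_real"

lemma pd_eqI:
 assumes "(f has_derivative D) (at x)" shows "pd i f x = D (axis i 1)"
 using frechet_derivative_at[OF assms] by (simp add: pd_def)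

lemma has_derivative_pd:
 fixes f :: "real ^ 'n::finite \<Rightarrow> 'b::real_normed_vector"
 assumes "f differentiable (at x)"
 shows "(f has_derivative (\<lambda>h. \<Sum>i\<in>UNIV. h $ i *\<^sub>R pd i f x)) (at x)"
proof -
 define D where "D = frechet_derivative f (at x)"
 have D: "(f has_derivative D) (at x)"
  using assms by (simp add: D_def frechet_derivative_works)
 interpret bounded_linear D using D by (rule has_derivative_bounded_linear)
 have "D h = (\<Sum>i\<in>UNIV. h $ i *\<^sub>R pd i f x)" for h
 proof -
  have "D h = D (\<Sum>i\<in>UNIV. h $ i *\<^sub>R axis i 1)"
   by (metis (no_types, lifting) basis_expansion scalar_mult_eq_scaleR sum.cong)
  also have "\<dots> = (\<Sum>i\<in>UNIV. h $ i *\<^sub>R D (axis i 1))" by (simp add: sum scaleR)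
  finally show ?thesis by (simp add: pd_def D_def)
 qed
 then show ?thesis using D by presburger
qed

section \<open>Congruence and localization over open sets\<close>

lemma has_derivative_cong_open:
 assumes "open V" "x \<in> V" "\<And>y. y \<in> V \<Longrightarrow> f y = g y"
 shows "(f has_derivative D) (at x) \<longleftrightarrow> (g has_derivative D) (at x)"
 by (metis assms has_derivative_transform_within_open)

lemma differentiable_cong_open:
 assumes "open V" "x \<in> V" "\<And>y. y \<in> V \<Longrightarrow> f y = g y"
 shows "f differentiable (at x) \<longleftrightarrow> g differentiable (at x)"
 using has_derivative_cong_open[OF assms] by (auto simp: differentiable_def)

lemma frechet_derivative_cong_open:
 assumes "open V" "x \<in> V" "\<And>y. y \<in> V \<Longrightarrow> f y = g y"
 shows "frechet_derivative f (at x) = frechet_derivative g (at x)"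
 using has_derivative_cong_open[OF assms] by (simp add: frechet_derivative_def)

lemma pd_cong_open:
 assumes "open V" "x \<in> V" "\<And>y. y \<in> V \<Longrightarrow> f y = g y"
 shows "pd i f x = pd i g x"
 using frechet_derivative_cong_open[OF assms] by (simp add: pd_def)

lemma iter_pd_cong_open:
 assumes "open V" "x \<in> V" "\<And>y. y \<in> V \<Longrightarrow> f y = g y"
 shows "iter_pd is f x = iter_pd is g x"
 using assms(2) by (induction "is" arbitrary: x) (auto simp: assms intro!: pd_cong_open[OF assms(1)])

lemma Ck_on_cong:
 assumes "open V" "\<And>y. y \<in> V \<Longrightarrow> f y = g y"
 shows "Ck_on k V f \<longleftrightarrow> Ck_on k V g"
 using assms(2)
proof (induction k arbitrary: f g)
 case (Suc k)
 have "Ck_on k V (pd i f) \<longleftrightarrow> Ck_on k V (pd i g)" for i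
  by (rule Suc.IH) (rule pd_cong_open[OF assms(1) _ Suc.prems])
 moreover have "f differentiable (at x) \<longleftrightarrow> g differentiable (at x)" if "x \<in> V" for x
  by (rule differentiable_cong_open[OF assms(1) that Suc.prems])
 ultimately show ?case by simp
qed (simp cong: continuous_on_cong)

lemma Ck_on_subset: "Ck_on k V f \<Longrightarrow> W \<subseteq> V \<Longrightarrow> Ck_on k W f"
 by (induction k arbitrary: f) (auto intro: continuous_on_subset)

lemma Ck_on_Suc: "Ck_on (Suc k) V f \<Longrightarrow> Ck_on k V f"
proof (induction k arbitrary: f)
 case 0
 then show ?case
  by (auto intro!: continuous_at_imp_continuous_on differentiable_imp_continuous_within)
qed simp

lemma Ck_on_local:
 assumes "\<And>x. x \<in> V \<Longrightarrow> \<exists>W. open W \<and> x \<in> W \<and> Ck_on k W f"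
 shows "Ck_on k V f"
 using assms
proof (induction k arbitrary: f)
 case 0
 then have "isCont f x" if "x \<in> V" for x
  using that by (metis Ck_on.simps(1) continuous_on_eq_continuous_at)
 then show ?case by (simp add: continuous_at_imp_continuous_on)
next
 case (Suc k)
 have "f differentiable (at x)" if "x \<in> V" for x
  using Suc.prems[OF that] by auto
 moreover have "Ck_on k V (pd i f)" for i
  by (rule Suc.IH) (use Suc.prems in fastforce)
 ultimately show ?case by simp
qed

lemma Ck_on_congI:
 "open V \<Longrightarrow> Ck_on k V g \<Longrightarrow> (\<And>y. y \<in> V \<Longrightarrow> f y = g y) \<Longrightarrow> Ck_on k V f"
 using Ck_on_cong by blast

lemma smooth_on_congI:
 "open V \<Longrightarrow> smooth_on V g \<Longrightarrow> (\<And>y. y \<in> V \<Longrightarrow> f y = g y) \<Longrightarrow> smooth_on V f"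
 unfolding smooth_on_def using Ck_on_congI by blast

lemma smooth_on_cong:
 "open V \<Longrightarrow> (\<And>y. y \<in> V \<Longrightarrow> f y = g y) \<Longrightarrow> smooth_on V f \<longleftrightarrow> smooth_on V g"
 unfolding smooth_on_def using Ck_on_cong by blast

lemma smooth_on_subset: "smooth_on V f \<Longrightarrow> W \<subseteq> V \<Longrightarrow> smooth_on W f"
 unfolding smooth_on_def using Ck_on_subset by blast

lemma smooth_on_local:
 "(\<And>x. x \<in> V \<Longrightarrow> \<exists>W. open W \<and> x \<in> W \<and> smooth_on W f) \<Longrightarrow> smooth_on V f"
 unfolding smooth_on_def by (intro allI Ck_on_local) meson

lemma smooth_on_differentiable: "smooth_on V f \<Longrightarrow> x \<in> V \<Longrightarrow> f differentiable (at x)"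
 unfolding smooth_on_def by (drule spec[of _ "Suc 0"]) simp

lemma smooth_on_pd [intro!]: "smooth_on V f \<Longrightarrow> smooth_on V (pd i f)"
 unfolding smooth_on_def using Ck_on.simps(2) by blast

lemma smooth_on_iter_pd [intro!]: "smooth_on V f \<Longrightarrow> smooth_on V (iter_pd is f)"
 by (induction "is") auto

lemma smooth_on_continuous_on: "smooth_on V f \<Longrightarrow> continuous_on V f"
 unfolding smooth_on_def by (drule spec[of _ 0]) simp

section \<open>Differentiation rules and closure properties of smooth functions\<close>

lemma pd_const [simp]: "pd i (\<lambda>x. c) x = 0"
 by (simp add: pd_def)

lemma pd_bounded_linear:
 assumes "bounded_linear L" "f differentiable (at x)"
 shows "pd i (\<lambda>x. L (f x)) x = L (pd i f x)"
 using pd_eqI[OF bounded_linear.has_derivative[OF assms(1) assms(2)[unfolded frechet_derivative_works]]]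
 by (simp add: pd_def)

lemma pd_add:
 assumes "f differentiable (at x)" "g differentiable (at x)"
 shows "pd i (\<lambda>x. f x + g x) x = pd i f x + pd i g x"
 using pd_eqI[OF has_derivative_add[OF assms[unfolded frechet_derivative_works]]]
 by (simp add: pd_def)

lemma pd_sum:
 assumes "\<And>a. a \<in> I \<Longrightarrow> f a differentiable (at x)"
 shows "pd i (\<lambda>x. \<Sum>a\<in>I. f a x) x = (\<Sum>a\<in>I. pd i (f a) x)"
 using pd_eqI[OF has_derivative_sum, of I f "\<lambda>a. frechet_derivative (f a) (at x)" x i] assms
 by (simp add: pd_def frechet_derivative_works[symmetric])

lemma pd_bilinear:
 assumes "bounded_bilinear B" "f differentiable (at x)" "g differentiable (at x)"
 shows "pd i (\<lambda>x. B (f x) (g x)) x = B (f x) (pd i g x) + B (pd i f x) (g x)"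
 using pd_eqI[OF bounded_bilinear.FDERIV[OF assms(1) assms(2,3)[unfolded frechet_derivative_works]]]
 by (simp add: pd_def)

lemmas pd_mult = pd_bilinear[OF bounded_bilinear_mult]

lemma Ck_on_const: "Ck_on k V (\<lambda>x. c)"
proof (induction k arbitrary: c)
 case (Suc k)
 have "pd i (\<lambda>x. c) = (\<lambda>x. 0)" for i :: 'a and c :: 'b by (simp add: fun_eq_iff)
 then show ?case using Suc[of 0] by simp
qed simp

lemma smooth_on_const [intro, simp]: "smooth_on V (\<lambda>x. c)"
 by (simp add: smooth_on_def Ck_on_const)

lemma Ck_on_bounded_linear:
 assumes "bounded_linear L" "open V" "Ck_on k V f"
 shows "Ck_on k V (\<lambda>x. L (f x))"
 using assms(3)
proof (induction k arbitrary: f)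
 case 0
 then show ?case by (simp add: bounded_linear.continuous_on[OF assms(1)])
next
 case (Suc k)
 have "Ck_on k V (pd i (\<lambda>x. L (f x)))" for i
 proof -
  have "Ck_on k V (\<lambda>x. L (pd i f x))" using Suc by simp
  then show ?thesis
   using Suc.prems by (subst Ck_on_cong[OF assms(2)]) (auto intro!: pd_bounded_linear[OF assms(1)])
 qed
 then show ?case
  using Suc.prems bounded_linear.has_derivative[OF assms(1)] by (auto simp: differentiable_def) blast
qed

lemma Ck_on_add:
 assumes "open V" "Ck_on k V f" "Ck_on k V g"
 shows "Ck_on k V (\<lambda>x. f x + g x)"
 using assms(2,3)
proof (induction k arbitrary: f g)
 case 0
 then show ?case by (simp add: continuous_on_add)
next
 case (Suc k)
 have "Ck_on k V (pd i (\<lambda>x. f x + g x))" for i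
 proof -
  have "Ck_on k V (\<lambda>x. pd i f x + pd i g x)" using Suc by simp
  then show ?thesis
   using Suc.prems by (subst Ck_on_cong[OF assms(1)]) (auto intro!: pd_add)
 qed
 then show ?case using Suc.prems by auto
qed

lemma Ck_on_bilinear:
 assumes "bounded_bilinear B" "open V" "Ck_on k V f" "Ck_on k V g"
 shows "Ck_on k V (\<lambda>x. B (f x) (g x))"
 using assms(3,4)
proof (induction k arbitrary: f g)
 case 0
 then show ?case by (simp add: bounded_bilinear.continuous_on[OF assms(1)])
next
 case (Suc k)
 have "Ck_on k V (pd i (\<lambda>x. B (f x) (g x)))" for i
 proof -
  have "Ck_on k V f" "Ck_on k V g" using Suc.prems Ck_on_Suc by blast+
  then have "Ck_on k V (\<lambda>x. B (f x) (pd i g x) + B (pd i f x) (g x))"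
   using Suc by (intro Ck_on_add[OF assms(2)]) auto
  then show ?thesis
   using Suc.prems by (subst Ck_on_cong[OF assms(2)]) (auto intro!: pd_bilinear[OF assms(1)])
 qed
 moreover have "(\<lambda>x. B (f x) (g x)) differentiable (at x)" if "x \<in> V" for x
  using Suc.prems that bounded_bilinear.FDERIV[OF assms(1), of f _ x UNIV g]
  by (auto simp: differentiable_def) blast
 ultimately show ?case by simp
qed

lemma smooth_on_bounded_linear:
 "bounded_linear L \<Longrightarrow> open V \<Longrightarrow> smooth_on V f \<Longrightarrow> smooth_on V (\<lambda>x. L (f x))"
 by (simp add: smooth_on_def Ck_on_bounded_linear)

lemma smooth_on_add [intro!]:
 "open V \<Longrightarrow> smooth_on V f \<Longrightarrow> smooth_on V g \<Longrightarrow> smooth_on V (\<lambda>x. f x + g x)"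
 by (simp add: smooth_on_def Ck_on_add)

lemma smooth_on_bilinear:
 "bounded_bilinear B \<Longrightarrow> open V \<Longrightarrow> smooth_on V f \<Longrightarrow> smooth_on V g \<Longrightarrow> smooth_on V (\<lambda>x. B (f x) (g x))"
 by (simp add: smooth_on_def Ck_on_bilinear)

lemma smooth_on_mult [intro!]:
 fixes f :: "_ \<Rightarrow> 'a::real_normed_algebra"
 shows "open V \<Longrightarrow> smooth_on V f \<Longrightarrow> smooth_on V g \<Longrightarrow> smooth_on V (\<lambda>x. f x * g x)"
 by (rule smooth_on_bilinear[OF bounded_bilinear_mult])

lemma smooth_on_scaleR [intro!]:
 "open V \<Longrightarrow> smooth_on V f \<Longrightarrow> smooth_on V g \<Longrightarrow> smooth_on V (\<lambda>x. f x *\<^sub>R g x)"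
 by (rule smooth_on_bilinear[OF bounded_bilinear_scaleR])

lemma smooth_on_minus [intro!]:
 "open V \<Longrightarrow> smooth_on V f \<Longrightarrow> smooth_on V (\<lambda>x. - f x)"
 by (rule smooth_on_bounded_linear[OF bounded_linear_minus[OF bounded_linear_ident]])

lemma smooth_on_diff [intro!]:
 "open V \<Longrightarrow> smooth_on V f \<Longrightarrow> smooth_on V g \<Longrightarrow> smooth_on V (\<lambda>x. f x - g x)"
 using smooth_on_add[OF _ _ smooth_on_minus, of V f g] by simp

lemma smooth_on_sum [intro!]:
 "open V \<Longrightarrow> (\<And>a. a \<in> I \<Longrightarrow> smooth_on V (f a)) \<Longrightarrow> smooth_on V (\<lambda>x. \<Sum>a\<in>I. f a x)"
 by (induction I rule: infinite_finite_induct) auto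

lemma smooth_on_prod [intro!]:
 fixes f :: "_ \<Rightarrow> _ \<Rightarrow> 'a::{real_normed_algebra_1,comm_ring_1}"
 shows "open V \<Longrightarrow> (\<And>a. a \<in> I \<Longrightarrow> smooth_on V (f a)) \<Longrightarrow> smooth_on V (\<lambda>x. \<Prod>a\<in>I. f a x)"
 by (induction I rule: infinite_finite_induct) auto

lemma smooth_on_if [intro!]:
 "(c \<Longrightarrow> smooth_on V f) \<Longrightarrow> (\<not> c \<Longrightarrow> smooth_on V h) \<Longrightarrow> smooth_on V (\<lambda>x. if c then f x else h x)"
 by (cases c) simp_all

lemma smooth_on_of_real [intro!]:
 "open V \<Longrightarrow> smooth_on V f \<Longrightarrow> smooth_on V (\<lambda>x. of_real (f x) :: 'a::real_normed_algebra_1)"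
 by (rule smooth_on_bounded_linear[OF bounded_linear_of_real])

lemma smooth_on_nth [intro!]:
 fixes f :: "_ \<Rightarrow> real ^ 'm"
 shows "open V \<Longrightarrow> smooth_on V f \<Longrightarrow> smooth_on V (\<lambda>x. f x $ j)"
 by (rule smooth_on_bounded_linear[OF bounded_linear_vec_nth])

lemma smooth_on_linear:
 fixes f :: "real ^ 'n::finite \<Rightarrow> 'b::real_normed_vector"
 assumes "bounded_linear f" shows "smooth_on V f"
proof -
 have pd: "pd i f = (\<lambda>x. f (axis i 1))" for i
  using pd_eqI[OF bounded_linear.has_derivative[OF assms has_derivative_ident]] by (simp add: fun_eq_iff)
 have "Ck_on k V f" for k
  by (cases k) (auto simp: pd Ck_on_const assms intro!: bounded_linear_imp_differentiable
    linear_continuous_on)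
 then show ?thesis by (simp add: smooth_on_def)
qed

lemma smooth_on_ident [intro, simp]: "smooth_on V (\<lambda>x. x)"
 by (rule smooth_on_linear) simp

lemma smooth_on_coord [intro, simp]: "smooth_on V (\<lambda>x. x $ i :: real)"
 by (rule smooth_on_linear) (rule bounded_linear_vec_nth)

lemma pd_coord [simp]: "pd i (\<lambda>x :: real ^ 'n::finite. x $ j) x = (if i = j then 1 else 0)"
 using pd_eqI[OF bounded_linear.has_derivative[OF bounded_linear_vec_nth has_derivative_ident], of i j x]
 by (simp add: axis_def)

lemma pd_of_real_coord [simp]:
 "pd i (\<lambda>x :: real ^ 'n::finite. of_real (x $ j) :: complex) x = (if i = j then 1 else 0)"
 by (subst pd_bounded_linear[OF bounded_linear_of_real])
  (auto intro: smooth_on_differentiable[of UNIV] simp: smooth_on_coord)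

lemma smooth_on_vecI:
 fixes f :: "real ^ 'n::finite \<Rightarrow> real ^ 'm::finite"
 assumes "open V" "\<And>j. smooth_on V (\<lambda>x. f x $ j)"
 shows "smooth_on V f"
proof -
 have "smooth_on V (\<lambda>x. \<Sum>j\<in>UNIV. (f x $ j) *\<^sub>R axis j (1::real))"
  using assms by (intro smooth_on_sum smooth_on_scaleR) auto
 also have "(\<lambda>x. \<Sum>j\<in>UNIV. (f x $ j) *\<^sub>R axis j (1::real)) = f"
  by (simp add: fun_eq_iff vec_eq_iff axis_def if_distrib[of "\<lambda>t. _ * t"] cong: if_cong)
 finally show ?thesis .
qed

lemma pd_nth:
 fixes f :: "real ^ 'n::finite \<Rightarrow> real ^ 'm::finite"
 shows "f differentiable (at x) \<Longrightarrow> pd i (\<lambda>x. f x $ j) x = pd i f x $ j"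
 by (rule pd_bounded_linear[OF bounded_linear_vec_nth])

lemma pd_compose:
 fixes \<phi> :: "real ^ 'n::finite \<Rightarrow> real ^ 'm::finite" and f :: "real ^ 'm \<Rightarrow> 'b::real_normed_vector"
 assumes "\<phi> differentiable (at x)" "f differentiable (at (\<phi> x))"
 shows "pd i (\<lambda>x. f (\<phi> x)) x = (\<Sum>j\<in>UNIV. pd i \<phi> x $ j *\<^sub>R pd j f (\<phi> x))"
 using pd_eqI[OF has_derivative_compose[OF has_derivative_pd[OF assms(1)] has_derivative_pd[OF assms(2)]], of i]
 by (simp add: axis_def if_distrib[of "\<lambda>t. t *\<^sub>R _"] cong: if_cong)

lemma Ck_on_compose:
 fixes \<phi> :: "real ^ 'n::finite \<Rightarrow> real ^ 'm::finite" and f :: "real ^ 'm \<Rightarrow> 'b::real_normed_vector"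
 assumes "open V" "Ck_on k V \<phi>" "Ck_on k V' f" "\<And>x. x \<in> V \<Longrightarrow> \<phi> x \<in> V'"
 shows "Ck_on k V (\<lambda>x. f (\<phi> x))"
 using assms(2,3)
proof (induction k arbitrary: f)
 case 0
 then show ?case using assms(4) by (auto intro: continuous_on_compose2)
next
 case (Suc k)
 have \<phi>: "Ck_on k V \<phi>" using Suc.prems Ck_on_Suc by blast
 have "Ck_on k V (pd i (\<lambda>x. f (\<phi> x)))" for i
 proof -
  have "Ck_on k V (\<lambda>x. pd i \<phi> x $ j *\<^sub>R pd j f (\<phi> x))" for j
   using Suc \<phi> by (intro Ck_on_bilinear[OF bounded_bilinear_scaleR assms(1)]
     Ck_on_bounded_linear[OF bounded_linear_vec_nth assms(1)]) auto
  then have "Ck_on k V (\<lambda>x. \<Sum>j\<in>F. pd i \<phi> x $ j *\<^sub>R pd j f (\<phi> x))" for F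
   by (induction F rule: infinite_finite_induct) (auto intro: Ck_on_add[OF assms(1)] Ck_on_const)
  then show ?thesis
   using Suc.prems assms(4) by (intro Ck_on_congI[OF assms(1) _ pd_compose]) auto
 qed
 then show ?case using Suc.prems assms(4) differentiable_compose[of f \<phi>] by auto
qed

lemma smooth_on_compose:
 fixes \<phi> :: "real ^ 'n::finite \<Rightarrow> real ^ 'm::finite" and f :: "real ^ 'm \<Rightarrow> 'b::real_normed_vector"
 assumes "open V" "smooth_on V \<phi>" "smooth_on V' f" "\<And>x. x \<in> V \<Longrightarrow> \<phi> x \<in> V'"
 shows "smooth_on V (\<lambda>x. f (\<phi> x))"
 using assms(2,3) Ck_on_compose[where \<phi> = \<phi> and f = f, OF assms(1) _ _ assms(4)]
 by (simp add: smooth_on_def)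

lemma pd_real_compose:
 assumes "f differentiable (at x)" "(h has_real_derivative h') (at (f x))"
 shows "pd i (\<lambda>x. h (f x)) x = h' * pd i f x"
 using pd_eqI[OF has_derivative_compose[OF assms(1)[unfolded frechet_derivative_works]
    assms(2)[unfolded has_field_derivative_def]]]
 by (simp add: pd_def)

text \<open>The chain rule turns \<open>h (u x)\<close> into \<open>h' (u x) * pd i u x\<close> with
  \<open>h'\<close> again in \<open>H\<close>, so the induction on the order runs over all members
  of \<open>H\<close> at once. It is applied to the exponential, to powers and to the functions
  behind the bump functions.\<close>

lemma smooth_on_real_family:
 fixes u :: "real ^ 'n::finite \<Rightarrow> real"
 assumes H: "\<And>h. h \<in> H \<Longrightarrow> \<exists>h'\<in>H. \<forall>t\<in>I. (h has_real_derivative h' t) (at t)"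
  and V: "open V" and u: "smooth_on V u" "\<And>x. x \<in> V \<Longrightarrow> u x \<in> I" and h: "h \<in> H"
 shows "smooth_on V (\<lambda>x. h (u x))"
proof -
 have "Ck_on k V (\<lambda>x. h (u x))" for k
  using h
 proof (induction k arbitrary: h)
  case 0
  then obtain h' where h': "\<forall>t\<in>I. (h has_real_derivative h' t) (at t)" using H by blast
  then have "continuous_on I h"
   by (meson DERIV_continuous continuous_at_imp_continuous_on)
  then show ?case
   using smooth_on_continuous_on[OF u(1)] u(2) by (auto intro: continuous_on_compose2)
 next
  case (Suc k)
  obtain h' where h': "h' \<in> H" "\<forall>t\<in>I. (h has_real_derivative h' t) (at t)" using H Suc.prems by blast
  have d: "u differentiable (at x)" if "x \<in> V" for x using smooth_on_differentiable[OF u(1) that] .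
  have "Ck_on k V (\<lambda>x. h' (u x) * pd i u x)" for i
   using smooth_on_pd[OF u(1), of i] by (intro Ck_on_bilinear[OF bounded_bilinear_mult V] Suc.IH h')
    (simp add: smooth_on_def)
  then have "Ck_on k V (pd i (\<lambda>x. h (u x)))" for i
   using h' d u(2) by (intro Ck_on_congI[OF V _ pd_real_compose]) auto
  moreover have "(\<lambda>x. h (u x)) differentiable (at x)" if "x \<in> V" for x
  proof -
   have "h differentiable (at (u x))"
    using h'(2) u(2)[OF that] by (auto simp: real_differentiable_def)
   then show ?thesis using d[OF that] differentiable_compose[of h u x] by (simp add: o_def)
  qed
  ultimately show ?case by simp
 qed
 then show ?thesis by (simp add: smooth_on_def)
qed

lemma smooth_on_exp:
 fixes u :: "real ^ 'n::finite \<Rightarrow> real"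
 assumes "open V" "smooth_on V u" shows "smooth_on V (\<lambda>x. exp (u x))"
 by (rule smooth_on_real_family[of "{exp}" UNIV]) (use assms in \<open>auto intro: DERIV_exp\<close>)

lemma smooth_on_powr:
 fixes u :: "real ^ 'n::finite \<Rightarrow> real"
 assumes "open V" "smooth_on V u" "\<And>x. x \<in> V \<Longrightarrow> 0 < u x"
 shows "smooth_on V (\<lambda>x. u x powr s)"
proof (rule smooth_on_real_family[of "{h. \<exists>c a. h = (\<lambda>t. c * t powr a)}" "{0<..}" V u "\<lambda>t. t powr s"])
 fix h :: "real \<Rightarrow> real" assume "h \<in> {h. \<exists>c a. h = (\<lambda>t. c * t powr a)}"
 then obtain c a where h: "h = (\<lambda>t. c * t powr a)" by blast
 have "(h has_real_derivative (c * a) * t powr (a - 1)) (at t)" if "0 < t" for t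
  unfolding h using DERIV_cmult[OF has_real_derivative_powr[OF that, of a], of c] by (simp add: mult.assoc)
 then show "\<exists>h'\<in>{h. \<exists>c a. h = (\<lambda>t. c * t powr a)}. \<forall>t\<in>{0<..}. (h has_real_derivative h' t) (at t)"
  by (intro bexI[of _ "\<lambda>t. (c * a) * t powr (a - 1)"]) auto
next
 show "(\<lambda>t. t powr s) \<in> {h. \<exists>c a. h = (\<lambda>t. c * t powr a)}"
  by (rule CollectI, rule exI[of _ 1]) auto
qed (use assms in auto)

text \<open>The absolute value is avoided by writing the function as the power s / 2 of the positive
  smooth function \<open>u x * u x\<close>.\<close>

lemma smooth_on_abs_powr:
 fixes u :: "real ^ 'n::finite \<Rightarrow> real"
 assumes "open V" "smooth_on V u" "\<And>x. x \<in> V \<Longrightarrow> u x \<noteq> 0"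
 shows "smooth_on V (\<lambda>x. \<bar>u x\<bar> powr s)"
proof -
 have "smooth_on V (\<lambda>x. (u x * u x) powr (s / 2))"
  using assms by (intro smooth_on_powr smooth_on_mult) (auto simp: zero_less_mult_iff linorder_neq_iff)
 moreover have "(u x * u x) powr (s / 2) = \<bar>u x\<bar> powr s" if "x \<in> V" for x
 proof -
  have "u x * u x = \<bar>u x\<bar> powr 2" using assms(3)[OF that] by (simp add: power2_eq_square)
  then show ?thesis unfolding powr_powr by (simp add: powr_powr del: powr_numeral)
 qed
 ultimately show ?thesis using smooth_on_cong[OF assms(1)] by (metis (no_types, lifting))
qed

lemma smooth_on_inverse:
 fixes u :: "real ^ 'n::finite \<Rightarrow> real"
 assumes "open V" "smooth_on V u" "\<And>x. x \<in> V \<Longrightarrow> u x \<noteq> 0"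
 shows "smooth_on V (\<lambda>x. inverse (u x))"
proof -
 have "smooth_on V (\<lambda>x. u x * \<bar>u x\<bar> powr (-2))"
  using assms by (intro smooth_on_mult smooth_on_abs_powr) auto
 moreover have "u x * \<bar>u x\<bar> powr (-2) = inverse (u x)" if "x \<in> V" for x
  using assms(3)[OF that] by (simp add: powr_minus field_simps power2_eq_square)
 ultimately show ?thesis using smooth_on_cong[OF assms(1)] by (metis (no_types, lifting))
qed

text \<open>The second difference over a small square equals h * h times either mixed derivative at
  some nearby point, by two applications of the mean value theorem. Continuity of both mixed
  derivatives then gives equality at the centre.\<close>

lemma pd_swap_real:
 fixes f :: "real ^ 'n::finite \<Rightarrow> real"
 assumes V: "open V" "x \<in> V" and f: "smooth_on V f"
 shows "pd i (pd j f) x = pd j (pd i f) x"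
proof -
 obtain e where e: "0 < e" "ball x e \<subseteq> V" using V open_contains_ball by blast
 have line: "((\<lambda>t. g (y + t *\<^sub>R axis k 1)) has_real_derivative pd k g (y + t *\<^sub>R axis k 1)) (at t)"
  if g: "smooth_on V g" "y + t *\<^sub>R axis k 1 \<in> V" for g :: "real ^ 'n \<Rightarrow> real" and y k t
 proof -
  have d: "((\<lambda>t. y + t *\<^sub>R axis k 1) has_derivative (\<lambda>h. h *\<^sub>R axis k 1)) (at t)"
   by (auto intro!: derivative_eq_intros)
  have "((\<lambda>t. g (y + t *\<^sub>R axis k 1)) has_derivative
    (\<lambda>h. frechet_derivative g (at (y + t *\<^sub>R axis k 1)) (h *\<^sub>R axis k 1))) (at t)"
   using has_derivative_compose[OF d, of g] smooth_on_differentiable[OF g]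
   by (simp add: frechet_derivative_works)
  then show ?thesis
   using linear_frechet_derivative[OF smooth_on_differentiable[OF g]]
   by (simp add: has_field_derivative_def pd_def linear_cmul mult.commute[of _ "frechet_derivative _ _ _"])
 qed
 have mvt: "\<exists>y\<in>ball x (3 * h). f (x + h *\<^sub>R axis a 1 + h *\<^sub>R axis b 1) - f (x + h *\<^sub>R axis a 1)
    - f (x + h *\<^sub>R axis b 1) + f x = h * h * pd b (pd a f) y"
  if h: "0 < h" "3 * h \<le> e" for h a b
 proof -
  have inV: "x + s *\<^sub>R axis a 1 + t *\<^sub>R axis b 1 \<in> ball x (3 * h)" if "0 \<le> s" "s \<le> h" "0 \<le> t" "t \<le> h" for s t
  proof -
   have "norm (s *\<^sub>R axis a (1::real) + t *\<^sub>R axis b 1) \<le> s + t"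
    using norm_triangle_ineq[of "s *\<^sub>R axis a (1::real)" "t *\<^sub>R axis b 1"] that by simp
   moreover have "dist x (x + s *\<^sub>R axis a 1 + t *\<^sub>R axis b 1) = norm (s *\<^sub>R axis a (1::real) + t *\<^sub>R axis b 1)"
    by (metis add.assoc add_diff_cancel_left' dist_commute dist_norm)
   ultimately show ?thesis using that h by simp
  qed
  have inV': "x + s *\<^sub>R axis a 1 + t *\<^sub>R axis b 1 \<in> V" if "0 \<le> s" "s \<le> h" "0 \<le> t" "t \<le> h" for s t
   using inV[OF that] e(2) h(2) by auto
  define F where "F s = f ((x + h *\<^sub>R axis b 1) + s *\<^sub>R axis a 1) - f (x + s *\<^sub>R axis a 1)" for s
  have "\<exists>z. 0 < z \<and> z < h \<and> F h - F 0 = (h - 0) *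
    (pd a f ((x + h *\<^sub>R axis b 1) + z *\<^sub>R axis a 1) - pd a f (x + z *\<^sub>R axis a 1))"
   unfolding F_def using inV'[of _ h] inV'[of _ 0] h(1)
   by (intro MVT2 allI impI DERIV_diff line f) (auto simp: add_ac)
  then obtain s where s: "0 < s" "s < h"
   "F h - F 0 = h * (pd a f ((x + s *\<^sub>R axis a 1) + h *\<^sub>R axis b 1) - pd a f ((x + s *\<^sub>R axis a 1) + 0 *\<^sub>R axis b 1))"
   by (auto simp: add_ac)
  have "\<exists>t. 0 < t \<and> t < h \<and> pd a f ((x + s *\<^sub>R axis a 1) + h *\<^sub>R axis b 1) - pd a f ((x + s *\<^sub>R axis a 1) + 0 *\<^sub>R axis b 1)
    = (h - 0) * pd b (pd a f) ((x + s *\<^sub>R axis a 1) + t *\<^sub>R axis b 1)"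
   using s inV'[of s] h(1) by (intro MVT2 line smooth_on_pd f) auto
  then obtain t where t: "0 < t" "t < h" "F h - F 0 = h * (h * pd b (pd a f) ((x + s *\<^sub>R axis a 1) + t *\<^sub>R axis b 1))"
   using s by auto
  have "F h - F 0 = f (x + h *\<^sub>R axis a 1 + h *\<^sub>R axis b 1) - f (x + h *\<^sub>R axis a 1)
    - f (x + h *\<^sub>R axis b 1) + f x"
   by (simp add: F_def add_ac)
  then show ?thesis using t s inV[of s t] by (intro bexI[of _ "x + s *\<^sub>R axis a 1 + t *\<^sub>R axis b 1"]) auto
 qed
 let ?A = "pd i (pd j f)" and ?B = "pd j (pd i f)"
 have cont: "isCont ?A x" "isCont ?B x"
  using f V by (auto intro!: continuous_on_interior[OF smooth_on_continuous_on] simp: interior_open)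
 have "dist (?A x) (?B x) < 2 * r" if "r > 0" for r
 proof -
  obtain d1 where d1: "0 < d1" "\<And>y. dist y x < d1 \<Longrightarrow> dist (?A y) (?A x) < r"
   using cont(1) \<open>r > 0\<close> by (auto simp: continuous_at_eps_delta)
  obtain d2 where d2: "0 < d2" "\<And>y. dist y x < d2 \<Longrightarrow> dist (?B y) (?B x) < r"
   using cont(2) \<open>r > 0\<close> by (auto simp: continuous_at_eps_delta)
  \<comment> \<open>The points supplied by \<open>mvt\<close> lie within distance 3 h of x, hence in
    the ball inside V and within both radii of continuity.\<close>
  define h where "h = Min {e, d1, d2} / 3"
  have h: "0 < h" "3 * h \<le> e" "3 * h \<le> d1" "3 * h \<le> d2" using e d1 d2 by (auto simp: h_def)
  obtain y where y: "y \<in> ball x (3 * h)" "f (x + h *\<^sub>R axis j 1 + h *\<^sub>R axis i 1) - f (x + h *\<^sub>R axis j 1)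
    - f (x + h *\<^sub>R axis i 1) + f x = h * h * ?A y" using mvt[OF h(1,2)] by blast
  obtain z where z: "z \<in> ball x (3 * h)" "f (x + h *\<^sub>R axis i 1 + h *\<^sub>R axis j 1) - f (x + h *\<^sub>R axis i 1)
    - f (x + h *\<^sub>R axis j 1) + f x = h * h * ?B z" using mvt[OF h(1,2)] by blast
  have "h * h * ?A y = h * h * ?B z" using y(2) z(2) by (simp add: algebra_simps)
  then have "?A y = ?B z" using h(1) by simp
  moreover have "dist (?A y) (?A x) < r" "dist (?B z) (?B x) < r"
   using y(1) z(1) h d1(2)[of y] d2(2)[of z] by (auto simp: dist_commute)
  ultimately show ?thesis by (metis dist_commute dist_triangle_less_add mult_2)
 qed
 then have "dist (?A x) (?B x) \<le> 0"
  by (metis (no_types, opaque_lifting) dense field_sum_of_halves mult_2 not_less not_le half_gt_zero less_irrefl)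
 then show ?thesis by simp
qed

lemma pd_swap:
 fixes f :: "real ^ 'n::finite \<Rightarrow> 'b::euclidean_space"
 assumes V: "open V" "x \<in> V" and f: "smooth_on V f"
 shows "pd i (pd j f) x = pd j (pd i f) x"
proof (rule euclidean_eqI)
 fix b :: 'b
 have inner: "pd a (\<lambda>x. g x \<bullet> b) y = pd a g y \<bullet> b" if "smooth_on V g" "y \<in> V" for a g y
  by (rule pd_bounded_linear[OF bounded_linear_inner_left smooth_on_differentiable[OF that]])
 have *: "pd i (pd j f) x \<bullet> b = pd i (pd j (\<lambda>x. f x \<bullet> b)) x" for i j
  unfolding inner[OF smooth_on_pd[OF f] V(2), symmetric]
  by (rule pd_cong_open[OF V]) (simp add: inner[OF f])
 show "pd i (pd j f) x \<bullet> b = pd j (pd i f) x \<bullet> b"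
  unfolding * by (rule pd_swap_real[OF V]) (intro smooth_on_bounded_linear[OF bounded_linear_inner_left] V f)
qed

section \<open>Polynomial symbols and normal ordering\<close>

type_synonym 'n sym = "real ^ 'n \<Rightarrow> real ^ 'n \<Rightarrow> complex"

abbreviation "Sym \<equiv> loc_symbol"

abbreviation "SymU \<equiv> loc_symbol_upto"

definition mon :: "'n::finite list \<Rightarrow> real ^ 'n \<Rightarrow> complex" where
 "mon is \<xi> = (\<Prod>i\<leftarrow>is. cr (\<xi> $ i))"

lemma mon_Nil [simp]: "mon [] \<xi> = 1"
 and mon_Cons [simp]: "mon (i # is) \<xi> = cr (\<xi> $ i) * mon is \<xi>"
 by (simp_all add: mon_def)

lemma smooth_on_mon [intro, simp]: "open V \<Longrightarrow> smooth_on V (mon is)"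
proof (induction "is")
 case Nil
 have "mon ([] :: 'a list) = (\<lambda>\<xi>. 1)" by (simp add: fun_eq_iff)
 then show ?case by simp
next
 case (Cons i "is")
 have "mon (i # is) = (\<lambda>\<xi>. cr (\<xi> $ i) * mon is \<xi>)" by (simp add: fun_eq_iff)
 then show ?case using Cons by auto
qed

text \<open>Index lists are multi-indices with a redundant order. A weight that depends only on the
  multiset of indices cannot tell apart two families of coefficients of one symbol. Monomials and
  iterated derivatives are such weights, and this makes normal ordering well defined.\<close>

definition perm_inv :: "('n list \<Rightarrow> 'c) \<Rightarrow> bool" where
 "perm_inv Y \<longleftrightarrow> (\<forall>is js. mset is = mset js \<longrightarrow> Y is = Y js)"

lemma perm_invD: "perm_inv Y \<Longrightarrow> mset is = mset js \<Longrightarrow> Y is = Y js"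
 unfolding perm_inv_def by blast

lemma perm_inv_mon: "perm_inv (\<lambda>is. mon is \<xi>)"
 unfolding perm_inv_def mon_def by (metis mset_map prod_mset_prod_list)

text \<open>An index can be moved to the front past its predecessors because partial derivatives
  commute; the induction then matches the head of the first list with an occurrence of it in the
  second.\<close>

lemma perm_inv_iter_pd:
 assumes V: "open V" and f: "smooth_on V f" and x: "x \<in> V"
 shows "perm_inv (\<lambda>is. iter_pd is f x)"
proof -
 have move: "iter_pd (us @ i # vs) f x = iter_pd (i # us @ vs) f x" if "x \<in> V" for us vs i x
  using that
 proof (induction us arbitrary: x)
  case (Cons u us)
  have "iter_pd ((u # us) @ i # vs) f x = pd u (iter_pd (i # us @ vs) f) x"
   using Cons by (auto intro!: pd_cong_open[OF V])
  also have "\<dots> = pd i (pd u (iter_pd (us @ vs) f)) x"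
   using pd_swap[OF V Cons.prems smooth_on_iter_pd[OF f]] by simp
  finally show ?case by simp
 qed simp
 have "iter_pd is f x = iter_pd js f x" if "mset is = mset js" "x \<in> V" for "is" js x
  using that
 proof (induction "is" arbitrary: js x)
  case (Cons i "is")
  then have "i \<in> set js" by (metis list.set_intros(1) set_mset_mset)
  then obtain us vs where js: "js = us @ i # vs" by (meson split_list)
  have eq: "mset is = mset (us @ vs)" using Cons.prems(1) js by simp
  have "iter_pd (i # is) f x = pd i (iter_pd (us @ vs) f) x"
   using Cons.IH[OF eq] Cons.prems(2) by (auto intro!: pd_cong_open[OF V])
  then show ?case using move[OF Cons.prems(2), of us i vs] js by simp
 qed simp
 then show ?thesis using x unfolding perm_inv_def by blast
qed

lemma finite_multi_indices [simp]: "finite (multi_indices k :: 'n::finite list set)"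
 by (rule finite_subset[OF _ finite_lists_length_le[of UNIV "nat k"]]) (auto simp: multi_indices_def)

lemma iter_pd_sum_mult:
 assumes V: "open V" "x \<in> V" and f: "\<And>a. a \<in> I \<Longrightarrow> smooth_on V (f a)"
 shows "iter_pd is (\<lambda>x. \<Sum>a\<in>I. c a * f a x) x = (\<Sum>a\<in>I. c a * iter_pd is (f a) x)"
 using V(2)
proof (induction "is" arbitrary: x)
 case (Cons i "is")
 have "iter_pd (i # is) (\<lambda>x. \<Sum>a\<in>I. c a * f a x) x = pd i (\<lambda>x. \<Sum>a\<in>I. c a * iter_pd is (f a) x) x"
  using Cons by (auto intro!: pd_cong_open[OF V(1)])
 also have "\<dots> = (\<Sum>a\<in>I. pd i (\<lambda>x. c a * iter_pd is (f a) x) x)"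
  using f Cons.prems V(1) by (intro pd_sum smooth_on_differentiable[of V]) auto
 also have "\<dots> = (\<Sum>a\<in>I. c a * iter_pd (i # is) (f a) x)"
  using f Cons.prems V(1)
  by (intro sum.cong refl) (auto intro!: pd_bounded_linear[OF bounded_linear_mult_right] smooth_on_differentiable[of V])
 finally show ?case .
qed simp

lemma iter_pd_const: "iter_pd is (\<lambda>\<xi>. c) = (\<lambda>\<xi>. if is = [] then c else 0)"
proof (induction "is")
 case (Cons i "is")
 show ?case by (rule ext) (simp add: Cons)
qed simp

text \<open>By the Leibniz rule at most one derivative can fall on the linear factor. The sum runs
  over the position m of that derivative, and the list in the summand is \<open>is\<close> without
  this entry.\<close>

lemma iter_pd_coord_mult:
 fixes q :: "real ^ 'n::finite \<Rightarrow> complex"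
 assumes V: "open V" "\<xi> \<in> V" and q: "smooth_on V q"
 shows "iter_pd is (\<lambda>\<xi>. cr (\<xi> $ j) * q \<xi>) \<xi> = cr (\<xi> $ j) * iter_pd is q \<xi> +
  (\<Sum>m<length is. if is ! m = j then iter_pd (take m is @ drop (Suc m) is) q \<xi> else 0)"
 using V(2)
proof (induction "is" arbitrary: \<xi>)
 case (Cons i "is")
 note d = smooth_on_differentiable[of V]
 have "iter_pd (i # is) (\<lambda>\<xi>. cr (\<xi> $ j) * q \<xi>) \<xi> =
   pd i (\<lambda>\<xi>. cr (\<xi> $ j) * iter_pd is q \<xi> +
    (\<Sum>m<length is. if is ! m = j then iter_pd (take m is @ drop (Suc m) is) q \<xi> else 0)) \<xi>"
  using Cons by (auto intro!: pd_cong_open[OF V(1)])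
 also have "\<dots> = pd i (\<lambda>\<xi>. cr (\<xi> $ j) * iter_pd is q \<xi>) \<xi> +
   pd i (\<lambda>\<xi>. \<Sum>m<length is. if is ! m = j then iter_pd (take m is @ drop (Suc m) is) q \<xi> else 0) \<xi>"
  using Cons.prems q V(1) by (intro pd_add d) (auto intro!: smooth_on_sum)
 also have "pd i (\<lambda>\<xi>. \<Sum>m<length is. if is ! m = j then iter_pd (take m is @ drop (Suc m) is) q \<xi> else 0) \<xi>
   = (\<Sum>m<length is. if is ! m = j then pd i (iter_pd (take m is @ drop (Suc m) is) q) \<xi> else 0)"
  using Cons.prems q V(1) by (subst pd_sum) (auto intro!: d sum.cong)
 also have "pd i (\<lambda>\<xi>. cr (\<xi> $ j) * iter_pd is q \<xi>) \<xi> =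
   cr (\<xi> $ j) * pd i (iter_pd is q) \<xi> + (if i = j then 1 else 0) * iter_pd is q \<xi>"
  using Cons.prems q V(1)
  by (subst pd_mult) (auto intro!: d)
 finally show ?case by (simp add: sum.lessThan_Suc_shift del: sum.lessThan_Suc cong: if_cong)
qed simp

lemma iter_pd_mon_zero:
 "length is \<noteq> length js \<Longrightarrow> iter_pd is (mon js) 0 = 0"
proof (induction js arbitrary: "is")
 case Nil
 have "mon ([] :: 'a list) = (\<lambda>\<xi>. 1)" by (simp add: fun_eq_iff)
 with Nil show ?case by (simp add: iter_pd_const)
next
 case (Cons j js)
 have eq: "mon (j # js) = (\<lambda>\<xi>. cr (\<xi> $ j) * mon js \<xi>)" by (simp add: fun_eq_iff)
 show ?case unfolding eq
  using Cons by (subst iter_pd_coord_mult[of UNIV]) (auto intro!: sum.neutral Cons.IH)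
qed

text \<open>Only rearrangements of \<open>js\<close> contribute, and together they count the
  permutations of its positions, whence the factorial. In the induction, each position at which the
  head j can be differentiated away contributes the same sum.\<close>

lemma iter_pd_mon_sum:
 assumes "perm_inv Y"
 shows "(\<Sum>is | length is = length js. iter_pd is (mon js) 0 * Y is) = fact (length js) * Y js"
 using assms
proof (induction js arbitrary: Y)
 case Nil
 then show ?case by simp
next
 case (Cons j js)
 let ?k = "length js"
 let ?F = "\<lambda>is. iter_pd is (mon js) 0"
 have fin: "finite {is :: 'a list. length is = n}" for n
  using finite_lists_length_eq[of "UNIV :: 'a set" n] by simp
 have Y': "perm_inv (\<lambda>js. Y (j # js))"
  using Cons.prems unfolding perm_inv_def by simp
 have eq: "mon (j # js) = (\<lambda>\<xi>. cr (\<xi> $ j) * mon js \<xi>)" by (simp add: fun_eq_iff)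
 have "(\<Sum>is | length is = Suc ?k. iter_pd is (mon (j # js)) 0 * Y is) =
   (\<Sum>is | length is = Suc ?k. \<Sum>m<Suc ?k. if is ! m = j then ?F (take m is @ drop (Suc m) is) * Y is else 0)"
  unfolding eq
  by (intro sum.cong refl, subst iter_pd_coord_mult[of UNIV])
   (auto simp: sum_distrib_right if_distrib[of "\<lambda>t. t * _"] simp del: sum.lessThan_Suc cong: if_cong)
 also have "\<dots> = (\<Sum>m<Suc ?k. \<Sum>is | length is = Suc ?k. if is ! m = j then ?F (take m is @ drop (Suc m) is) * Y is else 0)"
  by (rule sum.swap)
 also have "\<dots> = (\<Sum>m<Suc ?k. \<Sum>is | length is = ?k. ?F is * Y (j # is))"
 proof (rule sum.cong[OF refl])
  fix m assume m: "m \<in> {..<Suc ?k}"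
  have "(\<Sum>is | length is = Suc ?k. if is ! m = j then ?F (take m is @ drop (Suc m) is) * Y is else 0) =
   (\<Sum>is\<in>{is. length is = Suc ?k \<and> is ! m = j}. ?F (take m is @ drop (Suc m) is) * Y is)"
   using fin by (intro sum.mono_neutral_cong_right) auto
  \<comment> \<open>Inserting j at position m is a bijection from the shorter lists onto the lists
    with entry j there; permutation invariance of \<open>Y\<close> then moves j to the
    front.\<close>
  also have "\<dots> = (\<Sum>is | length is = ?k. ?F is * Y (j # is))"
  proof (rule sum.reindex_bij_witness[of _ "\<lambda>is. take m is @ j # drop m is" "\<lambda>is. take m is @ drop (Suc m) is"], goal_cases)
   case (1 "is")
   then show ?case using m id_take_nth_drop[of m "is"] by (auto simp: min_def)
  next
   case (5 "is")
   then have "mset is = mset (j # take m is @ drop (Suc m) is)"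
    using m by (subst id_take_nth_drop[of m "is"]) auto
   then show ?case using perm_invD[OF Cons.prems] by metis
  qed (use m in \<open>auto simp: min_def nth_append\<close>)
  finally show "(\<Sum>is | length is = Suc ?k. if is ! m = j then ?F (take m is @ drop (Suc m) is) * Y is else 0) =
   (\<Sum>is | length is = ?k. ?F is * Y (j # is))" .
 qed
 also have "\<dots> = fact (Suc ?k) * Y (j # js)"
  using Cons.IH[OF Y'] by (simp add: algebra_simps)
 finally show ?case by (simp only: length_Cons)
qed

text \<open>Arbitrary coefficients \<open>b\<close> may be replaced by Taylor coefficients at the
  origin in every sum against permutation invariant weights. With monomials as weights this recovers
  the polynomial; with iterated derivatives it shows that an operator depends on its symbol
  only.\<close>

lemma taylor_perm_inv:
 assumes Y: "perm_inv Y" and k: "k \<le> K"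
 shows "(\<Sum>is\<in>multi_indices K. iter_pd is (\<lambda>\<xi>. \<Sum>js\<in>multi_indices k. b js * mon js \<xi>) 0 / fact (length is) * Y is)
  = (\<Sum>js\<in>multi_indices k. b js * Y js)"
proof -
 have "(\<Sum>is\<in>multi_indices K. iter_pd is (\<lambda>\<xi>. \<Sum>js\<in>multi_indices k. b js * mon js \<xi>) 0 / fact (length is) * Y is)
  = (\<Sum>is\<in>multi_indices K. \<Sum>js\<in>multi_indices k. b js * (iter_pd is (mon js) 0 / fact (length is) * Y is))"
  by (subst iter_pd_sum_mult[of UNIV]) (auto simp: sum_distrib_right sum_divide_distrib mult.assoc intro!: sum.cong)
 also have "\<dots> = (\<Sum>js\<in>multi_indices k. b js * (\<Sum>is\<in>multi_indices K. iter_pd is (mon js) 0 / fact (length is) * Y is))"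
  by (subst sum.swap) (simp add: sum_distrib_left)
 also have "\<dots> = (\<Sum>js\<in>multi_indices k. b js * Y js)"
 proof (intro sum.cong refl arg_cong2[of _ _ _ _ "(*)"])
  fix js :: "'a list" assume js: "js \<in> multi_indices k"
  have "(\<Sum>is\<in>multi_indices K. iter_pd is (mon js) 0 / fact (length is) * Y is)
    = (\<Sum>is | length is = length js. iter_pd is (mon js) 0 / fact (length is) * Y is)"
   by (rule sum.mono_neutral_right[OF finite_multi_indices])
    (use js k in \<open>auto simp: multi_indices_def iter_pd_mon_zero\<close>)
  also have "\<dots> = (\<Sum>is | length is = length js. iter_pd is (mon js) 0 * Y is) / fact (length js)"
   by (subst sum_divide_distrib, intro sum.cong) auto
  finally show "(\<Sum>is\<in>multi_indices K. iter_pd is (mon js) 0 / fact (length is) * Y is) = Y js"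
   using iter_pd_mon_sum[OF Y, of js] by simp
 qed
 finally show ?thesis .
qed

text \<open>Unlike these Taylor coefficients, which are determined by the symbol, there is a choice in the coefficients of \<^const>\<open>poly_symbol\<close>.\<close>

definition scoeff :: "(real ^ 'n::finite \<Rightarrow> real ^ 'n \<Rightarrow> complex) \<Rightarrow> 'n list \<Rightarrow> real ^ 'n \<Rightarrow> complex" where
 "scoeff P is x = iter_pd is (P x) 0 / fact (length is)"

lemma poly_symbol_eq: "x \<in> V \<Longrightarrow> poly_symbol V k a x = (\<lambda>\<xi>. \<Sum>is\<in>multi_indices k. a is x * mon is \<xi>)"
 by (simp add: poly_symbol_def mon_def)

lemma poly_symbol_notin: "x \<notin> V \<Longrightarrow> poly_symbol V k a x = (\<lambda>\<xi>. 0)"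
 by (simp add: poly_symbol_def)

lemma sum_scoeff:
 assumes "x \<in> V" "perm_inv Y" "k \<le> K"
 shows "(\<Sum>is\<in>multi_indices K. scoeff (poly_symbol V k a) is x * Y is) = (\<Sum>is\<in>multi_indices k. a is x * Y is)"
 using taylor_perm_inv[OF assms(2,3), of "\<lambda>is. a is x"] by (simp add: scoeff_def poly_symbol_eq[OF assms(1)])

lemma poly_symbol_scoeff:
 assumes "k \<le> K" shows "poly_symbol V K (scoeff (poly_symbol V k a)) = poly_symbol V k a"
proof (intro ext)
 fix x \<xi>
 show "poly_symbol V K (scoeff (poly_symbol V k a)) x \<xi> = poly_symbol V k a x \<xi>"
  using sum_scoeff[where a = a, OF _ perm_inv_mon assms]
  by (cases "x \<in> V") (simp_all add: poly_symbol_eq poly_symbol_notin)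
qed

lemma smooth_on_scoeff:
 assumes V: "open V" and a: "\<And>is. smooth_on V (a is)"
 shows "smooth_on V (scoeff (poly_symbol V k a) is)"
proof (rule smooth_on_congI[OF V])
 show "smooth_on V (\<lambda>x. (\<Sum>js\<in>multi_indices k. a js x * iter_pd is (mon js) 0) * inverse (fact (length is)))"
  using V a by (intro smooth_on_mult smooth_on_sum) auto
 show "scoeff (poly_symbol V k a) is x =
   (\<Sum>js\<in>multi_indices k. a js x * iter_pd is (mon js) 0) * inverse (fact (length is))" if "x \<in> V" for x
  using that by (simp add: scoeff_def poly_symbol_eq divide_inverse iter_pd_sum_mult[of UNIV])
qed

lemma diff_op_eqI:
 assumes V: "open V" and eq: "poly_symbol V k a = poly_symbol V k' a'"
 shows "diff_op V k a = diff_op V k' a'"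
proof (intro ext)
 fix f x
 show "diff_op V k a f x = diff_op V k' a' f x"
 proof (cases "f \<in> loc_fun V \<and> x \<in> V")
  case True
  then have Y: "perm_inv (\<lambda>is. iter_pd is f x)"
   using perm_inv_iter_pd[OF V] by (simp add: loc_fun_def)
  show ?thesis
   using sum_scoeff[where V = V and a = a and k = k and K = "max k k'", OF _ Y]
    sum_scoeff[where V = V and a = a' and k = k' and K = "max k k'", OF _ Y] True
   by (simp add: diff_op_def eq)
 qed (auto simp: diff_op_def)
qed

lemma loc_symbol_uptoI: "(\<And>is. smooth_on V (a is)) \<Longrightarrow> poly_symbol V k a \<in> SymU V k"
 unfolding loc_symbol_upto_def by blast

lemma SymU_cases:
 assumes "P \<in> SymU V k"
 obtains a where "\<And>is. smooth_on V (a is)" "P = poly_symbol V k a"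
 using assms unfolding loc_symbol_upto_def by auto

lemma SymU_scoeff:
 assumes "P \<in> SymU V k" "open V" "k \<le> K"
 shows "poly_symbol V K (scoeff P) = P" and "smooth_on V (scoeff P is)"
 using assms(1) by (auto elim!: SymU_cases simp: poly_symbol_scoeff[OF assms(3)] smooth_on_scoeff[OF assms(2)])

lemma SymU_mono:
 "open V \<Longrightarrow> k \<le> K \<Longrightarrow> SymU V k \<subseteq> SymU V K"
 using SymU_scoeff[of _ V k K] loc_symbol_uptoI[of V _ K] by (metis subsetI)

lemma Sym_iff: "P \<in> Sym V \<longleftrightarrow> (\<exists>k. P \<in> SymU V k)"
 by (simp add: loc_symbol_def)

lemma Sym_natE:
 assumes "P \<in> Sym V" "open V" obtains k :: nat where "P \<in> SymU V (int k)"
proof -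
 obtain k where "P \<in> SymU V k" using assms by (auto simp: Sym_iff)
 then have "P \<in> SymU V (int (nat k))"
  using SymU_mono[OF assms(2), of k "int (nat k)"] by auto
 then show ?thesis by (rule that)
qed

section \<open>Restriction to open subsets, and normal ordering as a function\<close>

definition restrict_symbol :: "(real ^ 'n::finite) set \<Rightarrow> 'n sym \<Rightarrow> 'n sym" where
 "restrict_symbol W P = (\<lambda>x \<xi>. if x \<in> W then P x \<xi> else 0)"

definition restrict_fun :: "(real ^ 'n::finite) set \<Rightarrow> (real ^ 'n \<Rightarrow> complex) \<Rightarrow> real ^ 'n \<Rightarrow> complex" where
 "restrict_fun W f = (\<lambda>x. if x \<in> W then f x else 0)"

lemma restrict_poly_symbol: "W \<subseteq> V \<Longrightarrow> restrict_symbol W (poly_symbol V k a) = poly_symbol W k a"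
 by (auto simp: restrict_symbol_def poly_symbol_def fun_eq_iff)

lemma restrict_SymU:
 "P \<in> SymU V k \<Longrightarrow> W \<subseteq> V \<Longrightarrow> restrict_symbol W P \<in> SymU W k"
 by (erule SymU_cases) (simp add: restrict_poly_symbol, rule loc_symbol_uptoI, blast intro: smooth_on_subset)

lemma restrict_Sym:
 "P \<in> Sym V \<Longrightarrow> W \<subseteq> V \<Longrightarrow> restrict_symbol W P \<in> Sym W"
 unfolding Sym_iff using restrict_SymU by blast

lemma restrict_loc_fun:
 "open W \<Longrightarrow> f \<in> loc_fun V \<Longrightarrow> W \<subseteq> V \<Longrightarrow> restrict_fun W f \<in> loc_fun W"
 unfolding loc_fun_def restrict_fun_def by (auto intro: smooth_on_congI smooth_on_subset)

text \<open>Local membership supplies different coefficients on different open sets. The Taylor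
  coefficients \<open>scoeff P\<close> are formed pointwise from \<open>P\<close>, so they agree on
  overlaps and give one smooth family on V.\<close>

lemma SymU_local:
 assumes V: "open V" and out: "\<And>x \<xi>. x \<notin> V \<Longrightarrow> P x \<xi> = 0"
  and loc: "\<And>x. x \<in> V \<Longrightarrow> \<exists>W. open W \<and> x \<in> W \<and> W \<subseteq> V \<and> restrict_symbol W P \<in> SymU W k"
 shows "P \<in> SymU V k"
proof -
 have W: "smooth_on W (scoeff P is) \<and> restrict_symbol W P = poly_symbol W k (scoeff P)"
  if W: "open W" "restrict_symbol W P \<in> SymU W k" for W "is"
 proof -
  have *: "scoeff (restrict_symbol W P) is x = scoeff P is x" if "x \<in> W" for x "is"
   using that by (simp add: scoeff_def restrict_symbol_def)
  have "poly_symbol W k (scoeff (restrict_symbol W P)) = poly_symbol W k (scoeff P)"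
   by (auto simp: fun_eq_iff poly_symbol_def *)
  moreover have "smooth_on W (scoeff P is)"
   by (rule smooth_on_congI[OF W(1) SymU_scoeff(2)[OF W(2,1) order_refl]]) (simp add: *)
  ultimately show ?thesis using SymU_scoeff(1)[OF W(2,1) order_refl] by simp
 qed
 have "smooth_on V (scoeff P is)" for "is"
  by (rule smooth_on_local) (use loc W in meson)
 moreover have "P = poly_symbol V k (scoeff P)"
 proof (intro ext)
  fix x \<xi>
  show "P x \<xi> = poly_symbol V k (scoeff P) x \<xi>"
  proof (cases "x \<in> V")
   case True
   then obtain U where U: "open U" "x \<in> U" "restrict_symbol U P \<in> SymU U k" using loc by blast
   show ?thesis
    using fun_cong[OF fun_cong[OF conjunct2[OF W[OF U(1,3)]], of x], of \<xi>] U(2) True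
    by (simp add: restrict_symbol_def poly_symbol_eq)
  qed (simp add: out poly_symbol_notin)
 qed
 ultimately show ?thesis using loc_symbol_uptoI by metis
qed

text \<open>Turns the relation \<open>normal_ordered\<close> into a function from symbols to
  operators; the description denotes because equal symbols give equal operators.\<close>

definition nop :: "(real ^ 'n::finite) set \<Rightarrow> 'n sym \<Rightarrow>
  (real ^ 'n \<Rightarrow> complex) \<Rightarrow> real ^ 'n \<Rightarrow> complex" where
 "nop V P = (THE B. normal_ordered V B P)"

lemma nop_poly_symbol:
 assumes "open V" "\<And>is. smooth_on V (a is)"
 shows "nop V (poly_symbol V k a) = diff_op V k a"
 unfolding nop_def normal_ordered_def
 by (rule the_equality) (use assms diff_op_eqI[OF assms(1)] in metis)+

lemma normal_ordered_iff:
 assumes "open V" shows "normal_ordered V B P \<longleftrightarrow> P \<in> Sym V \<and> B = nop V P"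
proof
 assume "normal_ordered V B P"
 then show "P \<in> Sym V \<and> B = nop V P"
  by (auto simp: normal_ordered_def nop_poly_symbol[OF assms] Sym_iff intro: loc_symbol_uptoI)
next
 assume "P \<in> Sym V \<and> B = nop V P"
 then show "normal_ordered V B P"
  unfolding normal_ordered_def Sym_iff by (metis SymU_cases nop_poly_symbol[OF assms])
qed

lemma nop_apply:
 assumes "open V" "P \<in> SymU V k" "k \<le> K"
 shows "nop V P f x = (if f \<in> loc_fun V \<and> x \<in> V then \<Sum>is\<in>multi_indices K. scoeff P is x * iter_pd is f x else 0)"
 using nop_poly_symbol[where a = "scoeff P" and k = K, OF assms(1) SymU_scoeff(2)[OF assms(2,1,3)]]
 by (simp add: SymU_scoeff(1)[OF assms(2,1,3)] diff_op_def)

section \<open>Recovering a symbol from its operator by testing on exponentials\<close>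

definition exp_fun :: "(real ^ 'n::finite) set \<Rightarrow> real ^ 'n \<Rightarrow> real ^ 'n \<Rightarrow> complex" where
 "exp_fun V \<xi> = (\<lambda>x. if x \<in> V then cr (exp (\<xi> \<bullet> x)) else 0)"

lemma smooth_on_exp_inner: "smooth_on UNIV (\<lambda>x. cr (exp (\<xi> \<bullet> x)))"
 by (intro smooth_on_of_real smooth_on_exp smooth_on_linear bounded_linear_inner_right) auto

lemma exp_fun_loc_fun: "open V \<Longrightarrow> exp_fun V \<xi> \<in> loc_fun V"
 unfolding loc_fun_def exp_fun_def
 by (auto intro!: smooth_on_congI[OF _ smooth_on_subset[OF smooth_on_exp_inner[of \<xi>]]])

lemma iter_pd_exp_fun:
 assumes "open V" "x \<in> V" shows "iter_pd is (exp_fun V \<xi>) x = mon is \<xi> * cr (exp (\<xi> \<bullet> x))"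
 using assms(2)
proof (induction "is" arbitrary: x)
 case (Cons i "is")
 have "iter_pd (i # is) (exp_fun V \<xi>) x = pd i (\<lambda>x. mon is \<xi> * cr (exp (\<xi> \<bullet> x))) x"
  using Cons by (auto intro!: pd_cong_open[OF assms(1)])
 also have "\<dots> = mon is \<xi> * pd i (\<lambda>x. cr (exp (\<xi> \<bullet> x))) x"
  using smooth_on_differentiable[OF smooth_on_exp_inner] by (intro pd_bounded_linear[OF bounded_linear_mult_right]) auto
 also have "pd i (\<lambda>x. cr (exp (\<xi> \<bullet> x))) x = cr (pd i (\<lambda>x. exp (\<xi> \<bullet> x)) x)"
  by (intro pd_bounded_linear[OF bounded_linear_of_real] smooth_on_differentiable[of UNIV] smooth_on_exp
    smooth_on_linear bounded_linear_inner_right) auto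
 also have "pd i (\<lambda>x. exp (\<xi> \<bullet> x)) x = exp (\<xi> \<bullet> x) * pd i (\<lambda>x. \<xi> \<bullet> x) x"
  by (intro pd_real_compose DERIV_exp bounded_linear_imp_differentiable bounded_linear_inner_right)
 also have "pd i (\<lambda>x. \<xi> \<bullet> x) x = \<xi> $ i"
  using pd_eqI[OF bounded_linear.has_derivative[OF bounded_linear_inner_right has_derivative_ident], of i \<xi> x]
  by (simp add: inner_axis)
 finally show ?case by (simp add: mult_ac)
qed (simp add: exp_fun_def)

text \<open>Conjugating an operator by the exponential of \<xi> \<bullet> x replaces each partial
  derivative by multiplication with a fibre coordinate. On differential operators this inverts
  \<open>nop V\<close>.\<close>

definition full_symbol :: "(real ^ 'n::finite) set \<Rightarrow> ((real ^ 'n \<Rightarrow> complex) \<Rightarrow> real ^ 'n \<Rightarrow> complex) \<Rightarrow>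
  'n sym" where
 "full_symbol V B = (\<lambda>x \<xi>. if x \<in> V then B (exp_fun V \<xi>) x * cr (exp (- (\<xi> \<bullet> x))) else 0)"

lemma full_symbol_diff_op:
 assumes V: "open V" shows "full_symbol V (diff_op V k a) = poly_symbol V k a"
proof (intro ext)
 fix x \<xi> :: "real ^ 'a"
 have "cr (exp (\<xi> \<bullet> x)) * cr (exp (- (\<xi> \<bullet> x))) = 1"
  by (metis exp_minus_inverse of_real_1 of_real_mult)
 then show "full_symbol V (diff_op V k a) x \<xi> = poly_symbol V k a x \<xi>"
  by (simp add: full_symbol_def diff_op_def exp_fun_loc_fun[OF V] iter_pd_exp_fun[OF V] sum_distrib_right
    mult.assoc poly_symbol_def mon_def)
qed

lemma full_symbol_nop: "open V \<Longrightarrow> P \<in> Sym V \<Longrightarrow> full_symbol V (nop V P) = P"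
 by (auto simp: Sym_iff full_symbol_diff_op nop_poly_symbol elim!: SymU_cases)

lemma full_symbol_loc_op_upto: "open V \<Longrightarrow> B \<in> loc_op_upto V k \<Longrightarrow> full_symbol V B \<in> SymU V k"
 unfolding loc_op_upto_def by (auto simp: full_symbol_diff_op intro!: loc_symbol_uptoI)

lemma nop_loc_op_upto: "open V \<Longrightarrow> P \<in> SymU V k \<Longrightarrow> nop V P \<in> loc_op_upto V k"
 by (auto simp: loc_op_upto_def nop_poly_symbol elim!: SymU_cases)

lemma nop_full_symbol: "open V \<Longrightarrow> B \<in> loc_op_upto V k \<Longrightarrow> nop V (full_symbol V B) = B"
 unfolding loc_op_upto_def by (auto simp: full_symbol_diff_op nop_poly_symbol)

lemma bij_betw_nop: assumes "open V" shows "bij_betw (nop V) (Sym V) (loc_op V)"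
proof (rule bij_betwI[where g = "full_symbol V"])
 show "nop V \<in> Sym V \<rightarrow> loc_op V"
  unfolding loc_op_def loc_symbol_def using nop_loc_op_upto[OF assms] by blast
 show "full_symbol V \<in> loc_op V \<rightarrow> Sym V"
  unfolding loc_op_def loc_symbol_def using full_symbol_loc_op_upto[OF assms] by blast
qed (auto simp: full_symbol_nop[OF assms] nop_full_symbol[OF assms] loc_op_def)

lemma nop_inject:
 "open V \<Longrightarrow> P \<in> Sym V \<Longrightarrow> P' \<in> Sym V \<Longrightarrow> nop V P = nop V P' \<longleftrightarrow> P = P'"
 by (metis full_symbol_nop)

text \<open>The Taylor coefficients and the derivatives at a point of W are determined by the data
  on W.\<close>

lemma nop_restrict:
 assumes V: "open V" "open W" "W \<subseteq> V" and P: "P \<in> Sym V" and f: "f \<in> loc_fun V" and x: "x \<in> W"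
 shows "nop W (restrict_symbol W P) (restrict_fun W f) x = nop V P f x"
proof -
 obtain k where k: "P \<in> SymU V k" using P by (auto simp: Sym_iff)
 have "scoeff (restrict_symbol W P) is x = scoeff P is x" for "is"
  using x by (simp add: scoeff_def restrict_symbol_def)
 moreover have "iter_pd is (restrict_fun W f) x = iter_pd is f x" for "is"
  by (rule iter_pd_cong_open[OF V(2) x]) (simp add: restrict_fun_def)
 ultimately show ?thesis
  using nop_apply[OF V(2) restrict_SymU[OF k V(3)] order_refl] nop_apply[OF V(1) k order_refl]
   restrict_loc_fun[OF V(2) f V(3)] f x V(3) by auto
qed

subsection \<open>Symbols as sums of monomials\<close>

definition mono_symbol :: "(real ^ 'n::finite) set \<Rightarrow> (real ^ 'n \<Rightarrow> complex) \<Rightarrow> 'n list \<Rightarrow> 'n sym" where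
 "mono_symbol V u is = (\<lambda>x \<xi>. if x \<in> V then u x * mon is \<xi> else 0)"

lemma mono_symbol_poly: 
 assumes "int (length is) \<le> k"
 shows "mono_symbol V u is = poly_symbol V k (\<lambda>js. if js = is then u else (\<lambda>x. 0))"
proof (intro ext)
 fix x \<xi>
 have "(\<Sum>js\<in>multi_indices k. (if js = is then u else (\<lambda>x. 0)) x * mon js \<xi>) =
   (\<Sum>js\<in>multi_indices k. if js = is then u x * mon js \<xi> else 0)"
  by (intro sum.cong) auto
 then show "mono_symbol V u is x \<xi> = poly_symbol V k (\<lambda>js. if js = is then u else (\<lambda>x. 0)) x \<xi>"
  using assms by (cases "x \<in> V")
   (simp_all add: mono_symbol_def poly_symbol_eq poly_symbol_notin, simp add: multi_indices_def)
qed

lemma mono_symbol_upto [intro]: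
 "int (length is) \<le> k \<Longrightarrow> smooth_on V u \<Longrightarrow> mono_symbol V u is \<in> SymU V k"
 unfolding mono_symbol_poly by (rule loc_symbol_uptoI) auto

lemma mono_symbol_loc [intro]: "smooth_on V u \<Longrightarrow> mono_symbol V u is \<in> Sym V"
 unfolding Sym_iff by blast

lemma zero_SymU [intro, simp]: "(\<lambda>x \<xi>. 0) \<in> SymU V k"
proof -
 have "poly_symbol V k (\<lambda>is x. 0) = (\<lambda>x \<xi>. 0)" by (simp add: poly_symbol_def fun_eq_iff)
 then show ?thesis using loc_symbol_uptoI[of V "\<lambda>is x. 0" k] by simp
qed

lemma zero_Sym [intro, simp]: "(\<lambda>x \<xi>. 0) \<in> Sym V"
 unfolding Sym_iff by blast

lemma poly_symbol_lin:
 "(\<lambda>x \<xi>. a * poly_symbol V k b x \<xi> + c * poly_symbol V k d x \<xi>) = poly_symbol V k (\<lambda>is x. a * b is x + c * d is x)"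
 by (auto simp: fun_eq_iff poly_symbol_def sum_distrib_left sum.distrib algebra_simps)

lemma SymU_lin:
 assumes "open V" "P \<in> SymU V k" "P' \<in> SymU V k"
 shows "(\<lambda>x \<xi>. a * P x \<xi> + b * P' x \<xi>) \<in> SymU V k"
proof -
 obtain c d where *: "\<And>is. smooth_on V (c is)" "\<And>is. smooth_on V (d is)" "P = poly_symbol V k c" "P' = poly_symbol V k d"
  using assms unfolding loc_symbol_upto_def by auto
 show ?thesis unfolding * poly_symbol_lin by (rule loc_symbol_uptoI) (use * assms(1) in auto)
qed

lemma SymU_add:
 "open V \<Longrightarrow> P \<in> SymU V k \<Longrightarrow> P' \<in> SymU V k \<Longrightarrow> (\<lambda>x \<xi>. P x \<xi> + P' x \<xi>) \<in> SymU V k"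
 using SymU_lin[of V P k P' 1 1] by simp

lemma SymU_diff:
 "open V \<Longrightarrow> P \<in> SymU V k \<Longrightarrow> P' \<in> SymU V k \<Longrightarrow> (\<lambda>x \<xi>. P x \<xi> - P' x \<xi>) \<in> SymU V k"
 using SymU_lin[of V P k P' 1 "-1"] by simp

lemma SymU_scale:
 "open V \<Longrightarrow> P \<in> SymU V k \<Longrightarrow> (\<lambda>x \<xi>. c * P x \<xi>) \<in> SymU V k"
 using SymU_lin[of V P k P c 0] by simp

lemma Sym_common:
 assumes "open V" "P \<in> Sym V" "P' \<in> Sym V"
 obtains k :: nat where "P \<in> SymU V (int k)" "P' \<in> SymU V (int k)"
proof -
 obtain k k' :: nat where "P \<in> SymU V (int k)" "P' \<in> SymU V (int k')"
  using assms Sym_natE by metis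
 then show ?thesis
  using SymU_mono[OF assms(1), of "int k" "int (max k k')"]
   SymU_mono[OF assms(1), of "int k'" "int (max k k')"] that[of "max k k'"] by auto
qed

lemma Sym_lin:
 assumes "open V" "P \<in> Sym V" "P' \<in> Sym V"
 shows "(\<lambda>x \<xi>. a * P x \<xi> + b * P' x \<xi>) \<in> Sym V"
 by (rule Sym_common[OF assms]) (use SymU_lin[OF assms(1)] in \<open>unfold Sym_iff, blast\<close>)

lemma Sym_add:
 "open V \<Longrightarrow> P \<in> Sym V \<Longrightarrow> P' \<in> Sym V \<Longrightarrow> (\<lambda>x \<xi>. P x \<xi> + P' x \<xi>) \<in> Sym V"
 using Sym_lin[of V P P' 1 1] by simp

lemma Sym_scale: "open V \<Longrightarrow> P \<in> Sym V \<Longrightarrow> (\<lambda>x \<xi>. c * P x \<xi>) \<in> Sym V"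
 using Sym_lin[of V P P c 0] by simp

lemma SymU_sum:
 assumes V: "open V" and "\<And>a. a \<in> I \<Longrightarrow> P a \<in> SymU V k"
 shows "(\<lambda>x \<xi>. \<Sum>a\<in>I. P a x \<xi>) \<in> SymU V k"
 using assms(2) by (induction I rule: infinite_finite_induct) (auto intro: SymU_add[OF V])

lemma nop_lin:
 assumes V: "open V" and P: "P \<in> Sym V" "P' \<in> Sym V"
 shows "nop V (\<lambda>x \<xi>. a * P x \<xi> + b * P' x \<xi>) f x = a * nop V P f x + b * nop V P' f x"
proof -
 obtain k :: nat where "P \<in> SymU V (int k)" "P' \<in> SymU V (int k)"
  using Sym_common[OF assms] .
 then obtain c d where *: "\<And>is. smooth_on V (c is)" "\<And>is. smooth_on V (d is)"
   "P = poly_symbol V k c" "P' = poly_symbol V k d"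
  unfolding loc_symbol_upto_def by auto
 have s: "smooth_on V (\<lambda>x. a * c is x + b * d is x)" for "is" using * V by auto
 show ?thesis unfolding * poly_symbol_lin nop_poly_symbol[OF V s] nop_poly_symbol[OF V *(1)] nop_poly_symbol[OF V *(2)]
  by (auto simp: diff_op_def sum_distrib_left sum.distrib algebra_simps)
qed

lemma nop_add:
 assumes "open V" "P \<in> Sym V" "P' \<in> Sym V"
 shows "nop V (\<lambda>x \<xi>. P x \<xi> + P' x \<xi>) f x = nop V P f x + nop V P' f x"
 using nop_lin[OF assms, of 1 1] by simp

lemma nop_zero [simp]: "open V \<Longrightarrow> nop V (\<lambda>x \<xi>. 0) = (\<lambda>f x. 0)"
 using nop_lin[of V "\<lambda>x \<xi>. 0" "\<lambda>x \<xi>. 0" 0 0] by (simp add: fun_eq_iff)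

lemma nop_mono:
 assumes "open V" "smooth_on V u" "f \<in> loc_fun V" "x \<in> V"
 shows "nop V (mono_symbol V u is) f x = u x * iter_pd is f x"
proof -
 have "nop V (mono_symbol V u is) = diff_op V (int (length is)) (\<lambda>js. if js = is then u else (\<lambda>x. 0))"
  unfolding mono_symbol_poly[OF order_refl] using assms by (intro nop_poly_symbol) auto
 moreover have "(\<Sum>js\<in>multi_indices (int (length is)). (if js = is then u else (\<lambda>x. 0)) x * iter_pd js f x) =
   (\<Sum>js\<in>multi_indices (int (length is)). if js = is then u x * iter_pd js f x else 0)"
  by (intro sum.cong) auto
 moreover have "is \<in> multi_indices (int (length is))" by (simp add: multi_indices_def)
 ultimately show ?thesis using assms by (simp add: diff_op_def)
qed

lemma nop_notin: "open V \<Longrightarrow> P \<in> Sym V \<Longrightarrow> f \<notin> loc_fun V \<or> x \<notin> V \<Longrightarrow> nop V P f x = 0"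
 using nop_apply[OF _ _ order_refl] by (fastforce simp: Sym_iff)

lemma nop_loc_fun:
 assumes "open V" "P \<in> Sym V" "f \<in> loc_fun V" shows "nop V P f \<in> loc_fun V"
proof -
 obtain k where k: "P \<in> SymU V k" using assms by (auto simp: Sym_iff)
 have f: "smooth_on V f" using assms by (simp add: loc_fun_def)
 have "smooth_on V (\<lambda>x. \<Sum>is\<in>multi_indices k. scoeff P is x * iter_pd is f x)"
  using assms(1) SymU_scoeff(2)[OF k assms(1) order_refl] f by (intro smooth_on_sum smooth_on_mult) auto
 then have "smooth_on V (nop V P f)"
  by (rule smooth_on_congI[OF assms(1)]) (simp add: nop_apply[OF assms(1) k order_refl] assms(3))
 then show ?thesis using nop_notin[OF assms(1,2)] by (simp add: loc_fun_def)
qed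

text \<open>Every symbol is a finite sum of monomials \<open>u x * mon is \<xi>\<close>, so an
  additive statement has to be checked on these only. Most identities between operations on symbols
  are proved in this way.\<close>

lemma SymU_induct [consumes 2, case_names zero mono add]:
 assumes "P \<in> SymU V k" "open V"
  and zero: "\<Phi> (\<lambda>x \<xi>. 0)"
  and mono: "\<And>u is. smooth_on V u \<Longrightarrow> int (length is) \<le> k \<Longrightarrow> \<Phi> (mono_symbol V u is)"
  and add: "\<And>P Q. P \<in> SymU V k \<Longrightarrow> Q \<in> SymU V k \<Longrightarrow> \<Phi> P \<Longrightarrow> \<Phi> Q \<Longrightarrow> \<Phi> (\<lambda>x \<xi>. P x \<xi> + Q x \<xi>)"
 shows "\<Phi> P"
proof -
 obtain a where a: "\<And>is. smooth_on V (a is)" "P = poly_symbol V k a"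
  using assms(1) unfolding loc_symbol_upto_def by auto
 have "\<Phi> (\<lambda>x \<xi>. \<Sum>is\<in>F. mono_symbol V (a is) is x \<xi>) \<and> (\<lambda>x \<xi>. \<Sum>is\<in>F. mono_symbol V (a is) is x \<xi>) \<in> SymU V k"
  if "finite F" "F \<subseteq> multi_indices k" for F
  using that
 proof (induction F)
  case (insert "is" F)
  then have l: "int (length is) \<le> k" by (auto simp: multi_indices_def)
  show ?case using insert SymU_add[OF assms(2) mono_symbol_upto[OF l a(1)]]
    add[OF mono_symbol_upto[OF l a(1)] _ mono[OF a(1) l]] by auto
 qed (use zero in auto)
 from this[of "multi_indices k"] have "\<Phi> (\<lambda>x \<xi>. \<Sum>is\<in>multi_indices k. mono_symbol V (a is) is x \<xi>)" by simp
 also have "(\<lambda>x \<xi>. \<Sum>is\<in>multi_indices k. mono_symbol V (a is) is x \<xi>) = P"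
 proof (intro ext)
  fix x \<xi> show "(\<Sum>is\<in>multi_indices k. mono_symbol V (a is) is x \<xi>) = P x \<xi>"
   by (cases "x \<in> V") (simp_all add: a(2) mono_symbol_def poly_symbol_eq poly_symbol_notin)
 qed
 finally show ?thesis .
qed

lemma Sym_induct [consumes 2, case_names zero mono add]:
 assumes "P \<in> Sym V" "open V"
  and zero: "\<Phi> (\<lambda>x \<xi>. 0)"
  and mono: "\<And>u is. smooth_on V u \<Longrightarrow> \<Phi> (mono_symbol V u is)"
  and add: "\<And>P Q. P \<in> Sym V \<Longrightarrow> Q \<in> Sym V \<Longrightarrow> \<Phi> P \<Longrightarrow> \<Phi> Q \<Longrightarrow> \<Phi> (\<lambda>x \<xi>. P x \<xi> + Q x \<xi>)"
 shows "\<Phi> P"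
proof -
 obtain k where "P \<in> SymU V k" using assms by (auto simp: Sym_iff)
 then show ?thesis using assms(2)
  by (induction rule: SymU_induct) (use zero mono add in \<open>simp, simp, unfold Sym_iff, blast\<close>)
qed

subsection \<open>The Weyl algebra acting on symbols\<close>

definition mult_x :: "'n::finite \<Rightarrow> 'n sym \<Rightarrow> 'n sym" where
 "mult_x i P = (\<lambda>x \<xi>. cr (x $ i) * P x \<xi>)"

definition mult_xi :: "'n::finite \<Rightarrow> 'n sym \<Rightarrow> 'n sym" where
 "mult_xi i P = (\<lambda>x \<xi>. cr (\<xi> $ i) * P x \<xi>)"

definition deriv_x :: "(real ^ 'n) set \<Rightarrow> 'n::finite \<Rightarrow> 'n sym \<Rightarrow> 'n sym" where
 "deriv_x V i P = (\<lambda>x \<xi>. if x \<in> V then pd i (\<lambda>y. P y \<xi>) x else 0)"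

definition deriv_xi :: "'n::finite \<Rightarrow> 'n sym \<Rightarrow> 'n sym" where
 "deriv_xi i P = (\<lambda>x \<xi>. pd i (P x) \<xi>)"

lemma smooth_on_symbol_x:
 assumes "P \<in> Sym V" "open V" shows "smooth_on V (\<lambda>y. P y \<xi>)"
 using assms
proof (induction rule: Sym_induct)
 case (mono u "is")
 show ?case
  by (rule smooth_on_congI[OF assms(2), of "\<lambda>y. u y * mon is \<xi>"]) (use assms mono in \<open>auto simp: mono_symbol_def\<close>)
qed (use assms in auto)

lemma smooth_on_symbol_xi:
 assumes "P \<in> Sym V" "open V" shows "smooth_on UNIV (P x)"
 using assms
proof (induction rule: Sym_induct)
 case (mono u "is")
 then show ?case by (cases "x \<in> V") (auto simp: mono_symbol_def)
qed auto

lemma Sym_notin: "P \<in> Sym V \<Longrightarrow> x \<notin> V \<Longrightarrow> P x \<xi> = 0"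
 unfolding loc_symbol_def loc_symbol_upto_def by (auto simp: poly_symbol_notin)

lemma deriv_x_add:
 assumes "P \<in> Sym V" "Q \<in> Sym V" "open V"
 shows "deriv_x V i (\<lambda>x \<xi>. P x \<xi> + Q x \<xi>) = (\<lambda>x \<xi>. deriv_x V i P x \<xi> + deriv_x V i Q x \<xi>)"
 unfolding deriv_x_def fun_eq_iff
 using pd_add[OF smooth_on_differentiable[OF smooth_on_symbol_x[OF assms(1,3)]]
   smooth_on_differentiable[OF smooth_on_symbol_x[OF assms(2,3)]]] by auto

lemma deriv_xi_add:
 assumes "P \<in> Sym V" "Q \<in> Sym V" "open V"
 shows "deriv_xi i (\<lambda>x \<xi>. P x \<xi> + Q x \<xi>) = (\<lambda>x \<xi>. deriv_xi i P x \<xi> + deriv_xi i Q x \<xi>)"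
 unfolding deriv_xi_def fun_eq_iff
 using pd_add[OF smooth_on_differentiable[OF smooth_on_symbol_xi[OF assms(1,3)]]
   smooth_on_differentiable[OF smooth_on_symbol_xi[OF assms(2,3)]]] by auto

lemma deriv_x_scale:
 assumes "P \<in> Sym V" "open V"
 shows "deriv_x V i (\<lambda>x \<xi>. c * P x \<xi>) = (\<lambda>x \<xi>. c * deriv_x V i P x \<xi>)"
 unfolding deriv_x_def fun_eq_iff
 using pd_bounded_linear[OF bounded_linear_mult_right smooth_on_differentiable[OF smooth_on_symbol_x[OF assms]]] by auto

lemma deriv_xi_scale:
 assumes "P \<in> Sym V" "open V"
 shows "deriv_xi i (\<lambda>x \<xi>. c * P x \<xi>) = (\<lambda>x \<xi>. c * deriv_xi i P x \<xi>)"
 unfolding deriv_xi_def fun_eq_iff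
 using pd_bounded_linear[OF bounded_linear_mult_right smooth_on_differentiable[OF smooth_on_symbol_xi[OF assms]]] by auto

lemma mult_xi_mono: "mult_xi i (mono_symbol V u is) = mono_symbol V u (i # is)"
 by (auto simp: mult_xi_def mono_symbol_def fun_eq_iff)

lemma mult_x_mono: "mult_x i (mono_symbol V u is) = mono_symbol V (\<lambda>x. cr (x $ i) * u x) is"
 by (auto simp: mult_x_def mono_symbol_def fun_eq_iff)

lemma deriv_x_mono:
 assumes "open V" "smooth_on V u"
 shows "deriv_x V i (mono_symbol V u is) = mono_symbol V (pd i u) is"
proof -
 have "pd i (\<lambda>y. mono_symbol V u is y \<xi>) x = pd i u x * mon is \<xi>" if "x \<in> V" for x \<xi>
 proof -
  have "pd i (\<lambda>y. mono_symbol V u is y \<xi>) x = pd i (\<lambda>y. u y * mon is \<xi>) x"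
   by (rule pd_cong_open[OF assms(1) that]) (simp add: mono_symbol_def)
  then show ?thesis
   using pd_bounded_linear[OF bounded_linear_mult_left smooth_on_differentiable[OF assms(2) that]] by simp
 qed
 then show ?thesis by (auto simp: deriv_x_def mono_symbol_def fun_eq_iff)
qed

lemma deriv_xi_zero [simp]: "deriv_xi i (\<lambda>x \<xi>. 0) = (\<lambda>x \<xi>. 0)"
 and deriv_x_zero [simp]: "deriv_x V i (\<lambda>x \<xi>. 0) = (\<lambda>x \<xi>. 0)"
 and mult_x_zero [simp]: "mult_x i (\<lambda>x \<xi>. 0) = (\<lambda>x \<xi>. 0)"
 and mult_xi_zero [simp]: "mult_xi i (\<lambda>x \<xi>. 0) = (\<lambda>x \<xi>. 0)"
 by (intro ext, simp add: deriv_xi_def deriv_x_def mult_x_def mult_xi_def)+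

lemma deriv_xi_mono_Nil: "deriv_xi i (mono_symbol V u []) = (\<lambda>x \<xi>. 0)"
 by (intro ext) (simp add: deriv_xi_def mono_symbol_def cong: if_cong)

lemma deriv_xi_mult_xi:
 assumes "P \<in> Sym V" "open V"
 shows "deriv_xi i (mult_xi j P) = (\<lambda>x \<xi>. mult_xi j (deriv_xi i P) x \<xi> + (if i = j then P x \<xi> else 0))"
proof (intro ext)
 fix x \<xi>
 have "pd i (\<lambda>\<xi>. cr (\<xi> $ j) * P x \<xi>) \<xi> =
   cr (\<xi> $ j) * pd i (P x) \<xi> + pd i (\<lambda>\<xi>. cr (\<xi> $ j)) \<xi> * P x \<xi>"
  by (intro pd_mult smooth_on_differentiable[of UNIV] smooth_on_symbol_xi[OF assms]) auto
 then show "deriv_xi i (mult_xi j P) x \<xi> = mult_xi j (deriv_xi i P) x \<xi> + (if i = j then P x \<xi> else 0)"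
  by (simp add: deriv_xi_def mult_xi_def)
qed

lemma mult_x_upto:
 assumes "P \<in> SymU V k" "open V" shows "mult_x i P \<in> SymU V k"
 using assms
proof (induction rule: SymU_induct)
 case (mono u "is")
 then show ?case using assms(2) by (auto simp: mult_x_mono)
next
 case (add P Q)
 then show ?case using SymU_add[OF assms(2), of "mult_x i P" k "mult_x i Q"]
  by (simp add: mult_x_def distrib_left)
qed simp

lemma mult_xi_upto:
 assumes "P \<in> SymU V k" "open V" shows "mult_xi i P \<in> SymU V (k + 1)"
 using assms
proof (induction rule: SymU_induct)
 case (mono u "is")
 then show ?case by (auto simp: mult_xi_mono)
next
 case (add P Q)
 then show ?case using SymU_add[OF assms(2), of "mult_xi i P" _ "mult_xi i Q"]
  by (simp add: mult_xi_def distrib_left)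
qed simp

lemma deriv_x_upto:
 assumes "P \<in> SymU V k" "open V" shows "deriv_x V i P \<in> SymU V k"
 using assms
proof (induction rule: SymU_induct)
 case (mono u "is")
 then show ?case using assms(2) by (auto simp: deriv_x_mono)
next
 case (add P Q)
 then show ?case using SymU_add[OF assms(2), of "deriv_x V i P" _ "deriv_x V i Q"]
  by (subst deriv_x_add[OF _ _ assms(2)]) (auto simp: Sym_iff)
qed simp

text \<open>On a monomial the induction on \<open>is\<close> uses the commutation relation
  \<open>deriv_xi_mult_xi\<close> in place of an explicit derivative. It starts at the empty list,
  where the derivative is zero and thus has order -1.\<close>

lemma deriv_xi_upto:
 assumes "P \<in> SymU V k" "open V" shows "deriv_xi i P \<in> SymU V (k - 1)"
 using assms
proof (induction rule: SymU_induct)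
 case (mono u "is")
 have "deriv_xi i (mono_symbol V u is) \<in> SymU V (int (length is) - 1)"
 proof (induction "is")
  case (Cons j "is")
  have "mult_xi j (deriv_xi i (mono_symbol V u is)) \<in> SymU V (int (length is))"
   using mult_xi_upto[OF Cons assms(2)] by simp
  then have "(\<lambda>x \<xi>. mult_xi j (deriv_xi i (mono_symbol V u is)) x \<xi> + (if i = j then mono_symbol V u is x \<xi> else 0))
    \<in> SymU V (int (length is))"
   using mono(1) by (cases "i = j") (auto intro: SymU_add[OF assms(2)])
  then show ?case
   using mono(1) by (subst mult_xi_mono[symmetric], subst deriv_xi_mult_xi[OF _ assms(2)]) auto
 qed (simp add: deriv_xi_mono_Nil)
 then show ?case using SymU_mono[OF assms(2), of "int (length is) - 1" "k - 1"] mono(2) by auto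
next
 case (add P Q)
 then show ?case using SymU_add[OF assms(2), of "deriv_xi i P" _ "deriv_xi i Q"]
  by (subst deriv_xi_add[OF _ _ assms(2)]) (auto simp: Sym_iff)
qed simp

lemma mult_x_loc: "P \<in> Sym V \<Longrightarrow> open V \<Longrightarrow> mult_x i P \<in> Sym V"
 and mult_xi_loc: "P \<in> Sym V \<Longrightarrow> open V \<Longrightarrow> mult_xi i P \<in> Sym V"
 and deriv_x_loc: "P \<in> Sym V \<Longrightarrow> open V \<Longrightarrow> deriv_x V i P \<in> Sym V"
 and deriv_xi_loc: "P \<in> Sym V \<Longrightarrow> open V \<Longrightarrow> deriv_xi i P \<in> Sym V"
 unfolding Sym_iff by (blast intro: mult_x_upto mult_xi_upto deriv_x_upto deriv_xi_upto)+

section \<open>Composing an operator with a coordinate or a partial derivative on either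
  side\<close>

definition pd_on :: "(real ^ 'n) set \<Rightarrow> 'n::finite \<Rightarrow> (real ^ 'n \<Rightarrow> complex) \<Rightarrow> real ^ 'n \<Rightarrow> complex" where
 "pd_on V i f = (\<lambda>x. if x \<in> V then pd i f x else 0)"

definition coord_mult :: "'n::finite \<Rightarrow> (real ^ 'n \<Rightarrow> complex) \<Rightarrow> real ^ 'n \<Rightarrow> complex" where
 "coord_mult i f = (\<lambda>x. cr (x $ i) * f x)"

lemma loc_fun_add: "open V \<Longrightarrow> f \<in> loc_fun V \<Longrightarrow> h \<in> loc_fun V \<Longrightarrow> (\<lambda>x. f x + h x) \<in> loc_fun V"
 and loc_fun_scale: "open V \<Longrightarrow> f \<in> loc_fun V \<Longrightarrow> (\<lambda>x. c * f x) \<in> loc_fun V"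
 and coord_mult_loc_fun: "open V \<Longrightarrow> f \<in> loc_fun V \<Longrightarrow> coord_mult i f \<in> loc_fun V"
 and zero_loc_fun: "(\<lambda>x. 0) \<in> loc_fun V"
 by (auto simp: loc_fun_def coord_mult_def)

lemma pd_on_loc_fun: "open V \<Longrightarrow> f \<in> loc_fun V \<Longrightarrow> pd_on V i f \<in> loc_fun V"
 unfolding loc_fun_def pd_on_def using smooth_on_congI[of V "pd i f" "\<lambda>x. if x \<in> V then pd i f x else 0"] by auto

lemma nop_arg_lin:
 assumes V: "open V" and P: "P \<in> Sym V" and f: "f \<in> loc_fun V" "h \<in> loc_fun V"
 shows "nop V P (\<lambda>x. a * f x + b * h x) x = a * nop V P f x + b * nop V P h x"
proof (cases "x \<in> V")
 case True
 have fh: "(\<lambda>x. a * f x + b * h x) \<in> loc_fun V" using V f by (intro loc_fun_add loc_fun_scale)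
 have it: "iter_pd is (\<lambda>x. a * f x + b * h x) x = a * iter_pd is f x + b * iter_pd is h x" for "is"
  using iter_pd_sum_mult[OF V True, of "UNIV :: bool set" "\<lambda>t. if t then f else h" "is" "\<lambda>t. if t then a else b"] f
  by (simp add: UNIV_bool loc_fun_def add.commute)
 obtain k where k: "P \<in> SymU V k" using P by (auto simp: Sym_iff)
 show ?thesis using f fh True
  by (simp add: nop_apply[OF V k order_refl] it sum_distrib_left sum.distrib algebra_simps)
qed (simp add: nop_notin[OF V P])

text \<open>A derivative applied after the operator either differentiates a coefficient or adds a
  factor \<xi>.\<close>

lemma nop_pd_left:
 assumes V: "open V" and P: "P \<in> Sym V" and f: "f \<in> loc_fun V"
 shows "nop V (\<lambda>x \<xi>. deriv_x V i P x \<xi> + mult_xi i P x \<xi>) f = pd_on V i (nop V P f)"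
proof
 fix x
 show "nop V (\<lambda>x \<xi>. deriv_x V i P x \<xi> + mult_xi i P x \<xi>) f x = pd_on V i (nop V P f) x"
 proof (cases "x \<in> V")
  case True
  have f': "smooth_on V f" using f by (simp add: loc_fun_def)
  have sm: "smooth_on V (nop V P f)" if "P \<in> Sym V" for P
   using nop_loc_fun[OF V that f] by (simp add: loc_fun_def)
  have "nop V (\<lambda>x \<xi>. deriv_x V i P x \<xi> + mult_xi i P x \<xi>) f x = pd i (nop V P f) x"
   using P V
  proof (induction rule: Sym_induct)
   case zero
   then show ?case using V by simp
  next
   case (mono u "is")
   have "pd i (nop V (mono_symbol V u is) f) x = pd i (\<lambda>x. u x * iter_pd is f x) x"
    by (rule pd_cong_open[OF V True]) (simp add: nop_mono[OF V mono f])
   also have "\<dots> = u x * pd i (iter_pd is f) x + pd i u x * iter_pd is f x"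
    using mono True f' by (intro pd_mult smooth_on_differentiable[of V]) auto
   finally show ?case
    using mono True f' nop_mono[OF V _ f True]
    by (subst nop_add[OF V]) (auto simp: deriv_x_mono[OF V mono] mult_xi_mono V)
  next
   case (add P Q)
   have "nop V (\<lambda>x \<xi>. P x \<xi> + Q x \<xi>) f = (\<lambda>x. nop V P f x + nop V Q f x)"
    using nop_add[OF V add(1,2)] by auto
   then have "pd i (nop V (\<lambda>x \<xi>. P x \<xi> + Q x \<xi>) f) x = pd i (nop V P f) x + pd i (nop V Q f) x"
    using smooth_on_differentiable[OF sm True] add by (simp add: pd_add)
   also have "\<dots> = nop V (\<lambda>x \<xi>. (deriv_x V i P x \<xi> + mult_xi i P x \<xi>) + (deriv_x V i Q x \<xi> + mult_xi i Q x \<xi>)) f x"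
    using add V by (subst nop_add[OF V]) (auto intro!: Sym_add deriv_x_loc mult_xi_loc)
   also have "(\<lambda>x \<xi>. (deriv_x V i P x \<xi> + mult_xi i P x \<xi>) + (deriv_x V i Q x \<xi> + mult_xi i Q x \<xi>)) =
     (\<lambda>x \<xi>. deriv_x V i (\<lambda>x \<xi>. P x \<xi> + Q x \<xi>) x \<xi> + mult_xi i (\<lambda>x \<xi>. P x \<xi> + Q x \<xi>) x \<xi>)"
    using add V by (simp add: deriv_x_add mult_xi_def algebra_simps)
   finally show ?case by simp
  qed
  then show ?thesis using True by (simp add: pd_on_def)
 next
  case False
  then show ?thesis using V P by (simp add: pd_on_def nop_notin Sym_add deriv_x_loc mult_xi_loc)
 qed
qed

lemma nop_mult_left:
 assumes V: "open V" and P: "P \<in> Sym V" and f: "f \<in> loc_fun V"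
 shows "nop V (mult_x i P) f = coord_mult i (nop V P f)"
proof
 fix x
 obtain k where k: "P \<in> SymU V k" using P by (auto simp: Sym_iff)
 obtain a where a: "\<And>is. smooth_on V (a is)" "P = poly_symbol V k a" using k unfolding loc_symbol_upto_def by auto
 have "mult_x i P = poly_symbol V k (\<lambda>is x. cr (x $ i) * a is x)"
  by (auto simp: a(2) mult_x_def poly_symbol_def fun_eq_iff sum_distrib_left mult.assoc)
 then have "nop V (mult_x i P) = diff_op V k (\<lambda>is x. cr (x $ i) * a is x)"
  using a(1) V by (simp only:) (intro nop_poly_symbol, auto)
 moreover have "nop V P = diff_op V k a" unfolding a(2) by (rule nop_poly_symbol[OF V a(1)])
 ultimately show "nop V (mult_x i P) f x = coord_mult i (nop V P f) x"
  by (simp add: diff_op_def coord_mult_def sum_distrib_left mult.assoc)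
qed

lemma nop_pd_right:
 assumes V: "open V" and P: "P \<in> Sym V" and f: "f \<in> loc_fun V"
 shows "nop V (mult_xi i P) f = nop V P (pd_on V i f)"
proof
 fix x
 have pf: "pd_on V i f \<in> loc_fun V" by (rule pd_on_loc_fun[OF V f])
 show "nop V (mult_xi i P) f x = nop V P (pd_on V i f) x"
 proof (cases "x \<in> V")
  case True
  show ?thesis
   using P V
  proof (induction rule: Sym_induct)
   case zero
   then show ?case using V by (simp add: mult_xi_def)
  next
   case (mono u "is")
   have app: "iter_pd (is @ [i]) f = iter_pd is (pd i f)" by (induction "is") auto
   have "iter_pd (i # is) f x = iter_pd (is @ [i]) f x"
    using perm_invD[OF perm_inv_iter_pd[OF V _ True], of f "i # is" "is @ [i]"] f by (simp add: loc_fun_def)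
   also have "\<dots> = iter_pd is (pd_on V i f) x"
    unfolding app by (rule iter_pd_cong_open[OF V True]) (simp add: pd_on_def)
   finally show ?case
    using nop_mono[OF V mono f True] nop_mono[OF V mono pf True] by (simp add: mult_xi_mono)
  next
   case (add P Q)
   have "mult_xi i (\<lambda>x \<xi>. P x \<xi> + Q x \<xi>) = (\<lambda>x \<xi>. mult_xi i P x \<xi> + mult_xi i Q x \<xi>)"
    by (simp add: mult_xi_def distrib_left)
   then show ?case using add V by (simp add: nop_add mult_xi_loc)
  qed
 qed (use V P in \<open>simp add: nop_notin mult_xi_loc\<close>)
qed

text \<open>A coordinate multiplied on before the operator acts commutes with it up to
  \<open>deriv_xi i P\<close>. The induction on \<open>is\<close> varies f: one derivative is handed
  over to f, where the product rule for \<open>coord_mult i f\<close> is elementary.\<close>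

lemma nop_mult_right:
 assumes V: "open V" and P: "P \<in> Sym V" and f: "f \<in> loc_fun V"
 shows "nop V (\<lambda>x \<xi>. mult_x i P x \<xi> + deriv_xi i P x \<xi>) f = nop V P (coord_mult i f)"
proof
 fix x
 show "nop V (\<lambda>x \<xi>. mult_x i P x \<xi> + deriv_xi i P x \<xi>) f x = nop V P (coord_mult i f) x"
  using P V f
 proof (induction arbitrary: f rule: Sym_induct)
  case zero
  then show ?case using V by (simp add: mult_x_def deriv_xi_def)
 next
  case (mono u "is")
  show ?case using mono(2)
  proof (induction "is" arbitrary: f)
   case Nil
   then show ?case
   proof (cases "x \<in> V")
    case True
    then show ?thesis using V mono Nil
     by (simp add: deriv_xi_mono_Nil mult_x_mono coord_mult_def)
      (subst nop_mono[OF V], auto simp: nop_mono coord_mult_loc_fun[unfolded coord_mult_def])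
   qed (use V mono in \<open>simp add: nop_notin Sym_add mult_x_loc deriv_xi_loc mono_symbol_loc\<close>)
  next
   case (Cons j "is")
   let ?M = "mono_symbol V u is"
   have M: "?M \<in> Sym V" using mono by auto
   have pf: "pd_on V j f \<in> loc_fun V" by (rule pd_on_loc_fun[OF V Cons.prems])
   have pc: "pd_on V j (coord_mult i f) = (\<lambda>y. 1 * coord_mult i (pd_on V j f) y + (if i = j then 1 else 0) * f y)"
   proof
    fix y
    show "pd_on V j (coord_mult i f) y = 1 * coord_mult i (pd_on V j f) y + (if i = j then 1 else 0) * f y"
    proof (cases "y \<in> V")
     case True
     have "pd j (coord_mult i f) y = cr (y $ i) * pd j f y + pd j (\<lambda>y. cr (y $ i)) y * f y"
      unfolding coord_mult_def
      by (intro pd_mult smooth_on_differentiable[of V]) (use Cons.prems True V in \<open>auto simp: loc_fun_def\<close>)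
     then show ?thesis using True by (simp add: pd_on_def coord_mult_def)
    qed (use Cons.prems in \<open>auto simp: pd_on_def coord_mult_def loc_fun_def\<close>)
   qed
   have "nop V (mono_symbol V u (j # is)) (coord_mult i f) x = nop V ?M (pd_on V j (coord_mult i f)) x"
    unfolding mult_xi_mono[symmetric] using nop_pd_right[OF V M coord_mult_loc_fun[OF V Cons.prems]] by simp
   also have "\<dots> = nop V ?M (coord_mult i (pd_on V j f)) x + (if i = j then 1 else 0) * nop V ?M f x"
    unfolding pc by (subst nop_arg_lin[OF V M coord_mult_loc_fun[OF V pf] Cons.prems]) simp
   also have "nop V ?M (coord_mult i (pd_on V j f)) x = nop V (\<lambda>x \<xi>. mult_x i ?M x \<xi> + deriv_xi i ?M x \<xi>) (pd_on V j f) x"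
    using Cons.IH[OF pf] by simp
   also have "\<dots> = nop V (mult_xi j (\<lambda>x \<xi>. mult_x i ?M x \<xi> + deriv_xi i ?M x \<xi>)) f x"
    using nop_pd_right[OF V _ Cons.prems] M V by (simp add: Sym_add mult_x_loc deriv_xi_loc)
   also have "\<dots> + (if i = j then 1 else 0) * nop V ?M f x =
     nop V (\<lambda>x \<xi>. 1 * mult_xi j (\<lambda>x \<xi>. mult_x i ?M x \<xi> + deriv_xi i ?M x \<xi>) x \<xi> + (if i = j then 1 else 0) * ?M x \<xi>) f x"
    by (subst nop_lin[OF V]) (use M V in \<open>auto intro!: Sym_add mult_xi_loc mult_x_loc deriv_xi_loc\<close>)
   also have "(\<lambda>x \<xi>. 1 * mult_xi j (\<lambda>x \<xi>. mult_x i ?M x \<xi> + deriv_xi i ?M x \<xi>) x \<xi> + (if i = j then 1 else 0) * ?M x \<xi>)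
     = (\<lambda>x \<xi>. mult_x i (mult_xi j ?M) x \<xi> + deriv_xi i (mult_xi j ?M) x \<xi>)"
    unfolding deriv_xi_mult_xi[OF M V] by (auto simp: mult_xi_def mult_x_def algebra_simps fun_eq_iff)
   finally show ?case by (simp add: mult_xi_mono)
  qed
 next
  case (add P Q)
  have "(\<lambda>x \<xi>. mult_x i (\<lambda>x \<xi>. P x \<xi> + Q x \<xi>) x \<xi> + deriv_xi i (\<lambda>x \<xi>. P x \<xi> + Q x \<xi>) x \<xi>) =
    (\<lambda>x \<xi>. (mult_x i P x \<xi> + deriv_xi i P x \<xi>) + (mult_x i Q x \<xi> + deriv_xi i Q x \<xi>))"
   unfolding deriv_xi_add[OF add(1,2) V] by (simp add: mult_x_def algebra_simps)
  then show ?case using add V by (simp add: nop_add Sym_add mult_x_loc deriv_xi_loc)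
 qed
qed

section \<open>The Casimir element in the Weyl algebra\<close>

definition br :: "'a::ring_1 \<Rightarrow> 'a \<Rightarrow> 'a" where "br a b = a * b - b * a"

lemma br_mult_left: "br (a * b) c = a * br b c + br a c * b"
 and br_mult_right: "br a (b * c) = b * br a c + br a b * c"
 and br_add_left: "br (a + b) c = br a c + br b c"
 and br_add_right: "br c (a + b) = br c a + br c b"
 and br_diff_left: "br (a - b) c = br a c - br b c"
 and br_diff_right: "br c (a - b) = br c a - br c b"
 by (simp_all add: br_def algebra_simps)

lemma br_zero_one: "br 1 a = 0" "br a 1 = 0" "br 0 a = 0" "br a 0 = 0"
 by (simp_all add: br_def)

lemma br_swap: "br a b = - br b a" by (simp add: br_def)

lemma br_scaleR_left: "br (r *\<^sub>R a) b = r *\<^sub>R br a b"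
 and br_scaleR_right: "br a (r *\<^sub>R b) = r *\<^sub>R br a b" for a b :: "'a::real_algebra_1"
 by (simp_all add: br_def algebra_simps)

lemma br_sum_left: "br (\<Sum>i\<in>I. f i) b = (\<Sum>i\<in>I. br (f i) b)"
 and br_sum_right: "br b (\<Sum>i\<in>I. f i) = (\<Sum>i\<in>I. br b (f i))"
 by (simp_all add: br_def sum_distrib_left sum_distrib_right sum_subtractf)

lemmas br_simps = br_mult_left br_mult_right br_add_left br_add_right br_diff_left br_diff_right
 br_zero_one br_scaleR_left br_scaleR_right br_sum_left br_sum_right

text \<open>With \<open>br_D2\<close> this turns a known commutator into a rewriting rule that moves
  a past b; \<open>br_D2\<close> is the form for the interior of right associated products.\<close>

lemma br_D: "br a b = c \<Longrightarrow> a * b = b * a + c" by (auto simp: br_def)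

lemma br_D2: "br a b = c \<Longrightarrow> a * (b * z) = b * (a * z) + c * z"
 by (simp add: br_def algebra_simps flip: mult.assoc)

abbreviation contr (infix "\<odot>" 75) where "contr u v \<equiv> \<Sum>i\<in>UNIV. u i * v i"

text \<open>\<open>x\<close> and \<open>xi\<close> act by multiplication by the coordinates and by the fibre coordinates, \<open>d\<close> and \<open>et\<close> by the
 respective derivatives; \<open>h\<close> is the inverse of \<open>g\<close>.\<close>

locale weyl_algebra =
 fixes x d xi et :: "'n::finite \<Rightarrow> 'a::real_algebra_1" and g h :: "real ^ 'n ^ 'n"
 assumes xx: "br (x i) (x j) = 0" and dd: "br (d i) (d j) = 0"
  and xixi: "br (xi i) (xi j) = 0" and etet: "br (et i) (et j) = 0"
  and xxi: "br (x i) (xi j) = 0" and xet: "br (x i) (et j) = 0"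
  and dxi: "br (d i) (xi j) = 0" and det: "br (d i) (et j) = 0"
  and dx: "br (d i) (x j) = (if i = j then 1 else 0)"
  and etxi: "br (et i) (xi j) = (if i = j then 1 else 0)"
  and gsym: "g $ i $ j = g $ j $ i" and hsym: "h $ i $ j = h $ j $ i"
  and gh: "(\<Sum>k\<in>UNIV. g $ i $ k * h $ k $ j) = (if i = j then 1 else 0)"
begin

definition xl where "xl i = (\<Sum>j\<in>UNIV. g $ i $ j *\<^sub>R x j)"
definition el where "el i = (\<Sum>j\<in>UNIV. g $ i $ j *\<^sub>R et j)"
definition du where "du i = (\<Sum>j\<in>UNIV. h $ i $ j *\<^sub>R d j)"
definition xiu where "xiu i = (\<Sum>j\<in>UNIV. h $ i $ j *\<^sub>R xi j)"

text \<open>The ten contractions of two of the four vectors \<open>x\<close>, \<open>d\<close>,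
  \<open>xi\<close>, \<open>et\<close>: squared length \<open>x2\<close>, Euler operators
  \<open>th\<close> in x and \<open>EE\<close> in \<xi>, metric \<open>RR\<close>, trace
  \<open>TT\<close>, gradient \<open>GG\<close>, divergence \<open>DD\<close>, Laplacian
  \<open>LL\<close>, and the mixed \<open>aa\<close> and \<open>bb\<close>. Up to additive constants
  they span a copy of sp(4) that commutes with the rotations.\<close>

definition "x2 = xl \<odot> x"
definition "th = x \<odot> d"
definition "aa = x \<odot> xi"
definition "bb = xl \<odot> et"
definition "EE = xi \<odot> et"
definition "RR = xiu \<odot> xi"
definition "TT = el \<odot> et"
definition "GG = xiu \<odot> d"
definition "DD = d \<odot> et"
definition "LL = du \<odot> d"

section \<open>Commutators of the vectors and of their contractions\<close>

lemma hg: "(\<Sum>k\<in>UNIV. h $ i $ k * g $ k $ j) = (if i = j then 1 else 0)"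
proof -
 have "(\<Sum>k\<in>UNIV. h $ i $ k * g $ k $ j) = (\<Sum>k\<in>UNIV. g $ j $ k * h $ k $ i)"
  by (intro sum.cong refl) (simp add: gsym[of _ j] hsym[of i])
 then show ?thesis using gh[of j i] by auto
qed

lemma br_basic':
 "br (xi i) (x j) = 0" "br (et i) (x j) = 0" "br (xi i) (d j) = 0" "br (et i) (d j) = 0"
 "br (x i) (d j) = - (if i = j then 1 else 0)" "br (xi i) (et j) = - (if i = j then 1 else 0)"
 using br_swap[of "xi i" "x j"] br_swap[of "et i" "x j"] br_swap[of "xi i" "d j"] br_swap[of "et i" "d j"]
  br_swap[of "x i" "d j"] br_swap[of "xi i" "et j"]
 by (simp_all add: xxi xet dxi det dx etxi)

lemmas br_basic = xx dd xixi etet xxi xet dxi det dx etxi br_basic'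

lemma sum_scaleR_if:
 fixes c :: "'n \<Rightarrow> real"
 shows "(\<Sum>i\<in>UNIV. c i *\<^sub>R (if i = j then 1 else 0)) = c j *\<^sub>R (1::'a)"
 "(\<Sum>i\<in>UNIV. c i *\<^sub>R (if j = i then 1 else 0)) = c j *\<^sub>R (1::'a)"
 by (simp_all add: if_distrib[of "scaleR _"] cong: if_cong)

lemma br_lower:
 "br (x i) (xl j) = 0" "br (xi i) (xl j) = 0" "br (et i) (xl j) = 0" "br (d i) (xl j) = g $ i $ j *\<^sub>R 1"
 "br (xl i) (x j) = 0" "br (xl i) (xi j) = 0" "br (xl i) (et j) = 0" "br (xl i) (d j) = - (g $ i $ j *\<^sub>R 1)"
 "br (x i) (el j) = 0" "br (d i) (el j) = 0" "br (et i) (el j) = 0" "br (xi i) (el j) = - (g $ i $ j *\<^sub>R 1)"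
 "br (el i) (x j) = 0" "br (el i) (d j) = 0" "br (el i) (et j) = 0" "br (el i) (xi j) = g $ i $ j *\<^sub>R 1"
 "br (xl i) (xl j) = 0" "br (el i) (el j) = 0" "br (xl i) (el j) = 0" "br (el i) (xl j) = 0"
 by (simp_all add: xl_def el_def br_simps br_basic sum_negf sum_scaleR_if gsym[of i j] cong: if_cong)

lemma br_upper:
 "br (x i) (du j) = - (h $ i $ j *\<^sub>R 1)" "br (d i) (du j) = 0" "br (xi i) (du j) = 0" "br (et i) (du j) = 0"
 "br (du i) (x j) = h $ i $ j *\<^sub>R 1" "br (du i) (d j) = 0" "br (du i) (xi j) = 0" "br (du i) (et j) = 0"
 "br (xiu i) (x j) = 0" "br (xiu i) (d j) = 0" "br (xiu i) (xi j) = 0" "br (xiu i) (et j) = - (h $ i $ j *\<^sub>R 1)"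
 "br (x i) (xiu j) = 0" "br (d i) (xiu j) = 0" "br (xi i) (xiu j) = 0" "br (et i) (xiu j) = h $ i $ j *\<^sub>R 1"
 "br (du i) (du j) = 0" "br (xiu i) (xiu j) = 0" "br (du i) (xiu j) = 0" "br (xiu i) (du j) = 0"
 by (simp_all add: du_def xiu_def br_simps br_basic sum_negf sum_scaleR_if hsym[of i j] cong: if_cong)

lemma br_mixed:
 "br (du i) (xl j) = (if i = j then 1 else 0)" "br (xl i) (du j) = - (if i = j then 1 else 0)"
 "br (el i) (xiu j) = (if i = j then 1 else 0)" "br (xiu i) (el j) = - (if i = j then 1 else 0)"
 "br (du i) (el j) = 0" "br (el i) (du j) = 0" "br (xl i) (xiu j) = 0" "br (xiu i) (xl j) = 0"
 using hg[of i j] gh[of i j] gh[of j i]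
 by (simp_all add: xl_def el_def br_simps br_upper sum_negf hsym gsym flip: scaleR_sum_left)

lemmas br_vec = br_basic br_lower br_upper br_mixed

lemma raise_lower:
 "(\<Sum>i\<in>UNIV. h $ m $ i *\<^sub>R xl i) = x m" "(\<Sum>i\<in>UNIV. h $ m $ i *\<^sub>R el i) = et m"
 "(\<Sum>i\<in>UNIV. g $ m $ i *\<^sub>R du i) = d m" "(\<Sum>i\<in>UNIV. g $ m $ i *\<^sub>R xiu i) = xi m"
proof -
 have *: "(\<Sum>i\<in>UNIV. a $ m $ i *\<^sub>R (\<Sum>j\<in>UNIV. b $ i $ j *\<^sub>R f j)) = f m"
  if "\<And>j. (\<Sum>k\<in>UNIV. a $ m $ k * b $ k $ j) = (if m = j then 1 else 0)" for a b :: "real ^ 'n ^ 'n" and f :: "'n \<Rightarrow> 'a"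
 proof -
  have "(\<Sum>i\<in>UNIV. a $ m $ i *\<^sub>R (\<Sum>j\<in>UNIV. b $ i $ j *\<^sub>R f j)) = (\<Sum>j\<in>UNIV. \<Sum>i\<in>UNIV. (a $ m $ i * b $ i $ j) *\<^sub>R f j)"
   by (subst sum.swap) (simp add: scaleR_sum_right)
  also have "\<dots> = (\<Sum>j\<in>UNIV. (if m = j then 1 else 0) *\<^sub>R f j)"
   by (simp flip: scaleR_sum_left add: that)
  also have "\<dots> = f m" by (simp add: if_distrib[of "\<lambda>t. t *\<^sub>R _"] cong: if_cong)
  finally show ?thesis .
 qed
 show "(\<Sum>i\<in>UNIV. h $ m $ i *\<^sub>R xl i) = x m" "(\<Sum>i\<in>UNIV. h $ m $ i *\<^sub>R el i) = et m"
  "(\<Sum>i\<in>UNIV. g $ m $ i *\<^sub>R du i) = d m" "(\<Sum>i\<in>UNIV. g $ m $ i *\<^sub>R xiu i) = xi m"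
  unfolding xl_def el_def du_def xiu_def by (rule *, rule hg gh)+
qed

lemma raise_lower':
 "(\<Sum>i\<in>UNIV. h $ i $ m *\<^sub>R xl i) = x m" "(\<Sum>i\<in>UNIV. h $ i $ m *\<^sub>R el i) = et m"
 "(\<Sum>i\<in>UNIV. g $ i $ m *\<^sub>R du i) = d m" "(\<Sum>i\<in>UNIV. g $ i $ m *\<^sub>R xiu i) = xi m"
 "(\<Sum>i\<in>UNIV. g $ i $ m *\<^sub>R x i) = xl m" "(\<Sum>i\<in>UNIV. g $ i $ m *\<^sub>R et i) = el m"
 "(\<Sum>i\<in>UNIV. g $ m $ i *\<^sub>R x i) = xl m" "(\<Sum>i\<in>UNIV. g $ m $ i *\<^sub>R et i) = el m"
 "(\<Sum>i\<in>UNIV. h $ i $ m *\<^sub>R d i) = du m" "(\<Sum>i\<in>UNIV. h $ i $ m *\<^sub>R xi i) = xiu m"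
 "(\<Sum>i\<in>UNIV. h $ m $ i *\<^sub>R d i) = du m" "(\<Sum>i\<in>UNIV. h $ m $ i *\<^sub>R xi i) = xiu m"
 using raise_lower[of m] by (simp_all add: gsym[of _ m] hsym[of _ m] xl_def el_def du_def xiu_def)

lemmas contract = raise_lower raise_lower' sum.distrib sum_subtractf sum_negf if_distrib[of "\<lambda>t. _ * t"]
 if_distrib[of "\<lambda>t. t * _"] if_distrib[of uminus]

lemma br_x2: "br x2 (x m) = 0" "br x2 (d m) = - (xl m + xl m)" "br x2 (xi m) = 0" "br x2 (et m) = 0"
 "br x2 (xl m) = 0" "br x2 (el m) = 0"
 by (simp_all add: x2_def br_simps br_vec contract cong: if_cong)

lemma br_th: "br th (x m) = x m" "br th (d m) = - d m" "br th (xi m) = 0" "br th (et m) = 0"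
 "br th (xl m) = xl m" "br th (el m) = 0" "br th (du m) = - du m" "br th (xiu m) = 0"
 by (simp_all add: th_def br_simps br_vec contract cong: if_cong)

lemma br_aa: "br aa (x m) = 0" "br aa (d m) = - xi m" "br aa (xi m) = 0" "br aa (et m) = - x m"
 "br aa (xl m) = 0" "br aa (el m) = - xl m" "br aa (du m) = - xiu m"
 by (simp_all add: aa_def br_simps br_vec contract cong: if_cong)

lemma br_bb: "br bb (x m) = 0" "br bb (d m) = - el m" "br bb (xi m) = xl m" "br bb (et m) = 0"
 "br bb (xl m) = 0" "br bb (el m) = 0" "br bb (du m) = - et m" "br bb (xiu m) = x m"
 by (simp_all add: bb_def br_simps br_vec contract cong: if_cong)

lemma br_EE: "br EE (x m) = 0" "br EE (d m) = 0" "br EE (xi m) = xi m" "br EE (et m) = - et m"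
 "br EE (xl m) = 0" "br EE (el m) = - el m" "br EE (xiu m) = xiu m" "br EE (du m) = 0"
 by (simp_all add: EE_def br_simps br_vec contract cong: if_cong)

lemma br_RR: "br RR (x m) = 0" "br RR (d m) = 0" "br RR (xi m) = 0" "br RR (et m) = - (xiu m + xiu m)"
 "br RR (xl m) = 0" "br RR (el m) = - (xi m + xi m)"
 by (simp_all add: RR_def br_simps br_vec contract cong: if_cong)

lemma br_TT: "br TT (x m) = 0" "br TT (d m) = 0" "br TT (xi m) = el m + el m" "br TT (et m) = 0"
 "br TT (xl m) = 0" "br TT (el m) = 0" "br TT (xiu m) = et m + et m" "br TT (du m) = 0"
 by (simp_all add: TT_def br_simps br_vec contract cong: if_cong)

lemma br_GG: "br GG (x m) = xiu m" "br GG (d m) = 0" "br GG (xi m) = 0" "br GG (et m) = - du m"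
 "br GG (xl m) = xi m" "br GG (el m) = - d m"
 by (simp_all add: GG_def br_simps br_vec contract cong: if_cong)

lemma br_DD: "br DD (x m) = et m" "br DD (d m) = 0" "br DD (xi m) = d m" "br DD (et m) = 0"
 "br DD (xl m) = el m" "br DD (el m) = 0"
 by (simp_all add: DD_def br_simps br_vec contract cong: if_cong)

lemmas br_comp_vec = br_x2 br_th br_aa br_bb br_EE br_RR br_TT br_GG br_DD

lemma sums_comp:
 "xi \<odot> et = EE" "x \<odot> d = th" "xl \<odot> x = x2"
 "x \<odot> xi = aa" "xl \<odot> et = bb" "xiu \<odot> xi = RR"
 "el \<odot> et = TT" "xiu \<odot> d = GG" "d \<odot> et = DD"
 "du \<odot> d = LL"
 by (simp_all add: EE_def th_def x2_def aa_def bb_def RR_def TT_def GG_def DD_def LL_def)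

lemma contract_swap:
 "(\<Sum>i\<in>UNIV. (\<Sum>j\<in>UNIV. a $ i $ j *\<^sub>R u j) * v i) = (\<Sum>i\<in>UNIV. u i * (\<Sum>j\<in>UNIV. a $ j $ i *\<^sub>R v j))"
 for u v :: "'n \<Rightarrow> 'a" and a :: "real ^ 'n ^ 'n"
 by (simp add: sum_distrib_left sum_distrib_right) (subst sum.swap, simp)

lemma sums_comp':
 "x \<odot> xl = x2" "xl \<odot> du = th" "xl \<odot> xiu = aa"
 "x \<odot> el = bb" "xiu \<odot> el = EE" "xi \<odot> xiu = RR"
 "et \<odot> el = TT" "xi \<odot> du = GG" "du \<odot> el = DD"
 "d \<odot> du = LL"
proof -
 have hs: "h $ i $ j = h $ j $ i" "g $ i $ j = g $ j $ i" for i j by (rule hsym, rule gsym)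
 have c: "(\<Sum>i\<in>UNIV. (\<Sum>j\<in>UNIV. h $ i $ j *\<^sub>R u j) * v i) = (\<Sum>i\<in>UNIV. u i * (\<Sum>j\<in>UNIV. h $ i $ j *\<^sub>R v j))"
  "(\<Sum>i\<in>UNIV. (\<Sum>j\<in>UNIV. g $ i $ j *\<^sub>R u j) * v i) = (\<Sum>i\<in>UNIV. u i * (\<Sum>j\<in>UNIV. g $ i $ j *\<^sub>R v j))"
  for u v :: "'n \<Rightarrow> 'a"
  using contract_swap[of h u v] contract_swap[of g u v] by (simp_all add: hsym gsym)
 show "x \<odot> xl = x2" by (simp add: x2_def xl_def c)
 show "xi \<odot> xiu = RR" by (simp add: RR_def xiu_def c)
 show "et \<odot> el = TT" by (simp add: TT_def el_def c)
 show "d \<odot> du = LL" by (simp add: LL_def du_def c)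
 show "xi \<odot> du = GG" by (simp add: GG_def xiu_def c du_def)
 show "x \<odot> el = bb" by (simp add: bb_def el_def xl_def c)
 show "xl \<odot> du = th" by (simp add: th_def xl_def c raise_lower)
 show "xl \<odot> xiu = aa" by (simp add: aa_def xl_def c raise_lower)
 show "xiu \<odot> el = EE" by (simp add: EE_def xiu_def c raise_lower)
 show "du \<odot> el = DD" by (simp add: DD_def du_def c raise_lower)
qed

lemma et_xi: "et i * xi i = xi i * et i + 1" "el i * xiu i = xiu i * el i + 1" "d i * x i = x i * d i + 1"
 "du i * xl i = xl i * du i + 1"
 using br_D[OF etxi, of i i] br_D[OF br_mixed(3), of i i] br_D[OF dx, of i i] br_D[OF br_mixed(1), of i i]
 by simp_all

lemma sums_comp'':
 "et \<odot> d = DD" "el \<odot> x = bb" "xi \<odot> x = aa"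
 "et \<odot> xi = EE + real CARD('n) *\<^sub>R 1" "d \<odot> xiu = GG"
 "d \<odot> x = th + real CARD('n) *\<^sub>R 1" "d \<odot> xi = xi \<odot> d"
 "el \<odot> du = DD" "el \<odot> xiu = EE + real CARD('n) *\<^sub>R 1"
 "du \<odot> xl = th + real CARD('n) *\<^sub>R 1" "du \<odot> xi = GG"
 "xiu \<odot> x = x \<odot> xiu" "xiu \<odot> xl = aa"
proof -
 have c: "br u v = 0 \<Longrightarrow> u * v = v * u" for u v :: 'a by (simp add: br_def)
 have one: "(\<Sum>i\<in>(UNIV :: 'n set). (1::'a)) = real CARD('n) *\<^sub>R 1" by (simp add: scaleR_conv_of_real)
 show "et \<odot> d = DD" by (simp add: DD_def c[OF br_basic'(4)])
 show "el \<odot> x = bb" by (simp add: c[OF br_lower(13)] sums_comp')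
 show "xi \<odot> x = aa" by (simp add: c[OF br_basic'(1)] sums_comp)
 show "d \<odot> xiu = GG" by (simp add: c[OF br_upper(14)] sums_comp)
 show "d \<odot> xi = xi \<odot> d" by (simp add: c[OF dxi])
 show "el \<odot> du = DD" by (simp add: c[OF br_mixed(6)] sums_comp')
 show "du \<odot> xi = GG" by (simp add: c[OF br_upper(7)] sums_comp')
 show "xiu \<odot> x = x \<odot> xiu" by (simp add: c[OF br_upper(9)])
 show "xiu \<odot> xl = aa" by (simp add: c[OF br_mixed(8)] sums_comp')
 show "et \<odot> xi = EE + real CARD('n) *\<^sub>R 1"
  "d \<odot> x = th + real CARD('n) *\<^sub>R 1"
  "el \<odot> xiu = EE + real CARD('n) *\<^sub>R 1"
  "du \<odot> xl = th + real CARD('n) *\<^sub>R 1"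
  unfolding et_xi sum.distrib one sums_comp sums_comp' by simp_all
qed

lemma br_comp_right:
 "br S x2 = (\<Sum>i\<in>UNIV. xl i * br S (x i) + br S (xl i) * x i)"
 "br S th = (\<Sum>i\<in>UNIV. x i * br S (d i) + br S (x i) * d i)"
 "br S aa = (\<Sum>i\<in>UNIV. x i * br S (xi i) + br S (x i) * xi i)"
 "br S bb = (\<Sum>i\<in>UNIV. xl i * br S (et i) + br S (xl i) * et i)"
 "br S EE = (\<Sum>i\<in>UNIV. xi i * br S (et i) + br S (xi i) * et i)"
 "br S RR = (\<Sum>i\<in>UNIV. xiu i * br S (xi i) + br S (xiu i) * xi i)"
 "br S TT = (\<Sum>i\<in>UNIV. el i * br S (et i) + br S (el i) * et i)"
 "br S GG = (\<Sum>i\<in>UNIV. xiu i * br S (d i) + br S (xiu i) * d i)"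
 "br S DD = (\<Sum>i\<in>UNIV. d i * br S (et i) + br S (d i) * et i)"
 by (simp_all add: x2_def th_def aa_def bb_def RR_def TT_def GG_def DD_def EE_def br_sum_right br_mult_right)

lemma br_comp:
 "br EE x2 = 0" "br EE th = 0" "br EE aa = aa" "br EE bb = - bb" "br EE RR = RR + RR" "br EE GG = GG"
 "br RR x2 = 0" "br RR th = 0" "br RR aa = 0" "br RR bb = - (aa + aa)"
 "br GG x2 = aa + aa" "br GG th = GG" "br GG aa = RR" "br GG bb = EE - th"
 "br TT x2 = 0" "br TT th = 0" "br TT aa = bb + bb" "br TT bb = 0"
 "br TT RR = EE + EE + EE + EE + real CARD('n) *\<^sub>R 1 + real CARD('n) *\<^sub>R 1" "br TT GG = DD + DD" "br TT EE = TT + TT"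
 "br DD x2 = bb + bb" "br DD th = DD" "br DD bb = TT" "br DD EE = DD" "br DD TT = 0"
 "br DD aa = EE + th + real CARD('n) *\<^sub>R 1"
 by (simp_all add: br_comp_right br_comp_vec distrib_left distrib_right right_diff_distrib sum.distrib sum_subtractf sum_negf
   sums_comp sums_comp' sums_comp'')

text \<open>Infinitesimal actions of the conformal generators on symbols of weight \<open>p / n\<close>;
 \<open>KK\<close> is the action of the inversions on differential operators, transported by normal ordering, with \<open>q = n \<lambda>\<close>.\<close>

definition MM where "MM i j = xl i * d j - xl j * d i + xi i * el j - xi j * el i"
definition ee where "ee p = th - EE + p *\<^sub>R 1"
definition K0 where "K0 p m = x2 * d m - (xl m * th + xl m * th) - (xi m * bb + xi m * bb) + (aa * el m + aa * el m)
 + (xl m * EE + xl m * EE) - (p *\<^sub>R xl m + p *\<^sub>R xl m)"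
definition K1 where "K1 q m = (EE * el m + EE * el m) + (q *\<^sub>R el m + q *\<^sub>R el m) - xi m * TT"
definition KK where "KK p q m = K0 p m + K1 q m"

text \<open>\<open>C0\<close> and \<open>CC\<close> are closed forms of the Casimir element on
  symbols and on operators, as computed in \<open>casimir_symbol\<close> and
  \<open>casimir_op\<close>. The positions x have cancelled. \<open>C0\<close> preserves the degree
  in \<xi>, whereas \<open>C1\<close> is made of the divergence and of the gradient of the trace and
  lowers it by one.\<close>

definition C0 where "C0 p = (p * p - real CARD('n) * p) *\<^sub>R 1 + (EE * EE + EE * EE) - (p *\<^sub>R EE + p *\<^sub>R EE)
  + (real CARD('n) *\<^sub>R EE + real CARD('n) *\<^sub>R EE) - (EE + EE) - RR * TT"
definition C1 where "C1 q = (EE * DD + EE * DD) + (q *\<^sub>R DD + q *\<^sub>R DD) - GG * TT"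
definition CC where "CC p q = C0 p + C1 q"

text \<open>Commutators oriented as rewriting rules: contractions move to the right past vectors and
  past one another, so that the two sides of an identity reach a common normal form.\<close>

lemmas ord_rules = br_comp_vec[THEN br_D] br_comp[THEN br_D] br_comp_vec[THEN br_D2] br_comp[THEN br_D2]

lemmas expand_rules = ord_rules mult.assoc distrib_left distrib_right left_diff_distrib right_diff_distrib
 scaleR_add_left scaleR_add_right scaleR_diff_left scaleR_diff_right scaleR_minus_right
 mult.commute[where 'a = real] mult.left_commute[where 'a = real]

lemma CC_d: "CC p q * d m = d m * CC p q"
 by (simp add: CC_def C0_def C1_def expand_rules)

lemma CC_ee: "CC p q * ee r = ee r * CC p q"
 by (simp add: CC_def C0_def C1_def ee_def expand_rules)

lemma CC_KK: "CC p q * KK p q m = KK p q m * CC p q"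
 by (simp add: CC_def C0_def C1_def KK_def K0_def K1_def expand_rules)

text \<open>Contractions are rotation invariant. The five listed here are those occurring in
  \<open>CC\<close>, so \<open>CC_MM\<close> follows without multiplying out.\<close>

lemma br_MM: "br EE (MM i j) = 0" "br RR (MM i j) = 0" "br TT (MM i j) = 0" "br GG (MM i j) = 0" "br DD (MM i j) = 0"
proof -
 have c: "br u v = 0 \<Longrightarrow> u * v = v * u" for u v :: 'a by (simp add: br_def)
 show "br EE (MM i j) = 0" "br RR (MM i j) = 0" "br TT (MM i j) = 0" "br GG (MM i j) = 0" "br DD (MM i j) = 0"
  using c[OF xixi[of i j]] c[OF br_lower(18)[of i j]] c[OF dxi] c[OF br_lower(10)]
  by (simp_all add: MM_def br_simps br_comp_vec distrib_left distrib_right right_diff_distrib)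
qed

lemma CC_MM: "CC p q * MM i j = MM i j * CC p q"
proof -
 have "br (CC p q) (MM i j) = 0"
  by (simp add: CC_def C0_def C1_def br_simps br_MM)
 then show ?thesis by (simp add: br_def)
qed

section \<open>The Casimir element computed from the generators\<close>

definition Mup where "Mup i j = x i * du j - x j * du i + xiu i * et j - xiu j * et i"

lemma Mup_eq: "(\<Sum>a\<in>UNIV. \<Sum>b\<in>UNIV. (h $ i $ a * h $ j $ b) *\<^sub>R MM a b) = Mup i j"
proof -
 have *: "(\<Sum>a\<in>UNIV. \<Sum>b\<in>UNIV. (h $ i $ a * h $ j $ b) *\<^sub>R (u a * v b)) =
   (\<Sum>a\<in>UNIV. h $ i $ a *\<^sub>R u a) * (\<Sum>b\<in>UNIV. h $ j $ b *\<^sub>R v b)"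
  "(\<Sum>a\<in>UNIV. \<Sum>b\<in>UNIV. (h $ i $ a * h $ j $ b) *\<^sub>R (u b * v a)) =
   (\<Sum>b\<in>UNIV. h $ j $ b *\<^sub>R u b) * (\<Sum>a\<in>UNIV. h $ i $ a *\<^sub>R v a)" for u v :: "'n \<Rightarrow> 'a"
  by (simp_all add: sum_distrib_left sum_distrib_right scaleR_sum_right mult.commute)
   (subst sum.swap, simp)
 show ?thesis
  unfolding MM_def Mup_def scaleR_add_right scaleR_diff_right sum.distrib sum_subtractf *
  by (simp add: contract)
qed

text \<open>Only one half of the antisymmetric \<open>MM i j\<close> is multiplied with
  \<open>Mup i j\<close>; by antisymmetry of \<open>Mup\<close> the other half contributes the same
  amount, see \<open>casimir_rot'\<close>. The eight products are summed separately.\<close>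

lemma casimir_rot:
 "(\<Sum>i\<in>UNIV. \<Sum>j\<in>UNIV. (xl i * d j + xi i * el j) * Mup i j) =
  x2 * LL - th * th - (real CARD('n) *\<^sub>R th - (th + th)) + (aa * DD + aa * DD) - (bb * GG + bb * GG) + (th + th)
  + RR * TT - EE * EE - (real CARD('n) *\<^sub>R EE - (EE + EE))"
proof -
 have c: "br u v = 0 \<Longrightarrow> u * v = v * u" for u v :: 'a by (simp add: br_def)
 have dsum: "(\<Sum>i\<in>UNIV. \<Sum>j\<in>UNIV. u i * (v j * (w i * z j))) =
   (\<Sum>i\<in>UNIV. u i * (\<Sum>j\<in>UNIV. v j * (w i * z j)))" for u v w z :: "'n \<Rightarrow> 'a"
  by (simp add: sum_distrib_left)
 have 1: "(\<Sum>i\<in>UNIV. \<Sum>j\<in>UNIV. xl i * d j * (x i * du j)) = x2 * LL + th"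
 proof -
  have "xl i * d j * (x i * du j) = xl i * x i * (d j * du j) + (if j = i then xl i * du j else 0)" for i j
   using br_D2[OF dx, of j i "du j"] by (simp add: distrib_left mult.assoc)
  then show ?thesis
   by (simp add: sum.distrib sums_comp sums_comp' flip: sum_distrib_left sum_distrib_right)
 qed
 have 2: "(\<Sum>i\<in>UNIV. \<Sum>j\<in>UNIV. xl i * d j * (x j * du i)) = th * th + real CARD('n) *\<^sub>R th - th"
 proof -
  have "(\<Sum>i\<in>UNIV. \<Sum>j\<in>UNIV. xl i * d j * (x j * du i)) = (\<Sum>i\<in>UNIV. xl i * (\<Sum>j\<in>UNIV. d j * x j) * du i)"
   by (simp add: sum_distrib_left sum_distrib_right mult.assoc)
  also have "\<dots> = (\<Sum>i\<in>UNIV. (xl i * du i) * th - xl i * du i + real CARD('n) *\<^sub>R (xl i * du i))"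
   by (simp add: sums_comp'' distrib_left distrib_right mult.assoc br_th[THEN br_D] right_diff_distrib)
  also have "\<dots> = th * th - th + real CARD('n) *\<^sub>R th"
   by (simp add: sum.distrib sum_subtractf sums_comp' flip: sum_distrib_right scaleR_sum_right)
  finally show ?thesis by simp
 qed
 have 3: "(\<Sum>i\<in>UNIV. \<Sum>j\<in>UNIV. xl i * d j * (xiu i * et j)) = aa * DD"
 proof -
  have "xl i * d j * (xiu i * et j) = xl i * xiu i * (d j * et j)" for i j
   using br_D2[OF br_upper(14), of j i "et j"] by (simp add: mult.assoc)
  then show ?thesis by (simp add: sums_comp sums_comp' flip: sum_distrib_left sum_distrib_right)
 qed
 have 4: "(\<Sum>i\<in>UNIV. \<Sum>j\<in>UNIV. xl i * d j * (xiu j * et i)) = bb * GG - th"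
 proof -
  have "(\<Sum>i\<in>UNIV. \<Sum>j\<in>UNIV. xl i * d j * (xiu j * et i)) = (\<Sum>i\<in>UNIV. xl i * (\<Sum>j\<in>UNIV. d j * xiu j) * et i)"
   by (simp add: sum_distrib_left sum_distrib_right mult.assoc)
  also have "\<dots> = (\<Sum>i\<in>UNIV. xl i * et i * GG - xl i * du i)"
   by (simp add: sums_comp'' br_GG[THEN br_D] mult.assoc right_diff_distrib)
  finally show ?thesis by (simp add: sum_subtractf sums_comp sums_comp' flip: sum_distrib_right)
 qed
 have 5: "(\<Sum>i\<in>UNIV. \<Sum>j\<in>UNIV. xi i * el j * (x i * du j)) = aa * DD"
 proof -
  have "xi i * el j * (x i * du j) = xi i * x i * (el j * du j)" for i j
   using br_D2[OF br_lower(13), of j i "du j"] by (simp add: mult.assoc)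
  then show ?thesis by (simp add: sums_comp'' flip: sum_distrib_left sum_distrib_right)
 qed
 have 6: "(\<Sum>i\<in>UNIV. \<Sum>j\<in>UNIV. xi i * el j * (x j * du i)) = bb * GG - th"
 proof -
  have "(\<Sum>i\<in>UNIV. \<Sum>j\<in>UNIV. xi i * el j * (x j * du i)) = (\<Sum>i\<in>UNIV. xi i * (\<Sum>j\<in>UNIV. el j * x j) * du i)"
   by (simp add: sum_distrib_left sum_distrib_right mult.assoc)
  also have "\<dots> = (\<Sum>i\<in>UNIV. xi i * du i * bb - xi i * et i)"
   by (simp add: sums_comp'' br_bb[THEN br_D] mult.assoc right_diff_distrib)
  also have "\<dots> = GG * bb - EE"
   by (simp add: sum_subtractf sums_comp sums_comp' flip: sum_distrib_right)
  finally show ?thesis by (simp add: br_comp(14)[THEN br_D])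
 qed
 have 7: "(\<Sum>i\<in>UNIV. \<Sum>j\<in>UNIV. xi i * el j * (xiu i * et j)) = RR * TT + EE"
 proof -
  have "xi i * el j * (xiu i * et j) = xi i * xiu i * (el j * et j) + (if j = i then xi i * et j else 0)" for i j
   using br_D2[OF br_mixed(3), of j i "et j"] by (simp add: distrib_left mult.assoc)
  then show ?thesis
   by (simp add: sum.distrib sums_comp sums_comp' flip: sum_distrib_left sum_distrib_right)
 qed
 have 8: "(\<Sum>i\<in>UNIV. \<Sum>j\<in>UNIV. xi i * el j * (xiu j * et i)) = EE * EE + real CARD('n) *\<^sub>R EE - EE"
 proof -
  have "(\<Sum>i\<in>UNIV. \<Sum>j\<in>UNIV. xi i * el j * (xiu j * et i)) = (\<Sum>i\<in>UNIV. xi i * (\<Sum>j\<in>UNIV. el j * xiu j) * et i)"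
   by (simp add: sum_distrib_left sum_distrib_right mult.assoc)
  also have "\<dots> = (\<Sum>i\<in>UNIV. (xi i * et i) * EE - xi i * et i + real CARD('n) *\<^sub>R (xi i * et i))"
   by (simp add: sums_comp'' distrib_left distrib_right mult.assoc br_EE[THEN br_D] right_diff_distrib)
  also have "\<dots> = EE * EE - EE + real CARD('n) *\<^sub>R EE"
   by (simp add: sum.distrib sum_subtractf sums_comp flip: sum_distrib_right scaleR_sum_right)
  finally show ?thesis by simp
 qed
 have "(\<Sum>i\<in>UNIV. \<Sum>j\<in>UNIV. (xl i * d j + xi i * el j) * Mup i j) =
   (x2 * LL + th) - (th * th + real CARD('n) *\<^sub>R th - th) + aa * DD - (bb * GG - th)
   + aa * DD - (bb * GG - th) + (RR * TT + EE) - (EE * EE + real CARD('n) *\<^sub>R EE - EE)"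
  unfolding Mup_def distrib_left distrib_right right_diff_distrib sum.distrib sum_subtractf 1 2 3 4 5 6 7 8
  by simp
 then show ?thesis by simp
qed

lemma casimir_rot':
 "(\<Sum>i\<in>UNIV. \<Sum>j\<in>UNIV. \<Sum>a\<in>UNIV. \<Sum>b\<in>UNIV. (h $ i $ a * h $ j $ b) *\<^sub>R (MM i j * MM a b)) =
  2 *\<^sub>R (\<Sum>i\<in>UNIV. \<Sum>j\<in>UNIV. (xl i * d j + xi i * el j) * Mup i j)"
proof -
 let ?B = "\<lambda>i j. xl i * d j + xi i * el j"
 have "(\<Sum>a\<in>UNIV. \<Sum>b\<in>UNIV. (h $ i $ a * h $ j $ b) *\<^sub>R (MM i j * MM a b)) = MM i j * Mup i j" for i j
  unfolding Mup_eq[symmetric] by (simp add: sum_distrib_left)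
 moreover have "MM i j = ?B i j - ?B j i" for i j by (simp add: MM_def)
 moreover have "(\<Sum>i\<in>UNIV. \<Sum>j\<in>UNIV. ?B j i * Mup i j) = (\<Sum>i\<in>UNIV. \<Sum>j\<in>UNIV. ?B i j * Mup j i)"
  by (rule sum.swap)
 ultimately have "(\<Sum>i\<in>UNIV. \<Sum>j\<in>UNIV. \<Sum>a\<in>UNIV. \<Sum>b\<in>UNIV. (h $ i $ a * h $ j $ b) *\<^sub>R (MM i j * MM a b)) =
   (\<Sum>i\<in>UNIV. \<Sum>j\<in>UNIV. ?B i j * Mup i j) - (\<Sum>i\<in>UNIV. \<Sum>j\<in>UNIV. ?B i j * Mup j i)"
  by (simp only: left_diff_distrib sum_subtractf)
 also have "(\<Sum>i\<in>UNIV. \<Sum>j\<in>UNIV. ?B i j * Mup j i) = - (\<Sum>i\<in>UNIV. \<Sum>j\<in>UNIV. ?B i j * Mup i j)"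
 proof -
  have "Mup j i = - Mup i j" for i j by (simp add: Mup_def)
  then have "?B i j * Mup j i = - (?B i j * Mup i j)" for i j by (metis mult_minus_right)
  then show ?thesis by (simp only: sum_negf)
 qed
 finally show ?thesis by (simp only: scaleR_2 diff_minus_eq_add)
qed

lemma casimir_dK:
 "(\<Sum>i\<in>UNIV. \<Sum>j\<in>UNIV. h $ i $ j *\<^sub>R (d i * K0 p j)) =
  x2 * LL + (th + th) - ((th * th + real CARD('n) *\<^sub>R th) + (th * th + real CARD('n) *\<^sub>R th)) - (GG * bb + GG * bb)
  + (aa * DD + EE + aa * DD + EE) + (th * EE + real CARD('n) *\<^sub>R EE + th * EE + real CARD('n) *\<^sub>R EE)
  - (p *\<^sub>R (th + real CARD('n) *\<^sub>R 1) + p *\<^sub>R (th + real CARD('n) *\<^sub>R 1))"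
proof -
 have "(\<Sum>i\<in>UNIV. \<Sum>j\<in>UNIV. h $ i $ j *\<^sub>R (d i * K0 p j)) = (\<Sum>j\<in>UNIV. du j * K0 p j)"
  by (subst sum.swap) (simp add: raise_lower'(9)[symmetric] sum_distrib_right)
 moreover have "(\<Sum>j\<in>UNIV. du j * (x2 * d j)) = x2 * LL + (th + th)"
 proof -
  have "br x2 (du j) = - (x j + x j)" for j
   by (simp add: x2_def br_simps br_vec contract cong: if_cong)
  then have "br (du j) x2 = x j + x j" for j using br_swap[of "du j" x2] by simp
  from this[THEN br_D2] show ?thesis
   by (simp add: distrib_right sum.distrib sums_comp flip: sum_distrib_left)
 qed
 moreover have "(\<Sum>j\<in>UNIV. du j * (aa * el j)) = aa * DD + EE"
 proof -
  have "br (du j) aa = xiu j" for j using br_swap[of "du j" aa] br_aa(7)[of j] by simp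
  from this[THEN br_D2] show ?thesis
   by (simp add: sum.distrib sums_comp' flip: sum_distrib_left)
 qed
 moreover have "(\<Sum>j\<in>UNIV. du j * (xl j * z)) = (th + real CARD('n) *\<^sub>R 1) * z" for z
  by (simp add: sums_comp'' flip: mult.assoc sum_distrib_right)
 moreover have "(\<Sum>j\<in>UNIV. du j * (xi j * z)) = GG * z" for z
  by (simp add: sums_comp'' flip: mult.assoc sum_distrib_right)
 ultimately show ?thesis
  by (simp add: K0_def distrib_left distrib_right right_diff_distrib sum.distrib sum_subtractf sums_comp'' br_th(1)
    flip: scaleR_sum_right)
qed

text \<open>The left side is the quadratic Casimir element in the basis of the generators, in which
  translations are dual to inversions. The term linear in \<open>ee\<close> comes from writing all
  translations to the left of the inversions.\<close>

lemma casimir_symbol: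
 "(\<Sum>i\<in>UNIV. \<Sum>j\<in>UNIV. h $ i $ j *\<^sub>R (d i * K0 p j))
  - (1 / 2) *\<^sub>R (\<Sum>i\<in>UNIV. \<Sum>j\<in>UNIV. \<Sum>a\<in>UNIV. \<Sum>b\<in>UNIV. (h $ i $ a * h $ j $ b) *\<^sub>R (MM i j * MM a b))
  + ee p * ee p + real CARD('n) *\<^sub>R ee p = C0 p"
 unfolding casimir_rot' casimir_rot casimir_dK ee_def C0_def
 by (simp add: br_comp(2)[THEN br_D] br_comp(14)[THEN br_D] distrib_left distrib_right left_diff_distrib right_diff_distrib
   scaleR_add_left scaleR_add_right scaleR_diff_left scaleR_diff_right mult.commute[where 'a = real])

text \<open>Translations, rotations and the dilation act on operators as on symbols, so the only new
  term is the contraction of \<open>d\<close> with \<open>K1\<close>, and this equals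
  \<open>C1\<close>.\<close>

lemma casimir_op:
 "(\<Sum>i\<in>UNIV. \<Sum>j\<in>UNIV. h $ i $ j *\<^sub>R (d i * KK p q j))
  - (1 / 2) *\<^sub>R (\<Sum>i\<in>UNIV. \<Sum>j\<in>UNIV. \<Sum>a\<in>UNIV. \<Sum>b\<in>UNIV. (h $ i $ a * h $ j $ b) *\<^sub>R (MM i j * MM a b))
  + ee p * ee p + real CARD('n) *\<^sub>R ee p = CC p q"
proof -
 have "(\<Sum>i\<in>UNIV. \<Sum>j\<in>UNIV. h $ i $ j *\<^sub>R (d i * K1 q j)) = (\<Sum>j\<in>UNIV. du j * K1 q j)"
  by (subst sum.swap) (simp add: raise_lower'(9)[symmetric] sum_distrib_right)
 also have "\<dots> = C1 q"
 proof -
  have "du j * EE = EE * du j" for j using br_EE(8)[of j] by (simp add: br_def)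
  then have "du j * (EE * z) = EE * (du j * z)" for j z by (metis mult.assoc)
  moreover have "(\<Sum>j\<in>UNIV. du j * (xi j * z)) = GG * z" for z
   by (simp add: sums_comp'' flip: mult.assoc sum_distrib_right)
  ultimately show ?thesis
   by (simp add: K1_def C1_def distrib_left right_diff_distrib sum.distrib sum_subtractf sums_comp'
     flip: scaleR_sum_right sum_distrib_left)
 qed
 finally show ?thesis
  unfolding CC_def casimir_symbol[of p, symmetric] KK_def distrib_left scaleR_add_right sum.distrib by simp
qed

end

section \<open>Natural operators on symbols\<close>

text \<open>Families, indexed by all open sets, of linear operators on symbols compatible with restriction. Taking
 families rather than operators over one open set makes them a type, hence a ring in the sense of the type classes.\<close>

definition natural_op :: "((real ^ 'n::finite) set \<Rightarrow> 'n sym \<Rightarrow> 'n sym) \<Rightarrow> bool" where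
 "natural_op F \<longleftrightarrow>
  (\<forall>V P. open V \<and> P \<in> Sym V \<longrightarrow> F V P \<in> Sym V) \<and>
  (\<forall>V P Q a b. open V \<and> P \<in> Sym V \<and> Q \<in> Sym V \<longrightarrow>
    F V (\<lambda>x \<xi>. a * P x \<xi> + b * Q x \<xi>) = (\<lambda>x \<xi>. a * F V P x \<xi> + b * F V Q x \<xi>)) \<and>
  (\<forall>V W P. open V \<and> open W \<and> W \<subseteq> V \<and> P \<in> Sym V \<longrightarrow>
    F W (restrict_symbol W P) = restrict_symbol W (F V P)) \<and>
  (\<forall>V P. \<not> (open V \<and> P \<in> Sym V) \<longrightarrow> F V P = (\<lambda>x \<xi>. 0))"

lemma natural_opI:
 assumes "\<And>V P. open V \<Longrightarrow> P \<in> Sym V \<Longrightarrow> F V P \<in> Sym V"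
  and "\<And>V P Q a b. open V \<Longrightarrow> P \<in> Sym V \<Longrightarrow> Q \<in> Sym V \<Longrightarrow>
    F V (\<lambda>x \<xi>. a * P x \<xi> + b * Q x \<xi>) = (\<lambda>x \<xi>. a * F V P x \<xi> + b * F V Q x \<xi>)"
  and "\<And>V W P. open V \<Longrightarrow> open W \<Longrightarrow> W \<subseteq> V \<Longrightarrow> P \<in> Sym V \<Longrightarrow>
    F W (restrict_symbol W P) = restrict_symbol W (F V P)"
  and "\<And>V P. \<not> (open V \<and> P \<in> Sym V) \<Longrightarrow> F V P = (\<lambda>x \<xi>. 0)"
 shows "natural_op F"
 unfolding natural_op_def
proof (intro conjI allI impI, goal_cases)
 case 1 then show ?case using assms(1) by blast
next
 case 2 then show ?case by (intro assms(2)) auto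
next
 case 3 then show ?case by (intro assms(3)) auto
next
 case 4 then show ?case by (rule assms(4))
qed

lemma natural_op_loc: "natural_op F \<Longrightarrow> open V \<Longrightarrow> P \<in> Sym V \<Longrightarrow> F V P \<in> Sym V"
 and natural_op_lin: "natural_op F \<Longrightarrow> open V \<Longrightarrow> P \<in> Sym V \<Longrightarrow> Q \<in> Sym V \<Longrightarrow>
    F V (\<lambda>x \<xi>. a * P x \<xi> + b * Q x \<xi>) = (\<lambda>x \<xi>. a * F V P x \<xi> + b * F V Q x \<xi>)"
 and natural_op_restrict: "natural_op F \<Longrightarrow> open V \<Longrightarrow> open W \<Longrightarrow> W \<subseteq> V \<Longrightarrow> P \<in> Sym V \<Longrightarrow>
    F W (restrict_symbol W P) = restrict_symbol W (F V P)"
 and natural_op_out: "natural_op F \<Longrightarrow> \<not> (open V \<and> P \<in> Sym V) \<Longrightarrow> F V P = (\<lambda>x \<xi>. 0)"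
 by (drule natural_op_def[THEN iffD1], elim conjE, simp)+

lemma natural_op_zero: assumes "natural_op F" shows "F V (\<lambda>x \<xi>. 0) = (\<lambda>x \<xi>. 0)"
proof (cases "open V")
 case True
 then show ?thesis using natural_op_lin[OF assms True, of "\<lambda>x \<xi>. 0" "\<lambda>x \<xi>. 0" 0 0] by simp
qed (use natural_op_out[OF assms] in blast)

typedef 'n sop = "{F :: (real ^ 'n::finite) set \<Rightarrow> 'n sym \<Rightarrow> 'n sym. natural_op F}"
 morphisms app Abs_sop
 by (rule exI[of _ "\<lambda>V P x \<xi>. 0"]) (auto intro!: natural_opI simp: restrict_symbol_def)

setup_lifting type_definition_sop

lemma natural_app: "natural_op (app F)" using app[of F] by simp

lemmas app_loc [simp] = natural_op_loc[OF natural_app]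
 and app_lin = natural_op_lin[OF natural_app]
 and app_restrict = natural_op_restrict[OF natural_app]
 and app_out = natural_op_out[OF natural_app]
 and app_zero [simp] = natural_op_zero[OF natural_app]

lemma app_add: "open V \<Longrightarrow> P \<in> Sym V \<Longrightarrow> Q \<in> Sym V \<Longrightarrow>
  app F V (\<lambda>x \<xi>. P x \<xi> + Q x \<xi>) = (\<lambda>x \<xi>. app F V P x \<xi> + app F V Q x \<xi>)"
 and app_diff: "open V \<Longrightarrow> P \<in> Sym V \<Longrightarrow> Q \<in> Sym V \<Longrightarrow>
  app F V (\<lambda>x \<xi>. P x \<xi> - Q x \<xi>) = (\<lambda>x \<xi>. app F V P x \<xi> - app F V Q x \<xi>)"
 and app_scale: "open V \<Longrightarrow> P \<in> Sym V \<Longrightarrow> app F V (\<lambda>x \<xi>. c * P x \<xi>) = (\<lambda>x \<xi>. c * app F V P x \<xi>)"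
 using app_lin[of V P Q F 1 1] app_lin[of V P Q F 1 "-1"] app_lin[of V P P F c 0] by simp_all

lemma sop_eqI: "(\<And>V P. open V \<Longrightarrow> P \<in> Sym V \<Longrightarrow> app F V P = app G V P) \<Longrightarrow> F = G"
 by (metis app_inject app_out ext)

instantiation sop :: (finite) real_algebra_1
begin

lift_definition zero_sop :: "'a sop" is "\<lambda>V P x \<xi>. 0"
 by (auto intro!: natural_opI simp: restrict_symbol_def)

lift_definition one_sop :: "'a sop" is "\<lambda>V P. if open V \<and> P \<in> Sym V then P else (\<lambda>x \<xi>. 0)"
 by (auto intro!: natural_opI simp: Sym_lin restrict_Sym)

lift_definition plus_sop :: "'a sop \<Rightarrow> 'a sop \<Rightarrow> 'a sop" is "\<lambda>F G V P x \<xi>. F V P x \<xi> + G V P x \<xi>"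
 by (rule natural_opI)
  (simp_all add: natural_op_loc natural_op_lin natural_op_restrict natural_op_out Sym_add algebra_simps,
   simp add: restrict_symbol_def fun_eq_iff)

lift_definition scaleR_sop :: "real \<Rightarrow> 'a sop \<Rightarrow> 'a sop" is "\<lambda>r F V P x \<xi>. cr r * F V P x \<xi>"
 by (rule natural_opI)
  (simp_all add: natural_op_loc natural_op_lin natural_op_restrict natural_op_out Sym_scale algebra_simps,
   simp add: restrict_symbol_def fun_eq_iff)

definition uminus_sop :: "'a sop \<Rightarrow> 'a sop" where "uminus_sop F = scaleR (-1) F"

definition minus_sop :: "'a sop \<Rightarrow> 'a sop \<Rightarrow> 'a sop" where "minus_sop F G = F + - G"

lift_definition times_sop :: "'a sop \<Rightarrow> 'a sop \<Rightarrow> 'a sop" is "\<lambda>F G V P. F V (G V P)"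
 by (rule natural_opI)
  (simp_all add: natural_op_loc natural_op_lin natural_op_restrict natural_op_out natural_op_zero)

lemmas app_simps0 = zero_sop.rep_eq plus_sop.rep_eq scaleR_sop.rep_eq times_sop.rep_eq

lemma app_one: "open V \<Longrightarrow> P \<in> Sym V \<Longrightarrow> app 1 V P = P"
 by (simp add: one_sop.rep_eq)

instance
proof
 fix a b c :: "'a sop" and r s :: real
 show "a + b + c = a + (b + c)" "a + b = b + a" "0 + a = a" "- a + a = 0" "a - b = a + - b"
  by (rule sop_eqI; simp add: app_simps0 minus_sop_def uminus_sop_def algebra_simps)+
 show "a * b * c = a * (b * c)" "1 * a = a" "a * 1 = a" "(a + b) * c = a * c + b * c"
  by (rule sop_eqI; simp add: app_simps0 app_one)+
 show "a * (b + c) = a * b + a * c"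
  by (rule sop_eqI) (simp add: app_simps0 app_add)
 show "r *\<^sub>R (a + b) = r *\<^sub>R a + r *\<^sub>R b" "(r + s) *\<^sub>R a = r *\<^sub>R a + s *\<^sub>R a"
  "r *\<^sub>R s *\<^sub>R a = (r * s) *\<^sub>R a" "1 *\<^sub>R a = a" "r *\<^sub>R a * b = r *\<^sub>R (a * b)"
  by (rule sop_eqI; simp add: app_simps0 algebra_simps)+
 show "a * r *\<^sub>R b = r *\<^sub>R (a * b)"
  by (rule sop_eqI) (simp add: app_simps0 app_scale)
 show "(0::'a sop) \<noteq> 1"
 proof
  assume "(0::'a sop) = 1"
  \<comment> \<open>The constant symbol 1 on the whole space separates zero from the
    identity.\<close>
  then have "app (0 :: 'a sop) UNIV (mono_symbol UNIV (\<lambda>x. 1) []) 0 0 = app 1 UNIV (mono_symbol UNIV (\<lambda>x. 1) []) 0 0" by simp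
  then show False by (simp add: app_one app_simps0 mono_symbol_loc) (simp add: mono_symbol_def)
 qed
qed

end

lemma app_simps [simp]:
 "app 0 V P = (\<lambda>x \<xi>. 0)" "app (F + G) V P = (\<lambda>x \<xi>. app F V P x \<xi> + app G V P x \<xi>)"
 "app (- F) V P = (\<lambda>x \<xi>. - app F V P x \<xi>)" "app (F - G) V P = (\<lambda>x \<xi>. app F V P x \<xi> - app G V P x \<xi>)"
 "app (r *\<^sub>R F) V P = (\<lambda>x \<xi>. cr r * app F V P x \<xi>)" "app (F * G) V P = app F V (app G V P)"
 by (simp_all only: app_simps0 minus_sop_def uminus_sop_def) simp_all

lemma app_sum: "app (\<Sum>i\<in>I. F i) V P = (\<lambda>x \<xi>. \<Sum>i\<in>I. app (F i) V P x \<xi>)"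
 by (induction I rule: infinite_finite_induct) simp_all

text \<open>Cuts an operation given by a formula down to symbols over open sets, as the last clause
  of \<open>natural_op\<close> demands.\<close>

definition localize :: "('n::finite sym \<Rightarrow> 'n sym) \<Rightarrow>
  (real ^ 'n) set \<Rightarrow> 'n sym \<Rightarrow> 'n sym" where
 "localize F V P = (if open V \<and> P \<in> Sym V then F P else (\<lambda>x \<xi>. 0))"

lift_definition sX :: "'n::finite \<Rightarrow> 'n sop" is "\<lambda>i. localize (mult_x i)"
 by (rule natural_opI; clarsimp simp: localize_def mult_x_loc Sym_lin restrict_Sym)
  (auto simp: mult_x_def restrict_symbol_def fun_eq_iff algebra_simps)

lift_definition sXi :: "'n::finite \<Rightarrow> 'n sop" is "\<lambda>i. localize (mult_xi i)"
 by (rule natural_opI; clarsimp simp: localize_def mult_xi_loc Sym_lin restrict_Sym)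
  (auto simp: mult_xi_def restrict_symbol_def fun_eq_iff algebra_simps)

lift_definition sD :: "'n::finite \<Rightarrow> 'n sop" is "\<lambda>i V. localize (deriv_x V i) V"
proof (rule natural_opI, goal_cases)
 case (2 i V P Q a b)
 then show ?case
  by (simp add: localize_def Sym_lin deriv_x_add[OF Sym_scale Sym_scale] deriv_x_scale)
next
 case (3 i V W P)
 have "pd i (\<lambda>y. restrict_symbol W P y \<xi>) x = pd i (\<lambda>y. P y \<xi>) x" if "x \<in> W" for x \<xi>
  by (rule pd_cong_open[OF 3(2) that]) (simp add: restrict_symbol_def)
 then have "deriv_x W i (restrict_symbol W P) = restrict_symbol W (deriv_x V i P)"
  using 3(3) by (auto simp: deriv_x_def restrict_symbol_def fun_eq_iff)
 then show ?case using 3 by (simp add: localize_def restrict_Sym)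
qed (auto simp: localize_def deriv_x_loc)

lift_definition sEta :: "'n::finite \<Rightarrow> 'n sop" is "\<lambda>i. localize (deriv_xi i)"
proof (rule natural_opI, goal_cases)
 case (2 i V P Q a b)
 then show ?case
  by (simp add: localize_def Sym_lin deriv_xi_add[OF Sym_scale Sym_scale] deriv_xi_scale)
next
 case (3 i V W P)
 have "deriv_xi i (restrict_symbol W P) = restrict_symbol W (deriv_xi i P)"
  by (intro ext) (simp add: deriv_xi_def restrict_symbol_def)
 then show ?case using 3 by (simp add: localize_def restrict_Sym)
qed (auto simp: localize_def deriv_xi_loc)

lemma app_basic:
 assumes "open V" "P \<in> Sym V"
 shows "app (sX i) V P = mult_x i P" "app (sXi i) V P = mult_xi i P" "app (sD i) V P = deriv_x V i P"
  "app (sEta i) V P = deriv_xi i P"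
 using assms by (simp_all add: sX.rep_eq sXi.rep_eq sD.rep_eq sEta.rep_eq localize_def)

lemma br_sop_eqI:
 assumes "\<And>V P. open V \<Longrightarrow> P \<in> Sym V \<Longrightarrow> app A V (app B V P) = (\<lambda>x \<xi>. app B V (app A V P) x \<xi> + app C V P x \<xi>)"
 shows "br A B = C"
 unfolding br_def by (rule sop_eqI) (simp add: assms)

lemma deriv_x_mult_xi: "deriv_x V i (mult_xi j P) = mult_xi j (deriv_x V i P)"
 if "P \<in> Sym V" "open V"
 using that
proof (induction rule: Sym_induct)
 case (mono u "is")
 then show ?case using that by (simp add: mult_xi_mono deriv_x_mono)
next
 case (add P Q)
 have "mult_xi j (\<lambda>x \<xi>. P x \<xi> + Q x \<xi>) = (\<lambda>x \<xi>. mult_xi j P x \<xi> + mult_xi j Q x \<xi>)" for P Q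
  by (simp add: mult_xi_def distrib_left)
 then show ?case using add that by (simp add: deriv_x_add mult_xi_loc)
qed simp

text \<open>On monomials the derivative in \<xi> is unfolded recursively by
  \<open>deriv_xi_mult_xi\<close>, and every term of that recursion commutes with the derivative in
  x.\<close>

lemma deriv_x_deriv_xi: "deriv_x V i (deriv_xi j P) = deriv_xi j (deriv_x V i P)"
 if P: "P \<in> Sym V" and V: "open V"
 using that
proof (induction rule: Sym_induct)
 case (mono u "is")
 show ?case
 proof (induction "is")
  case (Cons a "is")
  let ?M = "mono_symbol V u is"
  have M: "?M \<in> Sym V" using mono by auto
  have "deriv_x V i (deriv_xi j (mono_symbol V u (a # is))) =
    deriv_x V i (\<lambda>x \<xi>. 1 * mult_xi a (deriv_xi j ?M) x \<xi> + (if j = a then 1 else 0) * ?M x \<xi>)"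
   unfolding mult_xi_mono[symmetric] deriv_xi_mult_xi[OF M V] by (intro arg_cong[of _ _ "deriv_x V i"]) auto
  also have "\<dots> = (\<lambda>x \<xi>. 1 * deriv_x V i (mult_xi a (deriv_xi j ?M)) x \<xi> + (if j = a then 1 else 0) * deriv_x V i ?M x \<xi>)"
   using M V by (subst deriv_x_add[OF Sym_scale Sym_scale]) (auto simp: mult_xi_loc deriv_xi_loc deriv_x_scale)
  also have "deriv_x V i (mult_xi a (deriv_xi j ?M)) = mult_xi a (deriv_xi j (deriv_x V i ?M))"
   using M V by (simp add: deriv_x_mult_xi deriv_xi_loc Cons)
  also have "(\<lambda>x \<xi>. 1 * mult_xi a (deriv_xi j (deriv_x V i ?M)) x \<xi> + (if j = a then 1 else 0) * deriv_x V i ?M x \<xi>)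
    = deriv_xi j (mult_xi a (deriv_x V i ?M))"
   unfolding deriv_xi_mult_xi[OF deriv_x_loc[OF M V] V] by auto
  also have "mult_xi a (deriv_x V i ?M) = deriv_x V i (mono_symbol V u (a # is))"
   using M V by (simp flip: mult_xi_mono add: deriv_x_mult_xi)
  finally show ?case .
 qed (use V mono in \<open>simp add: deriv_xi_mono_Nil deriv_x_mono\<close>)
next
 case (add P Q)
 then show ?case
  using deriv_xi_add[OF deriv_x_loc[OF add(1) V] deriv_x_loc[OF add(2) V] V] deriv_xi_add[OF add(1,2) V]
  by (simp add: deriv_x_add[OF _ _ V] deriv_xi_loc V)
qed simp

lemma sop_weyl:
 "br (sX i) (sX j) = 0" "br (sD i) (sD j) = 0" "br (sXi i) (sXi j) = 0" "br (sEta i) (sEta j) = 0"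
 "br (sX i) (sXi j) = 0" "br (sX i) (sEta j) = 0" "br (sD i) (sXi j) = 0" "br (sD i) (sEta j) = 0"
 "br (sD i) (sX j) = (if i = j then 1 else 0)" "br (sEta i) (sXi j) = (if i = j then 1 else 0)"
proof -
 show "br (sX i) (sX j) = 0" "br (sXi i) (sXi j) = 0" "br (sX i) (sXi j) = 0"
  by (rule br_sop_eqI; simp add: app_basic mult_x_loc mult_xi_loc; simp add: mult_x_def mult_xi_def algebra_simps)+
 show "br (sD i) (sXi j) = 0"
  by (rule br_sop_eqI) (simp add: app_basic mult_xi_loc deriv_x_loc deriv_x_mult_xi)
 show "br (sD i) (sEta j) = 0"
  by (rule br_sop_eqI) (simp add: app_basic deriv_xi_loc deriv_x_loc deriv_x_deriv_xi)
 show "br (sEta i) (sXi j) = (if i = j then 1 else 0)"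
  by (rule br_sop_eqI) (auto simp: app_basic deriv_xi_loc mult_xi_loc deriv_xi_mult_xi app_one)
 show "br (sX i) (sEta j) = 0"
 proof (rule br_sop_eqI)
  fix V and P :: "real ^ 'a \<Rightarrow> real ^ 'a \<Rightarrow> complex" assume VP: "open V" "P \<in> Sym V"
  have "deriv_xi j (mult_x i P) x \<xi> = mult_x i (deriv_xi j P) x \<xi>" for x \<xi>
   unfolding deriv_xi_def mult_x_def
   by (rule pd_bounded_linear[OF bounded_linear_mult_right smooth_on_differentiable[OF smooth_on_symbol_xi[OF VP(2,1)] UNIV_I]])
  then show "app (sX i) V (app (sEta j) V P) = (\<lambda>x \<xi>. app (sEta j) V (app (sX i) V P) x \<xi> + app 0 V P x \<xi>)"
   using VP by (simp add: app_basic deriv_xi_loc mult_x_loc fun_eq_iff)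
 qed
 show "br (sEta i) (sEta j) = 0"
 proof (rule br_sop_eqI)
  fix V and P :: "real ^ 'a \<Rightarrow> real ^ 'a \<Rightarrow> complex" assume VP: "open V" "P \<in> Sym V"
  have "deriv_xi i (deriv_xi j P) x \<xi> = deriv_xi j (deriv_xi i P) x \<xi>" for x \<xi>
   unfolding deriv_xi_def by (rule pd_swap[OF open_UNIV UNIV_I smooth_on_symbol_xi[OF VP(2,1)]])
  then show "app (sEta i) V (app (sEta j) V P) = (\<lambda>x \<xi>. app (sEta j) V (app (sEta i) V P) x \<xi> + app 0 V P x \<xi>)"
   using VP by (simp add: app_basic deriv_xi_loc fun_eq_iff)
 qed
 show "br (sD i) (sD j) = 0"
 proof (rule br_sop_eqI)
  fix V and P :: "real ^ 'a \<Rightarrow> real ^ 'a \<Rightarrow> complex" assume VP: "open V" "P \<in> Sym V"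
  have "deriv_x V i (deriv_x V j P) x \<xi> = deriv_x V j (deriv_x V i P) x \<xi>" for x \<xi>
  proof (cases "x \<in> V")
   case True
   have "pd i (\<lambda>y. if y \<in> V then pd j (\<lambda>y. P y \<xi>) y else 0) x = pd i (pd j (\<lambda>y. P y \<xi>)) x" for i j
    by (rule pd_cong_open[OF VP(1) True]) simp
   then show ?thesis using True pd_swap[OF VP(1) True smooth_on_symbol_x[OF VP(2,1)], of i j \<xi>]
    by (simp add: deriv_x_def)
  qed (simp add: deriv_x_def)
  then show "app (sD i) V (app (sD j) V P) = (\<lambda>x \<xi>. app (sD j) V (app (sD i) V P) x \<xi> + app 0 V P x \<xi>)"
   using VP by (simp add: app_basic deriv_x_loc fun_eq_iff)
 qed
 show "br (sD i) (sX j) = (if i = j then 1 else 0)"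
 proof (rule br_sop_eqI)
  fix V and P :: "real ^ 'a \<Rightarrow> real ^ 'a \<Rightarrow> complex" assume VP: "open V" "P \<in> Sym V"
  have "deriv_x V i (mult_x j P) x \<xi> = mult_x j (deriv_x V i P) x \<xi> + (if i = j then P x \<xi> else 0)" for x \<xi>
  proof (cases "x \<in> V")
   case True
   have "pd i (\<lambda>y. cr (y $ j) * P y \<xi>) x =
     cr (x $ j) * pd i (\<lambda>y. P y \<xi>) x + pd i (\<lambda>y. cr (y $ j)) x * P x \<xi>"
    by (intro pd_mult smooth_on_differentiable[OF _ True] smooth_on_symbol_x[OF VP(2,1)] smooth_on_of_real smooth_on_coord VP(1))
   then show ?thesis using True by (simp add: deriv_x_def mult_x_def)
  qed (use Sym_notin[OF VP(2)] in \<open>simp add: deriv_x_def mult_x_def\<close>)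
  then show "app (sD i) V (app (sX j) V P) = (\<lambda>x \<xi>. app (sX j) V (app (sD i) V P) x \<xi> + app (if i = j then 1 else 0) V P x \<xi>)"
   using VP by (auto simp: app_basic deriv_x_loc mult_x_loc app_one fun_eq_iff)
 qed
qed

subsection \<open>Order of operators\<close>

text \<open>A bound on the change of order, uniform over all open sets. \<open>e\<close> may be
  negative, and symbols of negative order are zero, so lowering the order often enough
  annihilates.\<close>

definition shifts_order :: "'n::finite sop \<Rightarrow> int \<Rightarrow> bool" where
 "shifts_order F e \<longleftrightarrow> (\<forall>V k P. open V \<longrightarrow> P \<in> SymU V k \<longrightarrow> app F V P \<in> SymU V (k + e))"

lemma shifts_orderD: "shifts_order F e \<Longrightarrow> open V \<Longrightarrow> P \<in> SymU V k \<Longrightarrow> app F V P \<in> SymU V (k + e)"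
 unfolding shifts_order_def by blast

lemma shifts_order_basic: "shifts_order (sX i) 0" "shifts_order (sD i) 0" "shifts_order (sXi i) 1" "shifts_order (sEta i) (-1)"
proof -
 have loc: "P \<in> SymU V k \<Longrightarrow> P \<in> Sym V" for P :: "real ^ 'a \<Rightarrow> real ^ 'a \<Rightarrow> complex" and V k
  by (auto simp: Sym_iff)
 show "shifts_order (sX i) 0" "shifts_order (sD i) 0" "shifts_order (sXi i) 1" "shifts_order (sEta i) (-1)"
  unfolding shifts_order_def
  using app_basic[OF _ loc] mult_x_upto[where i = i] deriv_x_upto[where i = i] mult_xi_upto[where i = i]
   deriv_xi_upto[where i = i] by fastforce+
qed

lemma shifts_order_zero: "shifts_order 0 e"
 and shifts_order_add: "shifts_order F e \<Longrightarrow> shifts_order G e \<Longrightarrow> shifts_order (F + G) e"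
 and shifts_order_diff: "shifts_order F e \<Longrightarrow> shifts_order G e \<Longrightarrow> shifts_order (F - G) e"
 and shifts_order_scaleR: "shifts_order F e \<Longrightarrow> shifts_order (r *\<^sub>R F) e"
 unfolding shifts_order_def by (simp_all add: SymU_add SymU_diff SymU_scale)

lemma shifts_order_one: "shifts_order 1 0"
 unfolding shifts_order_def by (metis add_0_right app_one Sym_iff)

lemma shifts_order_mult: "shifts_order F e \<Longrightarrow> shifts_order G e' \<Longrightarrow> shifts_order (F * G) (e' + e)"
 unfolding shifts_order_def by (simp add: add.assoc[symmetric])

lemma shifts_order_mono: "shifts_order F e \<Longrightarrow> e \<le> e' \<Longrightarrow> shifts_order F e'"
 unfolding shifts_order_def using SymU_mono by (metis add_left_mono in_mono)

lemma shifts_order_sum: "(\<And>i. i \<in> I \<Longrightarrow> shifts_order (F i) e) \<Longrightarrow> shifts_order (\<Sum>i\<in>I. F i) e"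
 by (induction I rule: infinite_finite_induct) (simp_all add: shifts_order_zero shifts_order_add)

lemma SymU_neg: "P \<in> SymU V k \<Longrightarrow> k < 0 \<Longrightarrow> P = (\<lambda>x \<xi>. 0)"
 by (auto elim!: SymU_cases simp: poly_symbol_def multi_indices_def fun_eq_iff)

subsection \<open>Homogeneous components\<close>

text \<open>The use of Taylor coefficients makes the component independent of the domain and of a
  choice of coefficients; in particular it commutes with restriction.\<close>

definition hcomp :: "nat \<Rightarrow> 'n::finite sym \<Rightarrow> 'n sym" where
 "hcomp k P = (\<lambda>x \<xi>. \<Sum>is | length is = k. scoeff P is x * mon is \<xi>)"

lemma finite_lists_length_le' [simp]: "finite {is :: 'n::finite list. length is \<le> k}"
 using finite_lists_length_le[of "UNIV :: 'n set" k] by simp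

lemma finite_lists_int_length_le [simp]: "finite {is :: 'n::finite list. int (length is) \<le> k}"
 using finite_multi_indices[of k] unfolding multi_indices_def .

text \<open>The weight equal to the monomial on lists of length k and to zero elsewhere is
  permutation invariant, so the coefficients at hand may replace the Taylor coefficients. The
  condition \<open>int k \<le> N\<close> makes the components above the order vanish.\<close>

lemma hcomp_poly_symbol:
 "hcomp k (poly_symbol V N a) = poly_symbol V (int k) (\<lambda>is x. if length is = k \<and> int k \<le> N then a is x else 0)"
proof (intro ext)
 fix x \<xi>
 show "hcomp k (poly_symbol V N a) x \<xi> = poly_symbol V (int k) (\<lambda>is x. if length is = k \<and> int k \<le> N then a is x else 0) x \<xi>"
 proof (cases "x \<in> V")
  case True
  let ?Y = "\<lambda>is. if length is = k then mon is \<xi> else 0"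
  have Y: "perm_inv ?Y"
   using perm_invD[OF perm_inv_mon] unfolding perm_inv_def by (metis size_mset)
  have "hcomp k (poly_symbol V N a) x \<xi> = (\<Sum>is\<in>multi_indices (max N (int k)). scoeff (poly_symbol V N a) is x * ?Y is)"
   unfolding hcomp_def by (rule sum.mono_neutral_cong_left) (auto, auto simp: multi_indices_def)
  also have "\<dots> = (\<Sum>is\<in>multi_indices N. a is x * ?Y is)"
   by (rule sum_scoeff[OF True Y]) simp
  also have "\<dots> = (\<Sum>is | length is = k. (if int k \<le> N then a is x * mon is \<xi> else 0))"
  proof (cases "int k \<le> N")
   case True
   then show ?thesis
    by (simp, intro sum.mono_neutral_cong_right) (auto simp: multi_indices_def)
  next
   case False
   then show ?thesis by (auto simp: multi_indices_def intro!: sum.neutral)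
  qed
  also have "\<dots> = poly_symbol V (int k) (\<lambda>is x. if length is = k \<and> int k \<le> N then a is x else 0) x \<xi>"
   unfolding poly_symbol_eq[OF True]
   by (rule sum.mono_neutral_cong_left) (auto simp: multi_indices_def)
  finally show ?thesis .
 next
  case False
  then show ?thesis by (simp add: hcomp_def scoeff_def poly_symbol_notin iter_pd_const)
 qed
qed

lemma hcomp_upto:
 assumes "P \<in> Sym V" shows "hcomp k P \<in> SymU V (int k)"
proof -
 obtain N where "P \<in> SymU V N" using assms by (auto simp: Sym_iff)
 then obtain a where a: "\<And>is. smooth_on V (a is)" "P = poly_symbol V N a"
  unfolding loc_symbol_upto_def by auto
 show ?thesis unfolding a(2) hcomp_poly_symbol by (rule loc_symbol_uptoI) (use a(1) in auto)
qed

lemma hcomp_loc [simp]: "P \<in> Sym V \<Longrightarrow> hcomp k P \<in> Sym V"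
 using hcomp_upto Sym_iff by metis

lemma hcomp_above: "P \<in> SymU V N \<Longrightarrow> N < int k \<Longrightarrow> hcomp k P = (\<lambda>x \<xi>. 0)"
 by (elim SymU_cases) (simp add: hcomp_poly_symbol, simp add: poly_symbol_def cong: if_cong)

lemma sum_hcomp:
 assumes "P \<in> SymU V (int N)" shows "P = (\<lambda>x \<xi>. \<Sum>k\<le>N. hcomp k P x \<xi>)"
proof (intro ext)
 fix x \<xi>
 obtain a where P: "P = poly_symbol V (int N) a" using assms by (rule SymU_cases)
 show "P x \<xi> = (\<Sum>k\<le>N. hcomp k P x \<xi>)"
 proof (cases "x \<in> V")
  case True
  have "(\<Sum>k\<le>N. hcomp k P x \<xi>) = (\<Sum>k\<le>N. \<Sum>is | is \<in> multi_indices (int N) \<and> length is = k. a is x * mon is \<xi>)"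
   unfolding P hcomp_poly_symbol poly_symbol_eq[OF True]
  proof (intro sum.cong[OF refl] sum.mono_neutral_cong_right, goal_cases)
   case (3 k)
   then show ?case by (auto simp: multi_indices_def)
  qed (auto simp: multi_indices_def)
  also have "\<dots> = (\<Sum>is\<in>multi_indices (int N). a is x * mon is \<xi>)"
   by (rule sum.group) (auto simp: multi_indices_def)
  finally show ?thesis by (simp add: P poly_symbol_eq[OF True])
 qed (simp add: P hcomp_poly_symbol poly_symbol_notin)
qed

lemma hcomp_top: "P \<in> SymU V (int k) \<Longrightarrow> open V \<Longrightarrow> (\<lambda>x \<xi>. P x \<xi> - hcomp k P x \<xi>) \<in> SymU V (int k - 1)"
proof -
 assume P: "P \<in> SymU V (int k)" and V: "open V"
 have "P x \<xi> = (\<Sum>j<k. hcomp j P x \<xi>) + hcomp k P x \<xi>" for x \<xi>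
  using fun_cong[OF fun_cong[OF sum_hcomp[OF P]], of x \<xi>] by (simp add: lessThan_Suc_atMost[symmetric])
 then have "(\<lambda>x \<xi>. P x \<xi> - hcomp k P x \<xi>) = (\<lambda>x \<xi>. \<Sum>j<k. hcomp j P x \<xi>)" by (simp add: fun_eq_iff)
 also have "\<dots> \<in> SymU V (int k - 1)"
 proof (rule SymU_sum[OF V])
  fix j assume "j \<in> {..<k}"
  then show "hcomp j P \<in> SymU V (int k - 1)"
   using hcomp_upto[of P V j] SymU_mono[OF V, of "int j" "int k - 1"] P by (auto simp: Sym_iff)
 qed
 finally show ?thesis .
qed

lemma hcomp_lin:
 assumes "open V" "P \<in> Sym V" "Q \<in> Sym V"
 shows "hcomp k (\<lambda>x \<xi>. a * P x \<xi> + b * Q x \<xi>) = (\<lambda>x \<xi>. a * hcomp k P x \<xi> + b * hcomp k Q x \<xi>)"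
proof -
 obtain N :: nat where "P \<in> SymU V (int N)" "Q \<in> SymU V (int N)"
  using Sym_common[OF assms] .
 then obtain c d where "P = poly_symbol V (int N) c" "Q = poly_symbol V (int N) d" by (metis SymU_cases)
 then show ?thesis
  by (simp only: poly_symbol_lin hcomp_poly_symbol) (intro arg_cong[of _ _ "poly_symbol V (int k)"] ext, simp)
qed

lemma hcomp_restrict: "hcomp k (restrict_symbol W P) = restrict_symbol W (hcomp k P)"
 by (auto simp: hcomp_def scoeff_def restrict_symbol_def fun_eq_iff iter_pd_const)

lemma hcomp_mono:
 "hcomp k (mono_symbol V u is) = (if length is = k then mono_symbol V u is else (\<lambda>x \<xi>. 0))"
proof -
 have "hcomp k (mono_symbol V u is) = poly_symbol V (int k) (\<lambda>js x. if length js = k \<and> int k \<le> int (length is) then (if js = is then u else (\<lambda>x. 0)) x else 0)"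
  unfolding mono_symbol_poly[OF order_refl] hcomp_poly_symbol ..
 also have "\<dots> = (if length is = k then mono_symbol V u is else (\<lambda>x \<xi>. 0))"
 proof (cases "length is = k")
  case True
  then show ?thesis
   by (simp add: mono_symbol_poly[of "is" "int k"]) (intro arg_cong[of _ _ "poly_symbol V (int k)"] ext, auto)
 qed (auto simp: poly_symbol_def fun_eq_iff intro!: sum.neutral)
 finally show ?thesis .
qed

section \<open>Polynomials in an operator\<close>

definition peval :: "real poly \<Rightarrow> 'a::real_algebra_1 \<Rightarrow> 'a" where
 "peval p a = (\<Sum>i\<le>degree p. coeff p i *\<^sub>R a ^ i)"

lemma peval_altdef: "degree p \<le> N \<Longrightarrow> peval p a = (\<Sum>i\<le>N. coeff p i *\<^sub>R a ^ i)"
 unfolding peval_def by (rule sum.mono_neutral_left) (auto simp: coeff_eq_0)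

lemma peval_pCons: "peval (pCons c p) a = c *\<^sub>R 1 + a * peval p a"
proof -
 have "peval (pCons c p) a = (\<Sum>i\<le>Suc (degree p). coeff (pCons c p) i *\<^sub>R a ^ i)"
  by (rule peval_altdef) (simp add: degree_pCons_le)
 also have "\<dots> = c *\<^sub>R 1 + (\<Sum>i\<le>degree p. coeff p i *\<^sub>R a ^ Suc i)"
  by (subst sum.atMost_Suc_shift) simp
 finally show ?thesis by (simp add: peval_def sum_distrib_left)
qed

lemma peval_0 [simp]: "peval 0 a = 0" and peval_1 [simp]: "peval 1 a = 1"
 by (simp_all add: peval_def)

lemma peval_add: "peval (p + q) a = peval p a + peval q a"
 using peval_altdef[of "p + q" "max (degree p) (degree q)" a] peval_altdef[of p "max (degree p) (degree q)" a]
  peval_altdef[of q "max (degree p) (degree q)" a]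
 by (simp add: degree_add_le scaleR_add_left sum.distrib)

lemma peval_smult: "peval (smult c p) a = c *\<^sub>R peval p a"
 using peval_altdef[of "smult c p" "degree p" a] by (simp add: peval_def degree_smult_le scaleR_sum_right)

lemma peval_mult: "peval (p * q) a = peval p a * peval q a"
 by (induction p) (simp_all add: peval_add peval_smult peval_pCons distrib_right mult.assoc)

lemma peval_linear: "peval [:- c, 1:] a = a - c *\<^sub>R 1"
 by (simp add: peval_pCons)

lemma peval_commute: "a * b = b * a \<Longrightarrow> peval p a * b = b * peval p a"
proof (induction p)
 case (pCons c p)
 then have "a * (peval p a * b) = b * (a * peval p a)" by (metis mult.assoc)
 then show ?case by (simp add: peval_pCons distrib_left distrib_right mult.assoc)
qed simp

lemma shifts_order_peval: "shifts_order F 0 \<Longrightarrow> shifts_order (peval p F) 0"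
proof (induction p)
 case (pCons c p)
 then show ?case
  using shifts_order_mult[of F 0 "peval p F" 0]
  by (simp add: peval_pCons shifts_order_add shifts_order_scaleR shifts_order_one)
qed (simp add: shifts_order_zero)

text \<open>Horner's scheme splits off one factor \<open>F - G\<close>, which lowers the order, and
  the remaining factors do not raise it.\<close>

lemma shifts_order_peval_diff:
 assumes "shifts_order F 0" "shifts_order G 0" "shifts_order (F - G) (-1)"
 shows "shifts_order (peval p F - peval p G) (-1)"
proof (induction p)
 case (pCons c p)
 have eq: "peval (pCons c p) F - peval (pCons c p) G = F * (peval p F - peval p G) + (F - G) * peval p G"
  by (simp add: peval_pCons algebra_simps)
 show ?case unfolding eq
  using shifts_order_mult[OF assms(1) pCons(2)] shifts_order_mult[OF assms(3) shifts_order_peval[OF assms(2)], of p]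
  by (intro shifts_order_add) simp_all
qed (simp add: shifts_order_zero)

text \<open>The Bezout form of coprimality. It passes to products, and \<open>peval\<close> carries
  it over to an identity between operators.\<close>

definition comaximal :: "'a::comm_ring_1 \<Rightarrow> 'a \<Rightarrow> bool" where
 "comaximal p q \<longleftrightarrow> (\<exists>r s. r * p + s * q = 1)"

lemma comaximal_mult:
 assumes "comaximal p q" "comaximal p q'" shows "comaximal p (q * q')"
proof -
 obtain r s r' s' where *: "r * p + s * q = 1" "r' * p + s' * q' = 1"
  using assms unfolding comaximal_def by blast
 have "1 = (r * p + s * q) * (r' * p + s' * q')" using * by simp
 then have "(r * (r' * p + s' * q') + s * q * r') * p + (s * s') * (q * q') = 1"
  by (simp add: algebra_simps)
 then show ?thesis unfolding comaximal_def by blast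
qed

lemma comaximal_sym: "comaximal p q \<Longrightarrow> comaximal q p"
 unfolding comaximal_def by (metis add.commute)

lemma comaximal_prod: "(\<And>i. i \<in> I \<Longrightarrow> comaximal p (f i)) \<Longrightarrow> comaximal p (\<Prod>i\<in>I. f i)"
proof (induction I rule: infinite_finite_induct)
 case (insert i I)
 then show ?case by (simp add: comaximal_mult)
qed (auto simp: comaximal_def intro: exI[of _ 0] exI[of _ 1])

lemma comaximal_linear:
 assumes "a \<noteq> b" shows "comaximal [:- a, 1:] [:- b, 1 :: real:]"
proof -
 define c where "c = 1 / (b - a)"
 have "c * (b - a) = 1" using assms by (simp add: c_def)
 then have "[:c:] * [:- a, 1:] + [:- c:] * [:- b, 1:] = 1"
  by (simp add: one_pCons algebra_simps)
 then show ?thesis unfolding comaximal_def by blast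
qed

lemma hcomp_zero [simp]: "hcomp k (\<lambda>x \<xi>. 0) = (\<lambda>x \<xi>. 0)"
 by (intro ext) (simp add: hcomp_def scoeff_def iter_pd_const)

section \<open>The quantization map on symbols\<close>

locale conformal_weights =
 fixes g h :: "real ^ 'n::finite ^ 'n" and lam \<delta> nd :: real
 assumes g_sym: "g $ i $ j = g $ j $ i" and h_sym: "h $ i $ j = h $ j $ i"
  and g_h: "(\<Sum>k\<in>UNIV. g $ i $ k * h $ k $ j) = (if i = j then 1 else 0)"
  and nd_eq: "nd = real CARD('n)"
  and nonresonant: "\<delta> \<notin> resonances CARD('n)"
begin

sublocale weyl_algebra sX sD sXi sEta g h
 by unfold_locales (fact sop_weyl g_sym h_sym g_h)+

abbreviation Cs where "Cs \<equiv> C0 (real CARD('n) * \<delta>)"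
abbreviation Co where "Co \<equiv> CC (real CARD('n) * \<delta>) (real CARD('n) * lam)"

section \<open>Orders of the Weyl algebra elements and the degree operator\<close>

lemma shifts_order_ops:
 "shifts_order (xl i) 0" "shifts_order (el i) (-1)" "shifts_order (du i) 0" "shifts_order (xiu i) 1"
 "shifts_order x2 0" "shifts_order th 0" "shifts_order aa 1" "shifts_order bb (-1)" "shifts_order EE 0"
 "shifts_order RR 2" "shifts_order TT (-2)" "shifts_order GG 1" "shifts_order DD (-1)"
proof -
 note b = shifts_order_basic
 show 1: "shifts_order (xl i) 0" "shifts_order (el i) (-1)" "shifts_order (du i) 0" "shifts_order (xiu i) 1" for i
  unfolding xl_def el_def du_def xiu_def by (intro shifts_order_sum shifts_order_scaleR b)+
 show "shifts_order x2 0" unfolding x2_def using shifts_order_mult[OF 1(1) b(1)] by (intro shifts_order_sum) simp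
 show "shifts_order th 0" unfolding th_def using shifts_order_mult[OF b(1) b(2)] by (intro shifts_order_sum) simp
 show "shifts_order aa 1" unfolding aa_def using shifts_order_mult[OF b(1) b(3)] by (intro shifts_order_sum) simp
 show "shifts_order bb (-1)" unfolding bb_def using shifts_order_mult[OF 1(1) b(4)] by (intro shifts_order_sum) simp
 show "shifts_order EE 0" unfolding EE_def using shifts_order_mult[OF b(3) b(4)] by (intro shifts_order_sum) simp
 show "shifts_order RR 2" unfolding RR_def using shifts_order_mult[OF 1(4) b(3)] by (intro shifts_order_sum) simp
 show "shifts_order TT (-2)" unfolding TT_def using shifts_order_mult[OF 1(2) b(4)] by (intro shifts_order_sum) simp
 show "shifts_order GG 1" unfolding GG_def using shifts_order_mult[OF 1(4) b(2)] by (intro shifts_order_sum) simp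
 show "shifts_order DD (-1)" unfolding DD_def using shifts_order_mult[OF b(2) b(4)] by (intro shifts_order_sum) simp
qed

lemma shifts_order_C0: "shifts_order (C0 p) 0"
 using shifts_order_mult[OF shifts_order_ops(9,9)] shifts_order_mult[OF shifts_order_ops(10,11)]
 unfolding C0_def
 by (intro shifts_order_add shifts_order_diff shifts_order_scaleR shifts_order_ops shifts_order_one) simp_all

lemma shifts_order_C1: "shifts_order (C1 q) (-1)"
 using shifts_order_mult[OF shifts_order_ops(9,13)] shifts_order_mult[OF shifts_order_ops(12,11)]
 unfolding C1_def
 by (intro shifts_order_add shifts_order_diff shifts_order_scaleR shifts_order_ops shifts_order_one) simp_all

lemma shifts_order_CC: "shifts_order (CC p q) 0"
 unfolding CC_def using shifts_order_mono[OF shifts_order_C1] by (intro shifts_order_add shifts_order_C0) simp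

lemma shifts_order_CC_C0: "shifts_order (CC p q - C0 p) (-1)"
 by (simp add: CC_def shifts_order_C1)

lemma app_EE_mono: "open V \<Longrightarrow> smooth_on V u \<Longrightarrow>
 app EE V (mono_symbol V u is) = (\<lambda>x \<xi>. of_nat (length is) * mono_symbol V u is x \<xi>)"
proof (induction "is")
 case Nil
 then show ?case by (simp add: EE_def app_sum app_basic mono_symbol_loc deriv_xi_mono_Nil)
next
 case (Cons j "is")
 let ?M = "mono_symbol V u is"
 have M: "?M \<in> Sym V" using Cons by auto
 have xi: "mono_symbol V u (j # is) = app (sXi j) V ?M" using M Cons by (simp add: app_basic mult_xi_mono)
 have "EE * sXi j = sXi j * EE + sXi j" by (rule br_D[OF br_EE(3)])
 then have "app (EE * sXi j) V ?M = app (sXi j * EE + sXi j) V ?M" by simp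
 then have "app EE V (app (sXi j) V ?M) = (\<lambda>x \<xi>. app (sXi j) V (app EE V ?M) x \<xi> + app (sXi j) V ?M x \<xi>)" by simp
 also have "\<dots> = (\<lambda>x \<xi>. of_nat (length (j # is)) * app (sXi j) V ?M x \<xi>)"
  using Cons M by (simp add: app_scale algebra_simps)
 finally show ?case by (simp only: xi)
qed

lemma app_EE_hcomp:
 assumes "open V" "P \<in> Sym V"
 shows "app EE V (hcomp k P) = (\<lambda>x \<xi>. of_nat k * hcomp k P x \<xi>)" and "hcomp k (app EE V P) = (\<lambda>x \<xi>. of_nat k * hcomp k P x \<xi>)"
proof -
 have "app EE V (hcomp k P) = (\<lambda>x \<xi>. of_nat k * hcomp k P x \<xi>) \<and> hcomp k (app EE V P) = (\<lambda>x \<xi>. of_nat k * hcomp k P x \<xi>)"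
  using assms(2,1)
 proof (induction rule: Sym_induct)
  case zero
  show ?case by simp
 next
  case (mono u "is")
  have "hcomp k (\<lambda>x \<xi>. of_nat (length is) * mono_symbol V u is x \<xi>) = (\<lambda>x \<xi>. of_nat (length is) * hcomp k (mono_symbol V u is) x \<xi>)"
   using hcomp_lin[OF assms(1) mono_symbol_loc[OF mono] mono_symbol_loc[OF mono], of k "of_nat (length is)" "is" 0] by simp
  then show ?case using mono assms(1) by (auto simp: hcomp_mono app_EE_mono)
 next
  case (add P Q)
  have l: "hcomp k (\<lambda>x \<xi>. P x \<xi> + Q x \<xi>) = (\<lambda>x \<xi>. hcomp k P x \<xi> + hcomp k Q x \<xi>)"
   if "P \<in> Sym V" "Q \<in> Sym V" for P Q
   using hcomp_lin[OF assms(1) that, of k 1 1] by simp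
  show ?case using add assms(1) by (simp add: l app_add algebra_simps)
 qed
 then show "app EE V (hcomp k P) = (\<lambda>x \<xi>. of_nat k * hcomp k P x \<xi>)" "hcomp k (app EE V P) = (\<lambda>x \<xi>. of_nat k * hcomp k P x \<xi>)"
  by simp_all
qed

lemma hcomp_eigen:
 assumes V: "open V" and P: "P \<in> Sym V" and E: "app EE V P = (\<lambda>x \<xi>. of_nat j * P x \<xi>)"
 shows "hcomp k P = (if k = j then P else (\<lambda>x \<xi>. 0))"
proof -
 have z: "hcomp k P = (\<lambda>x \<xi>. 0)" if "k \<noteq> j" for k
 proof (intro ext)
  fix x \<xi>
  have "hcomp k (\<lambda>x \<xi>. of_nat j * P x \<xi>) = (\<lambda>x \<xi>. of_nat j * hcomp k P x \<xi>)"
   using hcomp_lin[OF V P P, of k "of_nat j" 0] by simp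
  then have "of_nat j * hcomp k P x \<xi> = of_nat k * hcomp k P x \<xi>"
   using app_EE_hcomp(2)[OF V P, of k] E by (auto simp: fun_eq_iff)
  then show "hcomp k P x \<xi> = 0" using that by auto
 qed
 obtain N :: nat where N: "P \<in> SymU V (int N)" using Sym_natE[OF P V] .
 then have N': "P \<in> SymU V (int (max N j))" using SymU_mono[OF V, of "int N" "int (max N j)"] by auto
 have "hcomp j P = P"
 proof (intro ext)
  fix x \<xi>
  have "P x \<xi> = (\<Sum>k\<le>max N j. hcomp k P x \<xi>)" using sum_hcomp[OF N'] by (metis (no_types))
  also have "\<dots> = (\<Sum>k\<le>max N j. if k = j then hcomp j P x \<xi> else 0)" by (intro sum.cong refl) (auto simp: z)
  finally show "hcomp j P x \<xi> = P x \<xi>" by simp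
 qed
 then show ?thesis using z by auto
qed

text \<open>With p = n \<delta>, \<open>Gam k\<close> is the value of \<open>C0\<close> on trace
  free symbols of degree k. On the s-th power of the metric times a trace free symbol of degree k -
  2 s, \<open>RR * TT\<close> has the eigenvalue 2 s (n + 2 k - 2 s - 2), which
  \<open>gam k s\<close> subtracts.\<close>

definition Gam :: "real \<Rightarrow> real" where "Gam k = ((nd * \<delta>) - k) * ((nd * \<delta>) - k - nd) + k * (k + nd - 2)"
definition gam :: "nat \<Rightarrow> nat \<Rightarrow> real" where "gam k s = Gam (real k) - 2 * real s * (nd + 2 * real k - 2 * real s - 2)"
definition pk :: "nat \<Rightarrow> real poly" where "pk k = (\<Prod>s<Suc (k div 2). [:- gam k s, 1:])"
definition qk :: "nat \<Rightarrow> real poly" where "qk k = (\<Prod>l<k. pk l)"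
text \<open>A multiple of \<open>qk k\<close> that is 1 modulo \<open>pk k\<close>. At the Casimir
  operator \<open>Co\<close> it kills everything of order below k and changes a symbol of order k in
  lower order only.\<close>

definition uk :: "nat \<Rightarrow> real poly" where "uk k = (SOME u. \<exists>r s. u = s * qk k \<and> r * pk k + u = 1)"

text \<open>In the difference the terms quadratic in \<delta> cancel. What remains is affine in
  \<delta> with slope -2 n (k - l), and its zero is the resonance.\<close>

lemma gam_resonance:
 assumes "l < k" shows "gam k s - gam l t = 2 * real CARD('n) * (real k - real l) * (resonance CARD('n) k l s t - \<delta>)"
proof -
 have n: "real CARD('n) > 0" and kl: "real k - real l > 0" using assms by auto
 have "real CARD('n) * (real k - real l) * resonance CARD('n) k l s t =
   (real k - real l + real t - real s) * (real k + real l - 2 * (real s + real t) + real CARD('n) - 1)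
   + (real s - real t) * (real k + real l + 1) + 2 * (real k * real t - real l * real s)"
  using n kl by (simp add: resonance_def)
 then have "2 * real CARD('n) * (real k - real l) * (resonance CARD('n) k l s t - \<delta>) =
   2 * ((real k - real l + real t - real s) * (real k + real l - 2 * (real s + real t) + real CARD('n) - 1)
   + (real s - real t) * (real k + real l + 1) + 2 * (real k * real t - real l * real s)) - 2 * real CARD('n) * (real k - real l) * \<delta>"
  by (simp add: algebra_simps)
 also have "\<dots> = gam k s - gam l t"
  by (simp add: gam_def Gam_def nd_eq[symmetric] algebra_simps)
 finally show ?thesis by simp
qed

lemma gam_distinct:
 assumes "2 * s \<le> k" "2 * t \<le> l" "k \<noteq> l" shows "gam k s \<noteq> gam l t"
proof -
 have *: "gam k s \<noteq> gam l t" if "l < k" "2 * s \<le> k" "2 * t \<le> l" for k l s t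
 proof -
  have "resonance CARD('n) k l s t \<in> resonances CARD('n)" using that unfolding resonances_def by blast
  then have "resonance CARD('n) k l s t - \<delta> \<noteq> 0" using nonresonant by auto
  then show ?thesis using gam_resonance[OF that(1), of s t] that(1) by auto
 qed
 show ?thesis using *[of l k s t] *[of k l t s] assms by (metis nat_neq_iff)
qed

text \<open>Different degrees share no root by \<open>gam_distinct\<close>, and comaximality of
  linear factors passes to their products.\<close>

lemma uk_ex: "\<exists>r s. uk k = s * qk k \<and> r * pk k + uk k = 1"
proof -
 have "comaximal (pk k) (qk k)"
  unfolding qk_def pk_def
  by (intro comaximal_prod, rule comaximal_sym, intro comaximal_prod, rule comaximal_linear, rule gam_distinct) auto
 then have "\<exists>u r s. u = s * qk k \<and> r * pk k + u = 1" unfolding comaximal_def by blast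
 then show ?thesis unfolding uk_def by (rule someI_ex)
qed

lemma TT_C0: "TT * C0 p = C0 p * TT + (EE + EE + EE + EE + 1 + 1 + 1 + 1
  - (p *\<^sub>R 1 + p *\<^sub>R 1 + p *\<^sub>R 1 + p *\<^sub>R 1) + real CARD('n) *\<^sub>R 1 + real CARD('n) *\<^sub>R 1) * TT"
 by (simp add: C0_def expand_rules)

lemma C0_RR_TT:
 assumes V: "open V" and P: "P \<in> Sym V" and E: "app EE V P = (\<lambda>x \<xi>. of_real k * P x \<xi>)"
 shows "app Cs V P x \<xi> = of_real (Gam k) * P x \<xi> - app RR V (app TT V P) x \<xi>"
proof -
 have "app EE V (\<lambda>x \<xi>. of_real k * P x \<xi>) = (\<lambda>x \<xi>. of_real k * (of_real k * P x \<xi>))"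
  using app_scale[OF V P] E by simp
 then show ?thesis
  by (simp add: C0_def E Gam_def nd_eq[symmetric] app_one[OF V P] algebra_simps)
qed

text \<open>On degree k the shift in \<open>TT_C0\<close> is a number, because after the trace
  \<open>EE\<close> acts by k - 2. Hence moving \<open>TT\<close> past a polynomial in the Casimir
  operator lowers all its roots by this number.\<close>

lemma app_TT_peval:
 fixes a :: "nat \<Rightarrow> real" and m :: nat
 assumes V: "open V" and P: "P \<in> Sym V" and E: "app EE V P = (\<lambda>x \<xi>. of_real k * P x \<xi>)"
 shows "app TT V (app (peval (\<Prod>s<m. [:- a s, 1:]) Cs) V P) =
  app (peval (\<Prod>s<m. [:- (a s - (4 * (k - 2) + 4 - 4 * (real CARD('n) * \<delta>) + 2 * real CARD('n))), 1:]) Cs) V (app TT V P)"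
proof (induction m)
 case (Suc m)
 let ?D = "4 * (k - 2) + 4 - 4 * (real CARD('n) * \<delta>) + 2 * real CARD('n)"
 let ?f = "\<Prod>s<m. [:- a s, 1:]" and ?f' = "\<Prod>s<m. [:- (a s - ?D), 1:]"
 define W where "W = app (peval ?f Cs) V P"
 have W: "W \<in> Sym V" using V P by (simp add: W_def)
 have EC: "Cs * EE = EE * Cs"
  by (simp add: C0_def expand_rules)
 have "app EE V W = app (EE * peval ?f Cs) V P" by (simp add: W_def)
 also have "\<dots> = app (peval ?f Cs * EE) V P" using peval_commute[OF EC] by simp
 also have "\<dots> = (\<lambda>x \<xi>. of_real k * W x \<xi>)" using V P by (simp add: E W_def app_scale)
 finally have EW: "app EE V W = (\<lambda>x \<xi>. of_real k * W x \<xi>)" .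
 have "app (EE * TT) V W = app (TT * EE - (TT + TT)) V W"
  using br_comp(21)[THEN br_D] by (simp add: )
 then have ETW: "app EE V (app TT V W) = (\<lambda>x \<xi>. of_real (k - 2) * app TT V W x \<xi>)"
  using V W by (simp add: EW app_scale algebra_simps)
 have "app TT V (app (peval (\<Prod>s<Suc m. [:- a s, 1:]) Cs) V P) = app (TT * (Cs - a m *\<^sub>R 1)) V W"
  by (simp only: prod.lessThan_Suc mult.commute[of ?f] peval_mult peval_linear W_def app_simps)
 also have "\<dots> = app (Cs - (a m - ?D) *\<^sub>R 1) V (app TT V W)"
  unfolding right_diff_distrib TT_C0 using V W by (simp add: ETW app_one algebra_simps fun_eq_iff)
 also have "app TT V W = app (peval ?f' Cs) V (app TT V P)" using Suc by (simp add: W_def)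
 also have "app (Cs - (a m - ?D) *\<^sub>R 1) V (app (peval ?f' Cs) V (app TT V P)) =
   app (peval (\<Prod>s<Suc m. [:- (a s - ?D), 1:]) Cs) V (app TT V P)"
  by (simp only: prod.lessThan_Suc mult.commute[of ?f'] peval_mult peval_linear app_simps)
 finally show ?case .
qed (use V P in \<open>simp add: app_one\<close>)

text \<open>The Casimir operator acts on homogeneous symbols of degree \<open>k\<close> through \<open>RR * TT\<close> (multiplication by the metric
 after the Laplacian), and \<open>TT\<close> maps \<open>pk k\<close> on degree \<open>k\<close> to \<open>pk (k - 2)\<close> on degree \<open>k - 2\<close>; so no decomposition
 into harmonic components is needed.\<close>

lemma pk_annihilates:
 assumes V: "open V" and "P \<in> SymU V (int k)" and "app EE V P = (\<lambda>x \<xi>. of_nat k * P x \<xi>)"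
 shows "app (peval (pk k) Cs) V P = (\<lambda>x \<xi>. 0)"
 using assms(2,3)
proof (induction k arbitrary: P rule: less_induct)
 case (less k)
 have P: "P \<in> Sym V" using less.prems by (auto simp: Sym_iff)
 have E: "app EE V P = (\<lambda>x \<xi>. of_real (real k) * P x \<xi>)" using less.prems by simp
 have EC: "Cs * EE = EE * Cs"
  by (simp add: C0_def expand_rules)
 \<comment> \<open>All factors of \<open>pk k\<close> except the one for s = 0. Once they have made
   the trace vanish, \<open>C0\<close> acts by \<open>Gam k\<close>, which is the root left
   out.\<close>
 let ?f = "\<Prod>s<k div 2. [:- gam k (Suc s), 1:]"
 define W where "W = app (peval ?f Cs) V P"
 have W: "W \<in> Sym V" using V P by (simp add: W_def)
 have "app EE V W = app (EE * peval ?f Cs) V P" by (simp add: W_def)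
 also have "\<dots> = app (peval ?f Cs * EE) V P" using peval_commute[OF EC] by simp
 also have "\<dots> = (\<lambda>x \<xi>. of_real (real k) * W x \<xi>)" using V P by (simp add: E W_def app_scale)
 finally have EW: "app EE V W = (\<lambda>x \<xi>. of_real (real k) * W x \<xi>)" .
 have TP: "app TT V P \<in> SymU V (int k - 2)"
  using shifts_orderD[OF shifts_order_ops(11) V less.prems(1)] by simp
 have TW: "app TT V W = (\<lambda>x \<xi>. 0)"
 proof (cases "k < 2")
  case True
  then have "app TT V P = (\<lambda>x \<xi>. 0)" using SymU_neg[OF TP] by simp
  moreover have "k div 2 = 0" using True by simp
  ultimately show ?thesis using V P by (simp add: W_def app_one)
 next
  case False
  \<comment> \<open>Taking a trace lowers the degree by two and the power of the metric by one, and
    the shift from \<open>app_TT_peval\<close> is exactly the difference of the corresponding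
    roots.\<close>
  have eq: "gam k (Suc s) - (4 * (real k - 2) + 4 - 4 * (real CARD('n) * \<delta>) + 2 * real CARD('n)) = gam (k - 2) s" for s
   using False by (simp add: gam_def Gam_def nd_eq[symmetric] of_nat_diff algebra_simps)
  have Suc: "k div 2 = Suc ((k - 2) div 2)" using False by presburger
  have "app (EE * TT) V P = app (TT * EE - (TT + TT)) V P"
   using br_comp(21)[THEN br_D] by simp
  then have ETP: "app EE V (app TT V P) = (\<lambda>x \<xi>. of_nat (k - 2) * app TT V P x \<xi>)"
   using V P False by (simp add: E app_scale of_nat_diff algebra_simps)
  have "app TT V W = app (peval (pk (k - 2)) Cs) V (app TT V P)"
   unfolding W_def app_TT_peval[OF V P E] eq pk_def Suc ..
  also have "\<dots> = (\<lambda>x \<xi>. 0)"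
   using less.IH[of "k - 2" "app TT V P"] False TP ETP by (simp add: of_nat_diff)
  finally show ?thesis .
 qed
 have gam0: "gam k 0 = Gam (real k)" by (simp add: gam_def)
 have "pk k = [:- gam k 0, 1:] * ?f" by (simp only: pk_def prod.lessThan_Suc_shift)
 then have "app (peval (pk k) Cs) V P = app (Cs - gam k 0 *\<^sub>R 1) V W"
  by (simp only: peval_mult peval_linear W_def app_simps)
 also have "\<dots> = (\<lambda>x \<xi>. 0)"
  using V W gam0 by (simp add: C0_RR_TT[OF V W EW] TW app_one)
 finally show ?case .
qed

lemma peval_Co_order: "shifts_order (peval f Co) 0"
 by (rule shifts_order_peval[OF shifts_order_CC])

text \<open>On the top component the value of \<open>pk k\<close> at \<open>Cs\<close> vanishes, and
  replacing \<open>Cs\<close> by \<open>Co\<close> changes it by terms one order lower. The rest of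
  P has lower order from the start.\<close>

lemma pk_Co_lowers:
 assumes V: "open V" and P: "P \<in> SymU V (int k)"
 shows "app (peval (pk k) Co) V P \<in> SymU V (int k - 1)"
proof -
 have PL: "P \<in> Sym V" using P by (auto simp: Sym_iff)
 let ?H = "hcomp k P" and ?R = "\<lambda>x \<xi>. P x \<xi> - hcomp k P x \<xi>"
 have H: "?H \<in> SymU V (int k)" by (rule hcomp_upto[OF PL])
 have R: "?R \<in> SymU V (int k - 1)" by (rule hcomp_top[OF P V])
 then have RL: "?R \<in> Sym V" by (auto simp: Sym_iff)
 have "app (peval (pk k) Co - peval (pk k) Cs) V ?H \<in> SymU V (int k - 1)"
  using shifts_orderD[OF shifts_order_peval_diff[OF shifts_order_CC shifts_order_C0 shifts_order_CC_C0] V H] by simp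
 then have "app (peval (pk k) Co) V ?H \<in> SymU V (int k - 1)"
  using pk_annihilates[OF V H] app_EE_hcomp(1)[OF V PL, of k] by simp
 moreover have "app (peval (pk k) Co) V ?R \<in> SymU V (int k - 1)"
  using shifts_orderD[OF peval_Co_order V R] by simp
 moreover have "app (peval (pk k) Co) V P = (\<lambda>x \<xi>. app (peval (pk k) Co) V ?H x \<xi> + app (peval (pk k) Co) V ?R x \<xi>)"
  using app_add[OF V hcomp_loc[OF PL] RL, of "peval (pk k) Co" k] by simp
 ultimately show ?thesis by (simp add: SymU_add[OF V])
qed

text \<open>Each factor lowers the order by one, the one of highest degree acting first; k of them
  bring a symbol of order k - 1 down to order -1, which is zero.\<close>

lemma qk_kills:
 assumes V: "open V" and "P \<in> SymU V (int k - 1)"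
 shows "app (peval (qk k) Co) V P = (\<lambda>x \<xi>. 0)"
 using assms(2)
proof (induction k arbitrary: P)
 case 0
 then have "P = (\<lambda>x \<xi>. 0)" using SymU_neg by force
 then show ?case by simp
next
 case (Suc k)
 have "app (peval (qk (Suc k)) Co) V P = app (peval (qk k) Co) V (app (peval (pk k) Co) V P)"
  by (simp add: qk_def peval_mult)
 then show ?case using Suc.IH[OF pk_Co_lowers[OF V]] Suc.prems by simp
qed

lemma uk_kills:
 assumes V: "open V" and "P \<in> SymU V (int k - 1)"
 shows "app (peval (uk k) Co) V P = (\<lambda>x \<xi>. 0)"
proof -
 obtain r s where "uk k = s * qk k" using uk_ex by blast
 then show ?thesis using qk_kills[OF assms] by (simp add: peval_mult)
qed

lemma uk_pk:
 assumes V: "open V" and "P \<in> Sym V"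
 obtains r where "app (peval r Co) V (app (peval (pk k) Co) V P) = (\<lambda>x \<xi>. P x \<xi> - app (peval (uk k) Co) V P x \<xi>)"
proof -
 obtain r where "r * pk k + uk k = 1" using uk_ex by blast
 then have "peval r Co * peval (pk k) Co + peval (uk k) Co = 1"
  by (metis peval_1 peval_add peval_mult)
 then have "app (peval r Co * peval (pk k) Co) V P = app (1 - peval (uk k) Co) V P" by (metis add_diff_cancel_right')
 then show ?thesis using that[of r] by (simp add: app_one[OF assms])
qed

lemma uk_top:
 assumes V: "open V" and P: "P \<in> SymU V (int k)"
 shows "(\<lambda>x \<xi>. app (peval (uk k) Co) V P x \<xi> - P x \<xi>) \<in> SymU V (int k - 1)"
proof -
 have PL: "P \<in> Sym V" using P by (auto simp: Sym_iff)
 obtain r where r: "app (peval r Co) V (app (peval (pk k) Co) V P) = (\<lambda>x \<xi>. P x \<xi> - app (peval (uk k) Co) V P x \<xi>)"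
  using uk_pk[OF V PL] .
 have "app (peval r Co) V (app (peval (pk k) Co) V P) \<in> SymU V (int k - 1)"
  using shifts_orderD[OF peval_Co_order V pk_Co_lowers[OF V P]] by simp
 then show ?thesis using SymU_scale[OF V, of _ "int k - 1" "-1"] unfolding r by fastforce
qed

end

section \<open>The local quantization map: bijectivity, equivariance and uniqueness\<close>

context conformal_weights
begin

text \<open>Summing over the nonzero components keeps the sum finite without fixing an order, so
  that \<open>Qs V\<close> is one map on all symbols.\<close>

definition Qs :: "(real ^ 'n) set \<Rightarrow> 'n sym \<Rightarrow> 'n sym" where
 "Qs V P = (\<lambda>x \<xi>. \<Sum>k | hcomp k P \<noteq> (\<lambda>x \<xi>. 0). app (peval (uk k) Co) V (hcomp k P) x \<xi>)"

lemma Qs_eq: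
 assumes "P \<in> SymU V (int N)"
 shows "Qs V P = (\<lambda>x \<xi>. \<Sum>k\<le>N. app (peval (uk k) Co) V (hcomp k P) x \<xi>)"
proof (intro ext)
 fix x \<xi>
 have "hcomp k P = (\<lambda>x \<xi>. 0)" if "\<not> k \<le> N" for k
  using hcomp_above[OF assms] that by simp
 then show "Qs V P x \<xi> = (\<Sum>k\<le>N. app (peval (uk k) Co) V (hcomp k P) x \<xi>)"
  unfolding Qs_def by (intro sum.mono_neutral_left) auto
qed

lemma Qs_zero: "Qs V (\<lambda>x \<xi>. 0) = (\<lambda>x \<xi>. 0)"
 by (simp add: Qs_def)

lemma Qs_diff:
 assumes V: "open V" and P: "P \<in> SymU V k"
 shows "(\<lambda>x \<xi>. Qs V P x \<xi> - P x \<xi>) \<in> SymU V (k - 1)"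
proof (cases "k < 0")
 case True
 then have "P = (\<lambda>x \<xi>. 0)" by (rule SymU_neg[OF P])
 then show ?thesis by (simp add: Qs_zero)
next
 case False
 then obtain N where k: "k = int N" by (metis not_less zero_le_imp_eq_int)
 note P = P[unfolded k]
 have "P x \<xi> = (\<Sum>k\<le>N. hcomp k P x \<xi>)" for x \<xi> using sum_hcomp[OF P] by (metis (no_types))
 then have "(\<lambda>x \<xi>. Qs V P x \<xi> - P x \<xi>) = (\<lambda>x \<xi>. \<Sum>k\<le>N. app (peval (uk k) Co) V (hcomp k P) x \<xi> - hcomp k P x \<xi>)"
  unfolding Qs_eq[OF P] sum_subtractf by simp
 also have "\<dots> \<in> SymU V (k - 1)"
 proof (rule SymU_sum[OF V])
  fix j assume "j \<in> {..N}"
  then have "int j - 1 \<le> k - 1" by (simp add: k)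
  moreover have "hcomp j P \<in> SymU V (int j)" using P by (intro hcomp_upto) (auto simp: Sym_iff)
  ultimately show "(\<lambda>x \<xi>. app (peval (uk j) Co) V (hcomp j P) x \<xi> - hcomp j P x \<xi>) \<in> SymU V (k - 1)"
   using uk_top[OF V, of "hcomp j P" j] SymU_mono[OF V] by blast
 qed
 finally show ?thesis .
qed

lemma Qs_upto:
 assumes V: "open V" and P: "P \<in> SymU V k" shows "Qs V P \<in> SymU V k"
proof -
 have "(\<lambda>x \<xi>. Qs V P x \<xi> - P x \<xi>) \<in> SymU V k"
  using Qs_diff[OF assms] SymU_mono[OF V, of "k - 1" k] by auto
 from SymU_add[OF V this P] show ?thesis by simp
qed

lemma Qs_loc: "open V \<Longrightarrow> P \<in> Sym V \<Longrightarrow> Qs V P \<in> Sym V"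
 unfolding Sym_iff using Qs_upto by blast

lemma Qs_lin:
 assumes V: "open V" and P: "P \<in> Sym V" "P' \<in> Sym V"
 shows "Qs V (\<lambda>x \<xi>. a * P x \<xi> + b * P' x \<xi>) = (\<lambda>x \<xi>. a * Qs V P x \<xi> + b * Qs V P' x \<xi>)"
proof -
 obtain N :: nat where N: "P \<in> SymU V (int N)" "P' \<in> SymU V (int N)"
  using Sym_common[OF assms] .
 show ?thesis
  unfolding Qs_eq[OF N(1)] Qs_eq[OF N(2)] Qs_eq[OF SymU_lin[OF V N]] hcomp_lin[OF V P]
  using P by (simp add: app_lin[OF V] sum.distrib sum_distrib_left)
qed

lemma Qs_restrict:
 assumes "open V" "open W" "W \<subseteq> V" "P \<in> Sym V"
 shows "Qs W (restrict_symbol W P) = restrict_symbol W (Qs V P)"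
proof -
 obtain N :: nat where N: "P \<in> SymU V (int N)" using Sym_natE[OF assms(4,1)] .
 show ?thesis
  unfolding Qs_eq[OF N] Qs_eq[OF restrict_SymU[OF N assms(3)]] hcomp_restrict
  using assms by (simp add: app_restrict) (simp add: restrict_symbol_def fun_eq_iff)
qed

text \<open>\<open>Qs\<close> is the identity up to lower order, so R is almost its own preimage and
  the defect is corrected recursively. Orders are written \<open>int m - 1\<close> to let the
  induction start at order -1, where only zero is left.\<close>

lemma Qs_surj:
 assumes V: "open V" and R: "R \<in> SymU V k"
 shows "\<exists>P\<in>SymU V k. Qs V P = R"
proof -
 have "\<exists>P\<in>SymU V (int m - 1). Qs V P = R" if "R \<in> SymU V (int m - 1)" for m R
  using that
 proof (induction m arbitrary: R)
  case 0
  then have "R = (\<lambda>x \<xi>. 0)" using SymU_neg by force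
  then show ?case using Qs_zero zero_SymU by blast
 next
  case (Suc m)
  let ?S = "\<lambda>x \<xi>. R x \<xi> - Qs V R x \<xi>"
  have "?S \<in> SymU V (int m - 1)"
   using SymU_scale[OF V Qs_diff[OF V Suc.prems], of "-1"] by simp
  then obtain P where P: "P \<in> SymU V (int m - 1)" "Qs V P = ?S" using Suc.IH by blast
  have P': "P \<in> SymU V (int (Suc m) - 1)"
   using P(1) SymU_mono[OF V, of "int m - 1" "int (Suc m) - 1"] by auto
  have "Qs V (\<lambda>x \<xi>. R x \<xi> + P x \<xi>) = R"
   using Qs_lin[OF V, of R P 1 1] Suc.prems P by (auto simp: Sym_iff)
  then show ?case using SymU_add[OF V Suc.prems P'] by blast
 qed
 from this[of R "nat (k + 1)"] show ?thesis
 proof (cases "k < 0")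
  case True
  then have "R = (\<lambda>x \<xi>. 0)" using R SymU_neg by blast
  then show ?thesis using Qs_zero zero_SymU by blast
 qed (use R in auto)
qed

lemma Qs_inj:
 assumes V: "open V" and P: "P \<in> Sym V" and Q: "Qs V P = (\<lambda>x \<xi>. 0)"
 shows "P = (\<lambda>x \<xi>. 0)"
proof -
 have "P = (\<lambda>x \<xi>. 0)" if "P \<in> SymU V (int m - 1)" for m
  using that
 proof (induction m)
  case 0
  then show ?case using SymU_neg by force
 next
  case (Suc m)
  have "(\<lambda>x \<xi>. - P x \<xi>) \<in> SymU V (int m - 1)" using Qs_diff[OF V Suc.prems] by (simp add: Q)
  from SymU_scale[OF V this, of "-1"] show ?case using Suc.IH by simp
 qed
 moreover obtain m :: nat where "P \<in> SymU V (int m)" using Sym_natE[OF P V] .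
 ultimately show ?thesis by (metis add_diff_cancel_left' of_nat_Suc)
qed

lemma Qs_inject:
 assumes "open V" "P \<in> Sym V" "P' \<in> Sym V" "Qs V P = Qs V P'"
 shows "P = P'"
proof -
 have "Qs V (\<lambda>x \<xi>. 1 * P x \<xi> + (-1) * P' x \<xi>) = (\<lambda>x \<xi>. 0)"
  using Qs_lin[OF assms(1-3), of 1 "-1"] assms(4) by simp
 from Qs_inj[OF assms(1) Sym_lin[OF assms(1-3)] this] show ?thesis by (simp add: fun_eq_iff)
qed

lemma bij_betw_Qs:
 assumes "open V" shows "bij_betw (Qs V) (Sym V) (Sym V)"
 unfolding bij_betw_def
proof
 show "inj_on (Qs V) (Sym V)" using Qs_inject[OF assms] by (auto intro: inj_onI)
 show "Qs V ` Sym V = Sym V"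
 proof
  show "Qs V ` Sym V \<subseteq> Sym V" using Qs_loc[OF assms] by blast
  show "Sym V \<subseteq> Qs V ` Sym V"
   unfolding loc_symbol_def using Qs_surj[OF assms] by blast
 qed
qed

lemma app_sum_arg:
 assumes "open V" "finite I" "\<And>i. i \<in> I \<Longrightarrow> P i \<in> Sym V"
 shows "app F V (\<lambda>x \<xi>. \<Sum>i\<in>I. P i x \<xi>) = (\<lambda>x \<xi>. \<Sum>i\<in>I. app F V (P i) x \<xi>)
   \<and> hcomp k (\<lambda>x \<xi>. \<Sum>i\<in>I. P i x \<xi>) = (\<lambda>x \<xi>. \<Sum>i\<in>I. hcomp k (P i) x \<xi>)
   \<and> (\<lambda>x \<xi>. \<Sum>i\<in>I. P i x \<xi>) \<in> Sym V"
 using assms(2,3)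
proof (induction I)
 case (insert i I)
 then have *: "P i \<in> Sym V" "(\<lambda>x \<xi>. \<Sum>i\<in>I. P i x \<xi>) \<in> Sym V" by auto
 show ?case using insert app_lin[OF assms(1) *, of F 1 1] hcomp_lin[OF assms(1) *, of k 1 1] Sym_add[OF assms(1) *]
  by simp
qed simp

text \<open>An operator commuting with \<open>EE\<close> preserves its eigenspaces, which are the
  homogeneous symbols of a fixed degree.\<close>

lemma hcomp_app:
 assumes V: "open V" and P: "P \<in> Sym V" and L: "EE * L = L * EE"
 shows "hcomp k (app L V P) = app L V (hcomp k P)"
proof -
 obtain N' :: nat where N': "P \<in> SymU V (int N')" using Sym_natE[OF P V] .
 define N where "N = max N' k"
 have N: "P \<in> SymU V (int N)" using N' SymU_mono[OF V, of "int N'" "int N"] by (auto simp: N_def)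
 have E: "app EE V (app L V (hcomp j P)) = (\<lambda>x \<xi>. of_nat j * app L V (hcomp j P) x \<xi>)" for j
 proof -
  have "app EE V (app L V (hcomp j P)) = app (L * EE) V (hcomp j P)" by (simp flip: L)
  then show ?thesis using app_EE_hcomp(1)[OF V P] P V by (simp add: app_scale)
 qed
 have "app L V P = app L V (\<lambda>x \<xi>. \<Sum>j\<le>N. hcomp j P x \<xi>)" using sum_hcomp[OF N] by simp
 also have "\<dots> = (\<lambda>x \<xi>. \<Sum>j\<le>N. app L V (hcomp j P) x \<xi>)"
  using app_sum_arg[OF V, of "{..N}" "\<lambda>j. hcomp j P" L] P by simp
 finally have "hcomp k (app L V P) = (\<lambda>x \<xi>. \<Sum>j\<le>N. hcomp k (app L V (hcomp j P)) x \<xi>)"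
  using app_sum_arg[OF V, of "{..N}" "\<lambda>j. app L V (hcomp j P)" L k] P V by simp
 also have "\<dots> = (\<lambda>x \<xi>. \<Sum>j\<le>N. if j = k then app L V (hcomp k P) x \<xi> else 0)"
  using hcomp_eigen[OF V _ E] P V by (intro ext sum.cong refl) auto
 also have "\<dots> = app L V (hcomp k P)" by (simp add: N_def)
 finally show ?thesis .
qed

text \<open>\<open>L'\<close> passes through \<open>uk k\<close> because it commutes with the
  Casimir operator \<open>Co\<close>. On degree k it differs from \<open>L\<close> by terms of lower
  order, and these are killed by \<open>uk k\<close>.\<close>

lemma Qs_equivariant:
 assumes V: "open V" and P: "P \<in> Sym V"
  and L: "shifts_order L 0" "EE * L = L * EE" and L': "shifts_order (L' - L) (-1)" "Co * L' = L' * Co"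
 shows "Qs V (app L V P) = app L' V (Qs V P)"
proof -
 obtain N :: nat where N: "P \<in> SymU V (int N)" using Sym_natE[OF P V] .
 have LN: "app L V P \<in> SymU V (int N)" using shifts_orderD[OF L(1) V N] by simp
 have "app L' V (app (peval (uk k) Co) V (hcomp k P)) = app (peval (uk k) Co) V (app L V (hcomp k P))" for k
 proof -
  have H: "hcomp k P \<in> Sym V" using P by simp
  have "app L' V (app (peval (uk k) Co) V (hcomp k P)) = app (peval (uk k) Co * L') V (hcomp k P)"
   by (simp add: peval_commute[OF L'(2)])
  also have "L' = L + (L' - L)" by simp
  also have "app (peval (uk k) Co * (L + (L' - L))) V (hcomp k P) = (\<lambda>x \<xi>. app (peval (uk k) Co) V (app L V (hcomp k P)) x \<xi>
    + app (peval (uk k) Co) V (app (L' - L) V (hcomp k P)) x \<xi>)"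
   using V H by (simp only: distrib_left app_simps)
  also have "app (peval (uk k) Co) V (app (L' - L) V (hcomp k P)) = (\<lambda>x \<xi>. 0)"
   using shifts_orderD[OF L'(1) V hcomp_upto[OF P, of k]] by (intro uk_kills[OF V]) simp
  finally show ?thesis by simp
 qed
 then show ?thesis
  unfolding Qs_eq[OF N] Qs_eq[OF LN] hcomp_app[OF V P L(2)]
  using conjunct1[OF app_sum_arg[OF V, of "{..N}" "\<lambda>k. app (peval (uk k) Co) V (hcomp k P)" L']] P V by simp
qed

lemma shifts_order_gens:
 "shifts_order (MM i j) 0" "shifts_order (ee p) 0" "shifts_order (K0 p m) 0" "shifts_order (K1 q m) (-1)"
proof -
 note b = shifts_order_basic and o = shifts_order_ops
 show "shifts_order (MM i j) 0" unfolding MM_def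
  using shifts_order_mult[OF o(1) b(2)] shifts_order_mult[OF b(3) o(2)]
  by (intro shifts_order_add shifts_order_diff) simp_all
 show "shifts_order (ee p) 0" unfolding ee_def
  by (intro shifts_order_add shifts_order_diff shifts_order_scaleR shifts_order_one o)
 show "shifts_order (K0 p m) 0" unfolding K0_def
  using shifts_order_mult[OF o(5) b(2)] shifts_order_mult[OF o(1) o(6)] shifts_order_mult[OF b(3) o(8)]
   shifts_order_mult[OF o(7) o(2)] shifts_order_mult[OF o(1) o(9)]
  by (intro shifts_order_add shifts_order_diff shifts_order_scaleR o) simp_all
 show "shifts_order (K1 q m) (-1)" unfolding K1_def
  using shifts_order_mult[OF o(9) o(2)] shifts_order_mult[OF b(3) o(11)]
  by (intro shifts_order_add shifts_order_diff shifts_order_scaleR o) simp_all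
qed

lemma EE_comm: "EE * sD m = sD m * EE" "EE * ee p = ee p * EE" "EE * MM i j = MM i j * EE" "EE * K0 p m = K0 p m * EE"
proof -
 show "EE * MM i j = MM i j * EE" using br_MM(1)[of i j] by (simp add: br_def)
 show "EE * sD m = sD m * EE" "EE * ee p = ee p * EE"  "EE * K0 p m = K0 p m * EE"
  by (simp_all add: ee_def K0_def expand_rules)
qed

lemma Qs_generators:
 assumes "open V" "P \<in> Sym V"
 shows "Qs V (app (sD m) V P) = app (sD m) V (Qs V P)"
  "Qs V (app (ee p) V P) = app (ee p) V (Qs V P)"
  "Qs V (app (MM i j) V P) = app (MM i j) V (Qs V P)"
  "Qs V (app (K0 (real CARD('n) * \<delta>) m) V P) = app (KK (real CARD('n) * \<delta>) (real CARD('n) * lam) m) V (Qs V P)"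
 by (rule Qs_equivariant[OF assms shifts_order_basic(2) EE_comm(1)], simp_all add: shifts_order_zero CC_d,
   rule Qs_equivariant[OF assms shifts_order_gens(2) EE_comm(2)], simp_all add: shifts_order_zero CC_ee,
   rule Qs_equivariant[OF assms shifts_order_gens(1) EE_comm(3)], simp_all add: shifts_order_zero CC_MM,
   rule Qs_equivariant[OF assms shifts_order_gens(3) EE_comm(4)], simp_all add: KK_def shifts_order_gens CC_KK[unfolded KK_def])

text \<open>A acts at the source, where the module is that of symbols, and B at the target, where it
  is that of operators. F lives over the single set V. The relation passes to sums, products and
  multiples of pairs, hence to the Casimir elements.\<close>

definition intertwines :: "(real ^ 'n) set \<Rightarrow> ('n sym \<Rightarrow> 'n sym) \<Rightarrow>
  'n sop \<Rightarrow> 'n sop \<Rightarrow> bool" where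
 "intertwines V F A B \<longleftrightarrow> (\<forall>P\<in>Sym V. F (app A V P) = app B V (F P))"

text \<open>Such a map intertwines the Casimir operators, so on degree \<open>k\<close> it lands in the kernel of \<open>pk k\<close>, like \<^const>\<open>Qs\<close>;
 the difference of the two has lower order, where \<open>pk k\<close> is invertible.\<close>

lemma Qs_unique:
 assumes V: "open V" and F_loc: "\<And>P. P \<in> Sym V \<Longrightarrow> F P \<in> Sym V"
  and F_lin: "\<And>P Q a b. P \<in> Sym V \<Longrightarrow> Q \<in> Sym V \<Longrightarrow>
    F (\<lambda>x \<xi>. a * P x \<xi> + b * Q x \<xi>) = (\<lambda>x \<xi>. a * F P x \<xi> + b * F Q x \<xi>)"
  and gens: "\<And>m. intertwines V F (sD m) (sD m)" "intertwines V F (ee (real CARD('n) * \<delta>)) (ee (real CARD('n) * \<delta>))"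
   "\<And>i j. intertwines V F (MM i j) (MM i j)"
   "\<And>m. intertwines V F (K0 (real CARD('n) * \<delta>) m) (KK (real CARD('n) * \<delta>) (real CARD('n) * lam) m)"
  and P: "P \<in> Sym V"
  and top: "\<And>k. (\<lambda>x \<xi>. F (hcomp k P) x \<xi> - hcomp k P x \<xi>) \<in> SymU V (int k - 1)"
 shows "F P = Qs V P"
proof -
 have i_add: "intertwines V F (A + B) (A' + B')" if "intertwines V F A A'" "intertwines V F B B'" for A B A' B'
  using that V F_lin[of "app A V _" "app B V _" 1 1] by (simp add: intertwines_def)
 have i_scale: "intertwines V F (r *\<^sub>R A) (r *\<^sub>R A')" if "intertwines V F A A'" for A A' r
  unfolding intertwines_def
 proof
  fix P assume P: "P \<in> Sym V"
  then show "F (app (r *\<^sub>R A) V P) = app (r *\<^sub>R A') V (F P)"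
   using that V F_lin[of "app A V P" "app A V P" "of_real r" 0] by (simp add: intertwines_def)
 qed
 have i_diff: "intertwines V F (A - B) (A' - B')" if "intertwines V F A A'" "intertwines V F B B'" for A B A' B'
  using i_add[OF that(1) i_scale[OF that(2), of "-1"]] by simp
 have i_mult: "intertwines V F (A * B) (A' * B')" if "intertwines V F A A'" "intertwines V F B B'" for A B A' B'
  using that V by (simp add: intertwines_def)
 have F0: "F (\<lambda>x \<xi>. 0) = (\<lambda>x \<xi>. 0)" using F_lin[of "\<lambda>x \<xi>. 0" "\<lambda>x \<xi>. 0" 0 0] by simp
 have i_zero: "intertwines V F 0 0" by (simp add: intertwines_def F0)
 have i_one: "intertwines V F 1 1" by (simp add: intertwines_def app_one V F_loc)
 have i_sum: "intertwines V F (\<Sum>i\<in>I. A i) (\<Sum>i\<in>I. A' i)" if "\<And>i. intertwines V F (A i) (A' i)" for I :: "'n set" and A A'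
  by (induction I rule: infinite_finite_induct) (simp_all add: i_zero i_add that)
 \<comment> \<open>Both Casimir operators are the same expression in corresponding
   generators.\<close>
 have "intertwines V F Cs Co"
  unfolding casimir_op[symmetric] casimir_symbol[symmetric]
  by (intro i_add i_diff i_scale i_sum i_mult gens)
 then have i_peval: "intertwines V F (peval f Cs) (peval f Co)" for f
  by (induction f) (simp_all add: peval_pCons i_zero i_add i_scale i_one i_mult)
 have eq: "F (hcomp k P) = app (peval (uk k) Co) V (hcomp k P)" for k
 proof -
  let ?H = "hcomp k P" and ?u = "app (peval (uk k) Co) V (hcomp k P)"
  have H: "?H \<in> Sym V" "?H \<in> SymU V (int k)" using P by (simp_all add: hcomp_upto)
  have "app (peval (pk k) Co) V (F ?H) = F (app (peval (pk k) Cs) V ?H)"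
   using i_peval[of "pk k"] H by (simp add: intertwines_def)
  also have "\<dots> = (\<lambda>x \<xi>. 0)"
   using pk_annihilates[OF V H(2) app_EE_hcomp(1)[OF V P]] F0 by simp
  finally have z1: "app (peval (pk k) Co) V (F ?H) = (\<lambda>x \<xi>. 0)" .
  \<comment> \<open>Polynomials in one operator commute: \<open>pk k\<close> first lowers the order
    of the component, and \<open>uk k\<close> then kills it.\<close>
  have "app (peval (pk k) Co) V ?u = app (peval (uk k) Co) V (app (peval (pk k) Co) V ?H)"
   by (simp only: app_simps(6)[symmetric] peval_mult[symmetric] mult.commute[of "pk k"])
  also have "\<dots> = (\<lambda>x \<xi>. 0)" by (rule uk_kills[OF V pk_Co_lowers[OF V H(2)]])
  finally have z2: "app (peval (pk k) Co) V ?u = (\<lambda>x \<xi>. 0)" .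
  define D where "D = (\<lambda>x \<xi>. F ?H x \<xi> - ?u x \<xi>)"
  have "D = (\<lambda>x \<xi>. (F ?H x \<xi> - ?H x \<xi>) - (?u x \<xi> - ?H x \<xi>))" by (simp add: D_def)
  also have "\<dots> \<in> SymU V (int k - 1)"
   by (rule SymU_diff[OF V top uk_top[OF V H(2)]])
  finally have D: "D \<in> SymU V (int k - 1)" .
  then have DL: "D \<in> Sym V" by (auto simp: Sym_iff)
  have d1: "app (peval (pk k) Co) V D = (\<lambda>x \<xi>. 0)"
   unfolding D_def using app_diff[OF V, of "F ?H" ?u] F_loc[OF H(1)] H V by (simp add: z1 z2)
  have d2: "app (peval (uk k) Co) V D = (\<lambda>x \<xi>. 0)" by (rule uk_kills[OF V D])
  \<comment> \<open>On D both summands of the Bezout identity vanish: \<open>pk k\<close> because D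
    is a difference of two elements of its kernel, \<open>uk k\<close> because D has order below
    k.\<close>
  obtain r where "app (peval r Co) V (app (peval (pk k) Co) V D) = (\<lambda>x \<xi>. D x \<xi> - app (peval (uk k) Co) V D x \<xi>)"
   using uk_pk[OF V DL] .
  then have "D = (\<lambda>x \<xi>. 0)" unfolding d1 d2 by simp
  then show ?thesis by (simp add: D_def fun_eq_iff)
 qed
 have F_sum: "F (\<lambda>x \<xi>. \<Sum>k\<in>I. hcomp k P x \<xi>) = (\<lambda>x \<xi>. \<Sum>k\<in>I. F (hcomp k P) x \<xi>)" if "finite I" for I
  using that
 proof (induction I)
  case (insert k I)
  have "(\<lambda>x \<xi>. \<Sum>k\<in>I. hcomp k P x \<xi>) \<in> Sym V"
   using app_sum_arg[OF V insert(1), of "\<lambda>k. hcomp k P"] P by simp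
  then show ?case using insert F_lin[of "hcomp k P" "\<lambda>x \<xi>. \<Sum>k\<in>I. hcomp k P x \<xi>" 1 1] P by simp
 qed (simp add: F0)
 obtain N :: nat where N: "P \<in> SymU V (int N)" using Sym_natE[OF P V] .
 have "F P = F (\<lambda>x \<xi>. \<Sum>k\<le>N. hcomp k P x \<xi>)" using sum_hcomp[OF N] by simp
 also have "\<dots> = Qs V P" unfolding F_sum[OF finite_atMost] Qs_eq[OF N] eq ..
 finally show ?thesis .
qed

end

section \<open>Lie derivatives along the conformal generators\<close>

lemma smooth_on_lower_index [intro!]: "open V \<Longrightarrow> smooth_on V (\<lambda>x. lower_index g x i)"
 unfolding lower_index_def by auto

lemma pd_lower_index [simp]: "pd k (\<lambda>x. lower_index g x i) x = g $ i $ k"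
proof -
 have "bounded_linear (\<lambda>x. lower_index g x i)"
  unfolding lower_index_def by (intro bounded_linear_sum bounded_linear_const_mult bounded_linear_vec_nth)
 from pd_eqI[OF bounded_linear.has_derivative[OF this has_derivative_ident]] show ?thesis
  by (simp add: lower_index_def axis_def if_distrib[of "\<lambda>t. _ * t"] cong: if_cong)
qed

lemma differentiable_coord: "(\<lambda>x :: real ^ 'n::finite. x $ i) differentiable (at x)"
 and differentiable_lower: "(\<lambda>x :: real ^ 'n::finite. lower_index g x i) differentiable (at x)"
 by (rule smooth_on_differentiable[of UNIV]; auto)+

lemma pd_vec: "smooth_on UNIV X \<Longrightarrow> pd k X x $ j = pd k (\<lambda>x. X x $ j) x" for X :: "real ^ 'n::finite \<Rightarrow> real ^ 'n"
 by (rule pd_nth[symmetric]) (auto intro: smooth_on_differentiable)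

lemma smooth_on_generator:
 assumes "X \<in> conformal_generators g" shows "smooth_on UNIV X"
proof -
 have "smooth_on UNIV (vf_inv g m)" for m
  unfolding vf_inv_def by (intro smooth_on_vecI) (auto simp: axis_def)
 moreover have "smooth_on UNIV (vf_rot g i j)" for i j
  unfolding vf_rot_def by (intro smooth_on_vecI) auto
 moreover have "smooth_on UNIV (vf_transl m)" for m :: 'a
 proof -
  have "vf_transl m = (\<lambda>x. axis m 1)" by (simp add: vf_transl_def fun_eq_iff)
  then show ?thesis by simp
 qed
 moreover have "smooth_on UNIV (vf_euler :: real ^ 'a \<Rightarrow> _)"
 proof -
  have "(vf_euler :: real ^ 'a \<Rightarrow> _) = (\<lambda>x. x)" by (simp add: vf_euler_def fun_eq_iff)
  then show ?thesis by (metis smooth_on_ident)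
 qed
 ultimately show ?thesis using assms unfolding conformal_generators_def by auto
qed

lemma pd_vf_transl: "pd k (vf_transl m) x = 0"
 by (simp add: vf_transl_def[abs_def])

lemma pd_vf_euler: "pd k vf_euler x = axis k 1"
 using pd_eqI[OF has_derivative_ident, of k x] by (simp add: vf_euler_def[abs_def])

lemma pd_vf_rot: "pd k (vf_rot g i j) x = g $ i $ k *\<^sub>R axis j 1 - g $ j $ k *\<^sub>R axis i 1"
proof -
 have "pd k (vf_rot g i j) x $ l = g $ i $ k * axis j 1 $ l - g $ j $ k * axis i 1 $ l" for l
 proof -
  have lin: "pd k (\<lambda>x. c * lower_index g x i) x = c * g $ i $ k" for c i
   using pd_bounded_linear[OF bounded_linear_mult_right differentiable_lower, of k c g i x] by simp
  have "pd k (vf_rot g i j) x $ l = pd k (\<lambda>x. vf_rot g i j x $ l) x"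
   by (rule pd_vec[OF smooth_on_generator]) (auto simp: conformal_generators_def)
  also have "(\<lambda>x. vf_rot g i j x $ l) = (\<lambda>x. axis j 1 $ l * lower_index g x i + (- (axis i 1 $ l)) * lower_index g x j)"
   by (simp add: vf_rot_def fun_eq_iff)
  also have "pd k \<dots> x = axis j 1 $ l * g $ i $ k + (- (axis i 1 $ l)) * g $ j $ k"
   unfolding lin[symmetric] by (rule pd_add) (auto intro!: smooth_on_differentiable[of UNIV])
  finally show ?thesis by simp
 qed
 then show ?thesis by (simp add: vec_eq_iff)
qed

lemma pd_vf_inv:
 assumes sym: "\<And>i j. g $ i $ j = g $ j $ i"
 shows "pd k (vf_inv g m) x = (2 * lower_index g x k) *\<^sub>R axis m 1 - (2 * g $ m $ k) *\<^sub>R x - (2 * lower_index g x m) *\<^sub>R axis k 1"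
proof -
 let ?q = "\<lambda>x. \<Sum>j\<in>UNIV. lower_index g x j * x $ j"
 have "pd k ?q x = (\<Sum>j\<in>UNIV. pd k (\<lambda>x. lower_index g x j * x $ j) x)"
  by (rule pd_sum) (auto intro!: smooth_on_differentiable[of UNIV])
 also have "\<dots> = (\<Sum>j\<in>UNIV. lower_index g x j * (if k = j then 1 else 0) + g $ j $ k * x $ j)"
  by (intro sum.cong refl) (simp add: pd_mult differentiable_coord differentiable_lower)
 also have "\<dots> = 2 * lower_index g x k"
  using sym[of k] by (simp add: sum.distrib if_distrib[of "\<lambda>t. _ * t"] lower_index_def[of g x k] cong: if_cong)
 finally have q: "pd k ?q x = 2 * lower_index g x k" .
 have dq: "?q differentiable (at x)" by (auto intro!: smooth_on_differentiable[of UNIV])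
 have "pd k (vf_inv g m) x $ j = 2 * lower_index g x k * axis m 1 $ j - 2 * g $ m $ k * x $ j - 2 * lower_index g x m * axis k 1 $ j" for j
 proof -
  have "pd k (vf_inv g m) x $ j = pd k (\<lambda>x. vf_inv g m x $ j) x"
   by (rule pd_vec[OF smooth_on_generator]) (auto simp: conformal_generators_def)
  also have "(\<lambda>x. vf_inv g m x $ j) = (\<lambda>x. axis m 1 $ j * ?q x + (- 2) * (lower_index g x m * x $ j))"
   by (simp add: vf_inv_def fun_eq_iff)
  also have "pd k \<dots> x = pd k (\<lambda>x. axis m 1 $ j * ?q x) x + pd k (\<lambda>x. (- 2) * (lower_index g x m * x $ j)) x"
   by (rule pd_add) (auto intro!: smooth_on_differentiable[of UNIV])
  also have "pd k (\<lambda>x. axis m 1 $ j * ?q x) x = axis m 1 $ j * (2 * lower_index g x k)"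
   using pd_bounded_linear[OF bounded_linear_mult_right dq, of k "axis m 1 $ j"] q by simp
  also have "pd k (\<lambda>x. (- 2) * (lower_index g x m * x $ j)) x = (- 2) * pd k (\<lambda>x. lower_index g x m * x $ j) x"
   by (rule pd_bounded_linear[OF bounded_linear_mult_right]) (auto intro!: smooth_on_differentiable[of UNIV])
  also have "pd k (\<lambda>x. lower_index g x m * x $ j) x = lower_index g x m * (if k = j then 1 else 0) + g $ m $ k * x $ j"
   by (simp add: pd_mult differentiable_coord differentiable_lower)
  also have "(if k = j then 1 else 0) = axis k (1::real) $ j" by (simp add: axis_def)
  finally show ?thesis by (simp add: algebra_simps)
 qed
 then show ?thesis by (simp add: vec_eq_iff)
qed

lemma divergence_generators:
 assumes sym: "\<And>i j. g $ i $ j = g $ j $ i"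
 shows "divergence (vf_transl m) x = 0" "divergence (vf_rot g i j) x = 0"
  "divergence (vf_euler :: real ^ 'n::finite \<Rightarrow> _) y = real CARD('n)"
  "divergence (vf_inv g k :: real ^ 'n \<Rightarrow> _) y = - 2 * real CARD('n) * lower_index g y k"
proof -
 have s: "(\<Sum>i\<in>UNIV. c i * axis j (1::real) $ i) = c j" for c :: "'m::finite \<Rightarrow> real" and j
  by (simp add: axis_def if_distrib[of "\<lambda>t. _ * t"] cong: if_cong)
 have s': "axis i (1::real) $ i = 1" for i :: "'m::finite" by (simp add: axis_def)
 show "divergence (vf_transl m) x = 0" by (simp add: divergence_def pd_vf_transl)
 show "divergence (vf_rot g i j) x = 0"
  using sym by (simp add: divergence_def pd_vf_rot sum_subtractf s)
 show "divergence (vf_euler :: real ^ 'n::finite \<Rightarrow> _) y = real CARD('n)"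
  by (simp add: divergence_def pd_vf_euler s')
 have "divergence (vf_inv g k) y = 2 * lower_index g y k - 2 * (\<Sum>i\<in>UNIV. g $ k $ i * y $ i) - 2 * real CARD('n) * lower_index g y k"
  using s[of "\<lambda>i. 2 * lower_index g y i" k]
  by (simp add: divergence_def pd_vf_inv[OF sym] sum_subtractf s' sum_distrib_left mult.assoc)
 then show "divergence (vf_inv g k :: real ^ 'n \<Rightarrow> _) y = - 2 * real CARD('n) * lower_index g y k"
  by (simp add: lower_index_def)
qed

section \<open>The Lie derivative of symbols in terms of the Weyl algebra\<close>

context conformal_weights
begin

lemma app_comp:
 assumes V: "open V" and P: "P \<in> Sym V"
 shows "app (xl i) V P = (\<lambda>x \<xi>. cr (lower_index g x i) * P x \<xi>)"
  "app (el i) V P = (\<lambda>x \<xi>. \<Sum>k\<in>UNIV. cr (g $ i $ k) * deriv_xi k P x \<xi>)"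
  "app x2 V P = (\<lambda>x \<xi>. cr (\<Sum>j\<in>UNIV. lower_index g x j * x $ j) * P x \<xi>)"
  "app th V P = (\<lambda>x \<xi>. \<Sum>i\<in>UNIV. cr (x $ i) * deriv_x V i P x \<xi>)"
  "app EE V P = (\<lambda>x \<xi>. \<Sum>i\<in>UNIV. cr (\<xi> $ i) * deriv_xi i P x \<xi>)"
  "app aa V P = (\<lambda>x \<xi>. cr (\<Sum>i\<in>UNIV. x $ i * \<xi> $ i) * P x \<xi>)"
  "app bb V P = (\<lambda>x \<xi>. \<Sum>i\<in>UNIV. cr (lower_index g x i) * deriv_xi i P x \<xi>)"
proof -
 have xl: "app (xl i) V P = (\<lambda>x \<xi>. cr (lower_index g x i) * P x \<xi>)" if "P \<in> Sym V" for P i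
  using V that by (simp add: xl_def app_sum app_basic mult_x_def lower_index_def sum_distrib_right mult.assoc)
 then show "app (xl i) V P = (\<lambda>x \<xi>. cr (lower_index g x i) * P x \<xi>)" using P .
 show "app (el i) V P = (\<lambda>x \<xi>. \<Sum>k\<in>UNIV. cr (g $ i $ k) * deriv_xi k P x \<xi>)"
  using V P by (simp add: el_def app_sum app_basic)
 show "app x2 V P = (\<lambda>x \<xi>. cr (\<Sum>j\<in>UNIV. lower_index g x j * x $ j) * P x \<xi>)"
  using V P by (simp add: x2_def app_sum app_basic xl mult_x_loc) (simp add: mult_x_def sum_distrib_right mult.assoc)
 show "app th V P = (\<lambda>x \<xi>. \<Sum>i\<in>UNIV. cr (x $ i) * deriv_x V i P x \<xi>)"
  using V P by (simp add: th_def app_sum app_basic deriv_x_loc) (simp add: mult_x_def)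
 show "app EE V P = (\<lambda>x \<xi>. \<Sum>i\<in>UNIV. cr (\<xi> $ i) * deriv_xi i P x \<xi>)"
  using V P by (simp add: EE_def app_sum app_basic deriv_xi_loc) (simp add: mult_xi_def)
 show "app aa V P = (\<lambda>x \<xi>. cr (\<Sum>i\<in>UNIV. x $ i * \<xi> $ i) * P x \<xi>)"
  using V P by (simp add: aa_def app_sum app_basic mult_xi_loc)
   (simp add: mult_xi_def mult_x_def sum_distrib_right mult.assoc)
 show "app bb V P = (\<lambda>x \<xi>. \<Sum>i\<in>UNIV. cr (lower_index g x i) * deriv_xi i P x \<xi>)"
  using V P by (simp add: bb_def app_sum app_basic xl deriv_xi_loc)
qed

lemma lie_symbol_eq:
 assumes V: "open V" and P: "P \<in> Sym V" and x: "x \<in> V"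
 shows "lie_symbol V d X P x \<xi> = (\<Sum>i\<in>UNIV. cr (X x $ i) * deriv_x V i P x \<xi>)
  - (\<Sum>i\<in>UNIV. cr (\<Sum>j\<in>UNIV. pd i X x $ j * \<xi> $ j) * deriv_xi i P x \<xi>)
  + cr (d * divergence X x) * P x \<xi>"
 using x by (simp add: lie_symbol_def deriv_x_def deriv_xi_def)

lemma axis_sums:
 fixes f :: "'n \<Rightarrow> complex" and c :: "'n \<Rightarrow> real"
 shows "(\<Sum>i\<in>UNIV. cr (axis m 1 $ i) * f i) = f m"
  "(\<Sum>i\<in>UNIV. axis m 1 $ i * c i) = c m" "(\<Sum>i\<in>UNIV. c i * axis m 1 $ i) = c m"
  "(\<Sum>i\<in>UNIV. cr (r * axis m 1 $ i) * f i) = cr r * f m"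
 by (simp_all add: axis_def if_distrib[of cr] if_distrib[of "\<lambda>t. t * _"] if_distrib[of "\<lambda>t. _ * t"] cong: if_cong)

text \<open>The weight enters through the divergence, which is n for the Euler field and -2 n times
  the lowered coordinate for an inversion. This is where the parameter n \<delta> of
  \<open>ee\<close> and \<open>K0\<close> comes from.\<close>

lemma lie_symbol_generators:
 assumes V: "open V" and P: "P \<in> Sym V"
 shows "lie_symbol V \<delta> (vf_transl m) P = app (sD m) V P"
  "lie_symbol V \<delta> (vf_rot g i j) P = app (MM i j) V P"
  "lie_symbol V \<delta> vf_euler P = app (ee (real CARD('n) * \<delta>)) V P"
  "lie_symbol V \<delta> (vf_inv g m) P = app (K0 (real CARD('n) * \<delta>) m) V P"
proof -
 have ext: "lie_symbol V \<delta> X P = app F V P"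
  if "\<And>x \<xi>. x \<in> V \<Longrightarrow> lie_symbol V \<delta> X P x \<xi> = app F V P x \<xi>" for X F
 proof (intro ext)
  fix x \<xi>
  show "lie_symbol V \<delta> X P x \<xi> = app F V P x \<xi>"
   using that Sym_notin[OF app_loc[OF V P]] by (cases "x \<in> V") (auto simp: lie_symbol_def)
 qed
 show "lie_symbol V \<delta> (vf_transl m) P = app (sD m) V P"
  by (rule ext) (simp add: lie_symbol_eq[OF V P] pd_vf_transl divergence_generators[OF g_sym] axis_sums app_basic[OF V P] vf_transl_def)
 show "lie_symbol V \<delta> vf_euler P = app (ee (real CARD('n) * \<delta>)) V P"
  by (rule ext) (simp add: lie_symbol_eq[OF V P] pd_vf_euler divergence_generators[OF g_sym] axis_sums vf_euler_def ee_def
    app_comp[OF V P] app_one[OF V P] mult.commute[of \<delta>])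
 show "lie_symbol V \<delta> (vf_rot g i j) P = app (MM i j) V P"
 proof (rule ext)
  fix x \<xi> assume x: "x \<in> V"
  have el: "app (el i) V P \<in> Sym V" for i using V P by simp
  have pdX: "(\<Sum>l\<in>UNIV. pd k (vf_rot g i j) x $ l * \<xi> $ l) = g $ i $ k * \<xi> $ j - g $ j $ k * \<xi> $ i" for k
   unfolding pd_vf_rot by (simp add: left_diff_distrib sum_subtractf axis_sums mult.assoc flip: sum_distrib_left)
  have dX: "(\<Sum>k\<in>UNIV. cr (\<Sum>l\<in>UNIV. pd k (vf_rot g i j) x $ l * \<xi> $ l) * deriv_xi k P x \<xi>) =
    cr (\<xi> $ j) * app (el i) V P x \<xi> - cr (\<xi> $ i) * app (el j) V P x \<xi>"
   unfolding pdX app_comp[OF V P]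
   by (simp add: left_diff_distrib right_diff_distrib sum_subtractf sum_distrib_left mult_ac)
  have X: "(\<Sum>k\<in>UNIV. cr (vf_rot g i j x $ k) * deriv_x V k P x \<xi>) =
    cr (lower_index g x i) * deriv_x V j P x \<xi> - cr (lower_index g x j) * deriv_x V i P x \<xi>"
   unfolding vf_rot_def by (simp add: left_diff_distrib sum_subtractf axis_sums mult.assoc del: of_real_mult)
  have "app (MM i j) V P x \<xi> =
    cr (lower_index g x i) * deriv_x V j P x \<xi> - cr (lower_index g x j) * deriv_x V i P x \<xi>
    + cr (\<xi> $ i) * app (el j) V P x \<xi> - cr (\<xi> $ j) * app (el i) V P x \<xi>"
   by (simp only: MM_def app_simps app_basic[OF V P] app_comp(1)[OF V deriv_x_loc[OF P V]] app_basic(2)[OF V el] mult_xi_def)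
  then show "lie_symbol V \<delta> (vf_rot g i j) P x \<xi> = app (MM i j) V P x \<xi>"
   unfolding lie_symbol_eq[OF V P x] X dX divergence_generators(2)[OF g_sym] by simp
 qed
 show "lie_symbol V \<delta> (vf_inv g m) P = app (K0 (real CARD('n) * \<delta>) m) V P"
 proof (rule ext)
  fix x \<xi> assume x: "x \<in> V"
  let ?q = "\<Sum>j\<in>UNIV. lower_index g x j * x $ j"
  have pdX: "(\<Sum>j\<in>UNIV. pd i (vf_inv g m) x $ j * \<xi> $ j) =
    2 * \<xi> $ m * lower_index g x i - 2 * (\<Sum>j\<in>UNIV. x $ j * \<xi> $ j) * g $ m $ i - 2 * lower_index g x m * \<xi> $ i" for i
   unfolding pd_vf_inv[OF g_sym]
   by (simp add: left_diff_distrib sum_subtractf axis_sums mult.assoc flip: sum_distrib_left)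
  have X: "(\<Sum>i\<in>UNIV. cr (vf_inv g m x $ i) * deriv_x V i P x \<xi>) =
    cr ?q * deriv_x V m P x \<xi> - 2 * cr (lower_index g x m) * (\<Sum>i\<in>UNIV. cr (x $ i) * deriv_x V i P x \<xi>)"
   unfolding vf_inv_def
   by (simp add: left_diff_distrib sum_subtractf axis_sums mult.assoc del: of_real_sum flip: sum_distrib_left)
  have dX: "(\<Sum>i\<in>UNIV. cr (\<Sum>j\<in>UNIV. pd i (vf_inv g m) x $ j * \<xi> $ j) * deriv_xi i P x \<xi>) =
    2 * cr (\<xi> $ m) * (\<Sum>i\<in>UNIV. cr (lower_index g x i) * deriv_xi i P x \<xi>)
    - 2 * cr (\<Sum>j\<in>UNIV. x $ j * \<xi> $ j) * (\<Sum>i\<in>UNIV. cr (g $ m $ i) * deriv_xi i P x \<xi>)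
    - 2 * cr (lower_index g x m) * (\<Sum>i\<in>UNIV. cr (\<xi> $ i) * deriv_xi i P x \<xi>)"
   unfolding pdX
  proof -
   fix s
   show "(\<Sum>i\<in>UNIV. cr (2 * \<xi> $ m * lower_index g x i - 2 * s * g $ m $ i - 2 * lower_index g x m * \<xi> $ i) * deriv_xi i P x \<xi>) =
    2 * cr (\<xi> $ m) * (\<Sum>i\<in>UNIV. cr (lower_index g x i) * deriv_xi i P x \<xi>)
    - 2 * cr s * (\<Sum>i\<in>UNIV. cr (g $ m $ i) * deriv_xi i P x \<xi>)
    - 2 * cr (lower_index g x m) * (\<Sum>i\<in>UNIV. cr (\<xi> $ i) * deriv_xi i P x \<xi>)"
    by (simp add: left_diff_distrib sum_subtractf mult.assoc sum_distrib_left)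
  qed
  have el: "app (el m) V P \<in> Sym V" "app th V P \<in> Sym V" "app EE V P \<in> Sym V" "app bb V P \<in> Sym V"
   using V P by simp_all
  have "app (K0 (real CARD('n) * \<delta>) m) V P x \<xi> =
    cr ?q * deriv_x V m P x \<xi>
    - (cr (lower_index g x m) * app th V P x \<xi> + cr (lower_index g x m) * app th V P x \<xi>)
    - (cr (\<xi> $ m) * app bb V P x \<xi> + cr (\<xi> $ m) * app bb V P x \<xi>)
    + (cr (\<Sum>i\<in>UNIV. x $ i * \<xi> $ i) * app (el m) V P x \<xi> + cr (\<Sum>i\<in>UNIV. x $ i * \<xi> $ i) * app (el m) V P x \<xi>)
    + (cr (lower_index g x m) * app EE V P x \<xi> + cr (lower_index g x m) * app EE V P x \<xi>)
    - (cr (real CARD('n) * \<delta>) * (cr (lower_index g x m) * P x \<xi>)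
      + cr (real CARD('n) * \<delta>) * (cr (lower_index g x m) * P x \<xi>))"
   by (simp only: K0_def app_simps app_comp(1)[OF V el(2)] app_comp(1)[OF V el(3)] app_comp(1)[OF V P] app_comp(6)[OF V el(1)]
    app_basic(2)[OF V el(4)] app_basic(3)[OF V P] app_comp(3)[OF V deriv_x_loc[OF P V]] mult_xi_def)
  then show "lie_symbol V \<delta> (vf_inv g m) P x \<xi> = app (K0 (real CARD('n) * \<delta>) m) V P x \<xi>"
   unfolding lie_symbol_eq[OF V P x] X dX divergence_generators(4)[OF g_sym] app_comp[OF V P]
   by (simp add: algebra_simps del: of_real_sum)
 qed
qed

subsection \<open>The action on differential operators\<close>

text \<open>\<open>left_rep\<close> expresses composition with T after a normally ordered operator
  by an operator on symbols, \<open>right_rep\<close> composition with T before it. The second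
  reverses products, and it also has to record that T stays inside the function space, since
  \<open>nop V P\<close> is then applied to T f.\<close>

definition left_rep :: "(real ^ 'n) set \<Rightarrow> 'n sop \<Rightarrow> ((real ^ 'n \<Rightarrow> complex) \<Rightarrow> real ^ 'n \<Rightarrow> complex) \<Rightarrow> bool" where
 "left_rep V A T \<longleftrightarrow> (\<forall>P\<in>Sym V. \<forall>f\<in>loc_fun V. T (nop V P f) = nop V (app A V P) f)"

definition right_rep :: "(real ^ 'n) set \<Rightarrow> 'n sop \<Rightarrow> ((real ^ 'n \<Rightarrow> complex) \<Rightarrow> real ^ 'n \<Rightarrow> complex) \<Rightarrow> bool" where
 "right_rep V A T \<longleftrightarrow> (\<forall>P\<in>Sym V. \<forall>f\<in>loc_fun V. T f \<in> loc_fun V \<and> nop V P (T f) = nop V (app A V P) f)"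

lemma left_rep_basic:
 assumes V: "open V"
 shows "left_rep V (sX i) (coord_mult i)" "left_rep V (sD i + sXi i) (pd_on V i)"
 using nop_mult_left[OF V] nop_pd_left[OF V] by (simp_all add: left_rep_def app_basic V)

lemma right_rep_basic:
 assumes V: "open V"
 shows "right_rep V (sX i + sEta i) (coord_mult i)" "right_rep V (sXi i) (pd_on V i)"
 using nop_mult_right[OF V] nop_pd_right[OF V] coord_mult_loc_fun[OF V] pd_on_loc_fun[OF V]
 by (simp_all add: right_rep_def app_basic V)

lemma left_rep_comp: "open V \<Longrightarrow> left_rep V A T \<Longrightarrow> left_rep V B U \<Longrightarrow> left_rep V (A * B) (\<lambda>f. T (U f))"
 by (simp add: left_rep_def)

lemma right_rep_comp: "open V \<Longrightarrow> right_rep V A T \<Longrightarrow> right_rep V B U \<Longrightarrow> right_rep V (B * A) (\<lambda>f. T (U f))"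
 by (simp add: right_rep_def)

lemma left_rep_add: "open V \<Longrightarrow> left_rep V A T \<Longrightarrow> left_rep V B U \<Longrightarrow> left_rep V (A + B) (\<lambda>f x. T f x + U f x)"
 by (simp add: left_rep_def nop_add fun_eq_iff)

lemma nop_scale: "open V \<Longrightarrow> P \<in> Sym V \<Longrightarrow> nop V (\<lambda>x \<xi>. c * P x \<xi>) f x = c * nop V P f x"
 using nop_lin[of V P P c 0] by simp

lemma nop_arg_scale: "open V \<Longrightarrow> P \<in> Sym V \<Longrightarrow> f \<in> loc_fun V \<Longrightarrow> nop V P (\<lambda>x. c * f x) x = c * nop V P f x"
 using nop_arg_lin[of V P f f c 0] by simp

lemma left_rep_scale: "open V \<Longrightarrow> left_rep V A T \<Longrightarrow> left_rep V (r *\<^sub>R A) (\<lambda>f x. cr r * T f x)"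
 by (simp add: left_rep_def fun_eq_iff nop_scale)

lemma left_rep_zero: "open V \<Longrightarrow> left_rep V 0 (\<lambda>f x. 0)"
 by (simp add: left_rep_def)

lemma left_rep_one: "open V \<Longrightarrow> left_rep V 1 (\<lambda>f. f)"
 by (simp add: left_rep_def app_one)

lemma left_rep_sum: "open V \<Longrightarrow> (\<And>i. left_rep V (A i) (T i)) \<Longrightarrow> left_rep V (\<Sum>i\<in>I. A i) (\<lambda>f x. \<Sum>i\<in>I. T i f x)" for I :: "'n set"
 by (induction I rule: infinite_finite_induct) (simp_all add: left_rep_zero left_rep_add)

lemma right_rep_add: "open V \<Longrightarrow> right_rep V A T \<Longrightarrow> right_rep V B U \<Longrightarrow> right_rep V (A + B) (\<lambda>f x. T f x + U f x)"
 using nop_arg_lin[of V _ "T _" "U _" 1 1] by (simp add: right_rep_def nop_add fun_eq_iff loc_fun_add)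

lemma right_rep_scale: "open V \<Longrightarrow> right_rep V A T \<Longrightarrow> right_rep V (r *\<^sub>R A) (\<lambda>f x. cr r * T f x)"
 by (simp add: right_rep_def fun_eq_iff loc_fun_scale nop_scale nop_arg_scale)

lemma right_rep_zero: "open V \<Longrightarrow> right_rep V 0 (\<lambda>f x. 0)"
 using nop_arg_lin[of V _ "\<lambda>x. 0" "\<lambda>x. 0" 0 0] by (simp add: right_rep_def zero_loc_fun fun_eq_iff)

lemma right_rep_one: "open V \<Longrightarrow> right_rep V 1 (\<lambda>f. f)"
 by (simp add: right_rep_def app_one)

lemma right_rep_sum: "open V \<Longrightarrow> (\<And>i. right_rep V (A i) (T i)) \<Longrightarrow> right_rep V (\<Sum>i\<in>I. A i) (\<lambda>f x. \<Sum>i\<in>I. T i f x)" for I :: "'n set"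
 by (induction I rule: infinite_finite_induct) (simp_all add: right_rep_zero right_rep_add)

text \<open>The two terms of the action on operators are a composition on the left and one on the
  right, represented on symbols by A and B.\<close>

lemma lie_op_nop:
 assumes V: "open V" and P: "P \<in> Sym V"
  and L: "left_rep V A T" and R: "right_rep V B U"
  and T: "\<And>f. f \<in> loc_fun V \<Longrightarrow> lie_density V (lam + \<delta>) X f = T f"
  and U: "\<And>f. f \<in> loc_fun V \<Longrightarrow> lie_density V lam X f = U f"
 shows "lie_op V lam (lam + \<delta>) X (nop V P) = nop V (app (A - B) V P)"
proof (intro ext)
 fix f x
 show "lie_op V lam (lam + \<delta>) X (nop V P) f x = nop V (app (A - B) V P) f x"
 proof (cases "f \<in> loc_fun V")
  case True
  have "nop V (app (A - B) V P) f x = nop V (app A V P) f x - nop V (app B V P) f x"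
   using nop_lin[OF V, of "app A V P" "app B V P" 1 "-1"] V P by simp
  then show ?thesis
   using True L R P V by (simp add: lie_op_def T U nop_loc_fun left_rep_def right_rep_def)
 next
  case False
  then show ?thesis using nop_notin[OF V] P V by (simp add: lie_op_def del: app_simps)
 qed
qed

lemma lie_density_eq:
 assumes "f \<in> loc_fun V"
 shows "lie_density V l X f = (\<lambda>x. (\<Sum>i\<in>UNIV. cr (X x $ i) * pd_on V i f x) + cr (l * divergence X x) * f x)"
 using assms by (auto simp: lie_density_def pd_on_def loc_fun_def fun_eq_iff)

text \<open>The derivative contributes \<open>sD m + sXi m\<close> on the left and
  \<open>sXi m\<close> on the right; the difference is the action on symbols.\<close>

lemma lie_op_transl:
 fixes V :: "(real ^ 'n) set"
 assumes V: "open V" and P: "P \<in> Sym V"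
 shows "lie_op V lam (lam + \<delta>) (vf_transl m) (nop V P) = nop V (app (sD m) V P)"
proof -
 have "lie_density V l (vf_transl m) f = pd_on V m f" if "f \<in> loc_fun V" for f l
  unfolding lie_density_eq[OF that] divergence_generators[OF g_sym] by (simp add: vf_transl_def axis_sums)
 from lie_op_nop[OF V P left_rep_basic(2)[OF V] right_rep_basic(2)[OF V] this this] show ?thesis by simp
qed

lemma lie_op_euler:
 assumes V: "open V" and P: "P \<in> Sym V"
 shows "lie_op V lam (lam + \<delta>) vf_euler (nop V P) = nop V (app (ee (real CARD('n) * \<delta>)) V P)"
proof -
 have "lie_density V l vf_euler f = (\<lambda>x. (\<Sum>i\<in>UNIV. coord_mult i (pd_on V i f) x) + cr (real CARD('n) * l) * f x)"
  if "f \<in> loc_fun V" for f l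
  unfolding lie_density_eq[OF that] divergence_generators[OF g_sym] by (simp add: vf_euler_def coord_mult_def mult.commute)
 note * = lie_op_nop[OF V P left_rep_add[OF V left_rep_sum[OF V left_rep_comp[OF V left_rep_basic[OF V]]] left_rep_scale[OF V left_rep_one[OF V]]]
  right_rep_add[OF V right_rep_sum[OF V right_rep_comp[OF V right_rep_basic[OF V]]] right_rep_scale[OF V right_rep_one[OF V]]] this this]
 have c: "sX i * sXi i = sXi i * sX i" for i :: 'n
  using xxi[of i i] by (simp_all add: br_def)
 have "(\<Sum>i\<in>UNIV. sX i * (sD i + sXi i)) + (real CARD('n) * (lam + \<delta>)) *\<^sub>R 1
   - ((\<Sum>i\<in>UNIV. sXi i * (sX i + sEta i)) + (real CARD('n) * lam) *\<^sub>R 1) = ee (real CARD('n) * \<delta>)"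
  by (simp add: ee_def distrib_left sum.distrib sums_comp c sums_comp'' scaleR_add_left)
 with * show ?thesis by simp
qed

lemma lie_op_rot:
 assumes V: "open V" and P: "P \<in> Sym V"
 shows "lie_op V lam (lam + \<delta>) (vf_rot g a b) (nop V P) = nop V (app (MM a b) V P)"
proof -
 have "lie_density V l (vf_rot g a b) f = (\<lambda>x. (\<Sum>k\<in>UNIV. cr (g $ a $ k) * coord_mult k (pd_on V b f) x)
   + cr (-1) * (\<Sum>k\<in>UNIV. cr (g $ b $ k) * coord_mult k (pd_on V a f) x))"
  if "f \<in> loc_fun V" for f l
 proof -
  have 1: "cr (lower_index g x a) * z = (\<Sum>k\<in>UNIV. cr (g $ a $ k) * (cr (x $ k) * z))"
   for a and x :: "real ^ 'n" and z by (simp add: lower_index_def sum_distrib_right mult.assoc)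
  have "(\<Sum>i\<in>UNIV. cr (vf_rot g a b x $ i) * pd_on V i f x) =
    cr (lower_index g x a) * pd_on V b f x - cr (lower_index g x b) * pd_on V a f x" for x
   unfolding vf_rot_def by (simp add: left_diff_distrib sum_subtractf axis_sums mult.assoc del: of_real_mult)
  then show ?thesis
   unfolding lie_density_eq[OF that] divergence_generators(2)[OF g_sym] by (simp add: coord_mult_def 1)
 qed
 note * = lie_op_nop[OF V P left_rep_add[OF V left_rep_sum[OF V left_rep_scale[OF V left_rep_comp[OF V left_rep_basic[OF V]]]]
    left_rep_scale[OF V left_rep_sum[OF V left_rep_scale[OF V left_rep_comp[OF V left_rep_basic[OF V]]]]]]
   right_rep_add[OF V right_rep_sum[OF V right_rep_scale[OF V right_rep_comp[OF V right_rep_basic[OF V]]]]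
    right_rep_scale[OF V right_rep_sum[OF V right_rep_scale[OF V right_rep_comp[OF V right_rep_basic[OF V]]]]]] this this]
 have xl: "(\<Sum>k\<in>UNIV. g $ a $ k *\<^sub>R (sX k * z)) = xl a * z" "(\<Sum>k\<in>UNIV. g $ a $ k *\<^sub>R (z * (sX k + sEta k))) = z * (xl a + el a)" for a z
  by (simp_all add: xl_def el_def sum_distrib_left sum_distrib_right distrib_left scaleR_add_right sum.distrib)
 have c: "xl i * sXi j = sXi j * xl i" for i j using br_lower(6)[of i j] by (simp add: br_def)
 have "(\<Sum>k\<in>UNIV. g $ a $ k *\<^sub>R (sX k * (sD b + sXi b))) + (-1) *\<^sub>R (\<Sum>k\<in>UNIV. g $ b $ k *\<^sub>R (sX k * (sD a + sXi a)))
   - ((\<Sum>k\<in>UNIV. g $ a $ k *\<^sub>R (sXi b * (sX k + sEta k))) + (-1) *\<^sub>R (\<Sum>k\<in>UNIV. g $ b $ k *\<^sub>R (sXi a * (sX k + sEta k)))) = MM a b"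
  unfolding xl MM_def by (simp add: distrib_left c)
 then show ?thesis by (simp only: *)
qed

text \<open>Inversions are quadratic in x. Composition on the right replaces each coordinate by
  \<open>sX + sEta\<close>; the terms quadratic in \<open>sEta\<close> and the one carrying the
  weight lam do not occur in the action on symbols and make up \<open>K1\<close>.\<close>

lemma lie_op_inv:
 assumes V: "open V" and P: "P \<in> Sym V"
 shows "lie_op V lam (lam + \<delta>) (vf_inv g m) (nop V P) = nop V (app (KK (real CARD('n) * \<delta>) (real CARD('n) * lam) m) V P)"
proof -
 let ?T = "\<lambda>l f x. ((\<Sum>j\<in>UNIV. \<Sum>k\<in>UNIV. cr (g $ j $ k) * coord_mult k (coord_mult j (pd_on V m f)) x)
   + cr (-2) * (\<Sum>k\<in>UNIV. cr (g $ m $ k) * coord_mult k (\<lambda>x. \<Sum>i\<in>UNIV. coord_mult i (pd_on V i f) x) x))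
   + cr (- 2 * real CARD('n) * l) * (\<Sum>k\<in>UNIV. cr (g $ m $ k) * coord_mult k f x)"
 have T: "lie_density V l (vf_inv g m) f = ?T l f" if "f \<in> loc_fun V" for f l
 proof
  fix x
  have 1: "cr (\<Sum>j\<in>UNIV. lower_index g x j * x $ j) * z =
   (\<Sum>j\<in>UNIV. \<Sum>k\<in>UNIV. cr (g $ j $ k) * (cr (x $ k) * (cr (x $ j) * z)))" for z
   by (simp add: lower_index_def sum_distrib_right mult.assoc)
  have 2: "cr (lower_index g x m) * z = (\<Sum>k\<in>UNIV. cr (g $ m $ k) * (cr (x $ k) * z))" for z
   by (simp add: lower_index_def sum_distrib_right mult.assoc)
  have "(\<Sum>i\<in>UNIV. cr (vf_inv g m x $ i) * pd_on V i f x) =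
    cr (\<Sum>j\<in>UNIV. lower_index g x j * x $ j) * pd_on V m f x
    - 2 * (cr (lower_index g x m) * (\<Sum>i\<in>UNIV. cr (x $ i) * pd_on V i f x))"
   unfolding vf_inv_def
   by (simp add: left_diff_distrib sum_subtractf axis_sums mult.assoc del: of_real_sum flip: sum_distrib_left)
  moreover have "cr (l * divergence (vf_inv g m) x) * f x = cr (- 2 * real CARD('n) * l) * (cr (lower_index g x m) * f x)"
   unfolding divergence_generators[OF g_sym] by (simp add: algebra_simps)
  ultimately show "lie_density V l (vf_inv g m) f x = ?T l f x"
   unfolding lie_density_eq[OF that] 1 2 coord_mult_def by simp
 qed
 note b = left_rep_basic[OF V] right_rep_basic[OF V]
 note * = lie_op_nop[OF V P
   left_rep_add[OF V left_rep_add[OF V left_rep_sum[OF V left_rep_sum[OF V left_rep_scale[OF V left_rep_comp[OF V b(1) left_rep_comp[OF V b(1,2)]]]]]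
    left_rep_scale[OF V left_rep_sum[OF V left_rep_scale[OF V left_rep_comp[OF V b(1) left_rep_sum[OF V left_rep_comp[OF V b(1,2)]]]]]]]
    left_rep_scale[OF V left_rep_sum[OF V left_rep_scale[OF V b(1)]]]]
   right_rep_add[OF V right_rep_add[OF V right_rep_sum[OF V right_rep_sum[OF V right_rep_scale[OF V right_rep_comp[OF V b(3) right_rep_comp[OF V b(3,4)]]]]]
    right_rep_scale[OF V right_rep_sum[OF V right_rep_scale[OF V right_rep_comp[OF V b(3) right_rep_sum[OF V right_rep_comp[OF V b(3,4)]]]]]]]
    right_rep_scale[OF V right_rep_sum[OF V right_rep_scale[OF V b(3)]]]] T T]
 have c: "xl i * sXi j = sXi j * xl i" "x2 * sXi j = sXi j * x2" for i j
  using br_lower(6)[of i j] br_x2(3)[of j] by (simp_all add: br_def)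
 have xl: "(\<Sum>k\<in>UNIV. g $ m $ k *\<^sub>R (sX k * z)) = xl m * z" "(\<Sum>k\<in>UNIV. g $ m $ k *\<^sub>R (z * (sX k + sEta k))) = z * (xl m + el m)"
  "(\<Sum>k\<in>UNIV. g $ m $ k *\<^sub>R (sX k + sEta k)) = xl m + el m" "(\<Sum>k\<in>UNIV. g $ m $ k *\<^sub>R sX k) = xl m" for m z
  by (simp_all add: xl_def el_def sum_distrib_left sum_distrib_right distrib_left scaleR_add_right sum.distrib)
 have L1: "(\<Sum>j\<in>UNIV. \<Sum>k\<in>UNIV. g $ j $ k *\<^sub>R (sX k * (sX j * (sD m + sXi m)))) = x2 * (sD m + sXi m)"
  unfolding xl by (simp add: x2_def sum_distrib_right mult.assoc)
 have R1: "(\<Sum>j\<in>UNIV. \<Sum>k\<in>UNIV. g $ j $ k *\<^sub>R (sXi m * (sX j + sEta j) * (sX k + sEta k))) = sXi m * (x2 + bb + bb + TT)"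
 proof -
  have "(\<Sum>j\<in>UNIV. \<Sum>k\<in>UNIV. g $ j $ k *\<^sub>R (sXi m * (sX j + sEta j) * (sX k + sEta k))) = (\<Sum>j\<in>UNIV. sXi m * ((sX j + sEta j) * (xl j + el j)))"
   unfolding xl by (simp add: mult.assoc)
  also have "\<dots> = sXi m * (\<Sum>j\<in>UNIV. (sX j + sEta j) * (xl j + el j))" by (simp add: sum_distrib_left)
  also have "(\<Sum>j\<in>UNIV. sEta j * xl j) = bb"
  proof -
   have "sEta j * xl j = xl j * sEta j" for j using br_lower(3)[of j j] by (simp add: br_def)
   then show ?thesis by (simp add: sums_comp)
  qed
  then have "(\<Sum>j\<in>UNIV. (sX j + sEta j) * (xl j + el j)) = x2 + bb + bb + TT"
   by (simp add: distrib_left distrib_right sum.distrib sums_comp')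
  finally show ?thesis .
 qed
 have L2: "(\<Sum>i\<in>UNIV. sX i * (sD i + sXi i)) = th + aa" by (simp add: distrib_left sum.distrib sums_comp)
 have R2: "(\<Sum>i\<in>UNIV. sXi i * (sX i + sEta i)) = aa + EE" by (simp add: distrib_left sum.distrib sums_comp sums_comp'')
 have ca: "aa * xl m = xl m * aa" "EE * xl m = xl m * EE" using br_aa(5) br_EE(5) by (simp_all add: br_def)
 have two: "(- 2 * r * l) *\<^sub>R z = - ((r * l) *\<^sub>R z) - (r * l) *\<^sub>R z" "(-2) *\<^sub>R z = - z - z" for r l :: real and z :: "'n sop"
  using scaleR_2[of "(r * l) *\<^sub>R z"] scaleR_2[of z] by (simp_all add: mult.assoc)
 let ?n = "real CARD('n)"
 have "((\<Sum>j\<in>UNIV. \<Sum>k\<in>UNIV. g $ j $ k *\<^sub>R (sX k * (sX j * (sD m + sXi m))))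
   + (-2) *\<^sub>R (\<Sum>k\<in>UNIV. g $ m $ k *\<^sub>R (sX k * (\<Sum>i\<in>UNIV. sX i * (sD i + sXi i)))))
   + (- 2 * ?n * (lam + \<delta>)) *\<^sub>R (\<Sum>k\<in>UNIV. g $ m $ k *\<^sub>R sX k)
  - (((\<Sum>j\<in>UNIV. \<Sum>k\<in>UNIV. g $ j $ k *\<^sub>R (sXi m * (sX j + sEta j) * (sX k + sEta k)))
   + (-2) *\<^sub>R (\<Sum>k\<in>UNIV. g $ m $ k *\<^sub>R ((\<Sum>i\<in>UNIV. sXi i * (sX i + sEta i)) * (sX k + sEta k))))
   + (- 2 * ?n * lam) *\<^sub>R (\<Sum>k\<in>UNIV. g $ m $ k *\<^sub>R (sX k + sEta k))) = KK (?n * \<delta>) (?n * lam) m"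
  unfolding L1 R1 L2 R2 unfolding xl KK_def K0_def K1_def two
  by (simp add: distrib_left distrib_right c ca scaleR_add_right scaleR_add_left)
 then show ?thesis by (simp only: *)
qed

end

section \<open>Pulling back along diffeomorphisms\<close>

definition jmat :: "(real ^ 'n::finite \<Rightarrow> real ^ 'n) \<Rightarrow> real ^ 'n \<Rightarrow> real ^ 'n ^ 'n" where
 "jmat \<phi> x = matrix (frechet_derivative \<phi> (at x))"

declare transpose_matrix_vector [simp del]

lemma jmat_nth: "jmat \<phi> x $ i $ j = pd j \<phi> x $ i"
 by (simp add: jmat_def matrix_def pd_def)

lemma jmat_mult: "\<phi> differentiable (at x) \<Longrightarrow> jmat \<phi> x *v v = (\<Sum>i\<in>UNIV. v $ i *\<^sub>R pd i \<phi> x)"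
 by (simp add: vec_eq_iff matrix_vector_mult_def jmat_nth mult.commute)

lemma jmat_compose:
 assumes "\<phi> differentiable (at x)" "\<psi> differentiable (at (\<phi> x))"
 shows "jmat (\<lambda>x. \<psi> (\<phi> x)) x = jmat \<psi> (\<phi> x) ** jmat \<phi> x"
 by (simp add: vec_eq_iff jmat_nth matrix_matrix_mult_def pd_compose[OF assms] mult.commute)

lemma jmat_cong_open:
 "open V \<Longrightarrow> x \<in> V \<Longrightarrow> (\<And>y. y \<in> V \<Longrightarrow> \<phi> y = \<psi> y) \<Longrightarrow> jmat \<phi> x = jmat \<psi> x"
 unfolding jmat_def using frechet_derivative_cong_open by metis

lemma jmat_ident: "jmat (\<lambda>x. x) x = mat 1"
proof -
 have "pd j (\<lambda>x. x) x = axis j (1::real)" for j :: 'a using pd_eqI[OF has_derivative_ident] .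
 then show ?thesis by (simp add: vec_eq_iff jmat_nth mat_def axis_def)
qed

lemma smooth_on_jmat_nth: "open V \<Longrightarrow> smooth_on V \<phi> \<Longrightarrow> smooth_on V (\<lambda>x. jmat \<phi> x $ i $ j)"
 unfolding jmat_nth by auto

lemma smooth_on_det_jmat: "open V \<Longrightarrow> smooth_on V \<phi> \<Longrightarrow> smooth_on V (\<lambda>x. det (jmat \<phi> x))"
 unfolding det_def by (intro smooth_on_sum smooth_on_mult smooth_on_prod smooth_on_jmat_nth) auto

abbreviation dw :: "(real ^ 'n::finite \<Rightarrow> real ^ 'n) \<Rightarrow> real \<Rightarrow> real ^ 'n \<Rightarrow> real" where
 "dw \<phi> s x \<equiv> \<bar>det (jmat \<phi> x)\<bar> powr s"

definition dpull :: "(real ^ 'n::finite) set \<Rightarrow> (real ^ 'n \<Rightarrow> real ^ 'n) \<Rightarrow> real \<Rightarrow> (real ^ 'n \<Rightarrow> complex) \<Rightarrow> real ^ 'n \<Rightarrow> complex" where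
 "dpull V \<phi> s f = (\<lambda>x. if x \<in> V then cr (dw \<phi> s x) * f (\<phi> x) else 0)"

text \<open>\<open>\<psi>\<close> is meant to be the inverse of \<open>\<phi>\<close> and serves the
  fibres: a covector \<xi> at x corresponds at \<open>\<phi> x\<close> to the transposed Jacobian of
  \<open>\<psi>\<close> applied to \<xi>.\<close>

definition spull :: "(real ^ 'n::finite) set \<Rightarrow> (real ^ 'n \<Rightarrow> real ^ 'n) \<Rightarrow> (real ^ 'n \<Rightarrow> real ^ 'n) \<Rightarrow> real \<Rightarrow>
  'n sym \<Rightarrow> 'n sym" where
 "spull V \<phi> \<psi> s P = (\<lambda>x \<xi>. if x \<in> V then cr (dw \<phi> s x) *
   P (\<phi> x) (transpose (jmat \<psi> (\<phi> x)) *v \<xi>) else 0)"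

lemma dpull_lin: "dpull V \<phi> s (\<lambda>x. a * f x + b * h x) x = a * dpull V \<phi> s f x + b * dpull V \<phi> s h x"
 by (simp add: dpull_def algebra_simps)

lemma spull_zero [simp]: "spull V \<phi> \<psi> s (\<lambda>x \<xi>. 0) = (\<lambda>x \<xi>. 0)"
 by (intro ext) (simp add: spull_def)

lemma spull_lin: "spull V \<phi> \<psi> s (\<lambda>x \<xi>. a * P x \<xi> + b * Q x \<xi>) = (\<lambda>x \<xi>. a * spull V \<phi> \<psi> s P x \<xi> + b * spull V \<phi> \<psi> s Q x \<xi>)"
 by (auto simp: spull_def algebra_simps fun_eq_iff)

lemma spull_add: "spull V \<phi> \<psi> s (\<lambda>x \<xi>. P x \<xi> + Q x \<xi>) = (\<lambda>x \<xi>. spull V \<phi> \<psi> s P x \<xi> + spull V \<phi> \<psi> s Q x \<xi>)"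
 by (auto simp: spull_def algebra_simps fun_eq_iff)

definition fun_mult :: "(real ^ 'n::finite) set \<Rightarrow> (real ^ 'n \<Rightarrow> complex) \<Rightarrow> 'n sym \<Rightarrow> 'n sym" where
 "fun_mult V u P = (\<lambda>x \<xi>. if x \<in> V then u x * P x \<xi> else 0)"

lemma fun_mult_poly: "fun_mult V u (poly_symbol V k a) = poly_symbol V k (\<lambda>is x. u x * a is x)"
 by (auto simp: fun_mult_def poly_symbol_def sum_distrib_left mult.assoc fun_eq_iff)

lemma fun_mult_upto:
 assumes "open V" "smooth_on V u" "P \<in> SymU V k" shows "fun_mult V u P \<in> SymU V k"
proof -
 obtain a where a: "\<And>is. smooth_on V (a is)" "P = poly_symbol V k a" using assms(3) unfolding loc_symbol_upto_def by auto
 show ?thesis unfolding a fun_mult_poly by (rule loc_symbol_uptoI) (use assms a in auto)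
qed

lemma fun_mult_loc: "open V \<Longrightarrow> smooth_on V u \<Longrightarrow> P \<in> Sym V \<Longrightarrow> fun_mult V u P \<in> Sym V"
 using fun_mult_upto Sym_iff by metis

lemma nop_fun_mult:
 assumes V: "open V" and u: "smooth_on V u" and P: "P \<in> Sym V" and x: "x \<in> V"
 shows "nop V (fun_mult V u P) f x = u x * nop V P f x"
proof -
 obtain k where "P \<in> SymU V k" using P by (auto simp: Sym_iff)
 then obtain a where a: "\<And>is. smooth_on V (a is)" "P = poly_symbol V k a" unfolding loc_symbol_upto_def by auto
 have "smooth_on V (\<lambda>x. u x * a is x)" for "is" using V u a by auto
 then show ?thesis unfolding a fun_mult_poly
  by (simp add: nop_poly_symbol[OF V] a diff_op_def sum_distrib_left mult.assoc)
qed

text \<open>The total derivative along a covector field \<open>\<zeta>\<close>, where base point and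
  fibre variable move together.\<close>

lemma pd_symbol_compose:
 fixes \<zeta> :: "real ^ 'n::finite \<Rightarrow> real ^ 'n"
 assumes V: "open V" and Q: "Q \<in> Sym V" and \<zeta>: "smooth_on V \<zeta>" and x: "x \<in> V"
 shows "pd i (\<lambda>x. Q x (\<zeta> x)) x = deriv_x V i Q x (\<zeta> x) + (\<Sum>k\<in>UNIV. cr (pd i \<zeta> x $ k) * deriv_xi k Q x (\<zeta> x))"
  and "smooth_on V (\<lambda>x. Q x (\<zeta> x))"
proof -
 note d = smooth_on_differentiable[OF _ x]
 have "pd i (\<lambda>x. Q x (\<zeta> x)) x = deriv_x V i Q x (\<zeta> x) + (\<Sum>k\<in>UNIV. cr (pd i \<zeta> x $ k) * deriv_xi k Q x (\<zeta> x))
  \<and> smooth_on V (\<lambda>x. Q x (\<zeta> x))"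
  using Q V
 proof (induction rule: Sym_induct)
  case zero
  then show ?case by simp
 next
  case (mono u "is")
  show ?case
  proof (induction "is")
   case Nil
   have "smooth_on V (\<lambda>x. mono_symbol V u [] x (\<zeta> x))"
    by (rule smooth_on_congI[OF V mono]) (simp add: mono_symbol_def)
   moreover have "pd i (\<lambda>x. mono_symbol V u [] x (\<zeta> x)) x = pd i u x"
    by (rule pd_cong_open[OF V x]) (simp add: mono_symbol_def)
   ultimately show ?case using V x mono by (simp add: deriv_xi_mono_Nil deriv_x_mono) (simp add: mono_symbol_def)
  next
   case (Cons j "is")
   let ?M = "mono_symbol V u is"
   have M: "?M \<in> Sym V" using mono by auto
   have z: "smooth_on V (\<lambda>x. cr (\<zeta> x $ j))" using \<zeta> V by auto
   have eq: "(\<lambda>x. mono_symbol V u (j # is) x (\<zeta> x)) = (\<lambda>x. cr (\<zeta> x $ j) * ?M x (\<zeta> x))"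
    by (simp add: mono_symbol_def fun_eq_iff)
   have zj: "pd i (\<lambda>x. cr (\<zeta> x $ j)) x = cr (pd i \<zeta> x $ j)"
   proof -
    have "smooth_on V (\<lambda>x. \<zeta> x $ j)" using \<zeta> V by auto
    then show ?thesis
     by (simp add: pd_bounded_linear[OF bounded_linear_of_real] d pd_nth \<zeta>)
   qed
   have "pd i (\<lambda>x. cr (\<zeta> x $ j) * ?M x (\<zeta> x)) x =
     cr (\<zeta> x $ j) * pd i (\<lambda>x. ?M x (\<zeta> x)) x + cr (pd i \<zeta> x $ j) * ?M x (\<zeta> x)"
    unfolding zj[symmetric] using Cons z by (intro pd_mult d) auto
   moreover have "deriv_x V i (mono_symbol V u (j # is)) x (\<zeta> x) = cr (\<zeta> x $ j) * deriv_x V i ?M x (\<zeta> x)"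
    unfolding mult_xi_mono[symmetric] deriv_x_mult_xi[OF M V] by (simp add: mult_xi_def)
   moreover have "(\<Sum>k\<in>UNIV. cr (pd i \<zeta> x $ k) * deriv_xi k (mono_symbol V u (j # is)) x (\<zeta> x)) =
     cr (\<zeta> x $ j) * (\<Sum>k\<in>UNIV. cr (pd i \<zeta> x $ k) * deriv_xi k ?M x (\<zeta> x)) + cr (pd i \<zeta> x $ j) * ?M x (\<zeta> x)"
    unfolding mult_xi_mono[symmetric] deriv_xi_mult_xi[OF M V]
    by (simp add: mult_xi_def distrib_left sum.distrib if_distrib[of "\<lambda>t. _ * t"] sum_distrib_left mult_ac cong: if_cong)
   ultimately show ?case unfolding eq using Cons z V by (auto simp: algebra_simps)
  qed
 next
  case (add P Q)
  have "pd i (\<lambda>x. P x (\<zeta> x) + Q x (\<zeta> x)) x = pd i (\<lambda>x. P x (\<zeta> x)) x + pd i (\<lambda>x. Q x (\<zeta> x)) x"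
   using add by (intro pd_add d) auto
  then show ?case using add V by (simp add: deriv_x_add[OF _ _ V] deriv_xi_add[OF add(1,2) V] distrib_left sum.distrib smooth_on_add)
 qed
 then show "pd i (\<lambda>x. Q x (\<zeta> x)) x = deriv_x V i Q x (\<zeta> x) + (\<Sum>k\<in>UNIV. cr (pd i \<zeta> x $ k) * deriv_xi k Q x (\<zeta> x))"
  "smooth_on V (\<lambda>x. Q x (\<zeta> x))" by auto
qed

section \<open>Transport of densities, symbols and operators by a diffeomorphism\<close>

locale diffeo =
 fixes V V' :: "(real ^ 'n::finite) set" and \<phi> \<psi> :: "real ^ 'n \<Rightarrow> real ^ 'n"
 assumes open_V: "open V" and open_V': "open V'"
  and smooth_\<phi>: "smooth_on V \<phi>" and smooth_\<psi>: "smooth_on V' \<psi>"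
  and \<phi>_in: "x \<in> V \<Longrightarrow> \<phi> x \<in> V'" and \<psi>_in: "y \<in> V' \<Longrightarrow> \<psi> y \<in> V"
  and \<psi>_\<phi>: "x \<in> V \<Longrightarrow> \<psi> (\<phi> x) = x" and \<phi>_\<psi>: "y \<in> V' \<Longrightarrow> \<phi> (\<psi> y) = y"
begin

lemma diffeo_sym: "diffeo V' V \<psi> \<phi>"
 by unfold_locales (fact open_V open_V' smooth_\<phi> smooth_\<psi> | erule \<phi>_in \<psi>_in \<psi>_\<phi> \<phi>_\<psi>)+

lemma jmat_inv: assumes "x \<in> V" shows "jmat \<psi> (\<phi> x) ** jmat \<phi> x = mat 1"
proof -
 have "jmat (\<lambda>x. \<psi> (\<phi> x)) x = jmat \<psi> (\<phi> x) ** jmat \<phi> x"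
  using assms by (intro jmat_compose smooth_on_differentiable[OF smooth_\<phi>] smooth_on_differentiable[OF smooth_\<psi>] \<phi>_in)
 moreover have "jmat (\<lambda>x. \<psi> (\<phi> x)) x = jmat (\<lambda>x. x) x"
  by (rule jmat_cong_open[OF open_V assms \<psi>_\<phi>])
 ultimately show ?thesis by (simp add: jmat_ident)
qed

lemma det_jmat_inv: "x \<in> V \<Longrightarrow> det (jmat \<psi> (\<phi> x)) * det (jmat \<phi> x) = 1"
 using jmat_inv[of x] by (metis det_I det_mul)

lemma det_jmat_nz: "x \<in> V \<Longrightarrow> det (jmat \<phi> x) \<noteq> 0"
 using det_jmat_inv[of x] by auto

lemma weight_inv: "x \<in> V \<Longrightarrow> dw \<psi> s (\<phi> x) = dw \<phi> (- s) x"
proof -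
 assume x: "x \<in> V"
 have "\<bar>det (jmat \<psi> (\<phi> x))\<bar> = inverse \<bar>det (jmat \<phi> x)\<bar>"
  using det_jmat_inv[OF x] det_jmat_nz[OF x] by (metis abs_inverse inverse_unique mult.commute)
 then show ?thesis using det_jmat_nz[OF x] by (simp add: powr_minus inverse_powr)
qed

lemma smooth_weight: "smooth_on V (\<lambda>x. dw \<phi> s x)"
 by (intro smooth_on_abs_powr smooth_on_det_jmat open_V smooth_\<phi> det_jmat_nz)

lemma smooth_compose: "smooth_on V' f \<Longrightarrow> smooth_on V (\<lambda>x. f (\<phi> x))"
 by (rule smooth_on_compose[OF open_V smooth_\<phi> _ \<phi>_in])

lemma dpull_loc_fun: assumes "f \<in> loc_fun V'" shows "dpull V \<phi> s f \<in> loc_fun V"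
proof -
 have "smooth_on V (\<lambda>x. cr (dw \<phi> s x) * f (\<phi> x))"
  using assms smooth_weight smooth_compose open_V by (auto simp: loc_fun_def)
 then have "smooth_on V (dpull V \<phi> s f)"
  by (rule smooth_on_congI[OF open_V]) (simp add: dpull_def)
 then show ?thesis by (simp add: loc_fun_def dpull_def)
qed

lemma dpull_inverse: assumes "f \<in> loc_fun V" shows "dpull V \<phi> s (dpull V' \<psi> s f) = f"
proof
 fix x
 show "dpull V \<phi> s (dpull V' \<psi> s f) x = f x"
 proof (cases "x \<in> V")
  case True
  have "dw \<phi> s x * dw \<psi> s (\<phi> x) = 1"
   using True weight_inv[OF True, of s] det_jmat_nz[OF True] by (simp add: powr_minus)
  then have "cr (dw \<phi> s x) * cr (dw \<psi> s (\<phi> x)) = 1"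
   by (metis of_real_1 of_real_mult)
  then show ?thesis using True \<phi>_in \<psi>_\<phi> by (simp add: dpull_def flip: mult.assoc)
 qed (use assms in \<open>simp add: dpull_def loc_fun_def\<close>)
qed

lemma transpose_jmat_inv: "x \<in> V \<Longrightarrow> transpose (jmat \<phi> x) *v (transpose (jmat \<psi> (\<phi> x)) *v \<xi>) = \<xi>"
 using jmat_inv[of x] by (simp add: matrix_vector_mul_assoc matrix_transpose_mul[symmetric])

lemma transpose_jmat_inv': "x \<in> V \<Longrightarrow> transpose (jmat \<psi> (\<phi> x)) *v (transpose (jmat \<phi> x) *v \<xi>) = \<xi>"
 using jmat_inv[of x] by (simp add: matrix_vector_mul_assoc matrix_transpose_mul[symmetric] matrix_left_right_inverse)

lemma spull_inverse: assumes "P \<in> Sym V" shows "spull V \<phi> \<psi> s (spull V' \<psi> \<phi> s P) = P"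
proof (intro ext)
 fix x \<xi>
 show "spull V \<phi> \<psi> s (spull V' \<psi> \<phi> s P) x \<xi> = P x \<xi>"
 proof (cases "x \<in> V")
  case True
  have "dw \<phi> s x * dw \<psi> s (\<phi> x) = 1"
   using True weight_inv[OF True, of s] det_jmat_nz[OF True] by (simp add: powr_minus)
  then have "cr (dw \<phi> s x) * cr (dw \<psi> s (\<phi> x)) = 1"
   by (metis of_real_1 of_real_mult)
  then show ?thesis using True \<phi>_in \<psi>_\<phi> by (simp add: spull_def transpose_jmat_inv flip: mult.assoc)
 qed (use Sym_notin[OF assms] in \<open>simp add: spull_def\<close>)
qed

abbreviation cf where "cf j i x \<equiv> cr (jmat \<psi> (\<phi> x) $ j $ i)"

lemma smooth_cf: "smooth_on V (\<lambda>x. cf j i x)"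
 using smooth_compose[OF smooth_on_jmat_nth[OF open_V' smooth_\<psi>]] by (intro smooth_on_of_real open_V)

text \<open>One further fibre coordinate becomes a combination of fibre coordinates with the
  Jacobian entries \<open>cf\<close> as coefficients. Through this recursion pulling back is seen to
  preserve smoothness and order.\<close>

lemma spull_mono_Cons:
 "spull V \<phi> \<psi> s (mono_symbol V' u (i # is)) = (\<lambda>x \<xi>. \<Sum>j\<in>UNIV. fun_mult V (\<lambda>x. cf j i x) (mult_xi j (spull V \<phi> \<psi> s (mono_symbol V' u is))) x \<xi>)"
proof (intro ext)
 fix x \<xi>
 have "cr ((transpose (jmat \<psi> (\<phi> x)) *v \<xi>) $ i) = (\<Sum>j\<in>UNIV. cf j i x * cr (\<xi> $ j))"
  by (simp add: matrix_vector_mult_def transpose_def)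
 then show "spull V \<phi> \<psi> s (mono_symbol V' u (i # is)) x \<xi> =
   (\<Sum>j\<in>UNIV. fun_mult V (\<lambda>x. cf j i x) (mult_xi j (spull V \<phi> \<psi> s (mono_symbol V' u is))) x \<xi>)"
  using \<phi>_in by (cases "x \<in> V") (simp_all add: spull_def fun_mult_def mult_xi_def mono_symbol_def sum_distrib_left sum_distrib_right mult_ac)
qed

lemma spull_mono_upto:
 assumes "smooth_on V' u"
 shows "spull V \<phi> \<psi> s (mono_symbol V' u is) \<in> SymU V (int (length is))"
proof (induction "is")
 case Nil
 have "spull V \<phi> \<psi> s (mono_symbol V' u []) = mono_symbol V (\<lambda>x. cr (dw \<phi> s x) * u (\<phi> x)) []"
  using \<phi>_in by (auto simp: spull_def mono_symbol_def fun_eq_iff)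
 moreover have "smooth_on V (\<lambda>x. cr (dw \<phi> s x) * u (\<phi> x))"
  using assms smooth_weight smooth_compose open_V by auto
 ultimately show ?case
  using mono_symbol_upto[of "[]" "int (length [])" V "\<lambda>x. cr (dw \<phi> s x) * u (\<phi> x)"] by simp
next
 case (Cons i "is")
 have "fun_mult V (\<lambda>x. cf j i x) (mult_xi j (spull V \<phi> \<psi> s (mono_symbol V' u is))) \<in> SymU V (int (length (i # is)))" for j
  using fun_mult_upto[OF open_V smooth_cf mult_xi_upto[OF Cons open_V]] by (simp add: add.commute)
 then show ?case unfolding spull_mono_Cons by (intro SymU_sum open_V)
qed

lemma spull_upto:
 assumes "P \<in> SymU V' k" shows "spull V \<phi> \<psi> s P \<in> SymU V k"
 using assms open_V'
proof (induction rule: SymU_induct)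
 case zero
 then show ?case by simp
next
 case (mono u "is")
 show ?case by (rule subsetD[OF SymU_mono[OF open_V mono(2)] spull_mono_upto[OF mono(1)]])
next
 case (add P Q)
 show ?case unfolding spull_add by (rule SymU_add[OF open_V add(3,4)])
qed

lemma spull_loc: "P \<in> Sym V' \<Longrightarrow> spull V \<phi> \<psi> s P \<in> Sym V"
 using spull_upto Sym_iff by metis

text \<open>The chain rule, solved by the inverse Jacobian for the derivatives on the target,
  expresses one more derivative there through derivatives on V of the operator already found.
  Differentiating the density weight only adds terms of lower order.\<close>

lemma pull_monomial_op:
 fixes l m :: real
 defines "H \<equiv> (\<lambda>is f x. cr (dw \<phi> m x) * iter_pd is (dpull V' \<psi> l f) (\<phi> x))"
 shows "\<exists>P2\<in>SymU V (int (length is)).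
   (\<lambda>x \<xi>. P2 x \<xi> - spull V \<phi> \<psi> (m - l) (mono_symbol V' (\<lambda>x. 1) is) x \<xi>) \<in> SymU V (int (length is) - 1) \<and>
   (\<forall>f\<in>loc_fun V. \<forall>x\<in>V. H is f x = nop V P2 f x)"
proof (induction "is")
 case Nil
 let ?w = "\<lambda>x. cr (dw \<phi> (m - l) x)"
 have w: "smooth_on V ?w" using smooth_weight open_V by auto
 have "spull V \<phi> \<psi> (m - l) (mono_symbol V' (\<lambda>x. 1) []) = mono_symbol V ?w []"
  using \<phi>_in by (auto simp: spull_def mono_symbol_def fun_eq_iff)
 moreover have "H [] f x = nop V (mono_symbol V ?w []) f x" if f: "f \<in> loc_fun V" and x: "x \<in> V" for f x
 proof -
  have "dw \<phi> m x * dw \<psi> l (\<phi> x) = dw \<phi> (m - l) x"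
   unfolding weight_inv[OF x] using det_jmat_nz[OF x] by (simp add: powr_diff powr_minus field_simps)
  then have "cr (dw \<phi> m x) * cr (dw \<psi> l (\<phi> x)) = ?w x"
   by (metis of_real_mult)
  then show ?thesis using x \<phi>_in[OF x] \<psi>_\<phi>[OF x] nop_mono[OF open_V w f x, of "[]"]
   by (simp add: H_def dpull_def flip: mult.assoc)
 qed
 ultimately show ?case using mono_symbol_upto[OF _ w, of "[]"] by (intro bexI[of _ "mono_symbol V ?w []"]) auto
next
 case (Cons i "is")
 let ?k = "int (length is)" and ?S = "\<lambda>is. spull V \<phi> \<psi> (m - l) (mono_symbol V' (\<lambda>x. 1) is)"
 obtain P2 where P2: "P2 \<in> SymU V ?k" "(\<lambda>x \<xi>. P2 x \<xi> - ?S is x \<xi>) \<in> SymU V (?k - 1)"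
  "\<And>f x. f \<in> loc_fun V \<Longrightarrow> x \<in> V \<Longrightarrow> H is f x = nop V P2 f x"
  using Cons by blast
 have P2L: "P2 \<in> Sym V" using P2(1) by (auto simp: Sym_iff)
 define w where "w x = cr (dw \<phi> m x)" for x
 have w: "smooth_on V w" "\<And>x. x \<in> V \<Longrightarrow> w x \<noteq> 0"
 proof -
  have "w = (\<lambda>x. cr (dw \<phi> m x))" by (simp add: w_def fun_eq_iff)
  then show "smooth_on V w" using smooth_weight[of m] open_V by auto
 qed (use det_jmat_nz in \<open>simp add: w_def\<close>)
 \<comment> \<open>The logarithmic derivative of the weight \<open>w\<close>; it compensates for
   differentiating the weight together with the function.\<close>
 define v where "v j x = cr (dw \<phi> (- m) x) * pd j w x" for j x
 have v: "smooth_on V (v j)" for j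
  using smooth_weight[of "- m"] open_V w(1) by (auto simp: v_def[abs_def])
 have vw: "v j x * w x = pd j w x" if "x \<in> V" for j x
 proof -
  have "dw \<phi> (- m) x * dw \<phi> m x = 1"
   using det_jmat_nz[OF that] by (simp add: powr_minus)
  then have "cr (dw \<phi> (- m) x) * w x = 1"
   unfolding w_def by (metis of_real_1 of_real_mult)
  then show ?thesis by (simp add: v_def mult_ac)
 qed
 define R where "R j = (\<lambda>x \<xi>. deriv_x V j P2 x \<xi> - fun_mult V (v j) P2 x \<xi>)" for j
 define T where "T j = (\<lambda>x \<xi>. R j x \<xi> + mult_xi j P2 x \<xi>)" for j
 \<comment> \<open>\<open>T j\<close> is the symbol of the j-th derivative minus \<open>v j\<close>,
   composed after the operator of \<open>P2\<close>; the entries of the inverse Jacobian then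
   combine these.\<close>
 define N where "N = (\<lambda>x \<xi>. \<Sum>j\<in>UNIV. fun_mult V (\<lambda>x. cf j i x) (T j) x \<xi>)"
 have R: "R j \<in> SymU V ?k" for j
  unfolding R_def by (intro SymU_diff open_V deriv_x_upto P2 fun_mult_upto v)
 have T: "T j \<in> SymU V (?k + 1)" for j
  unfolding T_def using R SymU_mono[OF open_V, of ?k "?k + 1"] mult_xi_upto[OF P2(1) open_V]
  by (intro SymU_add open_V) auto
 have N: "N \<in> SymU V (?k + 1)"
  unfolding N_def by (intro SymU_sum fun_mult_upto open_V smooth_cf T)
 have "(\<lambda>x \<xi>. N x \<xi> - ?S (i # is) x \<xi>) = (\<lambda>x \<xi>. \<Sum>j\<in>UNIV. fun_mult V (\<lambda>x. cf j i x)
   (\<lambda>x \<xi>. R j x \<xi> + mult_xi j (\<lambda>x \<xi>. P2 x \<xi> - ?S is x \<xi>) x \<xi>) x \<xi>)"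
  unfolding N_def spull_mono_Cons sum_subtractf[symmetric]
  by (intro ext sum.cong refl) (auto simp: fun_mult_def T_def mult_xi_def algebra_simps)
 also have "\<dots> \<in> SymU V ?k"
  using mult_xi_upto[OF P2(2) open_V] by (intro SymU_sum fun_mult_upto SymU_add open_V smooth_cf R) simp
 finally have top: "(\<lambda>x \<xi>. N x \<xi> - ?S (i # is) x \<xi>) \<in> SymU V ?k" .
 have "H (i # is) f x = nop V N f x" if f: "f \<in> loc_fun V" and x: "x \<in> V" for f x
 proof -
  interpret s: diffeo V' V \<psi> \<phi> by (rule diffeo_sym)
  let ?h = "dpull V' \<psi> l f" and ?u = "nop V P2 f"
  have h: "smooth_on V' ?h" using s.dpull_loc_fun[OF f] by (simp add: loc_fun_def)
  have "pd j ?u x = v j x * ?u x + (\<Sum>a\<in>UNIV. cr (jmat \<phi> x $ a $ j) * H (a # is) f x)" for j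
  proof -
   have "pd j ?u x = pd j (\<lambda>x. w x * iter_pd is ?h (\<phi> x)) x"
    by (rule pd_cong_open[OF open_V x]) (simp add: P2(3)[OF f, symmetric] H_def w_def)
   also have "\<dots> = w x * pd j (\<lambda>x. iter_pd is ?h (\<phi> x)) x + pd j w x * iter_pd is ?h (\<phi> x)"
    using w(1) smooth_compose[OF smooth_on_iter_pd[OF h]] x by (intro pd_mult smooth_on_differentiable[of V]) auto
   also have "pd j (\<lambda>x. iter_pd is ?h (\<phi> x)) x = (\<Sum>a\<in>UNIV. pd j \<phi> x $ a *\<^sub>R pd a (iter_pd is ?h) (\<phi> x))"
    using smooth_\<phi> x \<phi>_in[OF x] h by (intro pd_compose smooth_on_differentiable[of V] smooth_on_differentiable[of V']) auto
   also have "pd j w x * iter_pd is ?h (\<phi> x) = v j x * ?u x"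
    using vw[OF x] P2(3)[OF f x] by (simp add: H_def w_def mult_ac flip: vw[OF x])
   finally show ?thesis by (simp add: H_def w_def jmat_nth scaleR_conv_of_real sum_distrib_left mult_ac)
  qed
  then have pdu: "pd j ?u x - v j x * ?u x = (\<Sum>a\<in>UNIV. cr (jmat \<phi> x $ a $ j) * H (a # is) f x)" for j by simp
  have "nop V N f x = (\<Sum>j\<in>UNIV. cf j i x * (pd j ?u x - v j x * ?u x))"
  proof -
   have nsum: "nop V (\<lambda>x \<xi>. \<Sum>j\<in>I. F j x \<xi>) f x = (\<Sum>j\<in>I. nop V (F j) f x) \<and> (\<lambda>x \<xi>. \<Sum>j\<in>I. F j x \<xi>) \<in> Sym V"
    if "\<And>j. F j \<in> Sym V" "finite I" for F and I :: "'n set"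
    using that(2)
   proof (induction I)
    case (insert j I)
    then show ?case using that(1)[of j] by (simp add: nop_add[OF open_V] Sym_add[OF open_V])
   qed (use open_V in simp)
   have TL: "T j \<in> Sym V" for j
    using T Sym_iff by blast
   have dm: "(\<lambda>x \<xi>. deriv_x V j P2 x \<xi> + mult_xi j P2 x \<xi>) \<in> Sym V" "fun_mult V (v j) P2 \<in> Sym V" for j
    by (intro Sym_add deriv_x_loc mult_xi_loc open_V P2L, intro fun_mult_loc open_V v P2L)
   have "T j = (\<lambda>x \<xi>. 1 * (deriv_x V j P2 x \<xi> + mult_xi j P2 x \<xi>) + (- 1) * fun_mult V (v j) P2 x \<xi>)" for j
    by (simp add: T_def R_def fun_eq_iff)
   then have "nop V (T j) f x = pd j ?u x - v j x * ?u x" for j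
    using nop_lin[OF open_V dm, of 1 j "- 1" j f x]
    unfolding nop_pd_left[OF open_V P2L f] nop_fun_mult[OF open_V v P2L x] using x by (simp add: pd_on_def)
   then show ?thesis
    unfolding N_def using nsum[of "\<lambda>j. fun_mult V (\<lambda>x. cf j i x) (T j)" UNIV]
    by (simp add: fun_mult_loc[OF open_V smooth_cf TL] nop_fun_mult[OF open_V smooth_cf TL x])
  qed
  also have "\<dots> = (\<Sum>a\<in>UNIV. (\<Sum>j\<in>UNIV. cf j i x * cr (jmat \<phi> x $ a $ j)) * H (a # is) f x)"
   unfolding pdu sum_distrib_left sum_distrib_right by (subst sum.swap) (simp add: mult_ac)
  also have "\<dots> = (\<Sum>a\<in>UNIV. (if a = i then 1 else 0) * H (a # is) f x)"
  proof (intro sum.cong refl arg_cong2[of _ _ _ _ "(*)"])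
   fix a
   have "jmat \<phi> x ** jmat \<psi> (\<phi> x) = mat 1" using jmat_inv[OF x] matrix_left_right_inverse by blast
   then have "(\<Sum>j\<in>UNIV. jmat \<phi> x $ a $ j * jmat \<psi> (\<phi> x) $ j $ i) = (if a = i then 1 else 0)"
    by (simp add: vec_eq_iff matrix_matrix_mult_def mat_def)
   then have "cr (\<Sum>j\<in>UNIV. jmat \<phi> x $ a $ j * jmat \<psi> (\<phi> x) $ j $ i) = (if a = i then 1 else 0)" by simp
   then show "(\<Sum>j\<in>UNIV. cf j i x * cr (jmat \<phi> x $ a $ j)) = (if a = i then 1 else 0)"
    by (simp add: mult.commute)
  qed
  also have "\<dots> = H (i # is) f x" by (simp add: if_distrib[of "\<lambda>t. t * _"] cong: if_cong)
  finally show ?thesis by simp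
 qed
 then show ?case using N top by (intro bexI[of _ N]) (auto simp: add.commute)
qed

text \<open>Monomials reduce to \<open>pull_monomial_op\<close> by multiplying with the transported
  coefficient. The bound on the difference to \<open>spull\<close> is what carries principal symbols
  through a change of coordinates.\<close>

lemma pull_op:
 assumes "P \<in> SymU V' k"
 shows "\<exists>P2\<in>SymU V k. (\<lambda>x \<xi>. P2 x \<xi> - spull V \<phi> \<psi> (m - l) P x \<xi>) \<in> SymU V (k - 1) \<and>
   (\<forall>f\<in>loc_fun V. dpull V \<phi> m (nop V' P (dpull V' \<psi> l f)) = nop V P2 f)"
 using assms open_V'
proof (induction rule: SymU_induct)
 case zero
 show ?case using open_V open_V' by (intro bexI[of _ "\<lambda>x \<xi>. 0"]) (auto simp: dpull_def)
next
 case (mono u "is")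
 interpret s: diffeo V' V \<psi> \<phi> by (rule diffeo_sym)
 from pull_monomial_op[of "is" m l] obtain P2 where P2: "P2 \<in> SymU V (int (length is))"
  "(\<lambda>x \<xi>. P2 x \<xi> - spull V \<phi> \<psi> (m - l) (mono_symbol V' (\<lambda>x. 1) is) x \<xi>) \<in> SymU V (int (length is) - 1)"
  and P2_all: "\<forall>f\<in>loc_fun V. \<forall>x\<in>V. cr (dw \<phi> m x) * iter_pd is (dpull V' \<psi> l f) (\<phi> x) = nop V P2 f x"
  by (elim bexE conjE)
 let ?P = "fun_mult V (\<lambda>x. u (\<phi> x)) P2"
 have u: "smooth_on V (\<lambda>x. u (\<phi> x))" using mono smooth_compose by blast
 have P2L: "P2 \<in> Sym V" using P2(1) by (auto simp: Sym_iff)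
 have m: "SymU V (int (length is)) \<subseteq> SymU V k" "SymU V (int (length is) - 1) \<subseteq> SymU V (k - 1)"
  using mono(2) by (intro SymU_mono open_V; simp)+
 have "(\<lambda>x \<xi>. ?P x \<xi> - spull V \<phi> \<psi> (m - l) (mono_symbol V' u is) x \<xi>) =
   fun_mult V (\<lambda>x. u (\<phi> x)) (\<lambda>x \<xi>. P2 x \<xi> - spull V \<phi> \<psi> (m - l) (mono_symbol V' (\<lambda>x. 1) is) x \<xi>)"
  using \<phi>_in by (auto simp: fun_mult_def spull_def mono_symbol_def fun_eq_iff algebra_simps)
 then have "(\<lambda>x \<xi>. ?P x \<xi> - spull V \<phi> \<psi> (m - l) (mono_symbol V' u is) x \<xi>) \<in> SymU V (k - 1)"
  using fun_mult_upto[OF open_V u P2(2)] m by auto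
 moreover have "dpull V \<phi> m (nop V' (mono_symbol V' u is) (dpull V' \<psi> l f)) x = nop V ?P f x" if f: "f \<in> loc_fun V" for f x
 proof (cases "x \<in> V")
  case True
  then show ?thesis
   using nop_fun_mult[OF open_V u P2L True] bspec[OF bspec[OF P2_all f] True] nop_mono[OF open_V' mono(1) s.dpull_loc_fun[OF f] \<phi>_in[OF True]]
   by (simp add: dpull_def[of V \<phi>] mult_ac)
 next
  case False
  then show ?thesis using nop_notin[OF open_V fun_mult_loc[OF open_V u P2L]] by (simp add: dpull_def)
 qed
 moreover have "?P \<in> SymU V k" using fun_mult_upto[OF open_V u P2(1)] m by auto
 ultimately show ?case by (intro bexI[of _ ?P]) auto
next
 case (add P Q)
 then obtain P2 Q2 where *: "P2 \<in> SymU V k" "(\<lambda>x \<xi>. P2 x \<xi> - spull V \<phi> \<psi> (m - l) P x \<xi>) \<in> SymU V (k - 1)"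
   "\<And>f. f \<in> loc_fun V \<Longrightarrow> dpull V \<phi> m (nop V' P (dpull V' \<psi> l f)) = nop V P2 f"
   "Q2 \<in> SymU V k" "(\<lambda>x \<xi>. Q2 x \<xi> - spull V \<phi> \<psi> (m - l) Q x \<xi>) \<in> SymU V (k - 1)"
   "\<And>f. f \<in> loc_fun V \<Longrightarrow> dpull V \<phi> m (nop V' Q (dpull V' \<psi> l f)) = nop V Q2 f" by blast
 have L: "P \<in> Sym V'" "Q \<in> Sym V'" "P2 \<in> Sym V" "Q2 \<in> Sym V"
  using add(1,2) *(1,4) by (auto simp: Sym_iff)
 have "(\<lambda>x \<xi>. (P2 x \<xi> + Q2 x \<xi>) - spull V \<phi> \<psi> (m - l) (\<lambda>x \<xi>. P x \<xi> + Q x \<xi>) x \<xi>) =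
   (\<lambda>x \<xi>. (P2 x \<xi> - spull V \<phi> \<psi> (m - l) P x \<xi>) + (Q2 x \<xi> - spull V \<phi> \<psi> (m - l) Q x \<xi>))"
  by (simp add: spull_add algebra_simps)
 then have "(\<lambda>x \<xi>. (P2 x \<xi> + Q2 x \<xi>) - spull V \<phi> \<psi> (m - l) (\<lambda>x \<xi>. P x \<xi> + Q x \<xi>) x \<xi>) \<in> SymU V (k - 1)"
  using SymU_add[OF open_V *(2,5)] by simp
 moreover have "dpull V \<phi> m (nop V' (\<lambda>x \<xi>. P x \<xi> + Q x \<xi>) (dpull V' \<psi> l f)) = nop V (\<lambda>x \<xi>. P2 x \<xi> + Q2 x \<xi>) f"
  if "f \<in> loc_fun V" for f
 proof
  fix x
  have "dpull V \<phi> m (nop V' (\<lambda>x \<xi>. P x \<xi> + Q x \<xi>) (dpull V' \<psi> l f)) x =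
    dpull V \<phi> m (nop V' P (dpull V' \<psi> l f)) x + dpull V \<phi> m (nop V' Q (dpull V' \<psi> l f)) x"
   using L by (simp add: dpull_def nop_add[OF open_V'] algebra_simps)
  then show "dpull V \<phi> m (nop V' (\<lambda>x \<xi>. P x \<xi> + Q x \<xi>) (dpull V' \<psi> l f)) x = nop V (\<lambda>x \<xi>. P2 x \<xi> + Q2 x \<xi>) f x"
   using *(3,6) that L by (simp add: nop_add[OF open_V])
 qed
 ultimately show ?case using SymU_add[OF open_V *(1,4)] by (intro bexI) auto
qed

subsection \<open>Related vector fields\<close>

text \<open>Besides relatedness of the two fields this records the infinitesimal change of variables
  for powers of the Jacobian determinant. For conformal fields it is verified in
  \<open>conformal_related\<close> by means of the scale factor.\<close>

definition related :: "(real ^ 'n \<Rightarrow> real ^ 'n) \<Rightarrow> (real ^ 'n \<Rightarrow> real ^ 'n) \<Rightarrow> bool" where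
 "related X X' \<longleftrightarrow> smooth_on UNIV X \<and> smooth_on UNIV X' \<and> (\<forall>x\<in>V. jmat \<phi> x *v X x = X' (\<phi> x) \<and>
   (\<forall>s. (\<Sum>i\<in>UNIV. X x $ i * pd i (\<lambda>x. dw \<phi> s x) x) =
    s * (divergence X' (\<phi> x) - divergence X x) * dw \<phi> s x))"

lemma related_sum_pd:
 assumes rel: "related X X'" and x: "x \<in> V" and f: "smooth_on V' f"
 shows "(\<Sum>i\<in>UNIV. cr (X x $ i) * pd i (\<lambda>x. cr (dw \<phi> s x) * f (\<phi> x)) x) =
   cr (dw \<phi> s x) * ((\<Sum>b\<in>UNIV. cr (X' (\<phi> x) $ b) * pd b f (\<phi> x))
    + cr (s * (divergence X' (\<phi> x) - divergence X x)) * f (\<phi> x))"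
proof -
 let ?w = "\<lambda>x. dw \<phi> s x"
 have w: "smooth_on V (\<lambda>x. cr (?w x))" "smooth_on V ?w" using smooth_weight open_V by auto
 note d = smooth_on_differentiable[OF _ x]
 have pw: "pd i (\<lambda>x. cr (?w x)) x = cr (pd i ?w x)" for i
  by (rule pd_bounded_linear[OF bounded_linear_of_real d[OF w(2)]])
 have pf: "pd i (\<lambda>x. f (\<phi> x)) x = (\<Sum>b\<in>UNIV. cr (jmat \<phi> x $ b $ i) * pd b f (\<phi> x))" for i
  unfolding jmat_nth
  by (subst pd_compose) (auto intro!: d smooth_\<phi> smooth_on_differentiable[OF f] \<phi>_in x simp: scaleR_conv_of_real)
 have "pd i (\<lambda>x. cr (?w x) * f (\<phi> x)) x =
   cr (?w x) * (\<Sum>b\<in>UNIV. cr (jmat \<phi> x $ b $ i) * pd b f (\<phi> x)) + cr (pd i ?w x) * f (\<phi> x)" for i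
  unfolding pf[symmetric] pw[symmetric] using w smooth_compose[OF f] by (intro pd_mult d)
 then have "(\<Sum>i\<in>UNIV. cr (X x $ i) * pd i (\<lambda>x. cr (?w x) * f (\<phi> x)) x) =
   cr (?w x) * (\<Sum>i\<in>UNIV. \<Sum>b\<in>UNIV. cr (jmat \<phi> x $ b $ i * X x $ i) * pd b f (\<phi> x))
   + cr (\<Sum>i\<in>UNIV. X x $ i * pd i ?w x) * f (\<phi> x)"
  by (simp add: distrib_left sum.distrib sum_distrib_left sum_distrib_right mult_ac)
 also have "(\<Sum>i\<in>UNIV. \<Sum>b\<in>UNIV. cr (jmat \<phi> x $ b $ i * X x $ i) * pd b f (\<phi> x)) =
   (\<Sum>b\<in>UNIV. cr ((jmat \<phi> x *v X x) $ b) * pd b f (\<phi> x))"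
  by (subst sum.swap) (simp add: matrix_vector_mult_def sum_distrib_right)
 finally show ?thesis using rel x unfolding related_def by (simp add: algebra_simps)
qed

lemma lie_density_natural:
 assumes rel: "related X X'" and f: "f \<in> loc_fun V'"
 shows "lie_density V s X (dpull V \<phi> s f) = dpull V \<phi> s (lie_density V' s X' f)"
proof
 fix x
 show "lie_density V s X (dpull V \<phi> s f) x = dpull V \<phi> s (lie_density V' s X' f) x"
 proof (cases "x \<in> V")
  case True
  have "pd i (dpull V \<phi> s f) x = pd i (\<lambda>x. cr (dw \<phi> s x) * f (\<phi> x)) x" for i
   by (rule pd_cong_open[OF open_V True]) (simp add: dpull_def)
  then show ?thesis
   using related_sum_pd[OF rel True, of f s] f True \<phi>_in[OF True]
   by (simp add: lie_density_def dpull_def loc_fun_def algebra_simps)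
 qed (simp add: lie_density_def dpull_def)
qed

text \<open>The covector is frozen at the target: for fixed \<open>\<eta>\<close> let
  \<open>\<zeta> y\<close> be its pull-back to y. Along \<open>\<zeta>\<close> the pulled back
  symbol is the weight times \<open>P (\<phi> y) \<eta>\<close>. Differentiating this along X yields
  the base terms, and the motion of \<open>\<zeta>\<close> accounts for the fibre terms.\<close>

lemma lie_symbol_natural:
 assumes rel: "related X X'" and P: "P \<in> Sym V'"
 shows "lie_symbol V s X (spull V \<phi> \<psi> s P) = spull V \<phi> \<psi> s (lie_symbol V' s X' P)"
proof (intro ext)
 fix x \<xi>
 let ?Q = "spull V \<phi> \<psi> s P"
 have Q: "?Q \<in> Sym V" by (rule spull_loc[OF P])
 show "lie_symbol V s X ?Q x \<xi> = spull V \<phi> \<psi> s (lie_symbol V' s X' P) x \<xi>"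
 proof (cases "x \<in> V")
  case x: True
  note d = smooth_on_differentiable[OF _ x]
  define \<eta> where "\<eta> = transpose (jmat \<psi> (\<phi> x)) *v \<xi>"
  define \<zeta> where "\<zeta> y = transpose (jmat \<phi> y) *v \<eta>" for y
  have \<zeta>x: "\<zeta> x = \<xi>" using transpose_jmat_inv[OF x] by (simp add: \<zeta>_def \<eta>_def)
  have \<zeta>_nth: "\<zeta> y $ k = (\<Sum>a\<in>UNIV. \<eta> $ a * pd k \<phi> y $ a)" for y k
   by (simp add: \<zeta>_def matrix_vector_mult_def transpose_def jmat_nth mult.commute)
  have \<zeta>: "smooth_on V \<zeta>"
   using smooth_\<phi> open_V by (intro smooth_on_vecI) (auto simp: \<zeta>_nth)
  let ?w = "\<lambda>x. cr (dw \<phi> s x)"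
  have ident: "?Q y (transpose (jmat \<phi> y) *v \<theta>) = ?w y * P (\<phi> y) \<theta>" if "y \<in> V" for y \<theta>
   using transpose_jmat_inv'[OF that] that by (simp add: spull_def)
  have X: "smooth_on V X" "smooth_on V' X'" "smooth_on UNIV X" "smooth_on UNIV X'"
   using rel smooth_on_subset unfolding related_def by blast+
  have \<phi>X: "jmat \<phi> y *v X y = X' (\<phi> y)" if "y \<in> V" for y using rel that unfolding related_def by blast
  have c\<zeta>: "(\<Sum>i\<in>UNIV. X x $ i * pd i \<zeta> x $ k) =
    (\<Sum>b\<in>UNIV. jmat \<phi> x $ b $ k * (\<Sum>a\<in>UNIV. pd b X' (\<phi> x) $ a * \<eta> $ a)) - (\<Sum>i\<in>UNIV. pd k X x $ i * \<xi> $ i)" for k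
  proof -
   have pd2: "pd i \<zeta> x $ k = (\<Sum>a\<in>UNIV. \<eta> $ a * pd k (pd i \<phi>) x $ a)" for i
   proof -
    have "pd i \<zeta> x $ k = pd i (\<lambda>y. \<zeta> y $ k) x" by (rule pd_nth[symmetric, OF d[OF \<zeta>]])
    also have "\<dots> = (\<Sum>a\<in>UNIV. pd i (\<lambda>y. \<eta> $ a * pd k \<phi> y $ a) x)"
     unfolding \<zeta>_nth using smooth_\<phi> open_V by (intro pd_sum d) auto
    also have "\<dots> = (\<Sum>a\<in>UNIV. \<eta> $ a * pd i (pd k \<phi>) x $ a)"
    proof (intro sum.cong refl)
     fix a
     have sm: "smooth_on V (pd k \<phi>)" "smooth_on V (\<lambda>y. pd k \<phi> y $ a)" using smooth_\<phi> open_V by auto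
     have "pd i (\<lambda>y. \<eta> $ a * pd k \<phi> y $ a) x = \<eta> $ a * pd i (\<lambda>y. pd k \<phi> y $ a) x"
      by (rule pd_bounded_linear[OF bounded_linear_mult_right d[OF sm(2)]])
     then show "pd i (\<lambda>y. \<eta> $ a * pd k \<phi> y $ a) x = \<eta> $ a * pd i (pd k \<phi>) x $ a"
      by (simp add: pd_nth[OF d[OF sm(1)]])
    qed
    finally show ?thesis by (simp add: pd_swap[OF open_V x smooth_\<phi>])
   qed
   \<comment> \<open>Second derivatives of \<open>\<phi>\<close> are eliminated by differentiating
     the relation \<open>jmat \<phi> y *v X y = X' (\<phi> y)\<close>.\<close>
   have der: "(\<Sum>i\<in>UNIV. X x $ i * pd k (pd i \<phi>) x $ a) =
     (\<Sum>b\<in>UNIV. jmat \<phi> x $ b $ k * pd b X' (\<phi> x) $ a) - (\<Sum>i\<in>UNIV. pd k X x $ i * jmat \<phi> x $ a $ i)" for a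
   proof -
    have "pd k (\<lambda>y. \<Sum>i\<in>UNIV. X y $ i * pd i \<phi> y $ a) x = pd k (\<lambda>y. X' (\<phi> y) $ a) x"
    proof (rule pd_cong_open[OF open_V x])
     fix y assume "y \<in> V"
     from \<phi>X[OF this] show "(\<Sum>i\<in>UNIV. X y $ i * pd i \<phi> y $ a) = X' (\<phi> y) $ a"
      by (simp add: vec_eq_iff matrix_vector_mult_def jmat_nth mult.commute)
    qed
    also have "pd k (\<lambda>y. X' (\<phi> y) $ a) x = pd k (\<lambda>y. X' (\<phi> y)) x $ a"
     by (rule pd_nth[OF d[OF smooth_compose[OF X(2)]]])
    also have "pd k (\<lambda>y. X' (\<phi> y)) x = (\<Sum>b\<in>UNIV. pd k \<phi> x $ b *\<^sub>R pd b X' (\<phi> x))"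
     using smooth_\<phi> X(2) \<phi>_in[OF x] by (intro pd_compose d smooth_on_differentiable[of V'])
    finally have 1: "pd k (\<lambda>y. \<Sum>i\<in>UNIV. X y $ i * pd i \<phi> y $ a) x = (\<Sum>b\<in>UNIV. jmat \<phi> x $ b $ k * pd b X' (\<phi> x) $ a)"
     by (simp add: jmat_nth)
    have "pd k (\<lambda>y. \<Sum>i\<in>UNIV. X y $ i * pd i \<phi> y $ a) x = (\<Sum>i\<in>UNIV. pd k (\<lambda>y. X y $ i * pd i \<phi> y $ a) x)"
     using X smooth_\<phi> open_V by (intro pd_sum d) auto
    also have "\<dots> = (\<Sum>i\<in>UNIV. X x $ i * pd k (pd i \<phi>) x $ a + pd k X x $ i * pd i \<phi> x $ a)"
    proof (intro sum.cong refl)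
     fix i
     have sm: "smooth_on V (pd i \<phi>)" "smooth_on V (\<lambda>y. pd i \<phi> y $ a)" "smooth_on V (\<lambda>y. X y $ i)"
      using X smooth_\<phi> open_V by auto
     have "pd k (\<lambda>y. X y $ i * pd i \<phi> y $ a) x = X x $ i * pd k (\<lambda>y. pd i \<phi> y $ a) x + pd k (\<lambda>y. X y $ i) x * pd i \<phi> x $ a"
      by (rule pd_mult[OF d[OF sm(3)] d[OF sm(2)]])
     then show "pd k (\<lambda>y. X y $ i * pd i \<phi> y $ a) x = X x $ i * pd k (pd i \<phi>) x $ a + pd k X x $ i * pd i \<phi> x $ a"
      by (simp add: pd_nth[OF d[OF sm(1)]] pd_nth[OF d[OF X(1)]])
    qed
    finally show ?thesis using 1 by (simp add: sum.distrib jmat_nth)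
   qed
   have "(\<Sum>i\<in>UNIV. X x $ i * pd i \<zeta> x $ k) = (\<Sum>a\<in>UNIV. \<eta> $ a * (\<Sum>i\<in>UNIV. X x $ i * pd k (pd i \<phi>) x $ a))"
    unfolding pd2 sum_distrib_left by (subst sum.swap) (simp add: mult_ac)
   also have "\<dots> = (\<Sum>a\<in>UNIV. \<eta> $ a * (\<Sum>b\<in>UNIV. jmat \<phi> x $ b $ k * pd b X' (\<phi> x) $ a))
     - (\<Sum>a\<in>UNIV. \<eta> $ a * (\<Sum>i\<in>UNIV. pd k X x $ i * jmat \<phi> x $ a $ i))"
    unfolding der by (simp add: right_diff_distrib sum_subtractf)
   also have "(\<Sum>a\<in>UNIV. \<eta> $ a * (\<Sum>b\<in>UNIV. jmat \<phi> x $ b $ k * pd b X' (\<phi> x) $ a)) =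
     (\<Sum>b\<in>UNIV. jmat \<phi> x $ b $ k * (\<Sum>a\<in>UNIV. pd b X' (\<phi> x) $ a * \<eta> $ a))"
    unfolding sum_distrib_left by (subst sum.swap) (simp add: mult_ac)
   also have "(\<Sum>a\<in>UNIV. \<eta> $ a * (\<Sum>i\<in>UNIV. pd k X x $ i * jmat \<phi> x $ a $ i)) = (\<Sum>i\<in>UNIV. pd k X x $ i * \<xi> $ i)"
    unfolding \<zeta>x[symmetric] \<zeta>_nth sum_distrib_left jmat_nth by (subst sum.swap) (simp add: mult_ac)
   finally show ?thesis .
  qed
  \<comment> \<open>Obtained by differentiating \<open>ident\<close> in the fibre direction, where
    the map is the linear one given by the transposed Jacobian.\<close>
  have deta: "(\<Sum>k\<in>UNIV. cr (jmat \<phi> x $ b $ k) * deriv_xi k ?Q x \<xi>) = ?w x * pd b (P (\<phi> x)) \<eta>" for b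
  proof -
   have lin: "bounded_linear (\<lambda>\<theta>. transpose (jmat \<phi> x) *v \<theta>)" by (rule matrix_vector_mul_bounded_linear)
   have dl: "(\<lambda>\<theta>. transpose (jmat \<phi> x) *v \<theta>) differentiable (at \<eta>)"
    by (rule bounded_linear_imp_differentiable[OF lin])
   have "pd b (\<lambda>\<theta>. ?Q x (transpose (jmat \<phi> x) *v \<theta>)) \<eta> =
    (\<Sum>k\<in>UNIV. pd b (\<lambda>\<theta>. transpose (jmat \<phi> x) *v \<theta>) \<eta> $ k *\<^sub>R pd k (?Q x) (transpose (jmat \<phi> x) *v \<eta>))"
    by (rule pd_compose[OF dl smooth_on_differentiable[OF smooth_on_symbol_xi[OF Q open_V] UNIV_I]])
   also have "pd b (\<lambda>\<theta>. transpose (jmat \<phi> x) *v \<theta>) \<eta> = transpose (jmat \<phi> x) *v axis b 1"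
    by (rule pd_eqI[OF bounded_linear.has_derivative[OF lin has_derivative_ident]])
   finally have "pd b (\<lambda>\<theta>. ?Q x (transpose (jmat \<phi> x) *v \<theta>)) \<eta> = (\<Sum>k\<in>UNIV. cr (jmat \<phi> x $ b $ k) * deriv_xi k ?Q x \<xi>)"
    using \<zeta>x by (simp add: \<zeta>_def scaleR_conv_of_real deriv_xi_def matrix_vector_mult_basis column_def transpose_def)
   moreover have "(\<lambda>\<theta>. ?Q x (transpose (jmat \<phi> x) *v \<theta>)) = (\<lambda>\<theta>. ?w x * P (\<phi> x) \<theta>)" using ident[OF x] by auto
   moreover have "pd b (\<lambda>\<theta>. ?w x * P (\<phi> x) \<theta>) \<eta> = ?w x * pd b (P (\<phi> x)) \<eta>"
    by (rule pd_bounded_linear[OF bounded_linear_mult_right smooth_on_differentiable[OF smooth_on_symbol_xi[OF P open_V'] UNIV_I]])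
   ultimately show ?thesis by metis
  qed
  let ?D = "\<lambda>k. deriv_xi k ?Q x \<xi>" and ?p = "P (\<phi> x) \<eta>" and ?k = "cr (s * (divergence X' (\<phi> x) - divergence X x))"
  let ?A = "\<Sum>i\<in>UNIV. cr (X x $ i) * deriv_x V i ?Q x \<xi>" and ?B = "\<Sum>k\<in>UNIV. cr (\<Sum>i\<in>UNIV. pd k X x $ i * \<xi> $ i) * ?D k"
   and ?C = "\<Sum>k\<in>UNIV. cr (\<Sum>i\<in>UNIV. X x $ i * pd i \<zeta> x $ k) * ?D k"
   and ?E = "\<Sum>b\<in>UNIV. cr (X' (\<phi> x) $ b) * pd b (\<lambda>y. P y \<eta>) (\<phi> x)"
   and ?F = "\<Sum>b\<in>UNIV. cr (\<Sum>a\<in>UNIV. pd b X' (\<phi> x) $ a * \<eta> $ a) * pd b (P (\<phi> x)) \<eta>"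
  have "pd i (\<lambda>y. ?Q y (\<zeta> y)) x = pd i (\<lambda>y. ?w y * P (\<phi> y) \<eta>) x" for i
   by (rule pd_cong_open[OF open_V x]) (simp add: \<zeta>_def ident)
  moreover have "pd i (\<lambda>y. ?Q y (\<zeta> y)) x = deriv_x V i ?Q x \<xi> + (\<Sum>k\<in>UNIV. cr (pd i \<zeta> x $ k) * ?D k)" for i
   using pd_symbol_compose(1)[OF open_V Q \<zeta> x] \<zeta>x by simp
  ultimately have "(\<Sum>i\<in>UNIV. cr (X x $ i) * (deriv_x V i ?Q x \<xi> + (\<Sum>k\<in>UNIV. cr (pd i \<zeta> x $ k) * ?D k)))
    = (\<Sum>i\<in>UNIV. cr (X x $ i) * pd i (\<lambda>y. ?w y * P (\<phi> y) \<eta>) x)" by simp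
  also have "\<dots> = ?w x * (?E + ?k * ?p)"
   by (rule related_sum_pd[OF rel x smooth_on_symbol_x[OF P open_V']])
  also have "(\<Sum>i\<in>UNIV. cr (X x $ i) * (deriv_x V i ?Q x \<xi> + (\<Sum>k\<in>UNIV. cr (pd i \<zeta> x $ k) * ?D k))) = ?A + ?C"
  proof -
   have "?C = (\<Sum>i\<in>UNIV. cr (X x $ i) * (\<Sum>k\<in>UNIV. cr (pd i \<zeta> x $ k) * ?D k))"
    unfolding sum_distrib_left by (subst sum.swap) (simp add: sum_distrib_right mult.assoc)
   then show ?thesis by (simp add: distrib_left sum.distrib)
  qed
  finally have main: "?A + ?C = ?w x * (?E + ?k * ?p)" .
  have "?C = (\<Sum>b\<in>UNIV. cr (\<Sum>a\<in>UNIV. pd b X' (\<phi> x) $ a * \<eta> $ a) * (?w x * pd b (P (\<phi> x)) \<eta>)) - ?B"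
  proof -
   have "(\<Sum>k\<in>UNIV. cr (\<Sum>b\<in>UNIV. jmat \<phi> x $ b $ k * c b) * D k) =
     (\<Sum>b\<in>UNIV. cr (c b) * (\<Sum>k\<in>UNIV. cr (jmat \<phi> x $ b $ k) * D k))" for c :: "'n \<Rightarrow> real" and D :: "'n \<Rightarrow> complex"
    by (simp add: sum_distrib_left sum_distrib_right) (subst sum.swap, simp add: mult_ac)
   then show ?thesis unfolding c\<zeta> deta[symmetric] of_real_diff left_diff_distrib sum_subtractf by (simp only:)
  qed
  also have "(\<Sum>b\<in>UNIV. cr (\<Sum>a\<in>UNIV. pd b X' (\<phi> x) $ a * \<eta> $ a) * (?w x * pd b (P (\<phi> x)) \<eta>)) = ?w x * ?F"
   unfolding sum_distrib_left[of "?w x"] by (intro sum.cong refl) (simp only: mult_ac)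
  finally have fin: "?C = ?w x * ?F - ?B" .
  \<comment> \<open>The final bookkeeping is stated for plain complex numbers, so that the sums stay
    opaque.\<close>
  have alg: "A - B + k2 * q = w * (D - F + k3 * p)"
   if "A + C = w * (D + k1 * p)" "C = w * F - B" "q = w * p" "k1 = k3 - k2" for A B C D F k1 k2 k3 p q w :: complex
   using that by (simp add: algebra_simps)
  have Qx: "?Q x \<xi> = ?w x * ?p" using x by (simp add: spull_def \<eta>_def)
  have k: "?k = cr (s * divergence X' (\<phi> x)) - cr (s * divergence X x)" by (simp add: algebra_simps)
  have lhs: "lie_symbol V s X ?Q x \<xi> = ?A - ?B + cr (s * divergence X x) * ?Q x \<xi>"
   using x by (simp add: lie_symbol_def deriv_x_def deriv_xi_def)
  have rhs: "spull V \<phi> \<psi> s (lie_symbol V' s X' P) x \<xi> = ?w x * (?E - ?F + cr (s * divergence X' (\<phi> x)) * ?p)"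
   using x \<phi>_in[OF x] by (simp add: spull_def lie_symbol_def \<eta>_def)
  show ?thesis unfolding lhs rhs by (rule alg[OF main fin Qx k])
 qed (simp add: lie_symbol_def spull_def)
qed

end

section \<open>Conformal transformations and Killing fields\<close>

lemma sum_ambient:
 fixes f :: "'n::finite + bool \<Rightarrow> 'a::comm_monoid_add"
 shows "(\<Sum>a\<in>UNIV. f a) = (\<Sum>i\<in>UNIV. f (Inl i)) + (f (Inr True) + f (Inr False))"
proof -
 have "(\<Sum>a\<in>UNIV. f a) = (\<Sum>a\<in>(UNIV :: 'n set) <+> (UNIV :: bool set). f a)" by simp
 also have "\<dots> = (\<Sum>i\<in>UNIV. f (Inl i)) + (\<Sum>u\<in>UNIV. f (Inr u))" by (subst sum.Plus) simp_all
 finally show ?thesis by (simp add: UNIV_bool add.commute)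
qed

lemma vec_ambient_eqI:
 fixes u v :: "real ^ ('n::finite + bool)"
 assumes "\<And>i. u $ Inl i = v $ Inl i" "u $ Inr True = v $ Inr True" "u $ Inr False = v $ Inr False"
 shows "u = v"
 unfolding vec_eq_iff
proof
 fix a show "u $ a = v $ a" using assms by (cases a) (auto, metis (full_types))
qed

definition gform :: "real ^ 'n::finite ^ 'n \<Rightarrow> real ^ 'n \<Rightarrow> real ^ 'n \<Rightarrow> real" where "gform g x y = x \<bullet> (g *v y)"

lemma gform_bilinear: "bounded_bilinear (gform g)"
 unfolding gform_def[abs_def]
 by (rule bounded_bilinear.comp[OF bounded_bilinear_inner bounded_linear_ident matrix_vector_mul_bounded_linear])

lemma gform_expand: "gform g u v = (\<Sum>i\<in>UNIV. \<Sum>j\<in>UNIV. u $ i * g $ i $ j * v $ j)"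
 by (simp add: gform_def inner_vec_def matrix_vector_mult_def sum_distrib_left mult.assoc)

lemma gform_commute:
 assumes "\<And>i j. g $ i $ j = g $ j $ i"
 shows "gform g u v = gform g v u"
proof -
 have "gform g u v = (\<Sum>j\<in>UNIV. \<Sum>i\<in>UNIV. u $ i * g $ i $ j * v $ j)"
  unfolding gform_expand by (rule sum.swap)
 also have "\<dots> = gform g v u"
  unfolding gform_expand
 proof (intro sum.cong refl)
  fix i j show "u $ j * g $ j $ i * v $ i = v $ i * g $ i $ j * u $ j" unfolding assms[of j i] by simp
 qed
 finally show ?thesis .
qed

lemma gform_sum_lower: "(\<And>i j. g $ i $ j = g $ j $ i) \<Longrightarrow> (\<Sum>j\<in>UNIV. lower_index g x j * y $ j) = gform g x y"
 by (simp add: gform_def lower_index_def inner_vec_def matrix_vector_mult_def sum_distrib_left sum_distrib_right)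
  (subst sum.swap, simp add: mult_ac)

definition aform :: "real ^ 'n::finite ^ 'n \<Rightarrow> real ^ ('n + bool) \<Rightarrow> real ^ ('n + bool) \<Rightarrow> real" where
 "aform g u v = u \<bullet> (ambient_form g *v v)"

lemma aform_eq:
 "aform g u v = gform g (\<chi> i. u $ Inl i) (\<chi> i. v $ Inl i) + (u $ Inr True * v $ Inr True - u $ Inr False * v $ Inr False)"
 by (simp add: aform_def gform_def inner_vec_def matrix_vector_mult_def sum_ambient ambient_form_def)

lemma aform_bilinear: "bounded_bilinear (aform g)"
 unfolding aform_def[abs_def]
 by (rule bounded_bilinear.comp[OF bounded_bilinear_inner bounded_linear_ident matrix_vector_mul_bounded_linear])

text \<open>The differential of \<open>null_lift g\<close> at x in the direction v, see
  \<open>pd_null_lift\<close>. By \<open>aform_lift\<close> such vectors are orthogonal to the lift,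
  and the ambient form restricts to \<open>g\<close> on them.\<close>

definition dlift :: "real ^ 'n::finite ^ 'n \<Rightarrow> real ^ 'n \<Rightarrow> real ^ 'n \<Rightarrow> real ^ ('n + bool)" where
 "dlift g x v = (\<chi> a. case a of Inl i \<Rightarrow> v $ i | Inr u \<Rightarrow> if u then - gform g x v else gform g x v)"

lemma dlift_nth [simp]: "dlift g x v $ Inl i = v $ i" "dlift g x v $ Inr True = - gform g x v" "dlift g x v $ Inr False = gform g x v"
 by (simp_all add: dlift_def)

lemma null_lift_nth [simp]: "null_lift g x $ Inl i = x $ i" "null_lift g x $ Inr True = (1 - gform g x x) / 2"
 "null_lift g x $ Inr False = (1 + gform g x x) / 2"
 by (simp_all add: null_lift_def gform_def)

lemma dlift_linear: "dlift g x (\<Sum>k\<in>I. c k *\<^sub>R v k) = (\<Sum>k\<in>I. c k *\<^sub>R dlift g x (v k))"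
proof -
 interpret bounded_bilinear "gform g" by (rule gform_bilinear)
 show ?thesis by (rule vec_ambient_eqI) (simp_all add: sum_right scaleR_right sum_negf)
qed

lemma pd_null_lift:
 fixes f :: "real ^ 'n::finite \<Rightarrow> real ^ 'n"
 assumes sym: "\<And>i j. g $ i $ j = g $ j $ i" and f: "f differentiable (at x)"
 shows "pd k (\<lambda>x. null_lift g (f x) $ a) x = dlift g (f x) (pd k f x) $ a"
  and "(\<lambda>x. null_lift g (f x) $ a) differentiable (at x)"
proof -
 note sy = gform_commute[OF sym]
 have d: "(\<lambda>x. gform g (f x) (f x)) differentiable (at x)"
  using bounded_bilinear.FDERIV[OF gform_bilinear f[unfolded frechet_derivative_works] f[unfolded frechet_derivative_works]]
  by (auto simp: differentiable_def)
 have pq: "pd k (\<lambda>x. gform g (f x) (f x)) x = 2 * gform g (f x) (pd k f x)"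
  unfolding pd_bilinear[OF gform_bilinear f f] by (simp add: sy[of "pd k f x"])
 have 1: "pd k (\<lambda>x. 1 / 2 + c * gform g (f x) (f x)) x = c * (2 * gform g (f x) (pd k f x))"
  and 2: "(\<lambda>x. 1 / 2 + c * gform g (f x) (f x)) differentiable (at x)" for c :: real
 proof -
  have dc: "(\<lambda>x. c * gform g (f x) (f x)) differentiable (at x)" using d by (intro differentiable_mult) auto
  then show "(\<lambda>x. 1 / 2 + c * gform g (f x) (f x)) differentiable (at x)" by (intro differentiable_add) auto
  have "pd k (\<lambda>x. 1 / 2 + c * gform g (f x) (f x)) x = pd k (\<lambda>x. 1 / 2) x + pd k (\<lambda>x. c * gform g (f x) (f x)) x"
   by (rule pd_add[OF _ dc]) simp
  then show "pd k (\<lambda>x. 1 / 2 + c * gform g (f x) (f x)) x = c * (2 * gform g (f x) (pd k f x))"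
   unfolding pq[symmetric] pd_bounded_linear[OF bounded_linear_mult_right d] by simp
 qed
 have "pd k (\<lambda>x. null_lift g (f x) $ a) x = dlift g (f x) (pd k f x) $ a \<and> (\<lambda>x. null_lift g (f x) $ a) differentiable (at x)"
 proof (cases a)
  case (Inl i)
  have "(\<lambda>x. f x $ i) differentiable (at x)"
   using bounded_linear.has_derivative[OF bounded_linear_vec_nth f[unfolded frechet_derivative_works]] by (auto simp: differentiable_def)
  then show ?thesis using pd_nth[OF f] Inl by simp
 next
  case (Inr u)
  have eq: "(\<lambda>x. null_lift g (f x) $ Inr True) = (\<lambda>x. 1 / 2 + (- 1 / 2) * gform g (f x) (f x))"
   "(\<lambda>x. null_lift g (f x) $ Inr False) = (\<lambda>x. 1 / 2 + (1 / 2) * gform g (f x) (f x))"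
   by (simp_all add: fun_eq_iff field_simps)
  show ?thesis
  proof (cases u)
   case True
   then show ?thesis unfolding Inr using eq 1[of "- 1 / 2"] 2[of "- 1 / 2"] by simp
  next
   case False
   then show ?thesis unfolding Inr using eq 1[of "1 / 2"] 2[of "1 / 2"] by simp
  qed
 qed
 then show "pd k (\<lambda>x. null_lift g (f x) $ a) x = dlift g (f x) (pd k f x) $ a"
  "(\<lambda>x. null_lift g (f x) $ a) differentiable (at x)" by auto
qed

text \<open>One formula serves both signs of t, since the division by t carries the sign.\<close>

lemma DERIV_abs_powr: "t \<noteq> 0 \<Longrightarrow> ((\<lambda>t. \<bar>t\<bar> powr a) has_real_derivative a * \<bar>t\<bar> powr a / t) (at t)"
proof -
 assume t: "t \<noteq> 0"
 show ?thesis
 proof (cases "t > 0")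
  case True
  have "((\<lambda>t. t powr a) has_real_derivative a * t powr (a - 1)) (at t)" by (rule has_real_derivative_powr[OF True])
  then have "((\<lambda>t. \<bar>t\<bar> powr a) has_real_derivative a * t powr (a - 1)) (at t)"
   by (rule has_field_derivative_transform_within_open[of _ _ _ "{0<..}"]) (use True in auto)
  then show ?thesis using True by (simp add: powr_diff)
 next
  case False
  then have "t < 0" using t by simp
  have "((\<lambda>t. (- t) powr a) has_real_derivative a * (- t) powr (a - 1) * (- 1)) (at t)"
   using \<open>t < 0\<close> by (auto intro!: derivative_eq_intros)
  then have "((\<lambda>t. \<bar>t\<bar> powr a) has_real_derivative a * (- t) powr (a - 1) * (- 1)) (at t)"
   by (rule has_field_derivative_transform_within_open[of _ _ _ "{..<0}"]) (use \<open>t < 0\<close> in auto)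
  then show ?thesis using \<open>t < 0\<close> by (simp add: powr_diff)
 qed
qed

text \<open>The linear span of the generators, built one term at a time so that statements linear in
  the field extend from the generators by induction.\<close>

inductive vf_span :: "real ^ 'n::finite ^ 'n \<Rightarrow> (real ^ 'n \<Rightarrow> real ^ 'n) \<Rightarrow> bool" for g where
 zero: "vf_span g (\<lambda>x. 0)"
| gen: "X \<in> conformal_generators g \<Longrightarrow> vf_span g Y \<Longrightarrow> vf_span g (\<lambda>x. c *\<^sub>R X x + Y x)"

lemma vf_span_smooth: "vf_span g X \<Longrightarrow> smooth_on UNIV X"
 by (induction rule: vf_span.induct) (auto intro: smooth_on_generator)

lemma vf_span_sum:
 "finite I \<Longrightarrow> (\<And>i. i \<in> I \<Longrightarrow> X i \<in> conformal_generators g) \<Longrightarrow> vf_span g Y \<Longrightarrow> vf_span g (\<lambda>x. (\<Sum>i\<in>I. c i *\<^sub>R X i x) + Y x)"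
proof (induction I rule: finite_induct)
 case (insert i I)
 then have "vf_span g (\<lambda>x. c i *\<^sub>R X i x + ((\<Sum>i\<in>I. c i *\<^sub>R X i x) + Y x))" by (intro vf_span.gen) auto
 then show ?case using insert by (simp add: add.assoc)
qed simp

lemma pd_gen_add:
 assumes "smooth_on UNIV X" "smooth_on UNIV Y"
 shows "pd i (\<lambda>x. c *\<^sub>R X x + Y x) x = c *\<^sub>R pd i X x + pd i Y x"
proof -
 note d = smooth_on_differentiable[OF _ UNIV_I]
 have "smooth_on UNIV (\<lambda>x. c *\<^sub>R X x)" using assms by auto
 then have "pd i (\<lambda>x. c *\<^sub>R X x + Y x) x = pd i (\<lambda>x. c *\<^sub>R X x) x + pd i Y x" using assms by (intro pd_add d)
 then show ?thesis by (simp add: pd_bounded_linear[OF bounded_linear_scaleR_right d[OF assms(1)]])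
qed

lemma divergence_gen_add:
 "smooth_on UNIV X \<Longrightarrow> smooth_on UNIV Y \<Longrightarrow> divergence (\<lambda>x. c *\<^sub>R X x + Y x) x = c * divergence X x + divergence Y x"
 by (simp add: divergence_def pd_gen_add sum.distrib sum_distrib_left)

lemma divergence_sum:
 assumes "finite I" "\<And>i. i \<in> I \<Longrightarrow> smooth_on UNIV (X i)" "smooth_on UNIV Y"
 shows "divergence (\<lambda>x. (\<Sum>i\<in>I. c i *\<^sub>R X i x) + Y x) x = (\<Sum>i\<in>I. c i * divergence (X i) x) + divergence Y x
  \<and> smooth_on UNIV (\<lambda>x. (\<Sum>i\<in>I. c i *\<^sub>R X i x) + Y x)"
 using assms
proof (induction I rule: finite_induct)
 case (insert i I)
 then have "divergence (\<lambda>x. c i *\<^sub>R X i x + ((\<Sum>i\<in>I. c i *\<^sub>R X i x) + Y x)) x =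
   c i * divergence (X i) x + divergence (\<lambda>x. (\<Sum>i\<in>I. c i *\<^sub>R X i x) + Y x) x"
  by (intro divergence_gen_add) auto
 then show ?case using insert by (simp add: add.assoc) auto
qed simp

text \<open>The Lie algebra \<open>so(p + 1, q + 1)\<close> acts on the null cone by \<open>skew\<close> matrices. Splitting the velocity of a point of
 the cone into a rescaling (\<open>kdil\<close>) and a motion of its projection (\<open>kfield\<close>) gives the conformal vector fields.\<close>

definition skew :: "real ^ 'n::finite ^ 'n \<Rightarrow> real ^ ('n + bool) ^ ('n + bool) \<Rightarrow> bool" where
 "skew g M \<longleftrightarrow> (\<forall>u v. aform g u (M *v v) = - aform g (M *v u) v)"

text \<open>The last two coordinates of \<open>null_lift g x\<close> add up to 1, so the sum of the
  corresponding components of the velocity is the rate of rescaling.\<close>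

definition kdil :: "real ^ 'n::finite ^ 'n \<Rightarrow> real ^ ('n + bool) ^ ('n + bool) \<Rightarrow> real ^ 'n \<Rightarrow> real" where
 "kdil g M x = (M *v null_lift g x) $ Inr True + (M *v null_lift g x) $ Inr False"

definition kfield :: "real ^ 'n::finite ^ 'n \<Rightarrow> real ^ ('n + bool) ^ ('n + bool) \<Rightarrow> real ^ 'n \<Rightarrow> real ^ 'n" where
 "kfield g M x = (\<chi> i. (M *v null_lift g x) $ Inl i - kdil g M x * x $ i)"

section \<open>Skew matrices and conformal vector fields\<close>

context conformal_weights
begin

lemma gform_sym: "gform g u v = gform g v u"
 by (rule gform_commute[OF g_sym])

lemma aform_sym: "aform g u v = aform g v u"
 unfolding aform_eq by (simp add: gform_sym[of "\<chi> i. u $ Inl i"] mult.commute)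

lemma aform_lift: "aform g (null_lift g x) (null_lift g x) = 0" "aform g (null_lift g x) (dlift g x v) = 0"
  "aform g (dlift g x v) (null_lift g x) = 0" "aform g (dlift g x v) (dlift g x w) = gform g v w"
proof -
 show 1: "aform g (null_lift g x) (null_lift g x) = 0" "aform g (null_lift g x) (dlift g x v) = 0"
  "aform g (dlift g x v) (dlift g x w) = gform g v w"
  by (simp_all add: aform_eq field_simps)
 show "aform g (dlift g x v) (null_lift g x) = 0" using 1(2) aform_sym by metis
qed

text \<open>By the choice of \<open>kfield\<close> and \<open>kdil\<close>, the defect u of the
  claimed splitting has only a component along the difference of the last two axes. Skewness makes
  it orthogonal to the lift, and pairing with the lift reads off precisely this component.\<close>

lemma skew_lift:
 assumes "skew g M"
 shows "M *v null_lift g x = dlift g x (kfield g M x) + kdil g M x *\<^sub>R null_lift g x"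
proof -
 interpret b: bounded_bilinear "aform g" by (rule aform_bilinear)
 define u where "u = M *v null_lift g x - (dlift g x (kfield g M x) + kdil g M x *\<^sub>R null_lift g x)"
 have i: "u $ Inl i = 0" for i by (simp add: u_def kfield_def)
 have s: "u $ Inr True + u $ Inr False = 0" by (simp add: u_def kdil_def field_simps)
 have "aform g (null_lift g x) (M *v null_lift g x) = 0"
  using assms aform_sym[of "M *v null_lift g x" "null_lift g x"] unfolding skew_def by (metis add.inverse_neutral equation_minus_iff neg_equal_zero)
 then have "aform g (null_lift g x) u = 0"
  by (simp add: u_def b.diff_right b.add_right b.scaleR_right aform_lift)
 moreover have "aform g (null_lift g x) u = u $ Inr True"
 proof -
  have "(\<chi> i. u $ Inl i) = 0" by (simp add: vec_eq_iff i)
  then have "aform g (null_lift g x) u = (1 - gform g x x) / 2 * u $ Inr True - (1 + gform g x x) / 2 * u $ Inr False"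
   by (simp add: aform_eq gform_def)
  moreover have "u $ Inr False = - u $ Inr True" using s by simp
  ultimately show ?thesis by (simp add: field_simps)
 qed
 ultimately have "u = 0" using i s by (intro vec_ambient_eqI) auto
 then show ?thesis by (simp add: u_def)
qed

lemma kfield_expand:
 "kdil g M x = (\<Sum>j\<in>UNIV. (M $ Inr True $ Inl j + M $ Inr False $ Inl j) * x $ j)
   + (M $ Inr True $ Inr True + M $ Inr False $ Inr True) * ((1 - gform g x x) / 2)
   + (M $ Inr True $ Inr False + M $ Inr False $ Inr False) * ((1 + gform g x x) / 2)"
 "kfield g M x $ i = (\<Sum>j\<in>UNIV. M $ Inl i $ Inl j * x $ j) + M $ Inl i $ Inr True * ((1 - gform g x x) / 2)
   + M $ Inl i $ Inr False * ((1 + gform g x x) / 2) - kdil g M x * x $ i"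
 by (simp_all add: kdil_def kfield_def matrix_vector_mult_def sum_ambient sum.distrib algebra_simps)

lemma skew_components:
 assumes "skew g M"
 shows "(\<Sum>k\<in>UNIV. g $ i $ k * M $ Inl k $ Inl j) = - (\<Sum>k\<in>UNIV. g $ j $ k * M $ Inl k $ Inl i)"
  "M $ Inr True $ Inl i = - (\<Sum>k\<in>UNIV. g $ i $ k * M $ Inl k $ Inr True)"
  "M $ Inr False $ Inl i = (\<Sum>k\<in>UNIV. g $ i $ k * M $ Inl k $ Inr False)"
  "M $ Inr True $ Inr True = 0" "M $ Inr False $ Inr False = 0" "M $ Inr False $ Inr True = M $ Inr True $ Inr False"
proof -
 have e: "aform g (axis a 1) (M *v axis b 1) = - aform g (axis b 1) (M *v axis a 1)" for a b
  using assms aform_sym unfolding skew_def by metis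
 have col: "(M *v axis b 1) $ a = M $ a $ b" for a b
  by (simp add: matrix_vector_mult_basis column_def)
 have l: "(\<chi> i. axis (Inl j) (1::real) $ (Inl i :: 'n + bool)) = axis j 1" "(\<chi> i. axis (Inr u) (1::real) $ (Inl i :: 'n + bool)) = (0 :: real ^ 'n)" for j :: 'n and u
  by (auto simp: vec_eq_iff axis_def)
 have gl: "gform g (axis i 1) v = (\<Sum>k\<in>UNIV. g $ i $ k * v $ k)" "gform g 0 v = 0" for i v
  by (simp_all add: gform_def inner_axis' matrix_vector_mult_def)
 have rows: "aform g (axis (Inl i) 1) (M *v axis b 1) = (\<Sum>k\<in>UNIV. g $ i $ k * M $ Inl k $ b)"
  "aform g (axis (Inr True) 1) (M *v axis b 1) = M $ Inr True $ b"
  "aform g (axis (Inr False) 1) (M *v axis b 1) = - M $ Inr False $ b" for i b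
  by (simp_all add: aform_eq l gl col) (simp_all add: axis_def)
 show "(\<Sum>k\<in>UNIV. g $ i $ k * M $ Inl k $ Inl j) = - (\<Sum>k\<in>UNIV. g $ j $ k * M $ Inl k $ Inl i)"
  using e[of "Inl i" "Inl j"] by (simp add: rows)
 show "M $ Inr True $ Inl i = - (\<Sum>k\<in>UNIV. g $ i $ k * M $ Inl k $ Inr True)"
  using e[of "Inr True" "Inl i"] by (simp add: rows)
 show "M $ Inr False $ Inl i = (\<Sum>k\<in>UNIV. g $ i $ k * M $ Inl k $ Inr False)"
  using e[of "Inr False" "Inl i"] by (simp add: rows)
 show "M $ Inr True $ Inr True = 0" "M $ Inr False $ Inr False = 0" "M $ Inr False $ Inr True = M $ Inr True $ Inr False"
  using e[of "Inr True" "Inr True"] e[of "Inr False" "Inr False"] e[of "Inr False" "Inr True"] by (simp_all add: rows)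
qed

text \<open>The blocks of a skew matrix are the parameters of the generators: the square block gives
  rotations, the sum and the difference of the two border columns give translations and inversions,
  and the corner entry gives the dilation.\<close>

lemma kfield_span:
 assumes M: "skew g M"
 shows "vf_span g (kfield g M)" and "divergence (kfield g M) x = - real CARD('n) * kdil g M x"
proof -
 note sk = skew_components[OF M]
 define \<beta> where "\<beta> k = M $ Inl k $ Inr False - M $ Inl k $ Inr True" for k
 \<comment> \<open>Raising the second index turns skewness with respect to \<open>g\<close> into
   plain antisymmetry. The sum over all index pairs counts each rotation twice, hence the factor one
   half in \<open>?Y\<close>.\<close>
 define N where "N i a = (\<Sum>j\<in>UNIV. M $ Inl i $ Inl j * h $ j $ a)" for i a
 have MN: "M $ Inl i $ Inl j = (\<Sum>a\<in>UNIV. N i a * g $ a $ j)" for i j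
 proof -
  have "(\<Sum>a\<in>UNIV. N i a * g $ a $ j) = (\<Sum>k\<in>UNIV. M $ Inl i $ Inl k * (\<Sum>a\<in>UNIV. h $ k $ a * g $ a $ j))"
   unfolding N_def sum_distrib_left sum_distrib_right by (subst sum.swap) (simp add: mult.assoc)
  also have "\<dots> = (\<Sum>k\<in>UNIV. if k = j then M $ Inl i $ Inl k else 0)"
   unfolding hg by (intro sum.cong) auto
  finally show ?thesis by simp
 qed
 have N_eq: "N i a = (\<Sum>b\<in>UNIV. \<Sum>j\<in>UNIV. h $ i $ b * (\<Sum>k\<in>UNIV. g $ b $ k * M $ Inl k $ Inl j) * h $ j $ a)" for i a
 proof -
  have "(\<Sum>b\<in>UNIV. \<Sum>j\<in>UNIV. h $ i $ b * (\<Sum>k\<in>UNIV. g $ b $ k * M $ Inl k $ Inl j) * h $ j $ a) =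
    (\<Sum>b\<in>UNIV. \<Sum>j\<in>UNIV. \<Sum>k\<in>UNIV. h $ i $ b * g $ b $ k * (M $ Inl k $ Inl j * h $ j $ a))"
   by (simp add: sum_distrib_left sum_distrib_right mult.assoc)
  also have "\<dots> = (\<Sum>j\<in>UNIV. \<Sum>k\<in>UNIV. \<Sum>b\<in>UNIV. h $ i $ b * g $ b $ k * (M $ Inl k $ Inl j * h $ j $ a))"
   by (subst sum.swap) (intro sum.cong refl sum.swap)
  also have "\<dots> = (\<Sum>j\<in>UNIV. \<Sum>k\<in>UNIV. (if i = k then 1 else 0) * (M $ Inl k $ Inl j * h $ j $ a))"
   by (simp add: hg flip: sum_distrib_right)
  also have "\<dots> = N i a" by (simp add: N_def if_distrib[of "\<lambda>t. t * _"] cong: if_cong)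
  finally show ?thesis by simp
 qed
 have N_anti: "N a i = - N i a" for i a
 proof -
  have "N a i = (\<Sum>j\<in>UNIV. \<Sum>b\<in>UNIV. h $ a $ b * (\<Sum>k\<in>UNIV. g $ b $ k * M $ Inl k $ Inl j) * h $ j $ i)"
   unfolding N_eq by (rule sum.swap)
  also have "\<dots> = (\<Sum>j\<in>UNIV. \<Sum>b\<in>UNIV. - (h $ i $ j * (\<Sum>k\<in>UNIV. g $ j $ k * M $ Inl k $ Inl b) * h $ b $ a))"
  proof (intro sum.cong refl)
   fix j b
   show "h $ a $ b * (\<Sum>k\<in>UNIV. g $ b $ k * M $ Inl k $ Inl j) * h $ j $ i = - (h $ i $ j * (\<Sum>k\<in>UNIV. g $ j $ k * M $ Inl k $ Inl b) * h $ b $ a)"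
    unfolding sk(1)[of b j] by (simp add: h_sym[of a b] h_sym[of j i])
  qed
  finally show ?thesis by (simp add: N_eq[of i a] sum_negf)
 qed
 define t where "t m = (M $ Inl m $ Inr True + M $ Inl m $ Inr False) / 2" for m
 define e where "e = - M $ Inr True $ Inr False"
 let ?Y = "\<lambda>x. (\<Sum>p\<in>UNIV. (N (snd p) (fst p) / 2) *\<^sub>R vf_rot g (fst p) (snd p) x) + ((\<Sum>m\<in>UNIV. t m *\<^sub>R vf_transl m x)
   + ((\<Sum>m\<in>UNIV. (\<beta> m / 2) *\<^sub>R vf_inv g m x) + (e *\<^sub>R vf_euler x + 0)))"
 have dil: "kdil g M x = (\<Sum>k\<in>UNIV. \<beta> k * lower_index g x k) - e" for x
 proof -
  have "(\<Sum>j\<in>UNIV. (M $ Inr True $ Inl j + M $ Inr False $ Inl j) * x $ j) = (\<Sum>j\<in>UNIV. \<Sum>k\<in>UNIV. \<beta> k * (g $ k $ j * x $ j))"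
  proof (intro sum.cong refl)
   fix j
   have "(M $ Inr True $ Inl j + M $ Inr False $ Inl j) = (\<Sum>k\<in>UNIV. \<beta> k * g $ k $ j)"
    unfolding sk \<beta>_def by (simp add: sum_subtractf[symmetric] algebra_simps g_sym[of j] flip: sum_subtractf)
   then show "(M $ Inr True $ Inl j + M $ Inr False $ Inl j) * x $ j = (\<Sum>k\<in>UNIV. \<beta> k * (g $ k $ j * x $ j))"
    by (simp add: sum_distrib_right mult.assoc)
  qed
  also have "\<dots> = (\<Sum>k\<in>UNIV. \<beta> k * lower_index g x k)"
   by (subst sum.swap) (simp add: lower_index_def sum_distrib_left)
  finally show ?thesis unfolding kfield_expand sk by (simp add: e_def field_simps)
 qed
 have eq: "kfield g M = ?Y"
 proof
  fix x
  show "kfield g M x = ?Y x"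
   unfolding vec_eq_iff
  proof
   fix i
   have rot: "(\<Sum>p\<in>UNIV. (N (snd p) (fst p) / 2) *\<^sub>R vf_rot g (fst p) (snd p) x) $ i = (\<Sum>j\<in>UNIV. M $ Inl i $ Inl j * x $ j)"
   proof -
    have "(\<Sum>p\<in>UNIV. (N (snd p) (fst p) / 2) *\<^sub>R vf_rot g (fst p) (snd p) x) $ i =
      (\<Sum>a\<in>UNIV. \<Sum>b\<in>UNIV. N b a / 2 * (lower_index g x a * axis b 1 $ i)) - (\<Sum>a\<in>UNIV. \<Sum>b\<in>UNIV. N b a / 2 * (lower_index g x b * axis a 1 $ i))"
     by (simp add: UNIV_Times_UNIV[symmetric] sum.cartesian_product' vf_rot_def right_diff_distrib sum_subtractf del: UNIV_Times_UNIV)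
    also have "(\<Sum>a\<in>UNIV. \<Sum>b\<in>UNIV. N b a / 2 * (lower_index g x a * axis b 1 $ i)) = (\<Sum>a\<in>UNIV. N i a / 2 * lower_index g x a)"
     by (simp add: axis_def if_distrib[of "\<lambda>t. _ * t"] cong: if_cong)
    also have "(\<Sum>a\<in>UNIV. \<Sum>b\<in>UNIV. N b a / 2 * (lower_index g x b * axis a 1 $ i)) = (\<Sum>b\<in>UNIV. N b i / 2 * lower_index g x b)"
     by (subst sum.swap) (simp add: axis_def if_distrib[of "\<lambda>t. _ * t"] cong: if_cong)
    also have "(\<Sum>a\<in>UNIV. N i a / 2 * lower_index g x a) - (\<Sum>b\<in>UNIV. N b i / 2 * lower_index g x b) = (\<Sum>a\<in>UNIV. N i a * lower_index g x a)"
     by (simp add: sum_subtractf[symmetric] N_anti[of _ i] field_simps)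
    also have "\<dots> = (\<Sum>j\<in>UNIV. M $ Inl i $ Inl j * x $ j)"
     unfolding MN lower_index_def sum_distrib_left sum_distrib_right by (subst sum.swap) (simp add: mult.assoc)
    finally show ?thesis .
   qed
   have tr: "(\<Sum>m\<in>UNIV. t m *\<^sub>R vf_transl m x) $ i = t i"
    by (simp add: vf_transl_def axis_def if_distrib[of "\<lambda>t. _ * t"] cong: if_cong)
   have inv: "(\<Sum>m\<in>UNIV. (\<beta> m / 2) *\<^sub>R vf_inv g m x) $ i = gform g x x * (\<beta> i / 2) - (\<Sum>k\<in>UNIV. \<beta> k * lower_index g x k) * x $ i"
    unfolding vf_inv_def gform_sum_lower[OF g_sym]
    by (simp add: right_diff_distrib sum_subtractf axis_def if_distrib[of "\<lambda>t. _ * t"] sum_distrib_right sum_distrib_left mult_ac cong: if_cong)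
   have tb: "t i + gform g x x * (\<beta> i / 2) = M $ Inl i $ Inr True * ((1 - gform g x x) / 2) + M $ Inl i $ Inr False * ((1 + gform g x x) / 2)"
    by (simp add: t_def \<beta>_def field_simps)
   show "kfield g M x $ i = ?Y x $ i"
    unfolding vector_add_component rot tr inv kfield_expand(2) dil using tb by (simp add: vf_euler_def left_diff_distrib)
  qed
 qed
 have G: "vf_rot g a b \<in> conformal_generators g" "vf_transl m \<in> conformal_generators g" "vf_inv g m \<in> conformal_generators g"
  "vf_euler \<in> conformal_generators g" for a b m
  unfolding conformal_generators_def by auto
 note sm = smooth_on_generator[OF G(1)] smooth_on_generator[OF G(2)] smooth_on_generator[OF G(3)] smooth_on_generator[OF G(4)]
 show "vf_span g (kfield g M)"
  unfolding eq by (intro vf_span_sum vf_span.gen vf_span.zero G finite)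
 have s0: "smooth_on UNIV (\<lambda>x. e *\<^sub>R vf_euler x + 0 :: real ^ 'n)" using sm(4) by auto
 have eul: "divergence (\<lambda>x. e *\<^sub>R vf_euler x + 0) x = e * real CARD('n)"
  using divergence_gen_add[OF sm(4), of "\<lambda>x. 0" e x] divergence_generators(3)[OF g_sym]
  by (simp add: divergence_def[of "\<lambda>x. 0"])
 have s1: "smooth_on UNIV (\<lambda>x. ((\<Sum>m\<in>UNIV. (\<beta> m / 2) *\<^sub>R vf_inv g m x) + (e *\<^sub>R vf_euler x + 0)))"
  by (rule conjunct2[OF divergence_sum[OF finite sm(3) s0]])
 have s2: "smooth_on UNIV (\<lambda>x. ((\<Sum>m\<in>UNIV. t m *\<^sub>R vf_transl m x) + ((\<Sum>m\<in>UNIV. (\<beta> m / 2) *\<^sub>R vf_inv g m x) + (e *\<^sub>R vf_euler x + 0))))"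
  by (rule conjunct2[OF divergence_sum[OF finite sm(2) s1]])
 have "divergence ?Y x = (\<Sum>p\<in>UNIV. N (snd p) (fst p) / 2 * divergence (vf_rot g (fst p) (snd p)) x) +
   ((\<Sum>m\<in>UNIV. t m * divergence (vf_transl m) x) + ((\<Sum>m\<in>UNIV. \<beta> m / 2 * divergence (vf_inv g m) x) + e * real CARD('n)))"
  unfolding conjunct1[OF divergence_sum[OF finite sm(1) s2]] conjunct1[OF divergence_sum[OF finite sm(2) s1]]
   conjunct1[OF divergence_sum[OF finite sm(3) s0]] eul ..
 also have "\<dots> = (\<Sum>m\<in>UNIV. \<beta> m / 2 * (- 2 * real CARD('n) * lower_index g x m)) + e * real CARD('n)"
  unfolding divergence_generators[OF g_sym] by simp
 also have "\<dots> = - real CARD('n) * kdil g M x"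
  unfolding dil by (simp add: sum_distrib_left algebra_simps)
 finally show "divergence (kfield g M) x = - real CARD('n) * kdil g M x" unfolding eq .
qed

text \<open>The matrix with prescribed rotation, translation, dilation and inversion parameters; its
  entries invert the reading of these parameters in \<open>kfield_span\<close>.\<close>

definition kmat :: "('n \<Rightarrow> 'n \<Rightarrow> real) \<Rightarrow> ('n \<Rightarrow> real) \<Rightarrow> real \<Rightarrow> ('n \<Rightarrow> real) \<Rightarrow> real ^ ('n + bool) ^ ('n + bool)" where
 "kmat N t e \<beta> = (\<chi> a b. case (a, b) of
   (Inl i, Inl j) \<Rightarrow> \<Sum>a\<in>UNIV. N i a * g $ a $ j
  | (Inl i, Inr u) \<Rightarrow> (if u then t i - \<beta> i / 2 else t i + \<beta> i / 2)
  | (Inr u, Inl j) \<Rightarrow> (if u then - (\<Sum>k\<in>UNIV. g $ j $ k * (t k - \<beta> k / 2)) else (\<Sum>k\<in>UNIV. g $ j $ k * (t k + \<beta> k / 2)))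
  | (Inr u, Inr v) \<Rightarrow> (if u = v then 0 else - e))"

lemma kmat_nth:
 "kmat N t e \<beta> $ Inl i $ Inl j = (\<Sum>a\<in>UNIV. N i a * g $ a $ j)"
 "kmat N t e \<beta> $ Inl i $ Inr True = t i - \<beta> i / 2" "kmat N t e \<beta> $ Inl i $ Inr False = t i + \<beta> i / 2"
 "kmat N t e \<beta> $ Inr True $ Inl j = - (\<Sum>k\<in>UNIV. g $ j $ k * (t k - \<beta> k / 2))"
 "kmat N t e \<beta> $ Inr False $ Inl j = (\<Sum>k\<in>UNIV. g $ j $ k * (t k + \<beta> k / 2))"
 "kmat N t e \<beta> $ Inr u $ Inr v = (if u = v then 0 else - e)"
 by (simp_all add: kmat_def)

lemma skew_kmat:
 assumes N: "\<And>i j. N j i = - N i j"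
 shows "skew g (kmat N t e \<beta>)"
proof -
 let ?M = "kmat N t e \<beta>"
 have "aform g u (?M *v v) + aform g (?M *v u) v = 0" for u v
 proof -
  define a b where "a = (\<chi> i. u $ Inl i)" and "b = (\<chi> i. v $ Inl i)"
  define tv bv where "tv = (\<chi> i. t i)" and "bv = (\<chi> i. \<beta> i)"
  define R where "R c = (\<chi> i. \<Sum>k\<in>UNIV. N i k * lower_index g c k)" for c
  interpret gb: bounded_bilinear "gform g" by (rule gform_bilinear)
  have top: "(\<chi> i. (?M *v w) $ Inl i) = R (\<chi> i. w $ Inl i) + (w $ Inr True) *\<^sub>R (tv - (1/2) *\<^sub>R bv) + (w $ Inr False) *\<^sub>R (tv + (1/2) *\<^sub>R bv)" for w
  proof -
   have "(\<Sum>j\<in>UNIV. (\<Sum>a\<in>UNIV. N i a * g $ a $ j) * w $ Inl j) = (\<Sum>k\<in>UNIV. N i k * (\<Sum>j\<in>UNIV. g $ k $ j * w $ Inl j))" for i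
    by (simp add: sum_distrib_left sum_distrib_right mult.assoc) (rule sum.swap)
   then show ?thesis
    by (simp add: vec_eq_iff matrix_vector_mult_def sum_ambient kmat_nth R_def tv_def bv_def lower_index_def algebra_simps)
  qed
  have gl: "(\<Sum>j\<in>UNIV. (\<Sum>k\<in>UNIV. g $ j $ k * c k) * w $ Inl j) = gform g (\<chi> i. w $ Inl i) (\<chi> i. c i)" for c :: "'n \<Rightarrow> real" and w :: "real ^ ('n + bool)"
   by (simp add: gform_expand sum_distrib_left sum_distrib_right mult_ac)
  have rows: "(?M *v w) $ Inr True = - gform g (\<chi> i. w $ Inl i) (tv - (1/2) *\<^sub>R bv) - e * w $ Inr False"
   "(?M *v w) $ Inr False = gform g (\<chi> i. w $ Inl i) (tv + (1/2) *\<^sub>R bv) - e * w $ Inr True" for w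
  proof -
   have c: "tv - (1/2) *\<^sub>R bv = (\<chi> i. t i - \<beta> i / 2)" "tv + (1/2) *\<^sub>R bv = (\<chi> i. t i + \<beta> i / 2)"
    by (simp_all add: vec_eq_iff tv_def bv_def)
   show "(?M *v w) $ Inr True = - gform g (\<chi> i. w $ Inl i) (tv - (1/2) *\<^sub>R bv) - e * w $ Inr False"
    "(?M *v w) $ Inr False = gform g (\<chi> i. w $ Inl i) (tv + (1/2) *\<^sub>R bv) - e * w $ Inr True"
    unfolding c gl[symmetric]
    by (simp_all only: matrix_vector_mult_def vec_lambda_beta sum_ambient kmat_nth) (simp_all add: sum_negf)
  qed
  have Rform: "gform g c (R d) = (\<Sum>i\<in>UNIV. \<Sum>k\<in>UNIV. lower_index g c i * (N i k * lower_index g d k))" for c d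
   unfolding gform_sum_lower[OF g_sym, symmetric] R_def by (simp add: sum_distrib_left)
  have R0: "gform g a (R b) + gform g (R a) b = 0"
  proof -
   have "gform g (R a) b = (\<Sum>i\<in>UNIV. \<Sum>k\<in>UNIV. lower_index g b i * (N i k * lower_index g a k))"
    unfolding gform_sym[of "R a" b] Rform ..
   also have "\<dots> = (\<Sum>k\<in>UNIV. \<Sum>i\<in>UNIV. lower_index g b i * (N i k * lower_index g a k))" by (rule sum.swap)
   also have "\<dots> = (\<Sum>k\<in>UNIV. \<Sum>i\<in>UNIV. - (lower_index g a k * (N k i * lower_index g b i)))"
   proof (intro sum.cong refl)
    fix k i show "lower_index g b i * (N i k * lower_index g a k) = - (lower_index g a k * (N k i * lower_index g b i))"
     using N[of i k] by simp
   qed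
   finally show ?thesis unfolding Rform by (simp add: sum_negf)
  qed
  show ?thesis
   unfolding aform_eq top rows a_def[symmetric] b_def[symmetric] gb.add_left gb.add_right gb.scaleR_left gb.scaleR_right
   using R0 by (simp add: gb.diff_left gb.diff_right gb.add_left gb.add_right gb.scaleR_left gb.scaleR_right gform_sym[of tv] gform_sym[of bv] algebra_simps)
 qed
 then show ?thesis unfolding skew_def by (simp add: eq_neg_iff_add_eq_0)
qed

lemma generator_kfield:
 assumes "X \<in> conformal_generators g" shows "\<exists>M. skew g M \<and> X = kfield g M"
proof -
 have kf: "kfield g (kmat N t e \<beta>) x $ i = (\<Sum>k\<in>UNIV. N i k * lower_index g x k) + t i + gform g x x * \<beta> i / 2
   - ((\<Sum>j\<in>UNIV. (\<Sum>k\<in>UNIV. g $ j $ k * \<beta> k) * x $ j) - e) * x $ i" for N t e \<beta> x i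
 proof -
  have 1: "(\<Sum>j\<in>UNIV. (\<Sum>a\<in>UNIV. N i a * g $ a $ j) * x $ j) = (\<Sum>k\<in>UNIV. N i k * lower_index g x k)"
   by (simp add: lower_index_def sum_distrib_left sum_distrib_right mult.assoc) (rule sum.swap)
  have 2: "- (\<Sum>k\<in>UNIV. g $ j $ k * (t k - \<beta> k / 2)) + (\<Sum>k\<in>UNIV. g $ j $ k * (t k + \<beta> k / 2)) = (\<Sum>k\<in>UNIV. g $ j $ k * \<beta> k)" for j
   by (simp add: sum_subtractf[symmetric] sum_negf[symmetric] sum.distrib[symmetric] algebra_simps)
  show ?thesis unfolding kfield_expand kmat_nth 1 2 by (simp add: field_simps)
 qed
 consider m where "X = vf_transl m" | i j where "X = vf_rot g i j" | "X = vf_euler" | m where "X = vf_inv g m"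
  using assms unfolding conformal_generators_def by blast
 then show ?thesis
 proof cases
  case 1
  have "X = kfield g (kmat (\<lambda>i j. 0) (\<lambda>i. axis m 1 $ i) 0 (\<lambda>i. 0))"
   by (auto simp: fun_eq_iff vec_eq_iff kf 1 vf_transl_def)
  moreover have "skew g (kmat (\<lambda>i j. 0) (\<lambda>i. axis m 1 $ i) 0 (\<lambda>i. 0))" by (rule skew_kmat) simp
  ultimately show ?thesis by blast
 next
  case (2 a b)
  let ?N = "\<lambda>i k. axis b (1::real) $ i * axis a 1 $ k - axis a 1 $ i * axis b 1 $ k"
  have "X = kfield g (kmat ?N (\<lambda>i. 0) 0 (\<lambda>i. 0))"
  proof (intro ext, unfold vec_eq_iff, intro allI)
   fix x i
   have s: "(\<Sum>k\<in>UNIV. axis a (1::real) $ k * c k) = c a" for a and c :: "'n \<Rightarrow> real"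
    by (rule axis_sums(2))
   show "X x $ i = kfield g (kmat ?N (\<lambda>i. 0) 0 (\<lambda>i. 0)) x $ i"
    unfolding kf by (simp add: 2 vf_rot_def left_diff_distrib sum_subtractf mult.assoc s flip: sum_distrib_left)
  qed
  moreover have "skew g (kmat ?N (\<lambda>i. 0) 0 (\<lambda>i. 0))" by (rule skew_kmat) simp
  ultimately show ?thesis by blast
 next
  case 3
  have "X = kfield g (kmat (\<lambda>i j. 0) (\<lambda>i. 0) 1 (\<lambda>i. 0))"
   by (auto simp: fun_eq_iff vec_eq_iff kf 3 vf_euler_def)
  moreover have "skew g (kmat (\<lambda>i j. 0) (\<lambda>i. 0) 1 (\<lambda>i. 0))" by (rule skew_kmat) simp
  ultimately show ?thesis by blast
 next
  case (4 m)
  \<comment> \<open>The factor 2 offsets the coefficient \<beta> / 2 with which inversions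
    occur.\<close>
  have "X = kfield g (kmat (\<lambda>i j. 0) (\<lambda>i. 0) 0 (\<lambda>i. 2 * axis m 1 $ i))"
  proof (intro ext, unfold vec_eq_iff, intro allI)
   fix x i
   have s: "(\<Sum>k\<in>UNIV. c k * (2 * axis m (1::real) $ k)) = 2 * c m" for c :: "'n \<Rightarrow> real"
    using axis_sums(3)[of "\<lambda>k. 2 * c k" m] by (simp add: mult_ac)
   have "(\<Sum>j\<in>UNIV. 2 * g $ j $ m * x $ j) = 2 * lower_index g x m"
    by (simp add: lower_index_def sum_distrib_left mult.assoc g_sym[of _ m])
   then show "X x $ i = kfield g (kmat (\<lambda>i j. 0) (\<lambda>i. 0) 0 (\<lambda>i. 2 * axis m 1 $ i)) x $ i"
    unfolding kf s by (simp add: 4 vf_inv_def gform_sum_lower[OF g_sym])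
  qed
  moreover have "skew g (kmat (\<lambda>i j. 0) (\<lambda>i. 0) 0 (\<lambda>i. 2 * axis m 1 $ i))" by (rule skew_kmat) simp
  ultimately show ?thesis by blast
 qed
qed

end

section \<open>Conformal maps relate conformal fields to conformal fields\<close>

lemma det_scale_matrix: "det (c *\<^sub>R (B :: real ^ 'n::finite ^ 'n)) = c ^ CARD('n) * det B"
proof -
 have "c *\<^sub>R B = (\<chi> i. c *s (B $ i))" by (simp add: vec_eq_iff)
 then show ?thesis by (simp add: det_rows_mul)
qed

lemma aform_invariant:
 assumes "transpose B ** ambient_form g ** B = ambient_form g"
 shows "aform g (B *v u) (B *v v) = aform g u v"
proof -
 have "aform g (B *v u) (B *v v) = u \<bullet> (transpose B *v (ambient_form g *v (B *v v)))"
  unfolding aform_def transpose_matrix_vector by (metis dot_lmul_matrix inner_commute)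
 then show ?thesis using assms by (simp add: aform_def matrix_vector_mul_assoc matrix_mul_assoc)
qed

context conformal_weights
begin

lemma det_g_nz: "det g \<noteq> 0"
proof -
 have "g ** h = mat 1" by (simp add: vec_eq_iff matrix_matrix_mult_def mat_def g_h)
 then have "det g * det h = 1" by (metis det_I det_mul)
 then show ?thesis by auto
qed

text \<open>The map \<open>\<phi>\<close> is induced by a linear map B of the cone, so the
  transported field belongs to the conjugate of M by B. The scale factor r of B along the lift
  governs both the conformal factor of \<open>\<phi>\<close> and, through its powers, the density
  weights.\<close>

lemma conformal_related:
 assumes dif: "diffeo V V' \<phi> \<psi>" and conf: "conformal_transformation_on g V \<phi>" and M: "skew g M"
 shows "\<exists>M'. skew g M' \<and> diffeo.related V \<phi> (kfield g M) (kfield g M')"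
proof -
 interpret diffeo V V' \<phi> \<psi> by (rule dif)
 obtain B where B: "B \<in> SO_ambient g" and lift: "\<And>x. x \<in> V \<Longrightarrow> \<exists>r. r \<noteq> 0 \<and> B *v null_lift g x = r *\<^sub>R null_lift g (\<phi> x)"
  using conf unfolding conformal_transformation_on_def by blast
 have B_form: "aform g (B *v u) (B *v v) = aform g u v" for u v
  using B aform_invariant unfolding SO_ambient_def by blast
 interpret ab: bounded_bilinear "aform g" by (rule aform_bilinear)
 \<comment> \<open>The last two coordinates of any lift sum to 1, so the factor can be read off from
   B. This exhibits it as a differentiable function, whereas \<open>lift\<close> supplies it only
   pointwise.\<close>
 define r where "r x = (B *v null_lift g x) $ Inr True + (B *v null_lift g x) $ Inr False" for x
 have lift_sum: "null_lift g y $ Inr True + null_lift g y $ Inr False = 1" for y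
  by (simp add: field_simps)
 have r: "r x \<noteq> 0 \<and> B *v null_lift g x = r x *\<^sub>R null_lift g (\<phi> x)" if x: "x \<in> V" for x
 proof -
  obtain s where s: "s \<noteq> 0" "B *v null_lift g x = s *\<^sub>R null_lift g (\<phi> x)" using lift[OF x] by blast
  have "r x = s * (null_lift g (\<phi> x) $ Inr True + null_lift g (\<phi> x) $ Inr False)"
   unfolding r_def s(2) by (simp only: vector_scaleR_component real_scaleR_def distrib_left)
  then show ?thesis using s lift_sum by simp
 qed
 have pdB: "pd k (\<lambda>x. (B *v null_lift g x) $ a) x = (B *v dlift g x (axis k 1)) $ a"
  "(\<lambda>x. (B *v null_lift g x) $ a) differentiable (at x)" for k a x
 proof -
  have id: "(\<lambda>x :: real ^ 'n. x) differentiable (at x)" by simp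
  have pid: "pd k (\<lambda>x :: real ^ 'n. x) x = axis k 1" by (rule pd_eqI[OF has_derivative_ident])
  note l = pd_null_lift(1)[OF g_sym id, where k = k, unfolded pid] pd_null_lift(2)[OF g_sym id]
  have d: "(\<lambda>x. B $ a $ b * null_lift g x $ b) differentiable (at x)" for b
   using l(2) by (intro differentiable_mult) auto
  show "(\<lambda>x. (B *v null_lift g x) $ a) differentiable (at x)"
   unfolding matrix_vector_mult_def vec_lambda_beta using d by (intro differentiable_sum) auto
  have "pd k (\<lambda>x. B $ a $ b * null_lift g x $ b) x = B $ a $ b * dlift g x (axis k 1) $ b" for b
   unfolding pd_bounded_linear[OF bounded_linear_mult_right l(2)] l(1) ..
  moreover have "pd k (\<lambda>x. \<Sum>b\<in>UNIV. B $ a $ b * null_lift g x $ b) x = (\<Sum>b\<in>UNIV. pd k (\<lambda>x. B $ a $ b * null_lift g x $ b) x)"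
   by (rule pd_sum[OF d])
  ultimately show "pd k (\<lambda>x. (B *v null_lift g x) $ a) x = (B *v dlift g x (axis k 1)) $ a"
   unfolding matrix_vector_mult_def vec_lambda_beta by simp
 qed
 have r_diff: "r differentiable (at x)" for x
  unfolding r_def[abs_def] by (intro differentiable_add pdB)
 define \<rho> where "\<rho> x v = (\<Sum>k\<in>UNIV. v $ k * pd k r x)" for x v
 \<comment> \<open>The derivative of
   \<open>B *v null_lift g x = r x *\<^sub>R null_lift g (\<phi> x)\<close> in the direction
   v.\<close>
 have Bd: "B *v dlift g x v = \<rho> x v *\<^sub>R null_lift g (\<phi> x) + r x *\<^sub>R dlift g (\<phi> x) (jmat \<phi> x *v v)" if x: "x \<in> V" for x v
 proof -
  have d\<phi>: "\<phi> differentiable (at x)" by (rule smooth_on_differentiable[OF smooth_\<phi> x])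
  have *: "B *v dlift g x (axis k 1) = pd k r x *\<^sub>R null_lift g (\<phi> x) + r x *\<^sub>R dlift g (\<phi> x) (pd k \<phi> x)" for k
   unfolding vec_eq_iff
  proof
   fix a
   have "(B *v dlift g x (axis k 1)) $ a = pd k (\<lambda>x. (B *v null_lift g x) $ a) x" by (simp add: pdB)
   also have "\<dots> = pd k (\<lambda>x. r x * null_lift g (\<phi> x) $ a) x"
    by (rule pd_cong_open[OF open_V x]) (metis r vector_scaleR_component real_scaleR_def)
   also have "\<dots> = pd k r x * null_lift g (\<phi> x) $ a + r x * dlift g (\<phi> x) (pd k \<phi> x) $ a"
    using pd_mult[OF r_diff pd_null_lift(2)[OF g_sym d\<phi>, where a = a], of k] pd_null_lift(1)[OF g_sym d\<phi>, where k = k and a = a] by (simp add: add.commute)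
   finally show "(B *v dlift g x (axis k 1)) $ a = (pd k r x *\<^sub>R null_lift g (\<phi> x) + r x *\<^sub>R dlift g (\<phi> x) (pd k \<phi> x)) $ a"
    by simp
  qed
  have v: "v = (\<Sum>k\<in>UNIV. v $ k *\<^sub>R axis k 1)"
   by (simp add: vec_eq_iff axis_def if_distrib[of "\<lambda>t. _ * t"] cong: if_cong)
  have "B *v dlift g x v = (\<Sum>k\<in>UNIV. v $ k *\<^sub>R (B *v dlift g x (axis k 1)))"
   by (subst v, subst dlift_linear) (simp add: matrix_vector_mult_scaleR linear_sum[OF matrix_vector_mul_linear])
  also have "\<dots> = \<rho> x v *\<^sub>R null_lift g (\<phi> x) + r x *\<^sub>R (\<Sum>k\<in>UNIV. v $ k *\<^sub>R dlift g (\<phi> x) (pd k \<phi> x))"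
   unfolding * \<rho>_def by (simp add: scaleR_add_right sum.distrib scaleR_sum_left scaleR_sum_right mult.commute)
  also have "(\<Sum>k\<in>UNIV. v $ k *\<^sub>R dlift g (\<phi> x) (pd k \<phi> x)) = dlift g (\<phi> x) (jmat \<phi> x *v v)"
   unfolding jmat_mult[OF d\<phi>] dlift_linear ..
  finally show ?thesis .
 qed
 \<comment> \<open>B preserves the ambient form, so by \<open>Bd\<close> the Jacobian of
   \<open>\<phi>\<close> scales \<open>g\<close> by the inverse square of r; taking determinants
   gives the power -n.\<close>
 have det_eq: "\<bar>det (jmat \<phi> x)\<bar> = \<bar>r x\<bar> powr (- real CARD('n))" if x: "x \<in> V" for x
 proof -
  let ?J = "jmat \<phi> x"
  have gf: "gform g v w = (r x)\<^sup>2 * gform g (?J *v v) (?J *v w)" for v w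
  proof -
   have "gform g v w = aform g (B *v dlift g x v) (B *v dlift g x w)" by (simp add: B_form aform_lift)
   also have "\<dots> = (r x)\<^sup>2 * gform g (?J *v v) (?J *v w)"
    by (simp add: Bd[OF x] ab.add_left ab.add_right ab.scaleR_left ab.scaleR_right aform_lift power2_eq_square)
   finally show ?thesis .
  qed
  have "g = (r x)\<^sup>2 *\<^sub>R (transpose ?J ** g ** ?J)"
  proof -
   have ent: "gform N (axis i 1) (axis j 1) = N $ i $ j" for N :: "real ^ 'n ^ 'n" and i j
    by (simp add: gform_def inner_axis' matrix_vector_mult_basis column_def)
   have tr: "gform g (?J *v v) (?J *v w) = gform (transpose ?J ** g ** ?J) v w" for v w
    unfolding gform_def matrix_vector_mul_assoc[symmetric] transpose_matrix_vector by (metis dot_lmul_matrix inner_commute)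
   have "gform g v w = (r x)\<^sup>2 * gform (transpose ?J ** g ** ?J) v w" for v w by (simp only: gf[of v w] tr)
   then have "g $ i $ j = (r x)\<^sup>2 * (transpose ?J ** g ** ?J) $ i $ j" for i j
    using ent by metis
   then show ?thesis by (simp add: vec_eq_iff)
  qed
  then have "det g = det ((r x)\<^sup>2 *\<^sub>R (transpose ?J ** g ** ?J))" by (rule arg_cong)
  also have "\<dots> = ((r x)\<^sup>2) ^ CARD('n) * (det ?J * det g * det ?J)"
   unfolding det_scale_matrix det_mul det_transpose ..
  also have "\<dots> = (r x ^ CARD('n) * det ?J)\<^sup>2 * det g"
   by (simp add: power_mult_distrib power2_eq_square mult_ac)
  finally have "(r x ^ CARD('n) * det ?J)\<^sup>2 = 1" using det_g_nz by simp
  then have "\<bar>r x\<bar> ^ CARD('n) * \<bar>det ?J\<bar> = 1"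
   by (simp add: abs_square_eq_1 abs_mult power_abs)
  then show ?thesis using r[OF x] by (simp add: powr_minus powr_realpow inverse_unique)
 qed
 have "invertible B" using B by (simp add: SO_ambient_def invertible_det_nz)
 then obtain B' where B': "B ** B' = mat 1" "B' ** B = mat 1" unfolding invertible_def by blast
 define M' where "M' = B ** M ** B'"
 have M'B: "M' *v (B *v u) = B *v (M *v u)" for u
  unfolding M'_def matrix_vector_mul_assoc by (simp add: matrix_mul_assoc[symmetric] B')
 have sk: "skew g M'"
  unfolding skew_def
 proof (intro allI)
  fix u v
  have uv: "u = B *v (B' *v u)" "v = B *v (B' *v v)" by (simp_all add: matrix_vector_mul_assoc B')
  show "aform g u (M' *v v) = - aform g (M' *v u) v"
   using M unfolding skew_def by (subst (1 2) uv(1), subst (1 2) uv(2)) (simp add: M'B B_form)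
 qed
 \<comment> \<open>The velocity of the moved point on the cone is computed in two ways, as B after M
   and as M' after B. Comparing the parts along the lift and across it gives the two claims.\<close>
 have key: "jmat \<phi> x *v kfield g M x = kfield g M' (\<phi> x) \<and> \<rho> x (kfield g M x) = r x * (kdil g M' (\<phi> x) - kdil g M x)" if x: "x \<in> V" for x
 proof -
  let ?l = "null_lift g (\<phi> x)" and ?K = "kfield g M x" and ?K' = "kfield g M' (\<phi> x)"
  have "B *v (M *v null_lift g x) = \<rho> x ?K *\<^sub>R ?l + r x *\<^sub>R dlift g (\<phi> x) (jmat \<phi> x *v ?K) + (kdil g M x * r x) *\<^sub>R ?l"
   unfolding skew_lift[OF M] by (simp add: matrix_vector_right_distrib matrix_vector_mult_scaleR Bd[OF x] conjunct2[OF r[OF x]])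
  moreover have "B *v (M *v null_lift g x) = r x *\<^sub>R (dlift g (\<phi> x) ?K' + kdil g M' (\<phi> x) *\<^sub>R ?l)"
   unfolding M'B[symmetric] conjunct2[OF r[OF x]] matrix_vector_mult_scaleR skew_lift[OF sk] ..
  ultimately have e: "\<rho> x ?K *\<^sub>R ?l + r x *\<^sub>R dlift g (\<phi> x) (jmat \<phi> x *v ?K) + (kdil g M x * r x) *\<^sub>R ?l
    = r x *\<^sub>R (dlift g (\<phi> x) ?K' + kdil g M' (\<phi> x) *\<^sub>R ?l)" by simp
  have e': "\<rho> x ?K * ?l $ a + r x * dlift g (\<phi> x) (jmat \<phi> x *v ?K) $ a + kdil g M x * r x * ?l $ a
    = r x * (dlift g (\<phi> x) ?K' $ a + kdil g M' (\<phi> x) * ?l $ a)" for a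
   using arg_cong[OF e, of "\<lambda>u. u $ a"] by simp
  have 1: "\<rho> x ?K = r x * (kdil g M' (\<phi> x) - kdil g M x)"
  proof -
   have "\<rho> x ?K * (?l $ Inr True + ?l $ Inr False) + kdil g M x * r x * (?l $ Inr True + ?l $ Inr False)
    = r x * kdil g M' (\<phi> x) * (?l $ Inr True + ?l $ Inr False)"
    using e'[of "Inr True"] e'[of "Inr False"] unfolding dlift_nth by argo
   then show ?thesis unfolding lift_sum by (simp add: algebra_simps)
  qed
  have "r x * (jmat \<phi> x *v ?K) $ i = r x * ?K' $ i" for i
   using e'[of "Inl i"] unfolding dlift_nth 1 by argo
  then have "jmat \<phi> x *v ?K = ?K'" using r[OF x] by (simp add: vec_eq_iff)
  with 1 show ?thesis by blast
 qed
 have "related (kfield g M) (kfield g M')"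
  unfolding related_def
 proof (intro conjI ballI allI)
  show "smooth_on UNIV (kfield g M)" "smooth_on UNIV (kfield g M')"
   using vf_span_smooth kfield_span(1) M sk by blast+
  fix x s assume x: "x \<in> V"
  show "jmat \<phi> x *v kfield g M x = kfield g M' (\<phi> x)" using key[OF x] by blast
  have rx: "r x \<noteq> 0" using r[OF x] by blast
  let ?n = "real CARD('n)"
  have P: "\<bar>det (jmat \<phi> y)\<bar> powr s = \<bar>r y\<bar> powr (- ?n * s)" if "y \<in> V" for y
   unfolding det_eq[OF that] by (simp add: powr_powr)
  have pds: "pd i (\<lambda>x. \<bar>det (jmat \<phi> x)\<bar> powr s) x = - ?n * s * \<bar>r x\<bar> powr (- ?n * s) / r x * pd i r x" for i
  proof -
   have "pd i (\<lambda>x. \<bar>det (jmat \<phi> x)\<bar> powr s) x = pd i (\<lambda>x. \<bar>r x\<bar> powr (- ?n * s)) x"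
    by (rule pd_cong_open[OF open_V x P])
   also have "\<dots> = - ?n * s * \<bar>r x\<bar> powr (- ?n * s) / r x * pd i r x"
    by (rule pd_real_compose[OF r_diff DERIV_abs_powr[OF rx]])
   finally show ?thesis .
  qed
  have "(\<Sum>i\<in>UNIV. kfield g M x $ i * pd i (\<lambda>x. \<bar>det (jmat \<phi> x)\<bar> powr s) x) =
    - ?n * s * \<bar>r x\<bar> powr (- ?n * s) / r x * \<rho> x (kfield g M x)"
   unfolding pds \<rho>_def sum_distrib_left by (intro sum.cong refl) simp
  also have "\<dots> = - ?n * s * \<bar>r x\<bar> powr (- ?n * s) * (kdil g M' (\<phi> x) - kdil g M x)"
   unfolding conjunct2[OF key[OF x]] using rx by simp
  also have "\<dots> = s * (divergence (kfield g M') (\<phi> x) - divergence (kfield g M) x) * \<bar>det (jmat \<phi> x)\<bar> powr s"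
   unfolding P[OF x] kfield_span(2)[OF M] kfield_span(2)[OF sk] by (simp add: algebra_simps)
  finally show "(\<Sum>i\<in>UNIV. kfield g M x $ i * pd i (\<lambda>x. \<bar>det (jmat \<phi> x)\<bar> powr s) x) =
    s * (divergence (kfield g M') (\<phi> x) - divergence (kfield g M) x) * \<bar>det (jmat \<phi> x)\<bar> powr s" .
 qed
 with sk show ?thesis by blast
qed

lemma generator_related:
 assumes "diffeo V V' \<phi> \<psi>" "conformal_transformation_on g V \<phi>" "X \<in> conformal_generators g"
 shows "\<exists>X'. vf_span g X' \<and> diffeo.related V \<phi> X X'"
 using generator_kfield[OF assms(3)] conformal_related[OF assms(1,2)] kfield_span(1) by blast

subsection \<open>Naturality of the quantization\<close>

lemma lie_density_gen_add:
 assumes f: "f \<in> loc_fun V" and XY: "smooth_on UNIV X" "smooth_on UNIV Y"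
 shows "lie_density V s (\<lambda>x. c *\<^sub>R X x + Y x) f = (\<lambda>x. cr c * lie_density V s X f x + lie_density V s Y f x)"
 unfolding lie_density_eq[OF f] divergence_gen_add[OF XY]
 by (simp add: fun_eq_iff algebra_simps sum.distrib sum_distrib_left)

lemma lie_symbol_gen_add:
 assumes XY: "smooth_on UNIV X" "smooth_on UNIV Y"
 shows "lie_symbol V s (\<lambda>x. c *\<^sub>R X x + Y x) P = (\<lambda>x \<xi>. cr c * lie_symbol V s X P x \<xi> + 1 * lie_symbol V s Y P x \<xi>)"
 unfolding lie_symbol_def pd_gen_add[OF XY] divergence_gen_add[OF XY]
 by (simp add: fun_eq_iff algebra_simps sum.distrib sum_distrib_left)

lemma lie_density_loc_fun:
 assumes V: "open V" and f: "f \<in> loc_fun V" and X: "smooth_on UNIV X"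
 shows "lie_density V s X f \<in> loc_fun V"
proof -
 have "smooth_on V (\<lambda>x. X x $ i)" "smooth_on V (divergence X)" "smooth_on V f" for i
 proof -
  have XV: "smooth_on V X" by (rule smooth_on_subset[OF X]) simp
  then show "smooth_on V (\<lambda>x. X x $ i)" using V by auto
  show "smooth_on V (divergence X)" unfolding divergence_def[abs_def] using XV V by auto
  show "smooth_on V f" using f by (simp add: loc_fun_def)
 qed
 then have "smooth_on V (\<lambda>x. (\<Sum>i\<in>UNIV. cr (X x $ i) * pd i f x) + cr (s * divergence X x) * f x)"
  using V by (intro smooth_on_add smooth_on_sum smooth_on_mult smooth_on_of_real smooth_on_pd smooth_on_const) auto
 then have "smooth_on V (lie_density V s X f)"
  by (rule smooth_on_congI[OF V]) (simp add: lie_density_def)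
 then show ?thesis by (simp add: loc_fun_def lie_density_def)
qed

lemma lie_symbol_loc:
 assumes V: "open V" and P: "P \<in> Sym V" and X: "vf_span g X"
 shows "lie_symbol V \<delta> X P \<in> Sym V"
 using X
proof induction
 case zero
 have d: "divergence (\<lambda>x :: real ^ 'n. 0) y = 0" for y by (simp add: divergence_def)
 have "lie_symbol V \<delta> (\<lambda>x. 0) P = (\<lambda>x \<xi>. 0)" by (simp add: lie_symbol_def d fun_eq_iff)
 then show ?case by simp
next
 case (gen X Y c)
 have "lie_symbol V \<delta> X P \<in> Sym V"
  using gen(1) lie_symbol_generators[OF V P] V P app_loc unfolding conformal_generators_def by auto
 then show ?case
  unfolding lie_symbol_gen_add[OF smooth_on_generator[OF gen(1)] vf_span_smooth[OF gen(2)]]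
  by (rule Sym_lin[OF V _ gen.IH])
qed

lemma Qs_generator_equivariant:
 assumes V: "open V" and X: "X \<in> conformal_generators g" and P: "P \<in> Sym V"
 shows "nop V (Qs V (lie_symbol V \<delta> X P)) = lie_op V lam (lam + \<delta>) X (nop V (Qs V P))"
proof -
 have q: "Qs V P \<in> Sym V" by (rule Qs_loc[OF V P])
 note lg = lie_symbol_generators[OF V P] and lo = lie_op_transl[OF V q] lie_op_euler[OF V q] lie_op_rot[OF V q] lie_op_inv[OF V q]
 show ?thesis
  using X unfolding conformal_generators_def by (auto simp: lg lo Qs_generators[OF V P])
qed

text \<open>The field that a conformal map relates to a generator is only a combination of
  generators, so equivariance has to be extended linearly to the span.\<close>

lemma Qs_span_equivariant:
 assumes V: "open V" and P: "P \<in> Sym V" and X: "vf_span g X" and f: "f \<in> loc_fun V"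
 shows "nop V (Qs V (lie_symbol V \<delta> X P)) f x = lie_density V (lam + \<delta>) X (nop V (Qs V P) f) x - nop V (Qs V P) (lie_density V lam X f) x"
 using X
proof induction
 case zero
 have d: "divergence (\<lambda>x :: real ^ 'n. 0) y = 0" for y by (simp add: divergence_def)
 have "lie_symbol V \<delta> (\<lambda>x. 0) P = (\<lambda>x \<xi>. 0)" by (simp add: lie_symbol_def d fun_eq_iff)
 moreover have "lie_density V s (\<lambda>x. 0) u = (\<lambda>x. 0)" for s u by (simp add: lie_density_def d fun_eq_iff)
 moreover have "nop V (Qs V P) (\<lambda>x. 0) x = 0"
  using nop_arg_lin[OF V Qs_loc[OF V P] zero_loc_fun zero_loc_fun, of 0 0] by simp
 ultimately show ?case using V by (simp add: Qs_zero)
next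
 case (gen X Y c)
 note sm = smooth_on_generator[OF gen(1)] vf_span_smooth[OF gen(2)]
 have q: "Qs V P \<in> Sym V" by (rule Qs_loc[OF V P])
 note * = Qs_generator_equivariant[OF V gen(1) P]
 have 1: "nop V (Qs V (lie_symbol V \<delta> X P)) f x = lie_density V (lam + \<delta>) X (nop V (Qs V P) f) x - nop V (Qs V P) (lie_density V lam X f) x"
  unfolding * lie_op_def using f by simp
 have L: "lie_symbol V \<delta> X P \<in> Sym V" "lie_symbol V \<delta> Y P \<in> Sym V"
  using lie_symbol_loc[OF V P] vf_span.gen[OF gen(1) vf_span.zero, of 1] gen(2) by auto
 have n: "nop V (Qs V P) f \<in> loc_fun V" by (rule nop_loc_fun[OF V q f])
 have lf: "lie_density V lam X f \<in> loc_fun V" "lie_density V lam Y f \<in> loc_fun V"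
  using lie_density_loc_fun[OF V f] sm by auto
 show ?case
  unfolding lie_symbol_gen_add[OF sm] Qs_lin[OF V L] nop_lin[OF V Qs_loc[OF V L(1)] Qs_loc[OF V L(2)]]
   lie_density_gen_add[OF f sm] lie_density_gen_add[OF n sm]
  using nop_arg_lin[OF V q lf, of "cr c" 1 x] by (simp add: 1 gen.IH algebra_simps)
qed

lemma Qs_unique_lie:
 assumes V: "open V" and F: "\<And>P. P \<in> Sym V \<Longrightarrow> F P \<in> Sym V"
  and lin: "\<And>P Q a b. P \<in> Sym V \<Longrightarrow> Q \<in> Sym V \<Longrightarrow>
   F (\<lambda>x \<xi>. a * P x \<xi> + b * Q x \<xi>) = (\<lambda>x \<xi>. a * F P x \<xi> + b * F Q x \<xi>)"
  and lie: "\<And>X P. X \<in> conformal_generators g \<Longrightarrow> P \<in> Sym V \<Longrightarrow>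
   nop V (F (lie_symbol V \<delta> X P)) = lie_op V lam (lam + \<delta>) X (nop V (F P))"
  and P: "P \<in> Sym V"
  and top: "\<And>k. (\<lambda>x \<xi>. F (hcomp k P) x \<xi> - hcomp k P x \<xi>) \<in> SymU V (int k - 1)"
 shows "F P = Qs V P"
proof -
 have inter: "intertwines V F L L'" if X: "X \<in> conformal_generators g"
  and L: "\<And>P. P \<in> Sym V \<Longrightarrow> lie_symbol V \<delta> X P = app L V P"
  and L': "\<And>P. P \<in> Sym V \<Longrightarrow> lie_op V lam (lam + \<delta>) X (nop V P) = nop V (app L' V P)" for X L L'
  unfolding intertwines_def
 proof (intro ballI)
  fix P assume P: "P \<in> Sym V"
  have "nop V (F (app L V P)) = nop V (app L' V (F P))"
   using lie[OF X P] L[OF P] L'[OF F[OF P]] by simp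
  then show "F (app L V P) = app L' V (F P)"
   using nop_inject[OF V F[OF app_loc[OF V P]] app_loc[OF V F[OF P]]] by blast
 qed
 have gX: "vf_transl m \<in> conformal_generators g" "vf_rot g a b \<in> conformal_generators g" "vf_euler \<in> conformal_generators g"
  "vf_inv g m \<in> conformal_generators g" for m a b unfolding conformal_generators_def by auto
 show ?thesis
  by (rule Qs_unique[OF V F lin _ _ _ _ P top]; (assumption | rule inter[OF gX(1) lie_symbol_generators(1)[OF V] lie_op_transl[OF V]]
   inter[OF gX(3) lie_symbol_generators(3)[OF V] lie_op_euler[OF V]] inter[OF gX(2) lie_symbol_generators(2)[OF V] lie_op_rot[OF V]]
   inter[OF gX(4) lie_symbol_generators(4)[OF V] lie_op_inv[OF V]]))
qed

text \<open>The conjugate of the quantization by \<open>\<phi>\<close> satisfies the assumptions of the preceding uniqueness statement.\<close>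

theorem Qs_conformal:
 assumes dif: "diffeo V V' \<phi> \<psi>" and conf: "conformal_transformation_on g V \<phi>"
  and P: "P \<in> Sym V'" and f: "f \<in> loc_fun V"
 shows "dpull V \<phi> (lam + \<delta>) (nop V' (Qs V' P) (dpull V' \<psi> lam f)) = nop V (Qs V (spull V \<phi> \<psi> \<delta> P)) f"
proof -
 interpret diffeo V V' \<phi> \<psi> by (rule dif)
 interpret s: diffeo V' V \<psi> \<phi> by (rule diffeo_sym)
 note V = open_V and V' = open_V'
 define T where "T P = spull V' \<psi> \<phi> \<delta> P" for P
 define B where "B P f = dpull V \<phi> (lam + \<delta>) (nop V' (Qs V' (T P)) (dpull V' \<psi> lam f))" for P f
 have T: "T P \<in> Sym V'" if "P \<in> Sym V" for P using that s.spull_loc by (simp add: T_def)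
 have T_upto: "T P \<in> SymU V' k" if "P \<in> SymU V k" for P k using that s.spull_upto by (simp add: T_def)
 \<comment> \<open>The symbol of the conjugated operator \<open>B P\<close>. It exists by
   \<open>pull_op\<close> and is unique because \<open>nop V\<close> is injective.\<close>
 define F where "F P = (SOME R. R \<in> Sym V \<and> (\<forall>f\<in>loc_fun V. B P f = nop V R f))" for P
 have ex: "\<exists>R\<in>SymU V k. (\<lambda>x \<xi>. R x \<xi> - spull V \<phi> \<psi> \<delta> (Qs V' (T P)) x \<xi>) \<in> SymU V (k - 1) \<and>
   (\<forall>f\<in>loc_fun V. B P f = nop V R f)" if "P \<in> SymU V k" for P k
  unfolding B_def using pull_op[OF Qs_upto[OF V' T_upto[OF that]], of "lam + \<delta>" lam] by simp
 have F: "F P \<in> Sym V \<and> (\<forall>f\<in>loc_fun V. B P f = nop V (F P) f)" if "P \<in> Sym V" for P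
 proof -
  obtain k where "P \<in> SymU V k" using \<open>P \<in> Sym V\<close> by (auto simp: Sym_iff)
  from ex[OF this] obtain R where "R \<in> Sym V \<and> (\<forall>f\<in>loc_fun V. B P f = nop V R f)" by (auto simp: Sym_iff)
  then show ?thesis unfolding F_def by (rule someI[where P = "\<lambda>R. R \<in> Sym V \<and> (\<forall>f\<in>loc_fun V. B P f = nop V R f)"])
 qed
 have F_unique: "F P = R" if "P \<in> Sym V" "R \<in> Sym V" "\<And>f x. f \<in> loc_fun V \<Longrightarrow> x \<in> V \<Longrightarrow> B P f x = nop V R f x" for P R
 proof -
  have "nop V (F P) = nop V R"
  proof (intro ext)
   fix f x show "nop V (F P) f x = nop V R f x"
    using F[OF that(1)] that(3)[of f x] nop_notin[OF V, of _ f x] that(2) by (cases "f \<in> loc_fun V \<and> x \<in> V") auto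
  qed
  then show ?thesis using nop_inject[OF V] F[OF that(1)] that(2) by blast
 qed
 have B_nop: "B P f x = nop V (F P) f x" if "P \<in> Sym V" "f \<in> loc_fun V" for P f x using F[OF that(1)] that(2) by simp
 have F_lin: "F (\<lambda>x \<xi>. a * P x \<xi> + b * Q x \<xi>) = (\<lambda>x \<xi>. a * F P x \<xi> + b * F Q x \<xi>)"
  if P: "P \<in> Sym V" and Q: "Q \<in> Sym V" for P Q a b
 proof (rule F_unique)
  show "(\<lambda>x \<xi>. a * P x \<xi> + b * Q x \<xi>) \<in> Sym V" by (rule Sym_lin[OF V P Q])
  show "(\<lambda>x \<xi>. a * F P x \<xi> + b * F Q x \<xi>) \<in> Sym V" using F P Q by (intro Sym_lin[OF V]) auto
  fix f x assume f: "f \<in> loc_fun V" and x: "x \<in> V"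
  have TT: "T (\<lambda>x \<xi>. a * P x \<xi> + b * Q x \<xi>) = (\<lambda>x \<xi>. a * T P x \<xi> + b * T Q x \<xi>)" unfolding T_def by (rule spull_lin)
  have "nop V' (Qs V' (T (\<lambda>x \<xi>. a * P x \<xi> + b * Q x \<xi>))) u = (\<lambda>y. a * nop V' (Qs V' (T P)) u y + b * nop V' (Qs V' (T Q)) u y)" for u
   unfolding TT Qs_lin[OF V' T[OF P] T[OF Q]] using nop_lin[OF V' Qs_loc[OF V' T[OF P]] Qs_loc[OF V' T[OF Q]]] by blast
  then have "B (\<lambda>x \<xi>. a * P x \<xi> + b * Q x \<xi>) f x = a * B P f x + b * B Q f x" unfolding B_def by (simp add: dpull_lin)
  also have "\<dots> = nop V (\<lambda>x \<xi>. a * F P x \<xi> + b * F Q x \<xi>) f x"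
   unfolding B_nop[OF P f] B_nop[OF Q f] by (rule nop_lin[OF V conjunct1[OF F[OF P]] conjunct1[OF F[OF Q]], symmetric])
  finally show "B (\<lambda>x \<xi>. a * P x \<xi> + b * Q x \<xi>) f x = nop V (\<lambda>x \<xi>. a * F P x \<xi> + b * F Q x \<xi>) f x" .
 qed
 have F_lie: "nop V (F (lie_symbol V \<delta> X P)) = lie_op V lam (lam + \<delta>) X (nop V (F P))"
  if X: "X \<in> conformal_generators g" and P: "P \<in> Sym V" for X P
 proof (intro ext)
  fix f x
  obtain X' where X': "vf_span g X'" "related X X'" using generator_related[OF dif conf X] by blast
  have spX: "vf_span g X" using vf_span.gen[OF X vf_span.zero, of 1] by simp
  have LP: "lie_symbol V \<delta> X P \<in> Sym V" by (rule lie_symbol_loc[OF V P spX])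
  show "nop V (F (lie_symbol V \<delta> X P)) f x = lie_op V lam (lam + \<delta>) X (nop V (F P)) f x"
  proof (cases "f \<in> loc_fun V")
   case f: True
   let ?u = "dpull V' \<psi> lam f"
   have u: "?u \<in> loc_fun V'" by (rule s.dpull_loc_fun[OF f])
   have q: "Qs V' (T P) \<in> Sym V'" by (rule Qs_loc[OF V' T[OF P]])
   \<comment> \<open>Under \<open>T\<close> the action of the generator X over V becomes that of the
     related field X' over V'.\<close>
   have TL: "T (lie_symbol V \<delta> X P) = lie_symbol V' \<delta> X' (T P)"
   proof -
    have "lie_symbol V \<delta> X P = spull V \<phi> \<psi> \<delta> (lie_symbol V' \<delta> X' (T P))"
     using lie_symbol_natural[OF X'(2) T[OF P], of \<delta>] spull_inverse[OF P] by (simp add: T_def)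
    then show ?thesis
     using s.spull_inverse[OF lie_symbol_loc[OF V' T[OF P] X'(1)]] by (simp add: T_def)
   qed
   have lf: "lie_density V lam X f = dpull V \<phi> lam (lie_density V' lam X' ?u)"
    using lie_density_natural[OF X'(2) u, of lam] dpull_inverse[OF f] by simp
   have smX': "smooth_on UNIV X'" and smX: "smooth_on UNIV X" using X'(2) unfolding related_def by auto
   have lfu: "dpull V' \<psi> lam (lie_density V lam X f) = lie_density V' lam X' ?u"
    unfolding lf by (rule s.dpull_inverse[OF lie_density_loc_fun[OF V' u smX']])
   have "nop V (F (lie_symbol V \<delta> X P)) f x = B (lie_symbol V \<delta> X P) f x" using B_nop[OF LP f] by simp
   also have "\<dots> = dpull V \<phi> (lam + \<delta>) (\<lambda>y. 1 * lie_density V' (lam + \<delta>) X' (nop V' (Qs V' (T P)) ?u) y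
      + (- 1) * nop V' (Qs V' (T P)) (lie_density V' lam X' ?u) y) x"
    unfolding B_def TL using Qs_span_equivariant[OF V' T[OF P] X'(1) u] by (simp add: dpull_def)
   also have "\<dots> = dpull V \<phi> (lam + \<delta>) (lie_density V' (lam + \<delta>) X' (nop V' (Qs V' (T P)) ?u)) x
      - dpull V \<phi> (lam + \<delta>) (nop V' (Qs V' (T P)) (lie_density V' lam X' ?u)) x"
    unfolding dpull_lin by simp
   also have "dpull V \<phi> (lam + \<delta>) (lie_density V' (lam + \<delta>) X' (nop V' (Qs V' (T P)) ?u)) = lie_density V (lam + \<delta>) X (B P f)"
    unfolding B_def by (rule lie_density_natural[symmetric, OF X'(2) nop_loc_fun[OF V' q u]])
   also have "dpull V \<phi> (lam + \<delta>) (nop V' (Qs V' (T P)) (lie_density V' lam X' ?u)) x = B P (lie_density V lam X f) x"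
    unfolding B_def lfu ..
   finally show ?thesis
    using F[OF P] f lie_density_loc_fun[OF V f smX, of lam] by (simp add: lie_op_def)
  next
   case False
   then show ?thesis using nop_notin[OF V, of "F (lie_symbol V \<delta> X P)" f x] F[OF LP] by (simp add: lie_op_def)
  qed
 qed
 \<comment> \<open>Uniqueness is applied to the pull-back of P, which \<open>T\<close> carries back
   to P.\<close>
 define P0 where "P0 = spull V \<phi> \<psi> \<delta> P"
 have P0: "P0 \<in> Sym V" unfolding P0_def by (rule spull_loc[OF P])
 have "F P0 = Qs V P0"
 proof (rule Qs_unique_lie[OF V conjunct1[OF F] F_lin F_lie P0])
  fix k :: nat
  let ?H = "hcomp k P0"
  have H: "?H \<in> SymU V (int k)" by (rule hcomp_upto[OF P0])
  obtain R where R: "R \<in> SymU V (int k)" "(\<lambda>x \<xi>. R x \<xi> - spull V \<phi> \<psi> \<delta> (Qs V' (T ?H)) x \<xi>) \<in> SymU V (int k - 1)"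
   "\<forall>f\<in>loc_fun V. B ?H f = nop V R f" using ex[OF H] by blast
  have Hl: "?H \<in> Sym V" using H by (auto simp: Sym_iff)
  have Rl: "R \<in> Sym V" using R(1) by (auto simp: Sym_iff)
  have FR: "F ?H = R" by (rule F_unique[OF Hl Rl]) (use R(3) in auto)
  \<comment> \<open>Conjugation respects principal symbols: over V' the map \<open>Qs\<close>
    changes \<open>T ?H\<close> in lower order only, and pulling back returns the component
    \<open>?H\<close>.\<close>
  have "spull V \<phi> \<psi> \<delta> (\<lambda>x \<xi>. 1 * Qs V' (T ?H) x \<xi> + (- 1) * T ?H x \<xi>) \<in> SymU V (int k - 1)"
   using spull_upto[OF Qs_diff[OF V' T_upto[OF H]]] by simp
  then have "(\<lambda>x \<xi>. 1 * spull V \<phi> \<psi> \<delta> (Qs V' (T ?H)) x \<xi> + (- 1) * spull V \<phi> \<psi> \<delta> (T ?H) x \<xi>) \<in> SymU V (int k - 1)"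
   unfolding spull_lin .
  moreover have "spull V \<phi> \<psi> \<delta> (T ?H) = ?H" unfolding T_def by (rule spull_inverse[OF Hl])
  ultimately have "(\<lambda>x \<xi>. spull V \<phi> \<psi> \<delta> (Qs V' (T ?H)) x \<xi> - ?H x \<xi>) \<in> SymU V (int k - 1)" by simp
  from SymU_add[OF V R(2) this] show "(\<lambda>x \<xi>. F ?H x \<xi> - ?H x \<xi>) \<in> SymU V (int k - 1)"
   unfolding FR by simp
 qed
 moreover have "T P0 = P" unfolding T_def P0_def by (rule s.spull_inverse[OF P])
 ultimately show ?thesis using B_nop[OF P0 f] unfolding B_def P0_def[symmetric] by auto
qed

end

section \<open>Densities and symbols on a smooth manifold\<close>

subsection \<open>Bump functions\<close>

text \<open>The free power k absorbs the factor s that each step of the induction on q brings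
  in.\<close>

lemma tendsto_power_poly_exp: "((\<lambda>s::real. s ^ k * poly q s * exp (- s)) \<longlongrightarrow> 0) at_top"
proof (induction q arbitrary: k)
 case (pCons a q)
 have "((\<lambda>s. a * (s ^ k / exp s) + s ^ Suc k * poly q s * exp (- s)) \<longlongrightarrow> a * 0 + 0) at_top"
  by (intro tendsto_intros tendsto_power_div_exp_0 pCons.IH)
 moreover have "(\<lambda>s. a * (s ^ k / exp s) + s ^ Suc k * poly q s * exp (- s)) = (\<lambda>s. s ^ k * poly (pCons a q) s * exp (- s))"
  by (simp add: fun_eq_iff exp_minus field_simps)
 ultimately show ?case by simp
qed simp

text \<open>This family of functions is closed under differentiation.\<close>

definition bexp :: "real poly \<Rightarrow> real \<Rightarrow> real" where
 "bexp q t = (if t > 0 then poly q (1 / t) * exp (- (1 / t)) else 0)"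

text \<open>With s = 1 / t the chain rule produces s * s times q minus its derivative. At 0 the left
  difference quotient vanishes, and the right one tends to 0 because the exponential dominates every
  polynomial in s.\<close>

lemma DERIV_bexp: "(bexp q has_real_derivative bexp ([:0, 0, 1:] * (q - pderiv q)) t) (at t)"
proof -
 consider "t > 0" | "t < 0" | "t = 0" by linarith
 then show ?thesis
 proof cases
  case 1
  have i: "((\<lambda>t. 1 / t) has_real_derivative - (1 / t ^ 2)) (at t)"
   using 1 by (auto intro!: derivative_eq_intros simp: power2_eq_square)
  have "((\<lambda>t. poly q (1 / t) * exp (- (1 / t))) has_real_derivative
    poly (pderiv q) (1 / t) * (- (1 / t ^ 2)) * exp (- (1 / t)) + exp (- (1 / t)) * (1 / t ^ 2) * poly q (1 / t)) (at t)"
   using DERIV_mult[OF DERIV_chain2[OF poly_DERIV i, of q] DERIV_fun_exp[OF DERIV_minus[OF i]]] by simp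
  then have "(bexp q has_real_derivative
    poly (pderiv q) (1 / t) * (- (1 / t ^ 2)) * exp (- (1 / t)) + exp (- (1 / t)) * (1 / t ^ 2) * poly q (1 / t)) (at t)"
   by (rule has_field_derivative_transform_within_open[of _ _ _ "{0<..}"]) (use 1 in \<open>auto simp: bexp_def\<close>)
  then show ?thesis
   using 1 by (simp add: bexp_def algebra_simps power2_eq_square)
 next
  case 2
  have "((\<lambda>t. 0) has_real_derivative 0) (at t)" by simp
  then have "(bexp q has_real_derivative 0) (at t)"
   by (rule has_field_derivative_transform_within_open[of _ _ _ "{..<0}"]) (use 2 in \<open>auto simp: bexp_def\<close>)
  then show ?thesis using 2 by (simp add: bexp_def)
 next
  case 3
  have "((\<lambda>h. bexp q h / h) \<longlongrightarrow> 0) (at_left 0)"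
   by (rule tendsto_eventually) (auto simp: eventually_at_left_field bexp_def intro!: exI[of _ "- 1"])
  moreover have "((\<lambda>h. bexp q h / h) \<longlongrightarrow> 0) (at_right 0)"
  proof -
   have "((\<lambda>h. (inverse h) ^ 1 * poly q (inverse h) * exp (- (inverse h))) \<longlongrightarrow> 0) (at_right (0::real))"
    by (rule filterlim_compose[OF tendsto_power_poly_exp filterlim_inverse_at_top_right])
   then show ?thesis
   proof (rule Lim_transform_eventually)
    show "\<forall>\<^sub>F h in at_right 0. inverse h ^ 1 * poly q (inverse h) * exp (- inverse h) = bexp q h / h"
     by (rule eventually_mono[OF eventually_at_right_less]) (auto simp: bexp_def field_simps)
   qed
  qed
  ultimately have "((\<lambda>h. bexp q h / h) \<longlongrightarrow> 0) (at 0)" by (simp add: filterlim_at_split)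
  then show ?thesis using 3 by (simp add: DERIV_def bexp_def)
 qed
qed

lemma smooth_on_bexp: "open V \<Longrightarrow> smooth_on V u \<Longrightarrow> smooth_on V (\<lambda>x. bexp q (u x))"
 by (rule smooth_on_real_family[where H = "range bexp" and I = UNIV]) (use DERIV_bexp in blast)+

lemma bump_exists:
 fixes a :: "real ^ 'n::finite"
 assumes "0 < \<rho>"
 obtains bump :: "real ^ 'n \<Rightarrow> real" where "smooth_on UNIV bump" "\<And>y. dist a y < \<rho> / 2 \<Longrightarrow> bump y = 1" "\<And>y. \<rho> < dist a y \<Longrightarrow> bump y = 0"
proof -
 define s where "s y = (\<Sum>i\<in>UNIV. (y $ i - a $ i) * (y $ i - a $ i)) * (1 / \<rho>\<^sup>2)" for y
 have sm: "smooth_on UNIV s"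
  unfolding s_def[abs_def] by (intro smooth_on_mult smooth_on_sum smooth_on_diff smooth_on_const smooth_on_coord) auto
 have s_dist: "s y = (dist a y / \<rho>)\<^sup>2" for y
 proof -
  have "(\<Sum>i\<in>UNIV. (y $ i - a $ i) * (y $ i - a $ i)) = (y - a) \<bullet> (y - a)" by (simp add: inner_vec_def)
  then show ?thesis by (simp add: s_def dist_norm norm_minus_commute power_divide flip: power2_norm_eq_inner)
 qed
 \<comment> \<open>The two summands of the denominator never vanish together, since
   \<open>s y < 1\<close> or \<open>s y > 1 / 2\<close>. In the half ball
   \<open>s y \<le> 1 / 4\<close> removes the second one; beyond radius \<rho> the numerator
   vanishes.\<close>
 define bump where "bump y = bexp 1 (1 - s y) * inverse (bexp 1 (1 - s y) + bexp 1 (s y - 1 / 2))" for y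
 have nn: "bexp 1 t \<ge> 0" for t by (simp add: bexp_def)
 have pos: "t > 0 \<Longrightarrow> bexp 1 t > 0" for t by (simp add: bexp_def)
 have den: "bexp 1 (1 - s y) + bexp 1 (s y - 1 / 2) \<noteq> 0" for y
  using nn[of "1 - s y"] nn[of "s y - 1 / 2"] pos[of "1 - s y"] pos[of "s y - 1 / 2"] by (cases "s y < 1") force+
 have sb: "smooth_on UNIV (\<lambda>y. bexp 1 (1 - s y))" "smooth_on UNIV (\<lambda>y. bexp 1 (s y - 1 / 2))"
  by (intro smooth_on_bexp smooth_on_diff smooth_on_const sm open_UNIV)+
 show thesis
 proof
  show "smooth_on UNIV bump"
   unfolding bump_def[abs_def] by (intro smooth_on_mult smooth_on_inverse smooth_on_add sb open_UNIV den)
  fix y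
  show "bump y = 1" if y: "dist a y < \<rho> / 2"
  proof -
   have "dist a y / \<rho> \<le> 1 / 2" using y assms by (simp add: field_simps)
   then have "s y \<le> (1 / 2)\<^sup>2" unfolding s_dist using assms by (intro power_mono) auto
   then have "bexp 1 (s y - 1 / 2) = 0" by (simp add: bexp_def power2_eq_square)
   then show ?thesis using den[of y] by (simp add: bump_def)
  qed
  show "bump y = 0" if y: "\<rho> < dist a y"
  proof -
   have "1 \<le> dist a y / \<rho>" using y assms by (simp add: field_simps)
   then have "1 ^ 2 \<le> s y" unfolding s_dist by (intro power_mono) auto
   then show ?thesis by (simp add: bump_def bexp_def)
  qed
 qed
qed

subsection \<open>Charts and transitions\<close>

locale smooth_manifold =
 fixes S :: "('m::{t2_space,second_countable_topology}, 'n::finite) chart set"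
 assumes smooth_structure: "smooth_structure S"
begin

lemma chart:
 assumes "c \<in> S"
 shows is_chart: "is_chart c" and open_cdom: "open (cdom c)" and open_cimg: "open (cimg c)"
  and homeo: "homeomorphism (cdom c) (cimg c) (coord c) (cinv c)"
 using assms smooth_structure unfolding smooth_structure_def is_chart_def by blast+

lemma cinv_coord: "c \<in> S \<Longrightarrow> x \<in> cdom c \<Longrightarrow> cinv c (coord c x) = x"
 using homeo unfolding homeomorphism_def by blast

lemma cinv_in: "y \<in> cimg c \<Longrightarrow> cinv c y \<in> cdom c"
 by (rule inv_into_into)

lemma open_coord_image:
 assumes c: "c \<in> S" and U: "open U" "U \<subseteq> cdom c" shows "open (coord c ` U)"
proof -
 have "coord c ` U = cimg c \<inter> cinv c -` U"
  using U(2) cinv_coord[OF c] by (force simp: image_iff)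
 moreover have "open (cimg c \<inter> cinv c -` U)"
  using homeo[OF c] open_cimg[OF c] U(1) unfolding homeomorphism_def by (intro continuous_open_preimage) auto
 ultimately show ?thesis by simp
qed

lemma smooth_transition:
 assumes "c \<in> S" "c' \<in> S" "U \<subseteq> cdom c \<inter> cdom c'" shows "smooth_on (coord c ` U) (transition c c')"
proof (rule smooth_on_subset)
 show "smooth_on (coord c ` (cdom c \<inter> cdom c')) (transition c c')"
  using assms smooth_structure unfolding smooth_structure_def smoothly_compatible_def by blast
qed (use assms in blast)

lemma transition_coord: "c \<in> S \<Longrightarrow> x \<in> cdom c \<Longrightarrow> transition c c' (coord c x) = coord c' x"
 by (simp add: transition_def cinv_coord)

lemma transition_diffeo:
 assumes "c \<in> S" "c' \<in> S" "open U" "U \<subseteq> cdom c \<inter> cdom c'"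
 shows "diffeo (coord c ` U) (coord c' ` U) (transition c c') (transition c' c)"
proof
 show "open (coord c ` U)" "open (coord c' ` U)" using assms open_coord_image by auto
 show "smooth_on (coord c ` U) (transition c c')" "smooth_on (coord c' ` U) (transition c' c)"
  using assms smooth_transition by blast+
 have tc: "transition c c' (coord c x) = coord c' x" "transition c' c (coord c' x) = coord c x" if "x \<in> U" for x
  using that assms(4) transition_coord[OF assms(1)] transition_coord[OF assms(2)] by blast+
 show "y \<in> coord c ` U \<Longrightarrow> transition c c' y \<in> coord c' ` U" "y \<in> coord c' ` U \<Longrightarrow> transition c' c y \<in> coord c ` U"
  "y \<in> coord c ` U \<Longrightarrow> transition c' c (transition c c' y) = y" "y \<in> coord c' ` U \<Longrightarrow> transition c c' (transition c' c y) = y" for y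
  by (auto simp: tc)
qed

lemma jac_jmat: "jac c c' x = jmat (transition c c') (coord c x)"
 by (simp add: jac_def jmat_def)

lemma jac_compose:
 assumes c: "c \<in> S" "c' \<in> S" "c'' \<in> S" and x: "x \<in> cdom c" "x \<in> cdom c'" "x \<in> cdom c''"
 shows "jac c c'' x = jac c' c'' x ** jac c c' x"
proof -
 define U where "U = cdom c \<inter> cdom c' \<inter> cdom c''"
 have U: "open U" "x \<in> U" unfolding U_def using x by (auto intro!: open_Int open_cdom c)
 have V: "open (coord c ` U)" by (rule open_coord_image[OF c(1) U(1)]) (auto simp: U_def)
 have "jmat (transition c c'') (coord c x) = jmat (\<lambda>y. transition c' c'' (transition c c' y)) (coord c x)"
  by (rule jmat_cong_open[OF V]) (use U c in \<open>auto simp: transition_coord U_def\<close>)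
 also have "\<dots> = jmat (transition c' c'') (transition c c' (coord c x)) ** jmat (transition c c') (coord c x)"
 proof (rule jmat_compose)
  show "transition c c' differentiable at (coord c x)"
   by (rule smooth_on_differentiable[OF smooth_transition[OF c(1,2), of U]]) (use U in \<open>auto simp: U_def\<close>)
  show "transition c' c'' differentiable at (transition c c' (coord c x))"
   unfolding transition_coord[OF c(1) x(1)]
   by (rule smooth_on_differentiable[OF smooth_transition[OF c(2,3), of U]]) (use U in \<open>auto simp: U_def\<close>)
 qed
 finally show ?thesis using c x by (simp add: jac_jmat transition_coord)
qed

lemma jac_self:
 assumes "c \<in> S" "x \<in> cdom c" shows "jac c c x = mat 1"
proof -
 have "jmat (transition c c) (coord c x) = jmat (\<lambda>y. y) (coord c x)"
  by (rule jmat_cong_open[OF open_cimg[OF assms(1)]]) (use assms in \<open>auto simp: transition_coord\<close>)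
 then show ?thesis by (simp add: jac_jmat jmat_ident)
qed

definition wgt :: "real \<Rightarrow> ('m, 'n) chart \<Rightarrow> ('m, 'n) chart \<Rightarrow> 'm \<Rightarrow> complex" where
 "wgt s c c' x = cr (\<bar>det (jac c c' x)\<bar> powr s)"

lemma wgt_compose:
 assumes "c \<in> S" "c' \<in> S" "c'' \<in> S" "x \<in> cdom c" "x \<in> cdom c'" "x \<in> cdom c''"
 shows "wgt s c c'' x = wgt s c c' x * wgt s c' c'' x"
 unfolding wgt_def jac_compose[OF assms] by (simp add: det_mul abs_mult powr_mult mult.commute)

lemma wgt_self: "c \<in> S \<Longrightarrow> x \<in> cdom c \<Longrightarrow> wgt s c c x = 1"
 by (simp add: wgt_def jac_self)

lemma transpose_jac_compose:
 assumes "c \<in> S" "c' \<in> S" "c'' \<in> S" "x \<in> cdom c" "x \<in> cdom c'" "x \<in> cdom c''"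
 shows "transpose (jac c c' x) *v (transpose (jac c' c'' x) *v \<xi>) = transpose (jac c c'' x) *v \<xi>"
 unfolding jac_compose[OF assms] by (simp add: matrix_vector_mul_assoc matrix_transpose_mul)

lemma transpose_jac_self: "c \<in> S \<Longrightarrow> x \<in> cdom c \<Longrightarrow> transpose (jac c c x) *v \<xi> = \<xi>"
 by (simp add: jac_self transpose_mat)

lemma dens_in_coord: "c \<in> S \<Longrightarrow> x \<in> cdom c \<Longrightarrow> dens_in c f (coord c x) = f c x"
 by (simp add: dens_in_def cinv_coord)

lemma symb_in_coord: "c \<in> S \<Longrightarrow> x \<in> cdom c \<Longrightarrow> symb_in c P (coord c x) \<xi> = P c x \<xi>"
 by (simp add: symb_in_def cinv_coord)

lemma densitiesD:
 assumes "f \<in> densities S l"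
 shows "c \<in> S \<Longrightarrow> dens_in c f \<in> loc_fun (cimg c)"
  and "c \<in> S \<Longrightarrow> c' \<in> S \<Longrightarrow> x \<in> cdom c \<Longrightarrow> x \<in> cdom c' \<Longrightarrow> f c x = wgt l c c' x * f c' x"
  and "c \<notin> S \<or> x \<notin> cdom c \<Longrightarrow> f c x = 0"
 using assms unfolding densities_def wgt_def by blast+

lemma symbolsD:
 assumes "P \<in> symbols_upto S d k"
 shows "c \<in> S \<Longrightarrow> symb_in c P \<in> SymU (cimg c) k"
  and "c \<in> S \<Longrightarrow> c' \<in> S \<Longrightarrow> x \<in> cdom c \<Longrightarrow> x \<in> cdom c' \<Longrightarrow> P c x (transpose (jac c c' x) *v \<xi>) = wgt d c c' x * P c' x \<xi>"
  and "c \<notin> S \<or> x \<notin> cdom c \<Longrightarrow> P c x \<xi> = 0"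
 using assms unfolding symbols_upto_def wgt_def by blast+

lemma densitiesI:
 assumes "\<And>c. c \<in> S \<Longrightarrow> dens_in c f \<in> loc_fun (cimg c)"
  and "\<And>c c' x. c \<in> S \<Longrightarrow> c' \<in> S \<Longrightarrow> x \<in> cdom c \<Longrightarrow> x \<in> cdom c' \<Longrightarrow> f c x = wgt l c c' x * f c' x"
  and "\<And>c x. c \<notin> S \<or> x \<notin> cdom c \<Longrightarrow> f c x = 0"
 shows "f \<in> densities S l"
 using assms unfolding densities_def wgt_def by blast

lemma dens_pull:
 assumes f: "f \<in> densities S s" and c: "c \<in> S" "c' \<in> S" and U: "U \<subseteq> cdom c \<inter> cdom c'"
 shows "dpull (coord c ` U) (transition c c') s (restrict_fun (coord c' ` U) (dens_in c' f)) = restrict_fun (coord c ` U) (dens_in c f)"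
proof
 fix y
 show "dpull (coord c ` U) (transition c c') s (restrict_fun (coord c' ` U) (dens_in c' f)) y = restrict_fun (coord c ` U) (dens_in c f) y"
 proof (cases "y \<in> coord c ` U")
  case True
  then obtain x where x: "x \<in> U" "y = coord c x" by blast
  then have x2: "x \<in> cdom c" "x \<in> cdom c'" using U by auto
  show ?thesis
   using x x2 c densitiesD(2)[OF f c x2]
   by (simp add: dpull_def restrict_fun_def transition_coord dens_in_coord wgt_def jac_jmat)
 qed (simp add: dpull_def restrict_fun_def)
qed

lemma symb_pull:
 assumes P: "P \<in> symbols_upto S d k" and c: "c \<in> S" "c' \<in> S" and U: "U \<subseteq> cdom c \<inter> cdom c'"
 shows "spull (coord c ` U) (transition c c') (transition c' c) d (restrict_symbol (coord c' ` U) (symb_in c' P)) =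
  restrict_symbol (coord c ` U) (symb_in c P)"
proof (intro ext)
 fix y \<xi>
 show "spull (coord c ` U) (transition c c') (transition c' c) d (restrict_symbol (coord c' ` U) (symb_in c' P)) y \<xi> =
  restrict_symbol (coord c ` U) (symb_in c P) y \<xi>"
 proof (cases "y \<in> coord c ` U")
  case True
  then obtain x where x: "x \<in> U" "y = coord c x" by blast
  then have x2: "x \<in> cdom c" "x \<in> cdom c'" using U by auto
  show ?thesis
   using x x2 c symbolsD(2)[OF P c x2, of "transpose (jac c' c x) *v \<xi>"]
   by (simp add: spull_def restrict_symbol_def transition_coord symb_in_coord wgt_def jac_jmat[symmetric] transpose_jac_compose transpose_jac_self)
 qed (simp add: spull_def restrict_symbol_def)
qed

text \<open>A cutoff equal to 1 near y allows u to be extended by zero. On overlaps with the chart c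
  smoothness follows from the law of densities. At points outside c it follows because the compact
  set K, off which the cut off density vanishes, is closed in a Hausdorff space.\<close>

lemma density_extension:
 assumes c: "c \<in> S" and y: "y \<in> cimg c" and u: "u \<in> loc_fun (cimg c)"
 shows "\<exists>f\<in>densities S l. \<exists>N. open N \<and> y \<in> N \<and> N \<subseteq> cimg c \<and> (\<forall>z\<in>N. dens_in c f z = u z)"
proof -
 obtain \<rho> where \<rho>: "\<rho> > 0" "cball y \<rho> \<subseteq> cimg c" using open_cimg[OF c] y unfolding open_contains_cball by blast
 obtain bump :: "real ^ 'n \<Rightarrow> real" where bump: "smooth_on UNIV bump" "\<And>z. dist y z < \<rho> / 2 \<Longrightarrow> bump z = 1" "\<And>z. \<rho> < dist y z \<Longrightarrow> bump z = 0"
  using bump_exists[OF \<rho>(1)] by blast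
 define v where "v z = cr (bump z) * u z" for z
 have v: "v \<in> loc_fun (cimg c)"
 proof -
  have "smooth_on (cimg c) bump" by (rule smooth_on_subset[OF bump(1)]) simp
  then have "smooth_on (cimg c) v"
   unfolding v_def[abs_def] using u open_cimg[OF c] by (intro smooth_on_mult smooth_on_of_real) (auto simp: loc_fun_def)
  then show ?thesis using u by (simp add: loc_fun_def v_def)
 qed
 define K where "K = cinv c ` cball y \<rho>"
 have "continuous_on (cimg c) (cinv c)" using homeo[OF c] unfolding homeomorphism_def by simp
 then have "continuous_on (cball y \<rho>) (cinv c)" by (rule continuous_on_subset[OF _ \<rho>(2)])
 then have K: "closed K" unfolding K_def by (intro compact_imp_closed compact_continuous_image) auto
 define f where "f c' x = (if c' \<in> S \<and> x \<in> cdom c' \<and> x \<in> cdom c then wgt l c' c x * v (coord c x) else 0)" for c' x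
 have f: "f \<in> densities S l"
 proof (rule densitiesI)
  fix c' assume c': "c' \<in> S"
  have "smooth_on (cimg c') (dens_in c' f)"
  proof (rule smooth_on_local)
   fix z assume z: "z \<in> cimg c'"
   then obtain x where x: "x \<in> cdom c'" "z = coord c' x" by blast
   show "\<exists>W. open W \<and> z \<in> W \<and> smooth_on W (dens_in c' f)"
   proof (cases "x \<in> cdom c")
    case True
    let ?U = "cdom c' \<inter> cdom c"
    have U: "open ?U" by (intro open_Int open_cdom c c')
    interpret diffeo "coord c' ` ?U" "coord c ` ?U" "transition c' c" "transition c c'"
     by (rule transition_diffeo[OF c' c U(1)]) simp
    have "restrict_fun (coord c ` ?U) v \<in> loc_fun (coord c ` ?U)"
     by (rule restrict_loc_fun[OF open_V' v]) blast
    from dpull_loc_fun[OF this, of l] have sm: "smooth_on (coord c' ` ?U) (dpull (coord c' ` ?U) (transition c' c) l (restrict_fun (coord c ` ?U) v))"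
     by (simp add: loc_fun_def)
    have "smooth_on (coord c' ` ?U) (dens_in c' f)"
    proof (rule smooth_on_congI[OF open_V sm])
     fix w assume "w \<in> coord c' ` ?U"
     then obtain x' where "x' \<in> cdom c'" "x' \<in> cdom c" "w = coord c' x'" by blast
     then show "dens_in c' f w = dpull (coord c' ` ?U) (transition c' c) l (restrict_fun (coord c ` ?U) v) w"
      using c c' by (simp add: dens_in_coord f_def dpull_def restrict_fun_def transition_coord wgt_def jac_jmat)
    qed
    then show ?thesis using open_V x True by blast
   next
    case False
    have KU: "K \<subseteq> cdom c" unfolding K_def using subsetD[OF \<rho>(2)] by (intro image_subsetI cinv_in)
    let ?U = "cdom c' - K"
    have U: "open (coord c' ` ?U)" using open_cdom[OF c'] K by (intro open_coord_image[OF c'] open_Diff) auto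
    have "smooth_on (coord c' ` ?U) (dens_in c' f)"
    proof (rule smooth_on_congI[OF U smooth_on_const])
     fix w assume "w \<in> coord c' ` ?U"
     then obtain x' where x': "x' \<in> cdom c'" "x' \<notin> K" "w = coord c' x'" by blast
     have "v (coord c x') = 0" if "x' \<in> cdom c"
     proof -
      have "coord c x' \<notin> cball y \<rho>" using x'(2) cinv_coord[OF c that] unfolding K_def by force
      then show ?thesis using bump(3) by (simp add: v_def)
     qed
     then show "dens_in c' f w = 0" using x' c' by (simp add: dens_in_coord f_def)
    qed
    then show ?thesis using U x False KU by blast
   qed
  qed
  then show "dens_in c' f \<in> loc_fun (cimg c')" by (simp add: loc_fun_def dens_in_def)
 next
  fix c1 c2 x assume "c1 \<in> S" "c2 \<in> S" "x \<in> cdom c1" "x \<in> cdom c2"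
  then show "f c1 x = wgt l c1 c2 x * f c2 x" using wgt_compose[OF _ _ c, of c1 c2 x l] by (simp add: f_def)
 qed (auto simp: f_def)
 have "dens_in c f z = u z" if "z \<in> ball y (\<rho> / 2)" for z
 proof -
  have "ball y (\<rho> / 2) \<subseteq> cball y \<rho>" using \<rho>(1) by auto
  then have "z \<in> cimg c" using that \<rho>(2) by blast
  then obtain x where x: "x \<in> cdom c" "z = coord c x" by blast
  show ?thesis
   using x c that bump(2)[of z] by (simp add: dens_in_coord f_def wgt_self v_def)
 qed
 moreover have "ball y (\<rho> / 2) \<subseteq> cimg c" using \<rho>(1) by (intro order_trans[OF _ \<rho>(2)]) auto
 ultimately show ?thesis using f \<rho>(1) by (intro bexI[of _ f] exI[of _ "ball y (\<rho> / 2)"]) auto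
qed

subsection \<open>Gluing symbols and operators\<close>

lemma nop_cong_open:
 assumes V: "open V" and R: "R \<in> Sym V" and u: "u \<in> loc_fun V" "u' \<in> loc_fun V"
  and N: "open N" "x \<in> N" "\<And>z. z \<in> N \<Longrightarrow> z \<in> V \<Longrightarrow> u z = u' z" and x: "x \<in> V"
 shows "nop V R u x = nop V R u' x"
proof -
 let ?N = "N \<inter> V"
 have N': "open ?N" "?N \<subseteq> V" "x \<in> ?N" using N V x by auto
 have "restrict_fun ?N u = restrict_fun ?N u'" using N(3) by (auto simp: restrict_fun_def)
 then show ?thesis
  using nop_restrict[OF V N'(1,2) R u(1) N'(3)] nop_restrict[OF V N'(1,2) R u(2) N'(3)] by simp
qed

text \<open>Operators on the manifold accept global densities only. This one continues an
  exponential given near y, which is enough to read off a symbol at y.\<close>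

definition exp_ext :: "real \<Rightarrow> ('m, 'n) chart \<Rightarrow> real ^ 'n \<Rightarrow> real ^ 'n \<Rightarrow> ('m, 'n) density" where
 "exp_ext l c y \<xi> = (SOME f. f \<in> densities S l \<and>
   (\<exists>N. open N \<and> y \<in> N \<and> N \<subseteq> cimg c \<and> (\<forall>z\<in>N. dens_in c f z = exp_fun (cimg c) \<xi> z)))"

lemma exp_ext:
 assumes c: "c \<in> S" and y: "y \<in> cimg c"
 shows "exp_ext l c y \<xi> \<in> densities S l"
  and "\<exists>N. open N \<and> y \<in> N \<and> N \<subseteq> cimg c \<and> (\<forall>z\<in>N. dens_in c (exp_ext l c y \<xi>) z = exp_fun (cimg c) \<xi> z)"
proof -
 have "\<exists>f. f \<in> densities S l \<and> (\<exists>N. open N \<and> y \<in> N \<and> N \<subseteq> cimg c \<and> (\<forall>z\<in>N. dens_in c f z = exp_fun (cimg c) \<xi> z))"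
  using density_extension[OF c y exp_fun_loc_fun[OF open_cimg[OF c]], of l \<xi>] by blast
 from someI_ex[OF this] have "exp_ext l c y \<xi> \<in> densities S l \<and>
   (\<exists>N. open N \<and> y \<in> N \<and> N \<subseteq> cimg c \<and> (\<forall>z\<in>N. dens_in c (exp_ext l c y \<xi>) z = exp_fun (cimg c) \<xi> z))"
  unfolding exp_ext_def[symmetric] .
 then show "exp_ext l c y \<xi> \<in> densities S l"
  "\<exists>N. open N \<and> y \<in> N \<and> N \<subseteq> cimg c \<and> (\<forall>z\<in>N. dens_in c (exp_ext l c y \<xi>) z = exp_fun (cimg c) \<xi> z)" by auto
qed

lemma symbol_exp_ext:
 assumes c: "c \<in> S" and W: "open W" "W \<subseteq> cimg c" and R: "R \<in> Sym W" and y: "y \<in> W"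
 shows "R y \<xi> = nop W R (restrict_fun W (dens_in c (exp_ext l c y \<xi>))) y * cr (exp (- (\<xi> \<bullet> y)))"
proof -
 have yc: "y \<in> cimg c" using W y by blast
 obtain N where N: "open N" "y \<in> N" "\<forall>z\<in>N. dens_in c (exp_ext l c y \<xi>) z = exp_fun (cimg c) \<xi> z"
  using exp_ext(2)[OF c yc, of l \<xi>] by (elim exE conjE)
 have "nop W R (restrict_fun W (dens_in c (exp_ext l c y \<xi>))) y = nop W R (exp_fun W \<xi>) y"
 proof (rule nop_cong_open[OF W(1) R _ exp_fun_loc_fun[OF W(1)] N(1,2) _ y])
  show "restrict_fun W (dens_in c (exp_ext l c y \<xi>)) \<in> loc_fun W"
   using restrict_loc_fun[OF W(1) densitiesD(1)[OF exp_ext(1)[OF c yc] c] W(2)] .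
  fix z assume "z \<in> N" "z \<in> W"
  then show "restrict_fun W (dens_in c (exp_ext l c y \<xi>)) z = exp_fun W \<xi> z"
   using N(3) W(2) by (auto simp: restrict_fun_def exp_fun_def)
 qed
 moreover have "R y \<xi> = full_symbol W (nop W R) y \<xi>" using full_symbol_nop[OF W(1) R] by simp
 ultimately show ?thesis using y by (simp add: full_symbol_def)
qed

lemma symbol_eqI:
 assumes c: "c \<in> S" and W: "open W" "W \<subseteq> cimg c" and R: "R \<in> Sym W" "R' \<in> Sym W"
  and eq: "\<And>f z. f \<in> densities S l \<Longrightarrow> z \<in> W \<Longrightarrow> nop W R (restrict_fun W (dens_in c f)) z = nop W R' (restrict_fun W (dens_in c f)) z"
 shows "R = R'"
proof (intro ext)
 fix y \<xi>
 show "R y \<xi> = R' y \<xi>"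
 proof (cases "y \<in> W")
  case True
  then have "y \<in> cimg c" using W by blast
  then show ?thesis
   using eq[OF exp_ext(1)[OF c] True] by (simp add: symbol_exp_ext[OF c W R(1) True, of _ l] symbol_exp_ext[OF c W R(2) True, of _ l])
 qed (use Sym_notin[OF R(1)] Sym_notin[OF R(2)] in simp)
qed

text \<open>Testing T on \<open>exp_ext\<close> gives a symbol P pointwise and without reference to
  the sets W. Over each W it is the local symbol R, so P is smooth and of order k.\<close>

lemma loc_op_glue:
 fixes T :: "('m, 'n) density \<Rightarrow> real ^ 'n \<Rightarrow> complex"
 assumes c: "c \<in> S"
  and loc: "\<And>y. y \<in> cimg c \<Longrightarrow> \<exists>W. open W \<and> y \<in> W \<and> W \<subseteq> cimg c \<and> (\<exists>R\<in>SymU W k.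
    \<forall>f\<in>densities S l. \<forall>z\<in>W. T f z = nop W R (restrict_fun W (dens_in c f)) z)"
 shows "\<exists>R\<in>SymU (cimg c) k. \<forall>f\<in>densities S l. \<forall>z\<in>cimg c. T f z = nop (cimg c) R (dens_in c f) z"
proof -
 note V = open_cimg[OF c]
 define P where "P y \<xi> = (if y \<in> cimg c then T (exp_ext l c y \<xi>) y * cr (exp (- (\<xi> \<bullet> y))) else 0)" for y \<xi>
 have PW: "restrict_symbol W P = R"
  if W: "open W" "W \<subseteq> cimg c" and R: "R \<in> SymU W k"
   and TR: "\<forall>f\<in>densities S l. \<forall>z\<in>W. T f z = nop W R (restrict_fun W (dens_in c f)) z" for W R
 proof (intro ext)
  fix y \<xi>
  have Rl: "R \<in> Sym W" using R by (auto simp: Sym_iff)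
  show "restrict_symbol W P y \<xi> = R y \<xi>"
  proof (cases "y \<in> W")
   case True
   then have "y \<in> cimg c" using W by blast
   then show ?thesis
    unfolding symbol_exp_ext[OF c W Rl True, of \<xi> l] using TR exp_ext(1)[OF c] True by (simp add: restrict_symbol_def P_def)
  qed (simp add: restrict_symbol_def Sym_notin[OF Rl])
 qed
 have P: "P \<in> SymU (cimg c) k"
 proof (rule SymU_local[OF V])
  show "\<And>x \<xi>. x \<notin> cimg c \<Longrightarrow> P x \<xi> = 0" unfolding P_def by simp
  fix x assume "x \<in> cimg c"
  from loc[OF this] PW show "\<exists>W. open W \<and> x \<in> W \<and> W \<subseteq> cimg c \<and> restrict_symbol W P \<in> SymU W k" by metis
 qed
 then have Pl: "P \<in> Sym (cimg c)" by (auto simp: Sym_iff)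
 have "T f z = nop (cimg c) P (dens_in c f) z" if f: "f \<in> densities S l" and z: "z \<in> cimg c" for f z
 proof -
  obtain W R where W: "open W" "z \<in> W" "W \<subseteq> cimg c" and R: "R \<in> SymU W k"
   and TR: "\<forall>f\<in>densities S l. \<forall>z\<in>W. T f z = nop W R (restrict_fun W (dens_in c f)) z" using loc[OF z] by blast
  show ?thesis
   using nop_restrict[OF V W(1,3) Pl densitiesD(1)[OF f c] W(2)] TR f W(2) unfolding PW[OF W(1,3) R TR] by simp
 qed
 with P show ?thesis by blast
qed

definition chart_at :: "('m, 'n) chart set \<Rightarrow> 'm \<Rightarrow> ('m, 'n) chart" where
 "chart_at C x = (SOME c. c \<in> C \<and> x \<in> cdom c)"

lemma chart_at: "(\<Union>c\<in>C. cdom c) = UNIV \<Longrightarrow> chart_at C x \<in> C \<and> x \<in> cdom (chart_at C x)"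
 unfolding chart_at_def by (rule someI_ex) blast

lemma dens_eqI:
 assumes C: "C \<subseteq> S" "(\<Union>c\<in>C. cdom c) = UNIV" and f: "f \<in> densities S l" "f' \<in> densities S l"
  and eq: "\<And>c. c \<in> C \<Longrightarrow> dens_in c f = dens_in c f'"
 shows "f = f'"
proof (intro ext)
 fix c x
 let ?c = "chart_at C x"
 have c: "?c \<in> C" "?c \<in> S" "x \<in> cdom ?c" using chart_at[OF C(2), of x] C(1) by auto
 show "f c x = f' c x"
 proof (cases "c \<in> S \<and> x \<in> cdom c")
  case True
  have "f ?c x = f' ?c x" using eq[OF c(1)] dens_in_coord[OF c(2,3)] by metis
  then show ?thesis using densitiesD(2)[OF f(1), of c ?c x] densitiesD(2)[OF f(2), of c ?c x] True c by simp
 qed (use densitiesD(3)[OF f(1)] densitiesD(3)[OF f(2)] in auto)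
qed

lemma symb_transform:
 assumes P: "P \<in> symbols_upto S d k" and c: "c \<in> S" "c' \<in> S" "x \<in> cdom c" "x \<in> cdom c'"
 shows "P c x \<xi> = wgt d c c' x * P c' x (transpose (jac c' c x) *v \<xi>)"
 using symbolsD(2)[OF P c, of "transpose (jac c' c x) *v \<xi>"] c by (simp add: transpose_jac_compose transpose_jac_self)

lemma symb_eqI:
 assumes C: "C \<subseteq> S" "(\<Union>c\<in>C. cdom c) = UNIV" and P: "P \<in> symbols_upto S d k" "P' \<in> symbols_upto S d k'"
  and eq: "\<And>c. c \<in> C \<Longrightarrow> symb_in c P = symb_in c P'"
 shows "P = P'"
proof (intro ext)
 fix c x \<xi>
 let ?c = "chart_at C x"
 have c: "?c \<in> C" "?c \<in> S" "x \<in> cdom ?c" using chart_at[OF C(2), of x] C(1) by auto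
 show "P c x \<xi> = P' c x \<xi>"
 proof (cases "c \<in> S \<and> x \<in> cdom c")
  case True
  have "P ?c x \<eta> = P' ?c x \<eta>" for \<eta> using eq[OF c(1)] symb_in_coord[OF c(2,3)] by metis
  then show ?thesis using symb_transform[OF P(1), of c ?c x] symb_transform[OF P(2), of c ?c x] True c by simp
 qed (use symbolsD(3)[OF P(1)] symbolsD(3)[OF P(2)] in auto)
qed

text \<open>The component in an arbitrary chart is transported from a chart of C chosen at the
  point. By \<open>compat\<close> any other chart of C gives the same value, so near a point one
  fixed chart of C can be used to check smoothness.\<close>

lemma glue_symbols:
 assumes C: "C \<subseteq> S" "(\<Union>c\<in>C. cdom c) = UNIV"
  and R: "\<And>c. c \<in> C \<Longrightarrow> R c \<in> SymU (cimg c) k"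
  and compat: "\<And>c c' x \<xi>. c \<in> C \<Longrightarrow> c' \<in> C \<Longrightarrow> x \<in> cdom c \<Longrightarrow> x \<in> cdom c' \<Longrightarrow>
    R c (coord c x) (transpose (jac c c' x) *v \<xi>) = wgt d c c' x * R c' (coord c' x) \<xi>"
 shows "\<exists>P\<in>symbols_upto S d k. \<forall>c\<in>C. symb_in c P = R c"
proof -
 define ch where "ch = chart_at C"
 have ch: "ch x \<in> C" "ch x \<in> S" "x \<in> cdom (ch x)" for x using chart_at[OF C(2), of x] C(1) unfolding ch_def by auto
 define P where "P c x \<xi> = (if c \<in> S \<and> x \<in> cdom c
   then wgt d c (ch x) x * R (ch x) (coord (ch x) x) (transpose (jac (ch x) c x) *v \<xi>) else 0)" for c x \<xi>
 have ind: "P c x \<xi> = wgt d c c' x * R c' (coord c' x) (transpose (jac c' c x) *v \<xi>)"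
  if c: "c \<in> S" "c' \<in> C" "x \<in> cdom c" "x \<in> cdom c'" for c c' x \<xi>
 proof -
  have c'S: "c' \<in> S" using c C by blast
  show ?thesis
   using compat[OF ch(1) c(2) ch(3) c(4), of "transpose (jac c' c x) *v \<xi>"] c c'S ch[of x] wgt_compose[OF c(1) ch(2) c'S c(3) ch(3) c(4), of d]
   by (simp add: P_def transpose_jac_compose)
 qed
 have P: "P \<in> symbols_upto S d k"
  unfolding symbols_upto_def
 proof (intro CollectI conjI ballI allI impI)
  fix c assume c: "c \<in> S"
  show "symb_in c P \<in> SymU (cimg c) k"
  proof (rule SymU_local[OF open_cimg[OF c]])
   show "\<And>x \<xi>. x \<notin> cimg c \<Longrightarrow> symb_in c P x \<xi> = 0" by (simp add: symb_in_def)
   fix y assume "y \<in> cimg c"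
   then obtain x where x: "x \<in> cdom c" "y = coord c x" by blast
   define c' where "c' = ch x"
   have c': "c' \<in> C" "c' \<in> S" "x \<in> cdom c'" using ch unfolding c'_def by auto
   let ?U = "cdom c \<inter> cdom c'"
   have U: "open ?U" by (intro open_Int open_cdom c c'(2))
   interpret diffeo "coord c ` ?U" "coord c' ` ?U" "transition c c'" "transition c' c"
    by (rule transition_diffeo[OF c c'(2) U]) simp
   have "restrict_symbol (coord c ` ?U) (symb_in c P) =
    spull (coord c ` ?U) (transition c c') (transition c' c) d (restrict_symbol (coord c' ` ?U) (R c'))"
   proof (intro ext)
    fix z \<xi>
    show "restrict_symbol (coord c ` ?U) (symb_in c P) z \<xi> =
     spull (coord c ` ?U) (transition c c') (transition c' c) d (restrict_symbol (coord c' ` ?U) (R c')) z \<xi>"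
    proof (cases "z \<in> coord c ` ?U")
     case True
     then obtain x' where "x' \<in> cdom c" "x' \<in> cdom c'" "z = coord c x'" by blast
     then show ?thesis
      using ind[OF c c'(1), of x' \<xi>] c c'(2)
      by (simp add: restrict_symbol_def spull_def symb_in_coord transition_coord wgt_def jac_jmat[symmetric])
    qed (simp add: restrict_symbol_def spull_def)
   qed
   moreover have "restrict_symbol (coord c' ` ?U) (R c') \<in> SymU (coord c' ` ?U) k"
    by (rule restrict_SymU[OF R[OF c'(1)]]) blast
   ultimately show "\<exists>W. open W \<and> y \<in> W \<and> W \<subseteq> cimg c \<and> restrict_symbol W (symb_in c P) \<in> SymU W k"
    using spull_upto open_V x c'(3) by (intro exI[of _ "coord c ` ?U"]) auto
  qed
 next
  fix c1 c2 x \<xi> assume c: "c1 \<in> S" "c2 \<in> S" "x \<in> cdom c1 \<inter> cdom c2"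
  then have x: "x \<in> cdom c1" "x \<in> cdom c2" by auto
  show "P c1 x (transpose (jac c1 c2 x) *v \<xi>) = cr (\<bar>det (jac c1 c2 x)\<bar> powr d) * P c2 x \<xi>"
   using c x ch[of x] wgt_compose[OF c(1,2) ch(2) x ch(3), of d]
   by (simp add: P_def transpose_jac_compose wgt_def[symmetric])
 qed (auto simp: P_def)
 moreover have "symb_in c P = R c" if c: "c \<in> C" for c
 proof (intro ext)
  fix y \<xi>
  have cS: "c \<in> S" using c C by blast
  have Rl: "R c \<in> Sym (cimg c)" using R[OF c] by (auto simp: Sym_iff)
  show "symb_in c P y \<xi> = R c y \<xi>"
  proof (cases "y \<in> cimg c")
   case True
   then obtain x where x: "x \<in> cdom c" "y = coord c x" by blast
   show ?thesis using ind[OF cS c x(1) x(1), of \<xi>] x cS by (simp add: symb_in_coord wgt_self transpose_jac_self)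
  qed (simp add: symb_in_def Sym_notin[OF Rl])
 qed
 ultimately show ?thesis by blast
qed

text \<open>Values are glued as for symbols, but the result has to be a differential operator in
  every chart of S. Locally it is the transport of \<open>R c'\<close> by \<open>pull_op\<close>,
  and \<open>loc_op_glue\<close> joins these local expressions.\<close>

lemma glue_operators:
 assumes C: "C \<subseteq> S" "(\<Union>c\<in>C. cdom c) = UNIV"
  and R: "\<And>c. c \<in> C \<Longrightarrow> R c \<in> SymU (cimg c) k"
  and compat: "\<And>c c' x f. c \<in> C \<Longrightarrow> c' \<in> C \<Longrightarrow> x \<in> cdom c \<Longrightarrow> x \<in> cdom c' \<Longrightarrow> f \<in> densities S l \<Longrightarrow>
    nop (cimg c) (R c) (dens_in c f) (coord c x) = wgt m c c' x * nop (cimg c') (R c') (dens_in c' f) (coord c' x)"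
 shows "\<exists>T\<in>operators_upto S l m k. \<forall>c\<in>C. \<forall>f\<in>densities S l. dens_in c (T f) = nop (cimg c) (R c) (dens_in c f)"
proof -
 define ch where "ch = chart_at C"
 have ch: "ch x \<in> C" "ch x \<in> S" "x \<in> cdom (ch x)" for x using chart_at[OF C(2), of x] C(1) unfolding ch_def by auto
 define T where "T f c x = (if f \<in> densities S l \<and> c \<in> S \<and> x \<in> cdom c
   then wgt m c (ch x) x * nop (cimg (ch x)) (R (ch x)) (dens_in (ch x) f) (coord (ch x) x) else 0)" for f c x
 have ind: "T f c x = wgt m c c' x * nop (cimg c') (R c') (dens_in c' f) (coord c' x)"
  if c: "c \<in> S" "c' \<in> C" "x \<in> cdom c" "x \<in> cdom c'" and f: "f \<in> densities S l" for f c c' x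
 proof -
  have c'S: "c' \<in> S" using c C by blast
  show ?thesis
   using compat[OF ch(1) c(2) ch(3) c(4) f] c f wgt_compose[OF c(1) ch(2) c'S c(3) ch(3) c(4), of m]
   by (simp add: T_def)
 qed
 have Rl: "R c \<in> Sym (cimg c)" if "c \<in> C" for c using R[OF that] by (auto simp: Sym_iff)
 have loc: "\<exists>R'\<in>SymU (cimg c) k. \<forall>f\<in>densities S l. \<forall>z\<in>cimg c. dens_in c (T f) z = nop (cimg c) R' (dens_in c f) z"
  if c: "c \<in> S" for c
 proof (rule loc_op_glue[OF c])
  fix y assume "y \<in> cimg c"
  then obtain x where x: "x \<in> cdom c" "y = coord c x" by blast
  define c' where "c' = ch x"
  have c': "c' \<in> C" "c' \<in> S" "x \<in> cdom c'" using ch unfolding c'_def by auto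
  let ?U = "cdom c \<inter> cdom c'"
  have U: "open ?U" by (intro open_Int open_cdom c c'(2))
  interpret diffeo "coord c ` ?U" "coord c' ` ?U" "transition c c'" "transition c' c"
   by (rule transition_diffeo[OF c c'(2) U]) simp
  have sub: "coord c ` ?U \<subseteq> cimg c" "coord c' ` ?U \<subseteq> cimg c'" by auto
  obtain P2 where P2: "P2 \<in> SymU (coord c ` ?U) k"
   "\<forall>u\<in>loc_fun (coord c ` ?U). dpull (coord c ` ?U) (transition c c') m
     (nop (coord c' ` ?U) (restrict_symbol (coord c' ` ?U) (R c')) (dpull (coord c' ` ?U) (transition c' c) l u)) = nop (coord c ` ?U) P2 u"
   using pull_op[OF restrict_SymU[OF R[OF c'(1)] sub(2)], of m l] by blast
  have "dens_in c (T f) z = nop (coord c ` ?U) P2 (restrict_fun (coord c ` ?U) (dens_in c f)) z"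
   if f: "f \<in> densities S l" and z: "z \<in> coord c ` ?U" for f z
  proof -
   obtain x' where x': "x' \<in> cdom c" "x' \<in> cdom c'" "z = coord c x'" using z by blast
   have rl: "restrict_fun (coord c ` ?U) (dens_in c f) \<in> loc_fun (coord c ` ?U)"
    by (rule restrict_loc_fun[OF open_V densitiesD(1)[OF f c] sub(1)])
   have z': "coord c' x' \<in> coord c' ` ?U" using x' by blast
   have "nop (coord c ` ?U) P2 (restrict_fun (coord c ` ?U) (dens_in c f)) z =
    dpull (coord c ` ?U) (transition c c') m (nop (coord c' ` ?U) (restrict_symbol (coord c' ` ?U) (R c')) (restrict_fun (coord c' ` ?U) (dens_in c' f))) z"
    using P2(2) rl dens_pull[OF f c'(2) c, of ?U] by (metis Int_commute order_refl)
   also have "\<dots> = wgt m c c' x' * nop (cimg c') (R c') (dens_in c' f) (coord c' x')"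
    using z x' c nop_restrict[OF open_cimg[OF c'(2)] open_V' sub(2) Rl[OF c'(1)] densitiesD(1)[OF f c'(2)] z']
    by (simp add: dpull_def transition_coord wgt_def jac_jmat)
   also have "\<dots> = dens_in c (T f) z" using ind[OF c c'(1) x'(1,2) f] x' c by (simp add: dens_in_coord)
   finally show ?thesis by simp
  qed
  then show "\<exists>W. open W \<and> y \<in> W \<and> W \<subseteq> cimg c \<and> (\<exists>R\<in>SymU W k.
    \<forall>f\<in>densities S l. \<forall>z\<in>W. dens_in c (T f) z = nop W R (restrict_fun W (dens_in c f)) z)"
   using open_V x c'(3) sub(1) P2(1) by (intro exI[of _ "coord c ` ?U"]) blast
 qed
 have loc': "\<exists>R'\<in>SymU (cimg c) k. \<forall>f\<in>densities S l. dens_in c (T f) = nop (cimg c) R' (dens_in c f)"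
  if c: "c \<in> S" for c
 proof -
  obtain R' where R': "R' \<in> SymU (cimg c) k" "\<forall>f\<in>densities S l. \<forall>z\<in>cimg c. dens_in c (T f) z = nop (cimg c) R' (dens_in c f) z"
   using loc[OF c] by blast
  then have "R' \<in> Sym (cimg c)" by (auto simp: Sym_iff)
  then have "dens_in c (T f) = nop (cimg c) R' (dens_in c f)" if "f \<in> densities S l" for f
   using R'(2) that nop_notin[OF open_cimg[OF c], of R' "dens_in c f"] by (auto simp: fun_eq_iff dens_in_def)
  with R'(1) show ?thesis by blast
 qed
 have "T \<in> operators_upto S l m k"
  unfolding operators_upto_def
 proof (intro CollectI conjI ballI allI impI)
  fix f assume f: "f \<in> densities S l"
  show "T f \<in> densities S m"
  proof (rule densitiesI)
   fix c assume c: "c \<in> S"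
   obtain R' where R': "R' \<in> SymU (cimg c) k" "dens_in c (T f) = nop (cimg c) R' (dens_in c f)"
    using loc'[OF c] f by blast
   then have "R' \<in> Sym (cimg c)" by (auto simp: Sym_iff)
   then show "dens_in c (T f) \<in> loc_fun (cimg c)"
    unfolding R'(2) by (rule nop_loc_fun[OF open_cimg[OF c] _ densitiesD(1)[OF f c]])
  next
   fix c1 c2 x assume "c1 \<in> S" "c2 \<in> S" "x \<in> cdom c1" "x \<in> cdom c2"
   then show "T f c1 x = wgt m c1 c2 x * T f c2 x"
    using wgt_compose[OF _ _ ch(2) _ _ ch(3), of c1 c2 x m] by (simp add: T_def)
  qed (auto simp: T_def)
 next
  fix f assume "f \<notin> densities S l"
  then show "T f = (\<lambda>c x. 0)" by (simp add: T_def fun_eq_iff)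
 next
  fix c assume c: "c \<in> S"
  show "\<exists>B\<in>loc_op_upto (cimg c) k. \<forall>f\<in>densities S l. dens_in c (T f) = B (dens_in c f)"
   using loc'[OF c] nop_loc_op_upto[OF open_cimg[OF c]] by metis
 qed
 moreover have "dens_in c (T f) = nop (cimg c) (R c) (dens_in c f)" if c: "c \<in> C" and f: "f \<in> densities S l" for c f
 proof
  fix y
  have cS: "c \<in> S" using c C by blast
  show "dens_in c (T f) y = nop (cimg c) (R c) (dens_in c f) y"
  proof (cases "y \<in> cimg c")
   case True
   then obtain x where x: "x \<in> cdom c" "y = coord c x" by blast
   show ?thesis using ind[OF cS c x(1) x(1) f] x cS by (simp add: dens_in_coord wgt_self)
  qed (simp add: dens_in_def nop_notin[OF open_cimg[OF cS] Rl[OF c]])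
 qed
 ultimately show ?thesis by blast
qed

text \<open>A smooth structure is maximal, so it is enough that the smaller chart is compatible with
  all charts of S.\<close>

lemma restricted_chart:
 assumes c: "c \<in> S" and U: "open U" "U \<subseteq> cdom c" shows "(U, coord c) \<in> S"
proof -
 let ?c = "(U, coord c)"
 have inj: "inj_on (coord c) (cdom c)" using cinv_coord[OF c] by (metis inj_onI)
 have inv: "inv_into U (coord c) y = cinv c y" if "y \<in> coord c ` U" for y
  using that U(2) cinv_coord[OF c] inv_into_f_f[OF inj_on_subset[OF inj U(2)]] by (auto simp: subset_iff)
 have op: "open (coord c ` W)" if "open W" "W \<subseteq> U" for W using that U open_coord_image[OF c] by blast
 have "is_chart ?c"
  unfolding is_chart_def fst_conv snd_conv
 proof (intro conjI U(1) op order_refl)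
  have "homeomorphism U (coord c ` U) (coord c) (cinv c)"
   by (rule homeomorphism_of_subsets[OF homeo[OF c] U(2)]) (use U cinv_coord[OF c] in auto)
  then show "homeomorphism U (coord c ` U) (coord c) (inv_into U (coord c))"
   by (rule homeomorphism_cong) (use inv in auto)
 qed
 moreover have "smoothly_compatible ?c c'" if c': "c' \<in> S" for c'
  unfolding smoothly_compatible_def fst_conv snd_conv
 proof
  have "open (U \<inter> cdom c')" using U open_cdom[OF c'] by blast
  then have o: "open (coord c ` (U \<inter> cdom c'))" by (intro op) auto
  have "smooth_on (coord c ` (U \<inter> cdom c')) (transition c c')" by (rule smooth_transition[OF c c']) (use U in blast)
  then show "smooth_on (coord c ` (U \<inter> cdom c')) (transition ?c c')"
   by (rule smooth_on_congI[OF o]) (use inv in \<open>auto simp: transition_def\<close>)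
  have "smooth_on (coord c' ` (U \<inter> cdom c')) (transition c' c)" by (rule smooth_on_subset[OF smooth_transition[OF c' c order_refl]]) (use U in blast)
  then show "smooth_on (coord c' ` (U \<inter> cdom c')) (transition c' ?c)" by (simp add: transition_def)
 qed
 ultimately show ?thesis using smooth_structure unfolding smooth_structure_def by blast
qed

end

section \<open>The quantization map on a conformally flat manifold\<close>

lemma poly_coeff_eq:
 fixes a b :: "nat \<Rightarrow> complex"
 assumes "\<And>t::real. (\<Sum>k\<le>N. cr t ^ k * a k) = (\<Sum>k\<le>N. cr t ^ k * b k)" and k: "k \<le> N"
 shows "a k = b k"
proof (rule ccontr)
 assume ne: "a k \<noteq> b k"
 have "finite {z. (\<Sum>i\<le>N. (a i - b i) * z ^ i) = 0}"
  unfolding polyfun_finite_roots using ne k by auto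
 moreover have "range cr \<subseteq> {z. (\<Sum>i\<le>N. (a i - b i) * z ^ i) = 0}"
 proof (intro image_subsetI CollectI)
  fix t
  have "(\<Sum>i\<le>N. (a i - b i) * cr t ^ i) = (\<Sum>i\<le>N. cr t ^ i * a i) - (\<Sum>i\<le>N. cr t ^ i * b i)"
   by (simp add: algebra_simps sum_subtractf)
  then show "(\<Sum>i\<le>N. (a i - b i) * cr t ^ i) = 0" unfolding assms(1) by simp
 qed
 ultimately have "finite (range cr)" by (rule finite_subset[rotated])
 then show False using finite_imageD[OF _ inj_of_real] infinite_UNIV_char_0 by blast
qed

lemma hcomp_scaleR: "hcomp k P x (t *\<^sub>R \<xi>) = cr t ^ k * hcomp k P x \<xi>"
proof -
 have "mon is (t *\<^sub>R \<xi>) = cr t ^ length is * mon is \<xi>" for "is" :: "'a list"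
  by (induction "is") (simp_all add: mult_ac)
 then show ?thesis by (simp add: hcomp_def sum_distrib_left mult_ac)
qed

text \<open>Scaling \<xi> by t commutes with the linear map of the fibres and multiplies the
  component of degree k by the k-th power of t. Comparing coefficients in t separates the
  degrees.\<close>

lemma hcomp_transform:
 assumes P: "P \<in> Sym V" "P' \<in> Sym V'" and V: "open V" "open V'"
  and eq: "\<And>\<xi>. P x (L *v \<xi>) = w * P' x' \<xi>"
 shows "hcomp k P x (L *v \<xi>) = w * hcomp k P' x' \<xi>"
proof -
 obtain n n' where n: "P \<in> SymU V (int n)" "P' \<in> SymU V' (int n')"
  using P V Sym_natE by metis
 define N where "N = max k (max n n')"
 have N: "P \<in> SymU V (int N)" "P' \<in> SymU V' (int N)"
  using subsetD[OF SymU_mono[OF V(1)] n(1)] subsetD[OF SymU_mono[OF V(2)] n(2)] by (simp_all add: N_def)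
 have "(\<Sum>k\<le>N. cr t ^ k * hcomp k P x (L *v \<xi>)) = (\<Sum>k\<le>N. cr t ^ k * (w * hcomp k P' x' \<xi>))" for t
 proof -
  have "(\<Sum>k\<le>N. cr t ^ k * hcomp k P x (L *v \<xi>)) = P x (L *v (t *\<^sub>R \<xi>))"
   by (subst sum_hcomp[OF N(1)]) (simp add: matrix_vector_mult_scaleR hcomp_scaleR)
  also have "\<dots> = w * P' x' (t *\<^sub>R \<xi>)" by (rule eq)
  also have "\<dots> = (\<Sum>k\<le>N. cr t ^ k * (w * hcomp k P' x' \<xi>))"
   by (subst sum_hcomp[OF N(2)]) (simp add: hcomp_scaleR sum_distrib_left mult_ac)
  finally show ?thesis .
 qed
 from poly_coeff_eq[OF this, of k] show ?thesis by (simp add: N_def)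
qed

locale conformal_manifold = smooth_manifold S + conformal_weights g h lam \<delta> nd
 for S :: "('m::{t2_space,second_countable_topology}, 'n::finite) chart set" and g h :: "real ^ 'n ^ 'n" and lam \<delta> nd :: real +
 fixes C :: "('m, 'n) chart set"
 assumes C_sub: "C \<subseteq> S" and C_cover: "(\<Union>c\<in>C. cdom c) = UNIV"
  and C_conf: "c \<in> C \<Longrightarrow> c' \<in> C \<Longrightarrow> x \<in> cdom c \<Longrightarrow> x \<in> cdom c' \<Longrightarrow> \<exists>W. open W \<and> coord c x \<in> W \<and>
    W \<subseteq> coord c ` (cdom c \<inter> cdom c') \<and> conformal_transformation_on g W (transition c c')"
begin

lemma CS: "c \<in> C \<Longrightarrow> c \<in> S" using C_sub by blast

abbreviation pulled :: "'m set \<Rightarrow> ('m, 'n) chart \<Rightarrow> ('m, 'n) chart \<Rightarrow> 'n sym \<Rightarrow> 'n sym" where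
 "pulled U c c' P \<equiv> spull (coord c ` U) (transition c c') (transition c' c) \<delta> (restrict_symbol (coord c' ` U) P)"

text \<open>On a neighbourhood where the coordinate change is given by one group element,
  \<open>Qs_conformal\<close> applies. Restriction then expresses the side of c' through its whole
  chart domain.\<close>

lemma Qs_compat:
 assumes c: "c \<in> C" "c' \<in> C" "x \<in> cdom c" "x \<in> cdom c'"
 shows "\<exists>U. open U \<and> x \<in> U \<and> U \<subseteq> cdom c \<inter> cdom c' \<and>
  (\<forall>P'\<in>Sym (cimg c'). \<forall>f\<in>densities S lam. \<forall>z\<in>U.
   nop (coord c ` U) (Qs (coord c ` U) (pulled U c c' P')) (restrict_fun (coord c ` U) (dens_in c f)) (coord c z) =
   wgt (lam + \<delta>) c c' z * nop (cimg c') (Qs (cimg c') P') (dens_in c' f) (coord c' z))"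
proof -
 note S = CS[OF c(1)] CS[OF c(2)]
 obtain W where W: "open W" "coord c x \<in> W" "W \<subseteq> coord c ` (cdom c \<inter> cdom c')" "conformal_transformation_on g W (transition c c')"
  using C_conf[OF c] by blast
 define U where "U = (cdom c \<inter> coord c -` W) \<inter> cdom c'"
 have "open (cdom c \<inter> coord c -` W)"
  using homeo[OF S(1)] open_cdom[OF S(1)] W(1) unfolding homeomorphism_def by (intro continuous_open_preimage) auto
 then have U: "open U" "x \<in> U" "U \<subseteq> cdom c \<inter> cdom c'"
  unfolding U_def using W(2) c open_cdom[OF S(2)] by auto
 let ?V = "coord c ` U" and ?V' = "coord c' ` U"
 have conf: "conformal_transformation_on g ?V (transition c c')"
  using W(4) unfolding conformal_transformation_on_def U_def by blast
 have dif: "diffeo ?V ?V' (transition c c') (transition c' c)" by (rule transition_diffeo[OF S U(1,3)])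
 interpret diffeo ?V ?V' "transition c c'" "transition c' c" by (rule dif)
 have sub: "?V \<subseteq> cimg c" "?V' \<subseteq> cimg c'" using U(3) by auto
 show ?thesis
 proof (intro exI conjI ballI, rule U, rule U, rule U)
  fix P' f z assume P': "P' \<in> Sym (cimg c')" and f: "f \<in> densities S lam" and z: "z \<in> U"
  have zz: "z \<in> cdom c" "z \<in> cdom c'" "coord c z \<in> ?V" "coord c' z \<in> ?V'" using z U by auto
  have rP: "restrict_symbol ?V' P' \<in> Sym ?V'" by (rule restrict_Sym[OF P' sub(2)])
  have rf: "restrict_fun ?V (dens_in c f) \<in> loc_fun ?V"
   by (rule restrict_loc_fun[OF open_V densitiesD(1)[OF f S(1)] sub(1)])
  have dp: "dpull ?V' (transition c' c) lam (restrict_fun ?V (dens_in c f)) = restrict_fun ?V' (dens_in c' f)"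
   by (rule dens_pull[OF f S(2,1)]) (use U(3) in blast)
  have "nop ?V (Qs ?V (pulled U c c' P')) (restrict_fun ?V (dens_in c f)) (coord c z) =
   dpull ?V (transition c c') (lam + \<delta>) (nop ?V' (Qs ?V' (restrict_symbol ?V' P')) (restrict_fun ?V' (dens_in c' f))) (coord c z)"
   unfolding Qs_conformal[OF dif conf rP rf, symmetric] dp ..
  also have "\<dots> = wgt (lam + \<delta>) c c' z * nop ?V' (restrict_symbol ?V' (Qs (cimg c') P')) (restrict_fun ?V' (dens_in c' f)) (coord c' z)"
   unfolding Qs_restrict[OF open_cimg[OF S(2)] open_V' sub(2) P']
   using zz S by (simp add: dpull_def transition_coord wgt_def jac_jmat)
  also have "\<dots> = wgt (lam + \<delta>) c c' z * nop (cimg c') (Qs (cimg c') P') (dens_in c' f) (coord c' z)"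
   unfolding nop_restrict[OF open_cimg[OF S(2)] open_V' sub(2) Qs_loc[OF open_cimg[OF S(2)] P'] densitiesD(1)[OF f S(2)] zz(4)] ..
  finally show "nop ?V (Qs ?V (pulled U c c' P')) (restrict_fun ?V (dens_in c f)) (coord c z) =
   wgt (lam + \<delta>) c c' z * nop (cimg c') (Qs (cimg c') P') (dens_in c' f) (coord c' z)" .
 qed
qed

lemma nop_Qs_restrict:
 assumes c: "c \<in> S" and P: "P \<in> Sym (cimg c)" and f: "f \<in> densities S lam" and V: "open V" "V \<subseteq> cimg c" "y \<in> V"
 shows "nop V (Qs V (restrict_symbol V P)) (restrict_fun V (dens_in c f)) y = nop (cimg c) (Qs (cimg c) P) (dens_in c f) y"
 unfolding Qs_restrict[OF open_cimg[OF c] V(1,2) P]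
 by (rule nop_restrict[OF open_cimg[OF c] V(1,2) Qs_loc[OF open_cimg[OF c] P] densitiesD(1)[OF f c] V(3)])

section \<open>The global quantization map\<close>

definition quantizes :: "('m, 'n) symbol \<Rightarrow> ('m, 'n) operator \<Rightarrow> bool" where
 "quantizes P T \<longleftrightarrow> (\<forall>c\<in>C. \<forall>f\<in>densities S lam. dens_in c (T f) = nop (cimg c) (Qs (cimg c) (symb_in c P)) (dens_in c f))"

definition Q :: "('m, 'n) symbol \<Rightarrow> ('m, 'n) operator" where
 "Q P = (SOME T. T \<in> operators S lam (lam + \<delta>) \<and> quantizes P T)"

lemma symb_in_loc: "P \<in> symbols_upto S \<delta> k \<Longrightarrow> c \<in> S \<Longrightarrow> symb_in c P \<in> Sym (cimg c)"
 using symbolsD(1) Sym_iff by blast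

lemma quantizes_exists:
 assumes P: "P \<in> symbols_upto S \<delta> k"
 shows "\<exists>T\<in>operators_upto S lam (lam + \<delta>) k. quantizes P T"
 unfolding quantizes_def
proof (rule glue_operators[OF C_sub C_cover])
 show "Qs (cimg c) (symb_in c P) \<in> SymU (cimg c) k" if "c \<in> C" for c
  by (rule Qs_upto[OF open_cimg[OF CS[OF that]] symbolsD(1)[OF P CS[OF that]]])
 fix c c' x f assume c: "c \<in> C" "c' \<in> C" "x \<in> cdom c" "x \<in> cdom c'" and f: "f \<in> densities S lam"
 note S = CS[OF c(1)] CS[OF c(2)]
 obtain U where U: "open U" "x \<in> U" "U \<subseteq> cdom c \<inter> cdom c'"
  and eq: "\<forall>P'\<in>Sym (cimg c'). \<forall>f\<in>densities S lam. \<forall>z\<in>U.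
   nop (coord c ` U) (Qs (coord c ` U) (pulled U c c' P')) (restrict_fun (coord c ` U) (dens_in c f)) (coord c z) =
   wgt (lam + \<delta>) c c' z * nop (cimg c') (Qs (cimg c') P') (dens_in c' f) (coord c' z)"
  using Qs_compat[OF c] by (elim exE conjE)
 have V: "open (coord c ` U)" "coord c ` U \<subseteq> cimg c" using open_coord_image[OF S(1) U(1)] U(3) by auto
 show "nop (cimg c) (Qs (cimg c) (symb_in c P)) (dens_in c f) (coord c x) =
  wgt (lam + \<delta>) c c' x * nop (cimg c') (Qs (cimg c') (symb_in c' P)) (dens_in c' f) (coord c' x)"
  using bspec[OF bspec[OF bspec[OF eq symb_in_loc[OF P S(2)]] f] U(2)] nop_Qs_restrict[OF S(1) symb_in_loc[OF P S(1)] f V imageI[OF U(2)]]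
  unfolding symb_pull[OF P S U(3)] by simp
qed

lemma operatorsD:
 assumes "T \<in> operators S l m"
 shows "f \<in> densities S l \<Longrightarrow> T f \<in> densities S m" and "f \<notin> densities S l \<Longrightarrow> T f = (\<lambda>c x. 0)"
 using assms unfolding operators_def operators_upto_def by blast+

lemma quantizes_unique:
 assumes "T \<in> operators S lam m" "T' \<in> operators S lam m" "quantizes P T" "quantizes P T'"
 shows "T = T'"
proof
 fix f
 show "T f = T' f"
 proof (cases "f \<in> densities S lam")
  case True
  then show ?thesis
   using assms(3,4) by (intro dens_eqI[OF C_sub C_cover operatorsD(1)[OF assms(1)] operatorsD(1)[OF assms(2)]]) (auto simp: quantizes_def)
 qed (simp add: operatorsD(2)[OF assms(1)] operatorsD(2)[OF assms(2)])
qed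

lemma Q:
 assumes "P \<in> symbols S \<delta>" shows "Q P \<in> operators S lam (lam + \<delta>) \<and> quantizes P (Q P)"
proof -
 have "\<exists>T. T \<in> operators S lam (lam + \<delta>) \<and> quantizes P T"
  using assms quantizes_exists unfolding symbols_def operators_def by blast
 then show ?thesis unfolding Q_def by (rule someI_ex)
qed

text \<open>In each chart the wanted symbol is the preimage under \<open>Qs\<close> of the symbol of
  T. On an overlap the two candidates have the same quantization because T f is a density, and
  injectivity of \<open>Qs\<close> makes the candidates themselves agree.\<close>

lemma Q_surj:
 assumes T: "T \<in> operators S lam (lam + \<delta>)" shows "\<exists>P\<in>symbols S \<delta>. Q P = T"
proof -
 obtain k where k: "T \<in> operators_upto S lam (lam + \<delta>) k" using T unfolding operators_def by blast
 have "\<forall>c\<in>C. \<exists>R\<in>SymU (cimg c) k. \<forall>f\<in>densities S lam. dens_in c (T f) = nop (cimg c) (Qs (cimg c) R) (dens_in c f)"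
 proof
  fix c assume c: "c \<in> C"
  note V = open_cimg[OF CS[OF c]]
  obtain B where B: "B \<in> loc_op_upto (cimg c) k" "\<forall>f\<in>densities S lam. dens_in c (T f) = B (dens_in c f)"
   using k CS[OF c] unfolding operators_upto_def by blast
  obtain R where "R \<in> SymU (cimg c) k" "Qs (cimg c) R = full_symbol (cimg c) B"
   using Qs_surj[OF V full_symbol_loc_op_upto[OF V B(1)]] by blast
  then show "\<exists>R\<in>SymU (cimg c) k. \<forall>f\<in>densities S lam. dens_in c (T f) = nop (cimg c) (Qs (cimg c) R) (dens_in c f)"
   using B(2) nop_full_symbol[OF V B(1)] by metis
 qed
 then obtain R where R: "\<And>c. c \<in> C \<Longrightarrow> R c \<in> SymU (cimg c) k"
  and TR: "\<And>c f. c \<in> C \<Longrightarrow> f \<in> densities S lam \<Longrightarrow> dens_in c (T f) = nop (cimg c) (Qs (cimg c) (R c)) (dens_in c f)"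
  by metis
 have Rl: "R c \<in> Sym (cimg c)" if "c \<in> C" for c using R[OF that] by (auto simp: Sym_iff)
 have "\<exists>P\<in>symbols_upto S \<delta> k. \<forall>c\<in>C. symb_in c P = R c"
 proof (rule glue_symbols[OF C_sub C_cover R])
  fix c c' x \<xi> assume c: "c \<in> C" "c' \<in> C" "x \<in> cdom c" "x \<in> cdom c'"
  note S = CS[OF c(1)] CS[OF c(2)]
  obtain U where U: "open U" "x \<in> U" "U \<subseteq> cdom c \<inter> cdom c'"
   and eq: "\<forall>P'\<in>Sym (cimg c'). \<forall>f\<in>densities S lam. \<forall>z\<in>U.
    nop (coord c ` U) (Qs (coord c ` U) (pulled U c c' P')) (restrict_fun (coord c ` U) (dens_in c f)) (coord c z) =
    wgt (lam + \<delta>) c c' z * nop (cimg c') (Qs (cimg c') P') (dens_in c' f) (coord c' z)"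
   using Qs_compat[OF c] by (elim exE conjE)
  let ?V = "coord c ` U" and ?V' = "coord c' ` U"
  let ?R = "pulled U c c' (R c')"
  interpret diffeo ?V ?V' "transition c c'" "transition c' c" by (rule transition_diffeo[OF S U(1,3)])
  have sub: "?V \<subseteq> cimg c" "?V' \<subseteq> cimg c'" using U(3) by auto
  have rl: "restrict_symbol ?V (R c) \<in> Sym ?V" by (rule restrict_Sym[OF Rl[OF c(1)] sub(1)])
  have sl: "?R \<in> Sym ?V" by (rule spull_loc[OF restrict_Sym[OF Rl[OF c(2)] sub(2)]])
  have "Qs ?V (restrict_symbol ?V (R c)) = Qs ?V ?R"
  proof (rule symbol_eqI[OF S(1) open_V sub(1) Qs_loc[OF open_V rl] Qs_loc[OF open_V sl], of lam])
   fix f y assume f: "f \<in> densities S lam" and "y \<in> ?V"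
   then obtain z where z: "z \<in> U" "y = coord c z" by blast
   then have zz: "z \<in> cdom c" "z \<in> cdom c'" using U(3) by auto
   have Tf: "T f \<in> densities S (lam + \<delta>)" by (rule operatorsD(1)[OF T f])
   have "nop ?V (Qs ?V (restrict_symbol ?V (R c))) (restrict_fun ?V (dens_in c f)) y = T f c z"
    unfolding z(2) nop_Qs_restrict[OF S(1) Rl[OF c(1)] f open_V sub(1) imageI[OF z(1)]] TR[OF c(1) f, symmetric]
    by (rule dens_in_coord[OF S(1) zz(1)])
   also have "\<dots> = wgt (lam + \<delta>) c c' z * dens_in c' (T f) (coord c' z)"
    using densitiesD(2)[OF Tf S zz] dens_in_coord[OF S(2) zz(2)] by simp
   also have "\<dots> = nop ?V (Qs ?V ?R) (restrict_fun ?V (dens_in c f)) y"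
    unfolding TR[OF c(2) f] z(2) using eq Rl[OF c(2)] f z(1) by simp
   finally show "nop ?V (Qs ?V (restrict_symbol ?V (R c))) (restrict_fun ?V (dens_in c f)) y =
    nop ?V (Qs ?V ?R) (restrict_fun ?V (dens_in c f)) y" .
  qed
  then have "restrict_symbol ?V (R c) = ?R" by (rule Qs_inject[OF open_V rl sl])
  then have "restrict_symbol ?V (R c) (coord c x) (transpose (jac c c' x) *v \<xi>) = ?R (coord c x) (transpose (jac c c' x) *v \<xi>)" by simp
  then show "R c (coord c x) (transpose (jac c c' x) *v \<xi>) = wgt \<delta> c c' x * R c' (coord c' x) \<xi>"
   using U(2) c S
   by (simp add: restrict_symbol_def spull_def transition_coord wgt_def jac_jmat[symmetric] transpose_jac_compose transpose_jac_self)
 qed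
 then obtain P where P: "P \<in> symbols_upto S \<delta> k" "\<forall>c\<in>C. symb_in c P = R c" by blast
 then have Ps: "P \<in> symbols S \<delta>" unfolding symbols_def by blast
 have "quantizes P T" unfolding quantizes_def using P(2) TR by simp
 then have "Q P = T" using quantizes_unique[OF _ T] Q[OF Ps] by blast
 with Ps show ?thesis by blast
qed

lemma densities_lin:
 assumes f: "f \<in> densities S m" "f' \<in> densities S m"
 shows "(\<lambda>c x. a * f c x + b * f' c x) \<in> densities S m"
proof (rule densitiesI)
 fix c assume c: "c \<in> S"
 have "dens_in c (\<lambda>c x. a * f c x + b * f' c x) = (\<lambda>x. a * dens_in c f x + b * dens_in c f' x)"
  by (auto simp: dens_in_def)
 moreover have "(\<lambda>x. a * dens_in c f x + b * dens_in c f' x) \<in> loc_fun (cimg c)"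
  using c by (intro loc_fun_add loc_fun_scale densitiesD(1)[OF f(1)] densitiesD(1)[OF f(2)] open_cimg)
 ultimately show "dens_in c (\<lambda>c x. a * f c x + b * f' c x) \<in> loc_fun (cimg c)" by simp
next
 fix c c' x assume "c \<in> S" "c' \<in> S" "x \<in> cdom c" "x \<in> cdom c'"
 from densitiesD(2)[OF f(1) this] densitiesD(2)[OF f(2) this]
 show "a * f c x + b * f' c x = wgt m c c' x * (a * f c' x + b * f' c' x)" by (simp add: algebra_simps)
next
 fix c x assume "c \<notin> S \<or> x \<notin> cdom c"
 from densitiesD(3)[OF f(1) this] densitiesD(3)[OF f(2) this] show "a * f c x + b * f' c x = 0" by simp
qed

lemma symb_in_lin: "symb_in c (\<lambda>c x \<xi>. a * P c x \<xi> + b * P' c x \<xi>) = (\<lambda>x \<xi>. a * symb_in c P x \<xi> + b * symb_in c P' x \<xi>)"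
 by (auto simp: symb_in_def fun_eq_iff)

lemma symbols_lin:
 assumes P: "P \<in> symbols S d" "P' \<in> symbols S d"
 shows "(\<lambda>c x \<xi>. a * P c x \<xi> + b * P' c x \<xi>) \<in> symbols S d"
proof -
 obtain k k' where k: "P \<in> symbols_upto S d k" "P' \<in> symbols_upto S d k'" using P unfolding symbols_def by blast
 have "(\<lambda>c x \<xi>. a * P c x \<xi> + b * P' c x \<xi>) \<in> symbols_upto S d (max k k')"
  unfolding symbols_upto_def
 proof (intro CollectI conjI ballI allI impI)
  fix c assume c: "c \<in> S"
  have "symb_in c P \<in> SymU (cimg c) (max k k')" "symb_in c P' \<in> SymU (cimg c) (max k k')"
   using symbolsD(1)[OF k(1) c] symbolsD(1)[OF k(2) c] SymU_mono[OF open_cimg[OF c]] by (meson max.cobounded1 max.cobounded2 subsetD)+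
  then show "symb_in c (\<lambda>c x \<xi>. a * P c x \<xi> + b * P' c x \<xi>) \<in> SymU (cimg c) (max k k')"
   unfolding symb_in_lin by (rule SymU_lin[OF open_cimg[OF c]])
 next
  fix c c' x \<xi> assume c: "c \<in> S" "c' \<in> S" "x \<in> cdom c \<inter> cdom c'"
  then have x: "x \<in> cdom c" "x \<in> cdom c'" by auto
  show "a * P c x (transpose (jac c c' x) *v \<xi>) + b * P' c x (transpose (jac c c' x) *v \<xi>) =
    cr (\<bar>det (jac c c' x)\<bar> powr d) * (a * P c' x \<xi> + b * P' c' x \<xi>)"
   unfolding symbolsD(2)[OF k(1) c(1,2) x] symbolsD(2)[OF k(2) c(1,2) x] wgt_def by (simp add: algebra_simps)
 next
  fix c x \<xi> assume "c \<notin> S \<or> x \<notin> cdom c"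
  from symbolsD(3)[OF k(1) this] symbolsD(3)[OF k(2) this] show "a * P c x \<xi> + b * P' c x \<xi> = 0" by simp
 qed
 then show ?thesis unfolding symbols_def by blast
qed

lemma Q_lin:
 assumes P: "P \<in> symbols S \<delta>" "P' \<in> symbols S \<delta>"
 shows "Q (\<lambda>c x \<xi>. a * P c x \<xi> + b * P' c x \<xi>) = (\<lambda>f c x. a * Q P f c x + b * Q P' f c x)"
proof
 fix f
 let ?P = "\<lambda>c x \<xi>. a * P c x \<xi> + b * P' c x \<xi>"
 note q = Q[OF P(1)] Q[OF P(2)] Q[OF symbols_lin[OF P]]
 note o = conjunct1[OF q(1)] conjunct1[OF q(2)] conjunct1[OF q(3)]
 show "Q ?P f = (\<lambda>c x. a * Q P f c x + b * Q P' f c x)"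
 proof (cases "f \<in> densities S lam")
  case f: True
  show ?thesis
  proof (rule dens_eqI[OF C_sub C_cover operatorsD(1)[OF o(3) f] densities_lin[OF operatorsD(1)[OF o(1) f] operatorsD(1)[OF o(2) f]]])
   fix c assume c: "c \<in> C"
   obtain k k' where k: "P \<in> symbols_upto S \<delta> k" "P' \<in> symbols_upto S \<delta> k'" using P unfolding symbols_def by blast
   note V = open_cimg[OF CS[OF c]] and s = symb_in_loc[OF k(1) CS[OF c]] symb_in_loc[OF k(2) CS[OF c]]
   have d: "dens_in c (Q R f) = nop (cimg c) (Qs (cimg c) (symb_in c R)) (dens_in c f)" if "quantizes R (Q R)" for R
    using that c f unfolding quantizes_def by blast
   have "dens_in c (\<lambda>c x. a * Q P f c x + b * Q P' f c x) = (\<lambda>x. a * dens_in c (Q P f) x + b * dens_in c (Q P' f) x)"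
    by (auto simp: dens_in_def)
   then show "dens_in c (Q ?P f) = dens_in c (\<lambda>c x. a * Q P f c x + b * Q P' f c x)"
    unfolding d[OF conjunct2[OF q(1)]] d[OF conjunct2[OF q(2)]] d[OF conjunct2[OF q(3)]] symb_in_lin Qs_lin[OF V s]
    using nop_lin[OF V Qs_loc[OF V s(1)] Qs_loc[OF V s(2)]] by (simp add: fun_eq_iff)
  qed
 qed (simp add: operatorsD(2)[OF o(1)] operatorsD(2)[OF o(2)] operatorsD(2)[OF o(3)])
qed

lemma loc_linear_iso_Qs:
 assumes V: "open V" shows "loc_linear_iso V (\<lambda>P. nop V (Qs V P))"
 unfolding loc_linear_iso_def
proof (intro conjI ballI allI)
 show "bij_betw (\<lambda>P. nop V (Qs V P)) (Sym V) (loc_op V)"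
  using bij_betw_trans[OF bij_betw_Qs[OF V] bij_betw_nop[OF V]] by (simp add: comp_def)
 fix P P' a b assume P: "P \<in> Sym V" "P' \<in> Sym V"
 show "nop V (Qs V (\<lambda>x \<xi>. a * P x \<xi> + b * P' x \<xi>)) = (\<lambda>f x. a * nop V (Qs V P) f x + b * nop V (Qs V P') f x)"
  unfolding Qs_lin[OF V P] using nop_lin[OF V Qs_loc[OF V P(1)] Qs_loc[OF V P(2)]] by (simp add: fun_eq_iff)
qed

lemma op_restricts_Q:
 assumes P: "P \<in> symbols S \<delta>" and c: "c \<in> C"
 shows "op_restricts_to S lam c (Q P) (nop (cimg c) (Qs (cimg c) (symb_in c P)))"
proof -
 obtain k where k: "P \<in> symbols_upto S \<delta> k" using P unfolding symbols_def by blast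
 have "nop (cimg c) (Qs (cimg c) (symb_in c P)) \<in> loc_op (cimg c)"
  using nop_loc_op_upto[OF open_cimg[OF CS[OF c]] Qs_upto[OF open_cimg[OF CS[OF c]] symbolsD(1)[OF k CS[OF c]]]]
  unfolding loc_op_def by blast
 then show ?thesis using Q[OF P] c unfolding op_restricts_to_def quantizes_def by blast
qed

text \<open>Global densities suffice to determine the full symbol over a chart. Hence the local
  operators occurring in \<open>conformal_module_iso\<close> and in
  \<open>preserves_principal_symbol\<close> can be identified.\<close>

lemma op_restricts_unique:
 assumes c: "c \<in> S" and B: "op_restricts_to S l c T B" "op_restricts_to S l c T B'"
 shows "B = B'"
proof -
 note V = open_cimg[OF c]
 obtain k k' where k: "B \<in> loc_op_upto (cimg c) k" "B' \<in> loc_op_upto (cimg c) k'"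
  using B unfolding op_restricts_to_def loc_op_def by blast
 have s: "full_symbol (cimg c) B \<in> Sym (cimg c)" "full_symbol (cimg c) B' \<in> Sym (cimg c)"
  using full_symbol_loc_op_upto[OF V k(1)] full_symbol_loc_op_upto[OF V k(2)] by (auto simp: Sym_iff)
 have "restrict_fun (cimg c) (dens_in c f) = dens_in c f" for f by (auto simp: restrict_fun_def dens_in_def)
 moreover have "B (dens_in c f) = B' (dens_in c f)" if "f \<in> densities S l" for f
  using B that unfolding op_restricts_to_def by metis
 ultimately have "full_symbol (cimg c) B = full_symbol (cimg c) B'"
  by (intro symbol_eqI[OF c V order_refl s, of l]) (simp add: nop_full_symbol[OF V k(1)] nop_full_symbol[OF V k(2)])
 then show ?thesis using nop_full_symbol[OF V k(1)] nop_full_symbol[OF V k(2)] by metis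
qed

lemma Q_inj:
 assumes P: "P \<in> symbols S \<delta>" "P' \<in> symbols S \<delta>" and eq: "Q P = Q P'" shows "P = P'"
proof -
 obtain k k' where k: "P \<in> symbols_upto S \<delta> k" "P' \<in> symbols_upto S \<delta> k'" using P unfolding symbols_def by blast
 show ?thesis
 proof (rule symb_eqI[OF C_sub C_cover k])
  fix c assume c: "c \<in> C"
  note V = open_cimg[OF CS[OF c]] and s = symb_in_loc[OF k(1) CS[OF c]] symb_in_loc[OF k(2) CS[OF c]]
  have "nop (cimg c) (Qs (cimg c) (symb_in c P)) = nop (cimg c) (Qs (cimg c) (symb_in c P'))"
   using op_restricts_unique[OF CS[OF c] op_restricts_Q[OF P(1) c]] op_restricts_Q[OF P(2) c] eq by simp
  then show "symb_in c P = symb_in c P'"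
   using nop_inject[OF V Qs_loc[OF V s(1)] Qs_loc[OF V s(2)]] Qs_inject[OF V s] by blast
 qed
qed

text \<open>The degree in \<xi> survives coordinate changes, so the homogeneous components glue.
  \<open>Q_unique\<close> feeds them to \<open>preserves_principal_symbol\<close>, which speaks of
  global symbols.\<close>

lemma symbol_component:
 assumes P: "P \<in> symbols S \<delta>"
 shows "\<exists>H\<in>symbols_upto S \<delta> (int k). \<forall>c\<in>C. symb_in c H = hcomp k (symb_in c P)"
proof (rule glue_symbols[OF C_sub C_cover])
 obtain j where j: "P \<in> symbols_upto S \<delta> j" using P unfolding symbols_def by blast
 note sl = symb_in_loc[OF j CS]
 show "hcomp k (symb_in c P) \<in> SymU (cimg c) (int k)" if "c \<in> C" for c by (rule hcomp_upto[OF sl[OF that]])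
 fix c c' x \<xi> assume c: "c \<in> C" "c' \<in> C" "x \<in> cdom c" "x \<in> cdom c'"
 note S = CS[OF c(1)] CS[OF c(2)]
 show "hcomp k (symb_in c P) (coord c x) (transpose (jac c c' x) *v \<xi>) = wgt \<delta> c c' x * hcomp k (symb_in c' P) (coord c' x) \<xi>"
 proof (rule hcomp_transform[OF sl[OF c(1)] sl[OF c(2)] open_cimg[OF S(1)] open_cimg[OF S(2)]])
  show "symb_in c P (coord c x) (transpose (jac c c' x) *v \<eta>) = wgt \<delta> c c' x * symb_in c' P (coord c' x) \<eta>" for \<eta>
   using symbolsD(2)[OF j S c(3,4)] by (simp add: symb_in_coord[OF S(1) c(3)] symb_in_coord[OF S(2) c(4)])
 qed
qed

context
 fixes A assumes C_eq: "C = adapted_charts A"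
begin

lemma Q_module_iso: "conformal_module_iso S A g lam (lam + \<delta>) Q"
 unfolding conformal_module_iso_def linear_iso_def C_eq[symmetric]
proof (intro conjI ballI allI)
 show "bij_betw Q (symbols S (lam + \<delta> - lam)) (operators S lam (lam + \<delta>))"
  by (simp add: bij_betw_def inj_on_def) (use Q Q_inj Q_surj in blast)
 show "Q (\<lambda>c x \<xi>. a * P c x \<xi> + b * P' c x \<xi>) = (\<lambda>f c x. a * Q P f c x + b * Q P' f c x)"
  if "P \<in> symbols S (lam + \<delta> - lam)" "P' \<in> symbols S (lam + \<delta> - lam)" for P P' a b
  using Q_lin that by simp
 fix c assume c: "c \<in> C"
 note V = open_cimg[OF CS[OF c]]
 show "\<exists>Qc. loc_linear_iso (cimg c) Qc \<and>
    (\<forall>P\<in>symbols S (lam + \<delta> - lam). op_restricts_to S lam c (Q P) (Qc (symb_in c P))) \<and>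
    (\<forall>X\<in>conformal_generators g. \<forall>P\<in>Sym (cimg c).
      Qc (lie_symbol (cimg c) (lam + \<delta> - lam) X P) = lie_op (cimg c) lam (lam + \<delta>) X (Qc P))"
  using loc_linear_iso_Qs[OF V] op_restricts_Q[OF _ c] Qs_generator_equivariant[OF V]
  by (intro exI[of _ "\<lambda>P. nop (cimg c) (Qs (cimg c) P)"]) simp
qed

lemma Q_principal: "preserves_principal_symbol S A lam (lam + \<delta>) Q"
 unfolding preserves_principal_symbol_def C_eq[symmetric]
proof (intro ballI allI)
 fix c k P assume c: "c \<in> C" and P: "P \<in> symbols_upto S (lam + \<delta> - lam) k"
 note V = open_cimg[OF CS[OF c]]
 have P': "P \<in> symbols_upto S \<delta> k" "P \<in> symbols S \<delta>" using P unfolding symbols_def by auto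
 have u: "symb_in c P \<in> SymU (cimg c) k" by (rule symbolsD(1)[OF P'(1) CS[OF c]])
 have "normal_ordered (cimg c) (nop (cimg c) (Qs (cimg c) (symb_in c P))) (Qs (cimg c) (symb_in c P))"
  using Qs_loc[OF V symb_in_loc[OF P'(1) CS[OF c]]] by (simp add: normal_ordered_iff[OF V])
 then show "\<exists>B. \<exists>N\<in>SymU (cimg c) (k - 1). op_restricts_to S lam c (Q P) B \<and>
   normal_ordered (cimg c) B (\<lambda>x \<xi>. symb_in c P x \<xi> + N x \<xi>)"
  using Qs_diff[OF V u] op_restricts_Q[OF P'(2) c]
  by (intro exI[of _ "nop (cimg c) (Qs (cimg c) (symb_in c P))"] bexI[OF _ Qs_diff[OF V u]]) simp
qed

text \<open>In each adapted chart the full symbol of the local map \<open>Qc\<close> satisfies the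
  hypotheses of \<open>Qs_unique_lie\<close> for the expression of P. Hence Q' P has the defining
  property of \<open>Q P\<close>.\<close>

lemma Q_unique:
 assumes iso: "conformal_module_iso S A g lam (lam + \<delta>) Q'" and pri: "preserves_principal_symbol S A lam (lam + \<delta>) Q'"
  and P: "P \<in> symbols S \<delta>"
 shows "Q' P = Q P"
proof -
 have Q'op: "Q' P \<in> operators S lam (lam + \<delta>)"
  using iso P unfolding conformal_module_iso_def linear_iso_def by (auto simp: bij_betw_def)
 have "quantizes P (Q' P)"
  unfolding quantizes_def
 proof (intro ballI)
  fix c f assume c: "c \<in> C" and f: "f \<in> densities S lam"
  note cS = CS[OF c]
  define V where "V = cimg c"
  have V: "open V" unfolding V_def by (rule open_cimg[OF cS])
  obtain Qc where Qc: "loc_linear_iso V Qc" and Qc_r: "\<And>P. P \<in> symbols S \<delta> \<Longrightarrow> op_restricts_to S lam c (Q' P) (Qc (symb_in c P))"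
   and Qc_e: "\<And>X P. X \<in> conformal_generators g \<Longrightarrow> P \<in> Sym V \<Longrightarrow> Qc (lie_symbol V \<delta> X P) = lie_op V lam (lam + \<delta>) X (Qc P)"
   using iso c unfolding conformal_module_iso_def C_eq[symmetric] V_def by auto
  define F where "F R = full_symbol V (Qc R)" for R
  have F: "F R \<in> Sym V" "Qc R = nop V (F R)" if "R \<in> Sym V" for R
  proof -
   have "Qc R \<in> loc_op V" using Qc that unfolding loc_linear_iso_def by (auto simp: bij_betw_def)
   then obtain k where "Qc R \<in> loc_op_upto V k" unfolding loc_op_def by blast
   then show "F R \<in> Sym V" "Qc R = nop V (F R)"
    unfolding F_def using full_symbol_loc_op_upto[OF V] nop_full_symbol[OF V] by (auto simp: Sym_iff)
  qed
  have F_lin: "F (\<lambda>x \<xi>. a * R x \<xi> + b * R' x \<xi>) = (\<lambda>x \<xi>. a * F R x \<xi> + b * F R' x \<xi>)"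
   if "R \<in> Sym V" "R' \<in> Sym V" for R R' a b
  proof -
   have "Qc (\<lambda>x \<xi>. a * R x \<xi> + b * R' x \<xi>) = (\<lambda>f x. a * Qc R f x + b * Qc R' f x)"
    using Qc that unfolding loc_linear_iso_def by blast
   then show ?thesis unfolding F_def full_symbol_def by (auto simp: fun_eq_iff algebra_simps)
  qed
  have F_lie: "nop V (F (lie_symbol V \<delta> X R)) = lie_op V lam (lam + \<delta>) X (nop V (F R))"
   if X: "X \<in> conformal_generators g" and R: "R \<in> Sym V" for X R
   using Qc_e[OF X R] F(2)[OF R] F(2)[OF lie_symbol_loc[OF V R, of X]] vf_span.gen[OF X vf_span.zero, of 1] by simp
  let ?P = "symb_in c P"
  obtain j where j: "P \<in> symbols_upto S \<delta> j" using P unfolding symbols_def by blast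
  have Pl: "?P \<in> Sym V" unfolding V_def by (rule symb_in_loc[OF j cS])
  have "F ?P = Qs V ?P"
  proof (rule Qs_unique_lie[OF V F(1) F_lin F_lie Pl])
   fix k :: nat
   obtain H where H: "H \<in> symbols_upto S \<delta> (int k)" "symb_in c H = hcomp k ?P" using symbol_component[OF P] c by blast
   have Hs: "H \<in> symbols S \<delta>" using H(1) unfolding symbols_def by blast
   obtain B N where N: "N \<in> SymU V (int k - 1)" and B: "op_restricts_to S lam c (Q' H) B"
    "normal_ordered V B (\<lambda>x \<xi>. symb_in c H x \<xi> + N x \<xi>)"
    using pri c H(1) unfolding preserves_principal_symbol_def C_eq[symmetric] V_def add_diff_cancel_left' by blast
   \<comment> \<open>The two hypotheses on Q' provide two local expressions of the operator Q' H,
     and these coincide.\<close>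
   have "B = Qc (symb_in c H)" by (rule op_restricts_unique[OF cS B(1) Qc_r[OF Hs]])
   then have "F (symb_in c H) = (\<lambda>x \<xi>. symb_in c H x \<xi> + N x \<xi>)"
    using B(2) full_symbol_nop[OF V, of "\<lambda>x \<xi>. symb_in c H x \<xi> + N x \<xi>"]
    unfolding F_def normal_ordered_iff[OF V] by simp
   then show "(\<lambda>x \<xi>. F (hcomp k ?P) x \<xi> - hcomp k ?P x \<xi>) \<in> SymU V (int k - 1)"
    using N unfolding H(2) by simp
  qed
  then have "Qc ?P = nop V (Qs V ?P)" using F(2)[OF Pl] by simp
  then show "dens_in c (Q' P f) = nop (cimg c) (Qs (cimg c) (symb_in c P)) (dens_in c f)"
   using Qc_r[OF P] f unfolding op_restricts_to_def V_def by simp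
 qed
 then show ?thesis using quantizes_unique[OF Q'op] Q[OF P] by blast
qed

end

end

text \<open>In the basis given by B the form is diagonal with entries 1 and -1, which yields
  symmetry and invertibility.\<close>

lemma has_signature_inverse:
 fixes g :: "real ^ 'n::finite ^ 'n"
 assumes "has_signature g p q"
 shows "g $ i $ j = g $ j $ i" "matrix_inv g $ i $ j = matrix_inv g $ j $ i"
  "(\<Sum>k\<in>UNIV. g $ i $ k * matrix_inv g $ k $ j) = (if i = j then 1 else 0)"
proof -
 obtain B :: "real ^ 'n ^ 'n" and I :: "'n set" where B: "invertible B" and D: "transpose B ** g ** B = (\<chi> i j. if i = j then (if i \<in> I then 1 else - 1) else 0)"
  using assms unfolding has_signature_def by blast
 define D where "D = (\<chi> (i::'n) j. if i = j then (if i \<in> I then 1 else - 1) else (0::real))"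
 obtain B' where B': "B ** B' = mat 1" "B' ** B = mat 1" using B unfolding invertible_def by blast
 have TB: "transpose B' ** transpose B = mat 1" using B'(1) by (metis matrix_transpose_mul transpose_mat)
 have g: "g = transpose B' ** D ** B'"
 proof -
  have "transpose B' ** D ** B' = (transpose B' ** transpose B) ** g ** (B ** B')"
   unfolding D_def D[symmetric] by (simp add: matrix_mul_assoc)
  then show ?thesis by (simp add: TB B')
 qed
 have DT: "transpose D = D" by (simp add: D_def vec_eq_iff transpose_def)
 have gT: "transpose g = g" unfolding g by (simp add: matrix_transpose_mul DT matrix_mul_assoc)
 have "det D \<noteq> 0" unfolding D_def by (subst det_diagonal) (auto simp: prod_zero_iff)
 moreover have "det B' \<noteq> 0" using B'(1) by (metis det_I det_mul mult_zero_right zero_neq_one)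
 ultimately have "det g \<noteq> 0" unfolding g by (simp add: det_mul)
 then have inv: "invertible g" by (simp add: invertible_det_nz)
 have gi: "g ** matrix_inv g = mat 1" "matrix_inv g ** g = mat 1"
  using someI_ex[OF inv[unfolded invertible_def]] unfolding matrix_inv_def by auto
 have "transpose (matrix_inv g) ** transpose g = mat 1"
  unfolding matrix_transpose_mul[symmetric] gi(1) by (rule transpose_mat)
 then have l: "transpose (matrix_inv g) ** g = mat 1" unfolding gT .
 have "transpose (matrix_inv g) = transpose (matrix_inv g) ** (g ** matrix_inv g)" by (simp add: gi(1))
 also have "\<dots> = matrix_inv g" unfolding matrix_mul_assoc l by simp
 finally have hT: "transpose (matrix_inv g) = matrix_inv g" .
 have entries: "N $ i $ j = N $ j $ i" if "transpose N = N" for N :: "real ^ 'n ^ 'n"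
  using arg_cong[OF that, of "\<lambda>N. N $ j $ i"] by (simp add: transpose_def)
 show "matrix_inv g $ i $ j = matrix_inv g $ j $ i" by (rule entries[OF hT])
 show "g $ i $ j = g $ j $ i" by (rule entries[OF gT])
 show "(\<Sum>k\<in>UNIV. g $ i $ k * matrix_inv g $ k $ j) = (if i = j then 1 else 0)"
  using arg_cong[OF gi(1), of "\<lambda>N. N $ i $ j"] by (simp add: matrix_matrix_mult_def mat_def)
qed

text \<open>Adapted charts are charts of A with smaller domains. They belong to S by maximality, and
  their coordinate changes are restrictions of conformal ones.\<close>

lemma (in smooth_manifold) adapted_charts_facts:
 assumes A: "adapted_atlas S G g A"
 shows "adapted_charts A \<subseteq> S" "(\<Union>c\<in>adapted_charts A. cdom c) = UNIV"
  "c \<in> adapted_charts A \<Longrightarrow> c' \<in> adapted_charts A \<Longrightarrow> x \<in> cdom c \<Longrightarrow> x \<in> cdom c' \<Longrightarrow> \<exists>W. open W \<and> coord c x \<in> W \<and>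
    W \<subseteq> coord c ` (cdom c \<inter> cdom c') \<and> conformal_transformation_on g W (transition c c')"
proof -
 have AS: "A \<subseteq> S" and cov: "(\<Union>c\<in>A. cdom c) = UNIV" using A unfolding adapted_atlas_def by auto
 have ad: "\<exists>U. (U, coord c) \<in> A \<and> cdom c \<subseteq> U \<and> open (cdom c)" if "c \<in> adapted_charts A" for c
  using that unfolding adapted_charts_def by (cases c) auto
 show sub: "adapted_charts A \<subseteq> S"
 proof
  fix c assume "c \<in> adapted_charts A"
  from ad[OF this] obtain U where U: "(U, coord c) \<in> A" "cdom c \<subseteq> U" "open (cdom c)" by blast
  then have "(U, coord c) \<in> S" using AS by blast
  from restricted_chart[OF this U(3)] U(2) show "c \<in> S" by simp
 qed
 have "A \<subseteq> adapted_charts A"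
 proof
  fix c assume c: "c \<in> A"
  then have "open (cdom c)" using AS open_cdom by blast
  then show "c \<in> adapted_charts A" using c unfolding adapted_charts_def by (cases c) auto
 qed
 then show "(\<Union>c\<in>adapted_charts A. cdom c) = UNIV" using cov by blast
 assume c: "c \<in> adapted_charts A" "c' \<in> adapted_charts A" and x: "x \<in> cdom c" "x \<in> cdom c'"
 note S = subsetD[OF sub c(1)] subsetD[OF sub c(2)]
 obtain U U' where U: "(U, coord c) \<in> A" "cdom c \<subseteq> U" and U': "(U', coord c') \<in> A" "cdom c' \<subseteq> U'"
  using ad[OF c(1)] ad[OF c(2)] by blast
 have US: "(U, coord c) \<in> S" "(U', coord c') \<in> S" using U U' AS by auto
 obtain W where W: "open W" "coord c x \<in> W" "conformal_transformation_on g W (transition (U, coord c) (U', coord c'))"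
 proof -
  have "\<forall>c\<in>A. \<forall>c'\<in>A. \<forall>x\<in>cdom c \<inter> cdom c'. \<exists>W. open W \<and> coord c x \<in> W \<and>
    W \<subseteq> coord c ` (cdom c \<inter> cdom c') \<and> conformal_transformation_on g W (transition c c')"
   using A unfolding adapted_atlas_def by (elim conjE)
  from bspec[OF bspec[OF bspec[OF this U(1)] U'(1)], of x] that show thesis using x U(2) U'(2) by auto
 qed
 let ?W = "W \<inter> coord c ` (cdom c \<inter> cdom c')"
 have "open ?W" by (intro open_Int W(1) open_coord_image[OF S(1)] open_cdom S) auto
 moreover have "transition c c' y = transition (U, coord c) (U', coord c') y" if y: "y \<in> ?W" for y
 proof -
  obtain z where z: "z \<in> cdom c" "y = coord c z" using y by blast
  show ?thesis using transition_coord[OF S(1) z(1), of c'] transition_coord[OF US(1), of z "(U', coord c')"] z U(2) by auto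
 qed
 then have "conformal_transformation_on g ?W (transition c c')"
  using W(3) unfolding conformal_transformation_on_def by (metis IntD1)
 ultimately show "\<exists>W. open W \<and> coord c x \<in> W \<and>
    W \<subseteq> coord c ` (cdom c \<inter> cdom c') \<and> conformal_transformation_on g W (transition c c')"
  using W(2) x by (intro exI[of _ ?W]) auto
qed

theorem theorem3p5:
  fixes S A :: "('m::{t2_space,second_countable_topology}, 'n::finite) chart set"
    and G :: "('m, 'n) chart \<Rightarrow> 'm \<Rightarrow> real ^ 'n ^ 'n"
    and g :: "real ^ 'n ^ 'n"
    and p q :: nat
    and lam mu \<delta> :: real
  assumes "smooth_structure S"
    and "orientable S"
    and "pseudo_riemannian_metric S p q G"
    and "conformally_flat S G"
    and "has_signature g p q"
    and "adapted_atlas S G g A"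
    and "CARD('n) = p + q"
    and "p + q \<ge> 2"
    and "\<delta> = mu - lam"
    and "\<delta> \<notin> resonances CARD('n)"
  shows "\<exists>Q. conformal_module_iso S A g lam mu Q \<and> preserves_principal_symbol S A lam mu Q \<and>
           (\<forall>Q'. conformal_module_iso S A g lam mu Q' \<and> preserves_principal_symbol S A lam mu Q' \<longrightarrow>
              (\<forall>P\<in>symbols S \<delta>. Q' P = Q P))"
proof -
  interpret smooth_manifold S by unfold_locales (rule assms(1))
  interpret conformal_manifold S g "matrix_inv g" lam \<delta> "real CARD('n)" "adapted_charts A"
  proof (intro conformal_manifold.intro conformal_weights.intro conformal_manifold_axioms.intro)
    show "smooth_manifold S" by (rule smooth_manifold_axioms)
    show "g $ i $ j = g $ j $ i" "matrix_inv g $ i $ j = matrix_inv g $ j $ i"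
      "(\<Sum>k\<in>UNIV. g $ i $ k * matrix_inv g $ k $ j) = (if i = j then 1 else 0)" for i j
      by (rule has_signature_inverse[OF assms(5)])+
    show "\<delta> \<notin> resonances CARD('n)" by (rule assms(10))
    show "adapted_charts A \<subseteq> S" "(\<Union>c\<in>adapted_charts A. cdom c) = UNIV"
      by (rule adapted_charts_facts[OF assms(6)])+
    show "\<exists>W. open W \<and> coord c x \<in> W \<and> W \<subseteq> coord c ` (cdom c \<inter> cdom c') \<and> conformal_transformation_on g W (transition c c')"
      if "c \<in> adapted_charts A" "c' \<in> adapted_charts A" "x \<in> cdom c" "x \<in> cdom c'" for c c' x
      using adapted_charts_facts(3)[OF assms(6) that] .
  qed (rule refl)
  have mu: "mu = lam + \<delta>" using assms(9) by simp
  show ?thesis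
    unfolding mu using Q_module_iso[OF refl] Q_principal[OF refl] Q_unique[OF refl] by blast
qed

end
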